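(* Let $p$ be a prime and $n \geq 1$. Suppose $G$ is a virtually torsion-free discrete group which admits a finite $\underline{E}G$. Then $$\sum_{[g_1,\dots,g_n] \in G \backslash G_{n,p}} \chi_{\mathrm{orb}}(C\langle g_1, \dots, g_n\rangle) \equiv 0 \mod \mathbb{Z}_{(p)},$$ where $C\langle g_1, \dots, g_n\rangle$ denotes the centralizer in $G$ of the subgroup generated by $g_1, \dots, g_n$.
   Context: For a discrete group $G$, a $G$-CW complex is proper if all cell stabilizers are finite, and finite if it has finitely many $G$-orbits of cells. $\underline{E}G$ denotes the classifying $G$-space for proper actions: a $G$-CW complex such that for every subgroup $H\le G$ the fixed subspace $\underline{E}G^H$ is contractible if $H$ is finite and empty otherwise; it is unique up to $G$-homotopy equivalence. "$G$ admits a finite $\underline{E}G$" means that some model of $\underline{E}G$ is a finite $G$-CW complex. For $G$ virtually torsion-free, $\Lambda\le G$ a finite index torsion-free subgroup and $X$ a finite proper $G$-CW complex, $\chi^G_{\mathrm{orb}}(X) = \chi_{\mathbb{Q}}(\Lambda\backslash X)/[G:\Lambda]\in\mathbb{Q}$, where $\chi_{\mathbb{Q}}$ is the classical Euler characteristic (this is independent of $\Lambda$). If $G$ admits a finite $\underline{E}G$, then $\chi_{\mathrm{orb}}(G)=\chi^G_{\mathrm{orb}}(\underline{E}G)$. If $G$ is virtually torsion-free with a finite $\underline{E}G$ and $H\le G$ is finite, then $\underline{E}G^H$ is a finite model of $\underline{E}C(H)$ for the centralizer $C(H)$, so $\chi_{\mathrm{orb}}(C(H))$ is defined. $G_{n,p}$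 is the set of $n$-tuples $(g_1,\dots,g_n)\in G^n$ of pairwise commuting elements, each of $p$-power order (order $1$ allowed). $G$ acts on $G_{n,p}$ by conjugation in each coordinate; $G\backslash G_{n,p}$ is the orbit set, which is finite when $G$ admits a finite $\underline{E}G$. $\mathbb{Z}_{(p)}\subset\mathbb{Q}$ is the localization of $\mathbb{Z}$ at $p$; for rationals, $a\equiv b \mod \mathbb{Z}_{(p)}$ means $a-b\in\mathbb{Z}_{(p)}$. *)

theory Defs
  imports
    "HOL-Homology.Homology"
    "HOL-Algebra.Group_Action"
    "HOL-Algebra.Generated_Groups"
    "HOL-Algebra.Multiplicative_Group"
    "HOL-Computational_Algebra.Primes"
begin

section \<open>Rational singular homology and the Euler characteristic\<close>

text \<open>
  The library's singular chain groups have integer coefficients; here is the same complex with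
  coefficients in the field of rationals.
\<close>

type_synonym 'x rat_chain = "((nat \<Rightarrow> real) \<Rightarrow> 'x) \<Rightarrow>\<^sub>0 rat"

definition rat_scale :: "rat \<Rightarrow> ('b \<Rightarrow>\<^sub>0 rat) \<Rightarrow> ('b \<Rightarrow>\<^sub>0 rat)" where
  "rat_scale q c = Poly_Mapping.map (\<lambda>r. q * r) c"

definition rat_chains :: "nat \<Rightarrow> 'x topology \<Rightarrow> 'x rat_chain set" where
  "rat_chains i X = {c. Poly_Mapping.keys c \<subseteq> singular_simplex_set i X}"

definition rat_boundary :: "nat \<Rightarrow> 'x rat_chain \<Rightarrow> 'x rat_chain" where
  "rat_boundary i c =
     (if i = 0 then 0
      else \<Sum>f\<in>Poly_Mapping.keys c. \<Sum>k\<le>i.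
             Poly_Mapping.single (singular_face i k f) ((-1) ^ k * Poly_Mapping.lookup c f))"

definition rat_cycles :: "nat \<Rightarrow> 'x topology \<Rightarrow> 'x rat_chain set" where
  "rat_cycles i X = {c \<in> rat_chains i X. rat_boundary i c = 0}"

definition rat_boundaries :: "nat \<Rightarrow> 'x topology \<Rightarrow> 'x rat_chain set" where
  "rat_boundaries i X = rat_boundary (Suc i) ` rat_chains (Suc i) X"

text \<open>
  \<open>quotient_basis Z B S\<close>: the finite set \<open>S\<close> represents a basis of the rational vector space
  \<open>Z / B\<close>. Independence modulo \<open>B\<close> also makes the classes of distinct elements distinct.
\<close>

definition quotient_basis ::
    "('b \<Rightarrow>\<^sub>0 rat) set \<Rightarrow> ('b \<Rightarrow>\<^sub>0 rat) set \<Rightarrow> ('b \<Rightarrow>\<^sub>0 rat) set \<Rightarrow> bool" where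
  "quotient_basis Z B S \<longleftrightarrow>
     finite S \<and> S \<subseteq> Z \<and>
     (\<forall>a. (\<Sum>s\<in>S. rat_scale (a s) s) \<in> B \<longrightarrow> (\<forall>s\<in>S. a s = 0)) \<and>
     (\<forall>z\<in>Z. \<exists>a. z - (\<Sum>s\<in>S. rat_scale (a s) s) \<in> B)"

definition rat_betti :: "nat \<Rightarrow> 'x topology \<Rightarrow> nat" where
  "rat_betti i X =
     (THE d. \<exists>S. quotient_basis (rat_cycles i X) (rat_boundaries i X) S \<and> card S = d)"

text \<open>Meaningful for spaces whose total rational homology is finite dimensional.\<close>

definition rat_euler_char :: "'x topology \<Rightarrow> int" where
  "rat_euler_char X = (\<Sum>i | rat_betti i X \<noteq> 0. (-1) ^ i * int (rat_betti i X))"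


section \<open>Equivariant CW complexes\<close>

definition unit_disc :: "nat \<Rightarrow> (nat \<Rightarrow> real) topology" where
  "unit_disc n = subtopology (Euclidean_space n) {x. (\<Sum>i<n. x i ^ 2) \<le> 1}"

definition open_unit_disc :: "nat \<Rightarrow> (nat \<Rightarrow> real) set" where
  "open_unit_disc n = {x \<in> topspace (Euclidean_space n). (\<Sum>i<n. x i ^ 2) < 1}"

definition unit_disc_boundary :: "nat \<Rightarrow> (nat \<Rightarrow> real) set" where
  "unit_disc_boundary n = {x \<in> topspace (Euclidean_space n). (\<Sum>i<n. x i ^ 2) = 1}"

text \<open>
  A CW structure in Whitehead's intrinsic form; \<open>E n\<close> is the set of open \<open>n\<close>-cells. The conjuncts
  say: \<open>X\<close> is Hausdorff; \<open>X\<close> is the disjoint union of the cells; every cell has a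
  characteristic map whose restriction to the boundary sphere lands in finitely many cells of
  smaller dimension; \<open>X\<close> carries the weak topology.
\<close>

definition CW_structure :: "'x topology \<Rightarrow> (nat \<Rightarrow> 'x set set) \<Rightarrow> bool" where
  "CW_structure X E \<longleftrightarrow>
     Hausdorff_space X \<and>
     topspace X = (\<Union>n. \<Union>(E n)) \<and>
     (\<forall>m n. \<forall>d\<in>E m. \<forall>e\<in>E n. (m, d) \<noteq> (n, e) \<longrightarrow> d \<inter> e = {}) \<and>
     (\<forall>n. \<forall>e\<in>E n. \<exists>\<Phi>.
        continuous_map (unit_disc n) X \<Phi> \<and>
        homeomorphic_map (subtopology (unit_disc n) (open_unit_disc n)) (subtopology X e) \<Phi> \<and>
        (\<exists>F. finite F \<and> F \<subseteq> (\<Union>m<n. E m) \<and> \<Phi> ` unit_disc_boundary n \<subseteq> \<Union>F)) \<and>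
     (\<forall>A \<subseteq> topspace X.
        (\<forall>n. \<forall>e\<in>E n. closedin X (A \<inter> X closure_of e)) \<longrightarrow> closedin X A)"

text \<open>
  For a discrete group, a \<open>G\<close>-CW complex (built by attaching cells \<open>G/K \<times> D\<^sup>n\<close>) is the same thing
  as a CW complex on which \<open>G\<close> acts by homeomorphisms permuting the open cells, such that an
  element mapping a cell to itself fixes that cell pointwise.
\<close>

definition G_CW_structure ::
    "('a, 'm) monoid_scheme \<Rightarrow> 'x topology \<Rightarrow> ('a \<Rightarrow> 'x \<Rightarrow> 'x) \<Rightarrow> (nat \<Rightarrow> 'x set set) \<Rightarrow> bool" where
  "G_CW_structure G X \<phi> E \<longleftrightarrow>
     group_action G (topspace X) \<phi> \<and>
     (\<forall>g\<in>carrier G. continuous_map X X (\<phi> g)) \<and>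
     CW_structure X E \<and>
     (\<forall>g\<in>carrier G. \<forall>n. \<forall>e\<in>E n. \<phi> g ` e \<in> E n) \<and>
     (\<forall>g\<in>carrier G. \<forall>n. \<forall>e\<in>E n. \<phi> g ` e = e \<longrightarrow> (\<forall>x\<in>e. \<phi> g x = x))"

definition finite_G_CW ::
    "('a, 'm) monoid_scheme \<Rightarrow> 'x topology \<Rightarrow> ('a \<Rightarrow> 'x \<Rightarrow> 'x) \<Rightarrow> bool" where
  "finite_G_CW G X \<phi> \<longleftrightarrow>
     (\<exists>E. G_CW_structure G X \<phi> E \<and> finite (\<Union>n. orbits G (E n) (\<lambda>g e. \<phi> g ` e)))"

definition fixed_points :: "'x topology \<Rightarrow> ('a \<Rightarrow> 'x \<Rightarrow> 'x) \<Rightarrow> 'a set \<Rightarrow> 'x set" where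
  "fixed_points X \<phi> H = {x \<in> topspace X. \<forall>h\<in>H. \<phi> h x = x}"

text \<open>
  Nonemptiness is required separately because \<^const>\<open>contractible_space\<close> holds of the empty space.
  Properness is automatic: a cell stabilizer fixes the points of its cell, hence is finite.
\<close>

definition finite_EG_model ::
    "('a, 'm) monoid_scheme \<Rightarrow> 'x topology \<Rightarrow> ('a \<Rightarrow> 'x \<Rightarrow> 'x) \<Rightarrow> bool" where
  "finite_EG_model G X \<phi> \<longleftrightarrow>
     finite_G_CW G X \<phi> \<and>
     (\<forall>H. subgroup H G \<longrightarrow>
        (if finite H
         then fixed_points X \<phi> H \<noteq> {} \<and>
              contractible_space (subtopology X (fixed_points X \<phi> H))
         else fixed_points X \<phi> H = {}))"

text \<open>
  HOL cannot quantify over types inside a formula, so the type of points of a model is a parameter.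
\<close>

definition admits_finite_EG :: "'x itself \<Rightarrow> ('a, 'm) monoid_scheme \<Rightarrow> bool" where
  "admits_finite_EG _ G \<longleftrightarrow> (\<exists>(X :: 'x topology) \<phi>. finite_EG_model G X \<phi>)"


section \<open>Orbifold Euler characteristics\<close>

definition quotient_topology :: "'x topology \<Rightarrow> ('x \<Rightarrow> 'y) \<Rightarrow> 'y topology" where
  "quotient_topology X f =
     topology (\<lambda>U. U \<subseteq> f ` topspace X \<and> openin X {x \<in> topspace X. f x \<in> U})"

lemma openin_quotient_topology:
  "openin (quotient_topology X f) U \<longleftrightarrow>
     U \<subseteq> f ` topspace X \<and> openin X {x \<in> topspace X. f x \<in> U}"
proof -
  have "istopology (\<lambda>U. U \<subseteq> f ` topspace X \<and> openin X {x \<in> topspace X. f x \<in> U})"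
    unfolding istopology_def
  proof (intro conjI allI impI)
    fix S T
    assume S: "S \<subseteq> f ` topspace X \<and> openin X {x \<in> topspace X. f x \<in> S}"
      and T: "T \<subseteq> f ` topspace X \<and> openin X {x \<in> topspace X. f x \<in> T}"
    show "S \<inter> T \<subseteq> f ` topspace X" using S by blast
    have "{x \<in> topspace X. f x \<in> S \<inter> T} =
          {x \<in> topspace X. f x \<in> S} \<inter> {x \<in> topspace X. f x \<in> T}" by blast
    then show "openin X {x \<in> topspace X. f x \<in> S \<inter> T}" using S T by auto
  next
    fix K
    assume K: "\<forall>S\<in>K. S \<subseteq> f ` topspace X \<and> openin X {x \<in> topspace X. f x \<in> S}"
    show "\<Union>K \<subseteq> f ` topspace X" using K by blast
    have "{x \<in> topspace X. f x \<in> \<Union>K} = (\<Union>S\<in>K. {x \<in> topspace X. f x \<in> S})" by blast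
    then show "openin X {x \<in> topspace X. f x \<in> \<Union>K}" using K by auto
  qed
  then show ?thesis by (simp add: quotient_topology_def)
qed

lemma topspace_quotient_topology [simp]: "topspace (quotient_topology X f) = f ` topspace X"
proof
  show "topspace (quotient_topology X f) \<subseteq> f ` topspace X"
    by (metis openin_quotient_topology openin_topspace)
  have "{x \<in> topspace X. f x \<in> f ` topspace X} = topspace X" by blast
  then have "openin (quotient_topology X f) (f ` topspace X)"
    by (simp add: openin_quotient_topology)
  then show "f ` topspace X \<subseteq> topspace (quotient_topology X f)"
    by (rule openin_subset)
qed

lemma quotient_map_quotient_topology: "quotient_map X (quotient_topology X f) f"
  by (simp add: quotient_map_def openin_quotient_topology)

definition orbit_space ::
    "('a, 'm) monoid_scheme \<Rightarrow> 'x topology \<Rightarrow> ('a \<Rightarrow> 'x \<Rightarrow> 'x) \<Rightarrow> 'x set topology" where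
  "orbit_space G X \<phi> = quotient_topology X (orbit G \<phi>)"

definition torsion_free_finite_index :: "'a set \<Rightarrow> ('a, 'm) monoid_scheme \<Rightarrow> bool" where
  "torsion_free_finite_index \<Lambda> G \<longleftrightarrow>
     subgroup \<Lambda> G \<and> finite (rcosets\<^bsub>G\<^esub> \<Lambda>) \<and>
     (\<forall>x\<in>\<Lambda>. \<forall>k::nat. 0 < k \<longrightarrow> x [^]\<^bsub>G\<^esub> k = \<one>\<^bsub>G\<^esub> \<longrightarrow> x = \<one>\<^bsub>G\<^esub>)"

definition virtually_torsion_free :: "('a, 'm) monoid_scheme \<Rightarrow> bool" where
  "virtually_torsion_free G \<longleftrightarrow> (\<exists>\<Lambda>. torsion_free_finite_index \<Lambda> G)"

text \<open>
  For a finite proper \<open>G\<close>-CW complex the value does not depend on the choice of \<open>\<Lambda>\<close>.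
\<close>

definition orb_euler_char_space ::
    "('a, 'm) monoid_scheme \<Rightarrow> 'x topology \<Rightarrow> ('a \<Rightarrow> 'x \<Rightarrow> 'x) \<Rightarrow> rat" where
  "orb_euler_char_space G X \<phi> =
     (let \<Lambda> = (SOME \<Lambda>. torsion_free_finite_index \<Lambda> G)
      in of_int (rat_euler_char (orbit_space (G\<lparr>carrier := \<Lambda>\<rparr>) X \<phi>)) /
         of_nat (card (rcosets\<^bsub>G\<^esub> \<Lambda>)))"

text \<open>
  The model is unique up to \<open>G\<close>-homotopy equivalence, so neither the choice of model nor the type
  carrying it affects the value, as long as a finite model exists on that type.
\<close>

definition orb_euler_char :: "'x itself \<Rightarrow> ('a, 'm) monoid_scheme \<Rightarrow> rat" where
  "orb_euler_char _ G =
     (case (SOME (X :: 'x topology, \<phi>). finite_EG_model G X \<phi>) of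
        (X, \<phi>) \<Rightarrow> orb_euler_char_space G X \<phi>)"


section \<open>Commuting tuples, centralizers and localization\<close>

definition commuting_p_tuples :: "('a, 'm) monoid_scheme \<Rightarrow> nat \<Rightarrow> nat \<Rightarrow> 'a list set" where
  "commuting_p_tuples G n p =
     {gs. length gs = n \<and> set gs \<subseteq> carrier G \<and>
          (\<forall>x\<in>set gs. \<forall>y\<in>set gs. x \<otimes>\<^bsub>G\<^esub> y = y \<otimes>\<^bsub>G\<^esub> x) \<and>
          (\<forall>x\<in>set gs. \<exists>k. group.ord G x = p ^ k)}"

definition conj_tuple :: "('a, 'm) monoid_scheme \<Rightarrow> 'a \<Rightarrow> 'a list \<Rightarrow> 'a list" where
  "conj_tuple G h gs = map (\<lambda>x. h \<otimes>\<^bsub>G\<^esub> x \<otimes>\<^bsub>G\<^esub> inv\<^bsub>G\<^esub> h) gs"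

definition centralizer_group ::
    "('a, 'm) monoid_scheme \<Rightarrow> 'a set \<Rightarrow> ('a, 'm) monoid_scheme" where
  "centralizer_group G H = G\<lparr>carrier := {x \<in> carrier G. \<forall>h\<in>H. x \<otimes>\<^bsub>G\<^esub> h = h \<otimes>\<^bsub>G\<^esub> x}\<rparr>"

definition localized_int :: "nat \<Rightarrow> rat set" where
  "localized_int p = {of_int a / of_int b | a b. \<not> int p dvd b}"

definition cong_localized :: "nat \<Rightarrow> rat \<Rightarrow> rat \<Rightarrow> bool" where
  "cong_localized p a b \<longleftrightarrow> a - b \<in> localized_int p"

end

theory Submission
  imports Defs "HOL-Number_Theory.Cong" "HOL-Algebra.Sylow" "HOL-Analysis.Abstract_Topological_Spaces"
begin

text \<open>
  Let \<open>X\<close> be a finite model with its \<open>G\<close>-equivariant cell structure. The stabilizer \<open>K\<^sub>r\<close> of a cell \<open>r\<close>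
  is a finite group. The theorem follows from a formula for the orbifold Euler characteristic of the
  centralizer of a commuting tuple: it is the sum of \<open>(-1)\<^sup>d N\<^sub>r / |K\<^sub>r|\<close>, where \<open>r\<close> runs over
  representatives of the \<open>G\<close>-orbits of cells, \<open>d\<close> is the dimension of \<open>r\<close>, and \<open>N\<^sub>r\<close> is the number of
  conjugates of the tuple with all entries in \<open>K\<^sub>r\<close> (\<open>orb_euler_char_centralizer\<close>). Summed over the
  conjugacy classes of tuples, the numbers \<open>N\<^sub>r\<close> add up to the number of commuting \<open>n\<close>-tuples of
  elements of \<open>p\<close>-power order in \<open>K\<^sub>r\<close>. The \<open>p\<close>-part of \<open>|K\<^sub>r|\<close> divides that number. For \<open>n = 1\<close> this is
  Frobenius's theorem (\<open>frobenius_p_elements\<close>); in general one entry of the tuple is counted in the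
  centralizer of the others, to which Frobenius's theorem applies
  (\<open>card_commuting_p_tuples_localized\<close>). So every \<open>r\<close> contributes a number whose denominator is prime
  to \<open>p\<close>.

  For the formula, let \<open>H\<close> be the subgroup generated by the tuple, which is finite. The fixed points
  of \<open>H\<close> in \<open>X\<close> form a finite model for the centralizer of \<open>H\<close> (\<open>finite_EG_model_fixed_points\<close>). A
  torsion-free subgroup \<open>\<Lambda>\<close> of finite index in the centralizer acts freely on it, and the Euler
  characteristic of the orbit space is the alternating number of \<open>\<Lambda>\<close>-orbits of cells
  (\<open>orb_euler_char_eq\<close>). The number of \<open>\<Lambda>\<close>-orbits of those translates of \<open>r\<close> that \<open>H\<close> fixes is
  \<open>N\<^sub>r / |K\<^sub>r|\<close> times the index of \<open>\<Lambda>\<close>, by counting a set of cosets in two ways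
  (\<open>card_fixed_cell_orbits\<close>).

  Two topological facts stand behind the count of orbits of cells. A Hausdorff space with finitely
  many cells has the alternating number of cells as its Euler characteristic
  (\<open>has_euler_finite_cells\<close>). This rests on the exact sequence of a pair and on excision for integral
  homology, whose ranks are the rational Betti numbers (\<open>rat_betti_eq_rank\<close>). Moreover, the Euler
  characteristic of a compact orbit space of a free action on a contractible space depends on the
  group only (\<open>has_euler_orbit_space_contractible\<close>): two such spaces are compared through the orbit
  space of their product, whose projections to the two orbit spaces are isomorphisms on homology,
  as one sees by patching over finitely many small open sets (\<open>homology_iso_orbit_spaces\<close>).
\<close>

text \<open>
  The values of a \<^locale>\<open>group_action\<close> are extensional bijections of the set acted on, so an action
  given by a formula has to be restricted.
\<close>

lemma group_actionI:
  fixes G (structure)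
  assumes "group G"
    and closed: "\<And>g x. g \<in> carrier G \<Longrightarrow> x \<in> S \<Longrightarrow> \<phi> g x \<in> S"
    and one: "\<And>x. x \<in> S \<Longrightarrow> \<phi> \<one>\<^bsub>G\<^esub> x = x"
    and mult: "\<And>g h x. g \<in> carrier G \<Longrightarrow> h \<in> carrier G \<Longrightarrow> x \<in> S \<Longrightarrow> \<phi> (g \<otimes>\<^bsub>G\<^esub> h) x = \<phi> g (\<phi> h x)"
  shows "group_action G S (\<lambda>g. restrict (\<phi> g) S)"
proof -
  interpret group G by fact
  have bij: "restrict (\<phi> g) S \<in> Bij S" if g: "g \<in> carrier G" for g
  proof -
    have "bij_betw (\<phi> g) S S"
      by (rule bij_betw_byWitness[where f' = "\<phi> (inv g)"])
         (use g in \<open>auto simp: closed one simp flip: mult\<close>)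
    then show ?thesis by (auto simp: Bij_def bij_betw_def inj_on_def)
  qed
  show ?thesis
    unfolding group_action_def group_hom_def group_hom_axioms_def hom_def
  proof (intro conjI CollectI ballI)
    show "group (BijGroup S)" by (rule group_BijGroup)
    show "(\<lambda>g. restrict (\<phi> g) S) \<in> carrier G \<rightarrow> carrier (BijGroup S)"
      using bij by (auto simp: BijGroup_def)
    fix g h assume "g \<in> carrier G" "h \<in> carrier G"
    then show "restrict (\<phi> (g \<otimes> h)) S = restrict (\<phi> g) S \<otimes>\<^bsub>BijGroup S\<^esub> restrict (\<phi> h) S"
      using bij by (auto simp: BijGroup_def compose_def restrict_def mult closed fun_eq_iff)
  qed (use assms in auto)
qed

section \<open>Rationals with denominator prime to a given prime\<close>

lemma localized_int_of_int: "prime p \<Longrightarrow> of_int a \<in> localized_int p"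
  unfolding localized_int_def
  by (rule CollectI, rule exI[of _ a], rule exI[of _ 1]) (auto simp: prime_nat_iff)

lemma localized_int_add:
  assumes "prime p" "a \<in> localized_int p" "b \<in> localized_int p"
  shows "a + b \<in> localized_int p"
proof -
  obtain x y z w where *: "a = of_int x / of_int y" "b = of_int z / of_int w" "\<not> int p dvd y" "\<not> int p dvd w"
    using assms unfolding localized_int_def by blast
  then have "y \<noteq> 0" "w \<noteq> 0" by auto
  then have "a + b = of_int (x * w + z * y) / of_int (y * w)"
    by (simp add: * field_simps)
  moreover have "\<not> int p dvd y * w"
    using * assms(1) by (simp add: prime_dvd_mult_iff)
  ultimately show ?thesis unfolding localized_int_def by blast
qed

lemma localized_int_mult:
  assumes "prime p" "a \<in> localized_int p" "b \<in> localized_int p"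
  shows "a * b \<in> localized_int p"
proof -
  obtain x y z w where *: "a = of_int x / of_int y" "b = of_int z / of_int w" "\<not> int p dvd y" "\<not> int p dvd w"
    using assms unfolding localized_int_def by blast
  then have "a * b = of_int (x * z) / of_int (y * w)" by simp
  moreover have "\<not> int p dvd y * w"
    using * assms(1) by (simp add: prime_dvd_mult_iff)
  ultimately show ?thesis unfolding localized_int_def by blast
qed

lemma localized_int_sum:
  assumes "prime p" "\<And>i. i \<in> I \<Longrightarrow> f i \<in> localized_int p"
  shows "sum f I \<in> localized_int p"
  using assms(2) localized_int_of_int[OF assms(1), of 0]
  by (induction I rule: infinite_finite_induct) (auto intro: localized_int_add[OF assms(1)])

lemma localized_int_div_unit:
  assumes "prime p" "of_nat n * a \<in> localized_int p" "\<not> p dvd n"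
  shows "a \<in> localized_int p"
proof -
  have "(of_int 1 / of_int (int n) :: rat) \<in> localized_int p"
    unfolding localized_int_def using assms(3)
    by (intro CollectI exI[of _ 1] exI[of _ "int n"]) simp
  from localized_int_mult[OF assms(1) this assms(2)] show ?thesis
    using assms(3) by (cases "n = 0") auto
qed

text \<open>
  By the orbit-stabilizer theorem, the orbit of \<open>x\<close> contributes \<open>w x / card (stabilizer G \<phi> x)\<close>
  to the quotient.
\<close>

lemma orbit_weighted_sum_localized:
  assumes "prime p" "group_action G S \<phi>" "finite S" "finite (carrier G)"
    and inv: "\<And>g x. g \<in> carrier G \<Longrightarrow> x \<in> S \<Longrightarrow> w (\<phi> g x) = w x"
    and loc: "\<And>x. x \<in> S \<Longrightarrow> of_nat (w x) / of_nat (card (stabilizer G \<phi> x)) \<in> localized_int p"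
  shows "(of_nat (\<Sum>x\<in>S. w x) / of_nat (order G) :: rat) \<in> localized_int p"
proof -
  interpret group_action G S \<phi> by fact
  have *: "(\<Sum>x\<in>o'. of_nat (w x) / of_nat (order G)) \<in> localized_int p" if "o' \<in> orbits G S \<phi>" for o'
  proof -
    from that obtain x where x: "x \<in> S" "o' = orbit G \<phi> x" unfolding orbits_def by blast
    have "(\<Sum>y\<in>o'. of_nat (w y) / of_nat (order G) :: rat) = (\<Sum>y\<in>o'. of_nat (w x) / of_nat (order G))"
      by (rule sum.cong) (use x inv in \<open>auto simp: orbit_def\<close>)
    also have "\<dots> = of_nat (w x) * of_nat (card o') / of_nat (order G)" by simp
    also have "\<dots> = of_nat (w x) / of_nat (card (stabilizer G \<phi> x))"
    proof -
      have "card o' * card (stabilizer G \<phi> x) = order G"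
        using orbit_stabilizer_theorem[OF x(1)] x by simp
      moreover have "card o' > 0"
      proof -
        have "o' \<subseteq> S" using orbits_coverture that by auto
        then have "finite o'" using assms(3) finite_subset by blast
        then show ?thesis using x orbit_refl by (auto simp: card_gt_0_iff)
      qed
      ultimately show ?thesis by (simp add: flip: \<open>card o' * card (stabilizer G \<phi> x) = order G\<close>)
    qed
    also have "\<dots> \<in> localized_int p" using loc x by auto
    finally show ?thesis .
  qed
  have "(of_nat (\<Sum>x\<in>S. w x) / of_nat (order G) :: rat) = (\<Sum>x\<in>S. of_nat (w x) / of_nat (order G))"
    by (simp add: sum_divide_distrib)
  also have "\<dots> = (\<Sum>o'\<in>orbits G S \<phi>. \<Sum>x\<in>o'. of_nat (w x) / of_nat (order G))"
    by (rule disjoint_sum[OF assms(3), symmetric])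
  also have "\<dots> \<in> localized_int p" using * by (rule localized_int_sum[OF assms(1)])
  finally show ?thesis .
qed

section \<open>Elements of prime power order in finite groups\<close>

text \<open>
  The condition is on powers, not on \<^const>\<open>group.ord\<close>, because powers agree in a group and its
  subgroups.
\<close>

definition p_elements :: "('a, 'm) monoid_scheme \<Rightarrow> nat \<Rightarrow> 'a set" where
  "p_elements G p = {x \<in> carrier G. \<exists>k. x [^]\<^bsub>G\<^esub> (p ^ k :: nat) = \<one>\<^bsub>G\<^esub>}"

lemma subgroup_centralizer:
  fixes G (structure)
  assumes "group G" "H \<subseteq> carrier G"
  shows "subgroup {x \<in> carrier G. \<forall>h\<in>H. x \<otimes>\<^bsub>G\<^esub> h = h \<otimes>\<^bsub>G\<^esub> x} G"
proof -
  interpret group G by fact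
  show ?thesis
  proof (rule subgroupI)
    fix a b assume a: "a \<in> {x \<in> carrier G. \<forall>h\<in>H. x \<otimes> h = h \<otimes> x}"
      and b: "b \<in> {x \<in> carrier G. \<forall>h\<in>H. x \<otimes> h = h \<otimes> x}"
    have "a \<otimes> b \<otimes> h = h \<otimes> (a \<otimes> b)" if "h \<in> H" for h
    proof -
      have "a \<otimes> b \<otimes> h = a \<otimes> (h \<otimes> b)" using a b that assms(2) m_assoc by auto
      also have "\<dots> = h \<otimes> a \<otimes> b" using a b that assms(2) m_assoc[of a h b] by auto
      finally show ?thesis using a b that assms(2) m_assoc by auto
    qed
    then show "a \<otimes> b \<in> {x \<in> carrier G. \<forall>h\<in>H. x \<otimes> h = h \<otimes> x}" using a b by auto
    have "inv a \<otimes> h = h \<otimes> inv a" if "h \<in> H" for h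
    proof -
      have ca: "a \<in> carrier G" "h \<in> carrier G" "a \<otimes> h = h \<otimes> a" using a that assms(2) by auto
      have "a \<otimes> (h \<otimes> inv a) = h \<otimes> a \<otimes> inv a" using ca by (simp flip: m_assoc)
      also have "\<dots> = h" using ca by (simp add: m_assoc)
      finally show ?thesis using ca inv_solve_left'[of "h \<otimes> inv a" a h] by auto
    qed
    then show "inv a \<in> {x \<in> carrier G. \<forall>h\<in>H. x \<otimes> h = h \<otimes> x}" using a by auto
  qed (use assms(2) in \<open>auto intro!: exI[of _ \<one>]\<close>)
qed

lemma group_centralizer_group:
  assumes "group G" "H \<subseteq> carrier G"
  shows "group (centralizer_group G H)"
  unfolding centralizer_group_def
  using group.subgroup_imp_group[OF assms(1) subgroup_centralizer[OF assms]] .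

lemma p_elements_finite_group:
  fixes K (structure)
  assumes "group K" "finite (carrier K)" "prime p" "order K = p ^ a * m" "\<not> p dvd m"
  shows "p_elements K p = {x \<in> carrier K. x [^]\<^bsub>K\<^esub> (p ^ a) = \<one>\<^bsub>K\<^esub>}"
proof -
  interpret group K by fact
  have "x [^] (p ^ a) = \<one>" if x: "x \<in> carrier K" "x [^] (p ^ k) = \<one>" for x k
  proof -
    have "ord x dvd p ^ k" using x pow_eq_id by blast
    moreover have "ord x dvd p ^ a * m" using ord_dvd_group_order x assms(4) by auto
    moreover have "coprime (p ^ k) m" using assms by (simp add: prime_imp_coprime)
    ultimately have "ord x dvd p ^ a"
      using coprime_divisors[OF \<open>ord x dvd p ^ k\<close> dvd_refl, of m] coprime_dvd_mult_left_iff by blast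
    then show ?thesis using x pow_eq_id by blast
  qed
  then show ?thesis unfolding p_elements_def by auto
qed

text \<open>
  Every element is uniquely a product of commuting elements \<open>v\<close> and \<open>u\<close>, of order prime to \<open>p\<close>
  and of \<open>p\<close>-power order; both factors are powers of the element. The sum groups the elements by
  \<open>v\<close>.
\<close>

lemma card_eq_sum_p_elements_centralizer:
  fixes K (structure)
  assumes "group K" "finite (carrier K)" "prime p" "order K = p ^ a * m" "\<not> p dvd m"
  shows "order K = (\<Sum>v | v \<in> carrier K \<and> v [^]\<^bsub>K\<^esub> m = \<one>\<^bsub>K\<^esub>. card (p_elements (centralizer_group K {v}) p))"
proof -
  interpret group K by fact
  let ?q = "p ^ a"
  let ?V = "{v \<in> carrier K. v [^] m = \<one>}"
  let ?C = "\<lambda>v. {x \<in> carrier K. x \<otimes> v = v \<otimes> x \<and> x [^] ?q = \<one>}"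
  have cop: "coprime ?q m" using assms by (simp add: prime_imp_coprime)
  \<comment> \<open>By the Chinese remainder theorem \<open>x [^] e\<close> is the \<open>p\<close>-part of \<open>x\<close> and \<open>x [^] f\<close> the \<open>p\<close>-regular part.\<close>
  obtain e where e: "[e = 1] (mod ?q)" "[e = 0] (mod m)"
    using binary_chinese_remainder_nat[OF cop] by blast
  obtain f where f: "[f = 0] (mod ?q)" "[f = 1] (mod m)"
    using binary_chinese_remainder_nat[OF cop] by blast
  have ef: "[e + f = 1] (mod ?q * m)"
    by (rule coprime_cong_mult_nat) (use cop e f cong_add[OF e(1) f(1)] cong_add[OF e(2) f(2)] in auto)
  have powcong: "x [^] i = x [^] j" if "x \<in> carrier K" "[i = j] (mod n)" "x [^] n = \<one>" for x i j and n :: nat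
  proof -
    have "x [^] k = x [^] (k mod n)" for k
    proof -
      have "x [^] (n * (k div n) + k mod n) = (x [^] n) [^] (k div n) \<otimes> x [^] (k mod n)"
        using that(1) by (simp add: nat_pow_pow nat_pow_mult)
      then show ?thesis using that by simp
    qed
    then show ?thesis using that(2) unfolding cong_def by metis
  qed
  have ord1: "x [^] (?q * m) = \<one>" if "x \<in> carrier K" for x
    using pow_order_eq_1[OF that] assms(4) by simp
  have PE: "p_elements (centralizer_group K {v}) p = ?C v" if "v \<in> carrier K" for v
  proof -
    have "x [^]\<^bsub>centralizer_group K {v}\<^esub> (n::nat) = x [^] n" for x n
      by (simp add: centralizer_group_def nat_pow_def)
    then show ?thesis
      using p_elements_finite_group[OF assms] that
      by (auto simp: p_elements_def centralizer_group_def)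
  qed
  have "bij_betw (\<lambda>(v, u). u \<otimes> v) (SIGMA v:?V. ?C v) (carrier K)"
  proof (rule bij_betw_byWitness[where f' = "\<lambda>x. (x [^] f, x [^] e)"])
    show "\<forall>z\<in>SIGMA v:?V. ?C v. (\<lambda>x. (x [^] f, x [^] e)) ((\<lambda>(v, u). u \<otimes> v) z) = z"
    proof
      fix z assume "z \<in> (SIGMA v:?V. ?C v)"
      then obtain v u where z: "z = (v, u)" and *: "v \<in> carrier K" "v [^] m = \<one>" "u \<in> carrier K" "u \<otimes> v = v \<otimes> u" "u [^] ?q = \<one>"
        by blast
      have "(u \<otimes> v) [^] e = u [^] e \<otimes> v [^] e" "(u \<otimes> v) [^] f = u [^] f \<otimes> v [^] f"
        using * pow_mult_distrib by auto
      moreover have "u [^] e = u [^] (1::nat)" "v [^] e = v [^] (0::nat)"  "u [^] f = u [^] (0::nat)" "v [^] f = v [^] (1::nat)"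
        using * e f powcong by blast+
      ultimately show "(\<lambda>x. (x [^] f, x [^] e)) ((\<lambda>(v, u). u \<otimes> v) z) = z" using * z by auto
    qed
    show "\<forall>x\<in>carrier K. (\<lambda>(v, u). u \<otimes> v) (x [^] f, x [^] e) = x"
    proof
      fix x assume x: "x \<in> carrier K"
      have "x [^] (e + f) = x [^] (1::nat)" using powcong[OF x ef ord1[OF x]] .
      then show "(\<lambda>(v, u). u \<otimes> v) (x [^] f, x [^] e) = x" using x by (simp add: nat_pow_mult)
    qed
    show "(\<lambda>(v, u). u \<otimes> v) ` (SIGMA v:?V. ?C v) \<subseteq> carrier K" by auto
    show "(\<lambda>x. (x [^] f, x [^] e)) ` carrier K \<subseteq> (SIGMA v:?V. ?C v)"
    proof
      fix z assume "z \<in> (\<lambda>x. (x [^] f, x [^] e)) ` carrier K"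
      then obtain x where x: "x \<in> carrier K" "z = (x [^] f, x [^] e)" by blast
      have "[f * m = 0] (mod ?q * m)" using f(1) by (simp add: cong_0_iff mult_dvd_mono)
      then have "x [^] (f * m) = x [^] (0::nat)" using powcong[OF x(1) _ ord1[OF x(1)]] by blast
      moreover have "[e * ?q = 0] (mod ?q * m)" using e(2) by (simp add: cong_0_iff mult.commute mult_dvd_mono)
      then have "x [^] (e * ?q) = x [^] (0::nat)" using powcong[OF x(1) _ ord1[OF x(1)]] by blast
      ultimately show "z \<in> (SIGMA v:?V. ?C v)" using x by (auto simp: nat_pow_pow nat_pow_mult add.commute)
    qed
  qed
  then have "card (carrier K) = card (SIGMA v:?V. ?C v)" by (simp add: bij_betw_same_card)
  also have "\<dots> = (\<Sum>v\<in>?V. card (?C v))" using assms(2) by (subst card_SigmaI) auto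
  also have "\<dots> = (\<Sum>v\<in>?V. card (p_elements (centralizer_group K {v}) p))"
    by (rule sum.cong) (auto simp: PE)
  finally show ?thesis by (simp add: order_def)
qed

lemma (in group) inv_mult_cancel:
  assumes "g \<in> carrier G" "x \<in> carrier G"
  shows "inv g \<otimes> (g \<otimes> x) = x" "g \<otimes> (inv g \<otimes> x) = x"
  using assms by (simp_all flip: m_assoc)

lemma (in group) conj_mult:
  assumes "g \<in> carrier G" "x \<in> carrier G" "y \<in> carrier G"
  shows "g \<otimes> x \<otimes> inv g \<otimes> (g \<otimes> y \<otimes> inv g) = g \<otimes> (x \<otimes> y) \<otimes> inv g"
  using assms by (simp add: m_assoc inv_mult_cancel)

lemma (in group) conj_nat_pow:
  assumes "g \<in> carrier G" "x \<in> carrier G"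
  shows "(g \<otimes> x \<otimes> inv g) [^] (n::nat) = g \<otimes> x [^] n \<otimes> inv g"
  by (induction n) (use assms in \<open>simp_all add: conj_mult\<close>)


lemma p_elements_centralizer_group:
  "p_elements (centralizer_group G H) p = {x \<in> p_elements G p. \<forall>h\<in>H. x \<otimes>\<^bsub>G\<^esub> h = h \<otimes>\<^bsub>G\<^esub> x}"
  unfolding p_elements_def centralizer_group_def by (auto simp: nat_pow_def)

lemma card_p_elements_centralizer_conj:
  fixes K (structure)
  assumes "group K" "g \<in> carrier K" "H \<subseteq> carrier K"
  shows "card (p_elements (centralizer_group K ((\<lambda>x. g \<otimes> x \<otimes> inv g) ` H)) p) =
         card (p_elements (centralizer_group K H) p)"
proof -
  interpret group K by fact
  have pow: "x [^]\<^bsub>centralizer_group K H\<^esub> (n::nat) = x [^] n" for x n H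
    by (simp add: centralizer_group_def nat_pow_def)
  have conj_pow: "(g \<otimes> x \<otimes> inv g) [^] (n::nat) = g \<otimes> x [^] n \<otimes> inv g"
    if "g \<in> carrier K" "x \<in> carrier K" for g x n
    using that by (rule conj_nat_pow)
  have sub: "(\<lambda>x. g \<otimes> x \<otimes> inv g) ` p_elements (centralizer_group K H) p
        \<subseteq> p_elements (centralizer_group K ((\<lambda>x. g \<otimes> x \<otimes> inv g) ` H)) p"
    if g: "g \<in> carrier K" and H: "H \<subseteq> carrier K" for g H
  proof -
    have "g \<otimes> x \<otimes> inv g \<otimes> (g \<otimes> h \<otimes> inv g) = g \<otimes> h \<otimes> inv g \<otimes> (g \<otimes> x \<otimes> inv g)"
      if "x \<in> carrier K" "h \<in> carrier K" "x \<otimes> h = h \<otimes> x" for x h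
      using that g by (simp add: conj_mult)
    then have comm: "\<forall>h\<in>(\<lambda>x. g \<otimes> x \<otimes> inv g) ` H. g \<otimes> x \<otimes> inv g \<otimes> h = h \<otimes> (g \<otimes> x \<otimes> inv g)"
      if "x \<in> carrier K" "\<forall>h\<in>H. x \<otimes> h = h \<otimes> x" for x
      using that H by blast
    have "(g \<otimes> x \<otimes> inv g) [^] (p ^ k) = \<one>" if "x \<in> carrier K" "x [^] (p ^ k) = \<one>" for x k
      using that g conj_pow by simp
    with comm show ?thesis
      unfolding p_elements_def pow using g H by (auto simp: centralizer_group_def simp del: conj_pow) blast+
  qed
  have cancel: "g \<otimes> (inv g \<otimes> x \<otimes> inv (inv g)) \<otimes> inv g = x" "inv g \<otimes> (g \<otimes> x \<otimes> inv g) \<otimes> inv (inv g) = x"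
    if "x \<in> carrier K" for x
    using that assms(2) by (simp_all add: m_assoc inv_mult_cancel)
  have "(\<lambda>x. inv g \<otimes> x \<otimes> inv (inv g)) ` ((\<lambda>x. g \<otimes> x \<otimes> inv g) ` H) = H"
    unfolding image_image using cancel(2) assms(3) by (auto simp: subset_iff image_iff intro!: bexI)
  then have sub': "(\<lambda>x. inv g \<otimes> x \<otimes> inv (inv g)) ` p_elements (centralizer_group K ((\<lambda>x. g \<otimes> x \<otimes> inv g) ` H)) p
    \<subseteq> p_elements (centralizer_group K H) p"
    using sub[of "inv g" "(\<lambda>x. g \<otimes> x \<otimes> inv g) ` H"] assms by auto
  have inK: "x \<in> carrier K" if "x \<in> p_elements (centralizer_group K H) p" for x H
    using that by (auto simp: p_elements_def centralizer_group_def)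
  have "bij_betw (\<lambda>x. g \<otimes> x \<otimes> inv g) (p_elements (centralizer_group K H) p)
    (p_elements (centralizer_group K ((\<lambda>x. g \<otimes> x \<otimes> inv g) ` H)) p)"
    by (rule bij_betw_byWitness[where f' = "\<lambda>x. inv g \<otimes> x \<otimes> inv (inv g)"])
       (use sub[OF assms(2,3)] sub' cancel inK in auto)
  then show ?thesis by (simp add: bij_betw_same_card)
qed

text \<open>
  If \<open>p\<close> divided the order, a subgroup of order \<open>p\<close>, which a Sylow theorem provides, would
  contain an element of order \<open>p\<close>.
\<close>

lemma not_dvd_card_subgroup_coprime_exponent:
  fixes K (structure)
  assumes "group K" "subgroup Z K" "finite Z" "prime p" "\<not> p dvd m"
    and exponent: "\<And>z. z \<in> Z \<Longrightarrow> z [^] m = \<one>"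
  shows "\<not> p dvd card Z"
proof
  interpret group K by fact
  assume "p dvd card Z"
  then obtain r where r: "card Z = p ^ 1 * r" by auto
  let ?Z = "K\<lparr>carrier := Z\<rparr>"
  have pow: "x [^]\<^bsub>?Z\<^esub> (n::nat) = x [^] n" for x n by (simp add: nat_pow_def)
  have gZ: "group ?Z" using subgroup_imp_group assms(2) by blast
  interpret Z: group ?Z by fact
  obtain P where P: "subgroup P ?Z" "card P = p ^ 1"
    using sylow_thm[OF assms(4) gZ, of 1 r] assms(3) r unfolding order_def by fastforce
  have "P \<noteq> {\<one>}" using P(2) assms(4) by (auto simp: prime_nat_iff)
  then obtain x where x: "x \<in> P" "x \<noteq> \<one>"
    using subgroup.one_closed[OF P(1)] by auto
  then have xZ: "x \<in> Z" "x \<in> carrier K" using subgroup.subset[OF P(1)] subgroup.subset[OF assms(2)] by auto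
  interpret P: group "?Z\<lparr>carrier := P\<rparr>" using Z.subgroup_imp_group[OF P(1)] .
  have "x [^]\<^bsub>?Z\<lparr>carrier := P\<rparr>\<^esub> p = \<one>"
    using P.pow_order_eq_1[of x] x P(2) by (simp add: order_def)
  then have "x [^] p = \<one>" by (simp add: nat_pow_def)
  then have "ord x dvd p" "ord x dvd m" using exponent[OF xZ(1)] pow_eq_id xZ(2) by auto
  then have "ord x = 1" using assms(4,5) by (metis One_nat_def dvd_trans prime_nat_iff)
  then show False using x(2) xZ(2) ord_eq_1 by auto
qed

text \<open>
  Frobenius's theorem that the \<open>p\<close>-part of the order of a finite group divides the number of its
  elements of \<open>p\<close>-power order. By induction on the order, apply the decomposition of \<open>K\<close>
  according to the \<open>p\<close>-regular part \<open>v\<close>. A noncentral \<open>v\<close> has a smaller centralizer, so the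
  conjugacy class of \<open>v\<close> contributes an element of \<^term>\<open>localized_int p\<close> to
  \<open>order K / order K = 1\<close>. Each central \<open>v\<close> contributes the number sought, and the number of
  central \<open>v\<close> is prime to \<open>p\<close>, so it can be divided out.
\<close>

theorem frobenius_p_elements:
  fixes K (structure)
  assumes "group K" "finite (carrier K)" "prime p"
  shows "of_nat (card (p_elements K p)) / of_nat (order K) \<in> localized_int p"
  using assms
proof (induction "order K" arbitrary: K rule: less_induct)
  case (less K)
  note grpK = \<open>group K\<close> and finK = \<open>finite (carrier K)\<close>
  interpret K: group K by fact
  have "order K \<noteq> 0" using finK K.order_gt_0_iff_finite by auto
  then obtain a m where am: "order K = p ^ a * m" "\<not> p dvd m"
    using multiplicity_decompose'[OF _ prime_elem_not_unit[OF prime_imp_prime_elem[OF assms(3)]], of "order K"] by blast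
  let ?V = "{v \<in> carrier K. v [^]\<^bsub>K\<^esub> m = \<one>\<^bsub>K\<^esub>}"
  let ?f = "\<lambda>v. card (p_elements (centralizer_group K {v}) p)"
  let ?Z = "{v \<in> ?V. \<forall>x\<in>carrier K. v \<otimes>\<^bsub>K\<^esub> x = x \<otimes>\<^bsub>K\<^esub> v}"
  let ?w = "\<lambda>v. if v \<in> ?Z then 0 else ?f v"
  let ?c = "\<lambda>g x. g \<otimes>\<^bsub>K\<^esub> x \<otimes>\<^bsub>K\<^esub> inv\<^bsub>K\<^esub> g"
  have conj_pow: "?c g x [^]\<^bsub>K\<^esub> (n::nat) = ?c g (x [^]\<^bsub>K\<^esub> n)"
    if "g \<in> carrier K" "x \<in> carrier K" for g x n
    using that by (rule K.conj_nat_pow)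
  have act: "group_action K ?V (\<lambda>g. restrict (?c g) ?V)"
    by (rule group_actionI[OF grpK]) (simp_all add: conj_pow, simp add: K.inv_mult_group K.m_assoc)
  have conj_fix: "?c g v = v \<longleftrightarrow> g \<otimes>\<^bsub>K\<^esub> v = v \<otimes>\<^bsub>K\<^esub> g" if "g \<in> carrier K" "v \<in> carrier K" for g v
    using that by (auto simp: K.inv_solve_right')
  have stab: "stabilizer K (\<lambda>g. restrict (?c g) ?V) v = carrier (centralizer_group K {v})" if "v \<in> ?V" for v
    using that conj_fix by (auto simp: stabilizer_def centralizer_group_def)
  have Z: "subgroup ?Z K"
  proof -
    have sc: "subgroup {x \<in> carrier K. \<forall>h\<in>carrier K. x \<otimes>\<^bsub>K\<^esub> h = h \<otimes>\<^bsub>K\<^esub> x} K"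
      by (rule subgroup_centralizer[OF grpK]) auto
    show ?thesis
    proof (rule K.subgroupI)
      fix x y assume x: "x \<in> ?Z" and y: "y \<in> ?Z"
      show "inv\<^bsub>K\<^esub> x \<in> ?Z"
        using subgroup.m_inv_closed[OF sc, of x] x by (auto simp: K.nat_pow_inv)
      show "x \<otimes>\<^bsub>K\<^esub> y \<in> ?Z"
      proof -
        have xy: "x \<in> carrier K" "y \<in> carrier K" "x \<otimes>\<^bsub>K\<^esub> y = y \<otimes>\<^bsub>K\<^esub> x" "x [^]\<^bsub>K\<^esub> m = \<one>\<^bsub>K\<^esub>" "y [^]\<^bsub>K\<^esub> m = \<one>\<^bsub>K\<^esub>"
          using x y by blast+
        have "(x \<otimes>\<^bsub>K\<^esub> y) [^]\<^bsub>K\<^esub> m = \<one>\<^bsub>K\<^esub>" using K.pow_mult_distrib[OF xy(3,1,2), of m] xy by simp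
        moreover have "x \<otimes>\<^bsub>K\<^esub> y \<in> {x \<in> carrier K. \<forall>h\<in>carrier K. x \<otimes>\<^bsub>K\<^esub> h = h \<otimes>\<^bsub>K\<^esub> x}"
          by (rule subgroup.m_closed[OF sc]) (use x y in blast)+
        ultimately show ?thesis by blast
      qed
    qed (auto intro!: exI[of _ "\<one>\<^bsub>K\<^esub>"])
  qed
  have finZ: "finite ?Z" "finite ?V" using finK by auto
  have *: "\<not> p dvd card ?Z"
    by (rule not_dvd_card_subgroup_coprime_exponent[OF grpK Z finZ(1) assms(3) am(2)]) auto
  have noncentral: "(of_nat (\<Sum>x\<in>?V. ?w x) / of_nat (order K) :: rat) \<in> localized_int p"
  proof (rule orbit_weighted_sum_localized[OF assms(3) act finZ(2) finK])
    show "?w (restrict (?c g) ?V v) = ?w v" if g: "g \<in> carrier K" and v: "v \<in> ?V" for g v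
    proof -
      have "?c g v \<in> ?Z \<longleftrightarrow> v \<in> ?Z"
      proof
        assume cv: "?c g v \<in> ?Z"
        have "g \<otimes>\<^bsub>K\<^esub> v = ?c g v \<otimes>\<^bsub>K\<^esub> g" using g v by (simp add: K.m_assoc)
        also have "\<dots> = g \<otimes>\<^bsub>K\<^esub> ?c g v" using cv g by simp
        finally have "?c g v = v" using g v cv by simp
        then show "v \<in> ?Z" using cv by simp
      next
        assume vZ: "v \<in> ?Z"
        then have "?c g v = v" using conj_fix[of g v] g by auto
        then show "?c g v \<in> ?Z" using vZ by simp
      qed
      moreover have "?f (?c g v) = ?f v"
        using card_p_elements_centralizer_conj[OF grpK g, of "{v}" p] v by auto
      ultimately show ?thesis using v by simp
    qed
    show "of_nat (?w v) / of_nat (card (stabilizer K (\<lambda>g. restrict (?c g) ?V) v)) \<in> localized_int p"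
      if v: "v \<in> ?V" for v
    proof (cases "v \<in> ?Z")
      case True
      then show ?thesis using localized_int_of_int[OF assms(3), of 0] by simp
    next
      case False
      have sub: "carrier (centralizer_group K {v}) \<subset> carrier K"
      proof
        show "carrier (centralizer_group K {v}) \<subseteq> carrier K" by (auto simp: centralizer_group_def)
        obtain x where "x \<in> carrier K" "v \<otimes>\<^bsub>K\<^esub> x \<noteq> x \<otimes>\<^bsub>K\<^esub> v" using False v by blast
        then have "x \<notin> carrier (centralizer_group K {v})" by (auto simp: centralizer_group_def)
        then show "carrier (centralizer_group K {v}) \<noteq> carrier K" using \<open>x \<in> carrier K\<close> by blast
      qed
      then have "order (centralizer_group K {v}) < order K"
        unfolding order_def using finK by (rule psubset_card_mono[rotated])
      moreover have "group (centralizer_group K {v})" using group_centralizer_group[OF grpK] v by simp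
      moreover have "finite (carrier (centralizer_group K {v}))" using sub finK finite_subset by blast
      ultimately have "of_nat (?f v) / of_nat (order (centralizer_group K {v})) \<in> localized_int p"
        using less.hyps assms(3) by blast
      then have "of_nat (?f v) / of_nat (card (stabilizer K (\<lambda>g. restrict (?c g) ?V) v)) \<in> localized_int p"
        unfolding stab[OF v] order_def .
      then show ?thesis unfolding if_not_P[OF False] .
    qed
  qed
  have central: "?f v = card (p_elements K p)" if "v \<in> ?Z" for v
  proof -
    have "centralizer_group K {v} = K" using that by (auto simp: centralizer_group_def intro!: monoid.equality)
    then show ?thesis by simp
  qed
  have "order K = (\<Sum>v\<in>?V. ?f v)"
    using card_eq_sum_p_elements_centralizer[OF grpK finK assms(3) am] by simp
  also have "\<dots> = (\<Sum>v\<in>?V. ?w v) + (\<Sum>v\<in>?V. if v \<in> ?Z then ?f v else 0)"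
    by (subst sum.distrib[symmetric], rule sum.cong) auto
  also have "(\<Sum>v\<in>?V. if v \<in> ?Z then ?f v else 0) = (\<Sum>v\<in>?Z. ?f v)"
  proof -
    have "{v \<in> ?V. v \<in> ?Z} = ?Z" by blast
    then show ?thesis using sum.inter_filter[OF finZ(2), of ?f "\<lambda>v. v \<in> ?Z"] by (simp only:)
  qed
  also have "\<dots> = card ?Z * card (p_elements K p)"
    using central by simp
  finally have "order K = (\<Sum>v\<in>?V. ?w v) + card ?Z * card (p_elements K p)" .
  then have "of_nat (order K) = (of_nat (\<Sum>v\<in>?V. ?w v) + of_nat (card ?Z) * of_nat (card (p_elements K p)) :: rat)"
    by (simp only: of_nat_add of_nat_mult)
  then have "of_nat (card ?Z) * (of_nat (card (p_elements K p)) / of_nat (order K))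
      = (of_int 1 :: rat) + of_int (-1) * (of_nat (\<Sum>x\<in>?V. ?w x) / of_nat (order K))"
    using \<open>order K \<noteq> 0\<close> by (simp add: field_simps del: of_nat_sum)
  also have "\<dots> \<in> localized_int p"
    by (intro localized_int_add localized_int_mult localized_int_of_int noncentral assms(3))
  finally show ?case using localized_int_div_unit[OF assms(3) _ *] by blast
qed

lemma commuting_p_tuples_eq_p_elements:
  assumes "group G" "prime p"
  shows "commuting_p_tuples G n p =
    {gs. length gs = n \<and> set gs \<subseteq> p_elements G p \<and> (\<forall>x\<in>set gs. \<forall>y\<in>set gs. x \<otimes>\<^bsub>G\<^esub> y = y \<otimes>\<^bsub>G\<^esub> x)}"
proof -
  interpret group G by fact
  have "(\<exists>k. group.ord G x = p ^ k) \<longleftrightarrow> (\<exists>k. x [^]\<^bsub>G\<^esub> (p ^ k) = \<one>\<^bsub>G\<^esub>)" if "x \<in> carrier G" for x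
    using that pow_eq_id divides_primepow_nat[OF assms(2)] by (metis dvd_refl)
  then show ?thesis unfolding commuting_p_tuples_def p_elements_def by (auto simp: subset_iff)
qed

lemma (in group) conj_tuple_mult:
  assumes "g \<in> carrier G" "h \<in> carrier G" "set gs \<subseteq> carrier G"
  shows "conj_tuple G (g \<otimes> h) gs = conj_tuple G g (conj_tuple G h gs)"
proof -
  have "(g \<otimes> h) \<otimes> x \<otimes> inv (g \<otimes> h) = g \<otimes> (h \<otimes> x \<otimes> inv h) \<otimes> inv g" if "x \<in> set gs" for x
    using assms that by (auto simp: inv_mult_group m_assoc subset_iff)
  then show ?thesis by (simp add: conj_tuple_def)
qed

lemma (in group) conj_tuple_one: "set gs \<subseteq> carrier G \<Longrightarrow> conj_tuple G \<one> gs = gs"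
  by (auto simp: conj_tuple_def subset_iff intro: map_idI)

lemma (in group) conj_tuple_eq_iff:
  assumes "g \<in> carrier G" "h \<in> carrier G" "set gs \<subseteq> carrier G"
  shows "conj_tuple G g gs = conj_tuple G h gs \<longleftrightarrow> inv h \<otimes> g \<in> carrier (centralizer_group G (set gs))"
proof -
  have "g \<otimes> x \<otimes> inv g = h \<otimes> x \<otimes> inv h \<longleftrightarrow> (inv h \<otimes> g) \<otimes> x = x \<otimes> (inv h \<otimes> g)" if "x \<in> set gs" for x
  proof -
    have x: "x \<in> carrier G" using that assms(3) by blast
    have "g \<otimes> x \<otimes> inv g = h \<otimes> x \<otimes> inv h \<longleftrightarrow> inv h \<otimes> (g \<otimes> x \<otimes> inv g) \<otimes> g = inv h \<otimes> (h \<otimes> x \<otimes> inv h) \<otimes> g"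
      using assms x by simp
    then show ?thesis using assms(1,2) x by (simp add: m_assoc inv_mult_cancel)
  qed
  then show ?thesis using assms(1,2) by (auto simp: conj_tuple_def centralizer_group_def)
qed

lemma (in group) conj_tuple_commuting_p_tuples:
  assumes "prime p" "g \<in> carrier G" "gs \<in> commuting_p_tuples G n p"
  shows "conj_tuple G g gs \<in> commuting_p_tuples G n p"
proof -
  have gs: "length gs = n" "set gs \<subseteq> carrier G"
    "\<And>x. x \<in> set gs \<Longrightarrow> \<exists>k. x [^] (p ^ k) = \<one>" "\<And>x y. x \<in> set gs \<Longrightarrow> y \<in> set gs \<Longrightarrow> x \<otimes> y = y \<otimes> x"
    using assms(3) unfolding commuting_p_tuples_eq_p_elements[OF is_group assms(1)] p_elements_def by auto
  have "\<exists>k. (g \<otimes> x \<otimes> inv g) [^] (p ^ k) = \<one>" if x: "x \<in> set gs" for x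
  proof -
    obtain k where "x [^] (p ^ k) = \<one>" using gs(3)[OF x] by blast
    moreover have "x \<in> carrier G" using gs(2) x by blast
    ultimately have "(g \<otimes> x \<otimes> inv g) [^] (p ^ k) = \<one>" using conj_nat_pow[OF assms(2), of x] assms(2) by simp
    then show ?thesis by blast
  qed
  moreover have "(g \<otimes> x \<otimes> inv g) \<otimes> (g \<otimes> y \<otimes> inv g) = (g \<otimes> y \<otimes> inv g) \<otimes> (g \<otimes> x \<otimes> inv g)"
    if "x \<in> set gs" "y \<in> set gs" for x y
  proof -
    have "x \<in> carrier G" "y \<in> carrier G" using that gs(2) by auto
    then show ?thesis using conj_mult[OF assms(2), of x y] conj_mult[OF assms(2), of y x] gs(4)[OF that] by simp
  qed
  ultimately show ?thesis
    using gs(1,2) assms(2) unfolding commuting_p_tuples_eq_p_elements[OF is_group assms(1)] p_elements_def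
    by (auto simp: conj_tuple_def)
qed

text \<open>
  A tuple of length \<open>l + 1\<close> consists of a tuple of length \<open>l\<close> and an element of \<open>p\<close>-power order
  of its centralizer. The centralizer is the stabilizer of the shorter tuple under conjugation,
  so Frobenius's theorem for it is what the weighted orbit count asks for.
\<close>

theorem card_commuting_p_tuples_localized:
  fixes K (structure)
  assumes "group K" "finite (carrier K)" "prime p" "n \<ge> 1"
  shows "of_nat (card (commuting_p_tuples K n p)) / of_nat (order K) \<in> localized_int p"
proof -
  interpret group K by fact
  obtain l where n: "n = Suc l" using assms(4) by (cases n) auto
  let ?S = "commuting_p_tuples K l p"
  let ?w = "\<lambda>gs. card (p_elements (centralizer_group K (set gs)) p)"
  have Scar: "set gs \<subseteq> carrier K" if "gs \<in> ?S" for gs using that unfolding commuting_p_tuples_def by auto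
  have "?S \<subseteq> {gs. set gs \<subseteq> carrier K \<and> length gs = l}" unfolding commuting_p_tuples_def by auto
  then have finS: "finite ?S" using finite_lists_length_eq[OF assms(2)] finite_subset by blast
  have finP: "finite (p_elements (centralizer_group K H) p)" for H
    using assms(2) by (auto simp: p_elements_def centralizer_group_def)
  have act: "group_action K ?S (\<lambda>g. restrict (conj_tuple K g) ?S)"
    by (rule group_actionI[OF assms(1)])
      (use conj_tuple_commuting_p_tuples[OF assms(3)] conj_tuple_one conj_tuple_mult Scar in auto)
  have stab: "stabilizer K (\<lambda>g. restrict (conj_tuple K g) ?S) gs = carrier (centralizer_group K (set gs))"
    if gs: "gs \<in> ?S" for gs
  proof -
    have "conj_tuple K g gs = gs \<longleftrightarrow> g \<in> carrier (centralizer_group K (set gs))" if g: "g \<in> carrier K" for g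
      using conj_tuple_eq_iff[OF g one_closed Scar[OF gs]] conj_tuple_one[OF Scar[OF gs]] g by simp
    then show ?thesis using gs by (auto simp: stabilizer_def centralizer_group_def)
  qed
  have "bij_betw (\<lambda>(gs, x). x # gs) (SIGMA gs:?S. p_elements (centralizer_group K (set gs)) p) (commuting_p_tuples K n p)"
  proof -
    have "x # gs \<in> commuting_p_tuples K n p \<longleftrightarrow> gs \<in> ?S \<and> x \<in> p_elements (centralizer_group K (set gs)) p" for x gs
      unfolding commuting_p_tuples_eq_p_elements[OF assms(1,3)] p_elements_centralizer_group n by auto
    moreover have "\<exists>x gs. hs = x # gs" if "hs \<in> commuting_p_tuples K n p" for hs
      using that unfolding n commuting_p_tuples_def by (auto simp: length_Suc_conv)
    ultimately have "(\<lambda>(gs, x). x # gs) ` (SIGMA gs:?S. p_elements (centralizer_group K (set gs)) p) = commuting_p_tuples K n p"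
      by (force simp: image_iff)
    then show ?thesis unfolding bij_betw_def by (auto simp: inj_on_def)
  qed
  then have "card (commuting_p_tuples K n p) = card (SIGMA gs:?S. p_elements (centralizer_group K (set gs)) p)"
    by (simp add: bij_betw_same_card)
  also have "\<dots> = (\<Sum>gs\<in>?S. ?w gs)" using finS finP by (subst card_SigmaI) auto
  finally have "card (commuting_p_tuples K n p) = (\<Sum>gs\<in>?S. ?w gs)" .
  moreover have "(of_nat (\<Sum>gs\<in>?S. ?w gs) / of_nat (order K) :: rat) \<in> localized_int p"
  proof (rule orbit_weighted_sum_localized[OF assms(3) act finS assms(2)])
    show "?w (restrict (conj_tuple K g) ?S gs) = ?w gs" if "g \<in> carrier K" "gs \<in> ?S" for g gs
      using card_p_elements_centralizer_conj[OF assms(1) that(1) Scar[OF that(2)], of p] that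
      by (simp add: conj_tuple_def)
    show "of_nat (?w gs) / of_nat (card (stabilizer K (\<lambda>g. restrict (conj_tuple K g) ?S) gs)) \<in> localized_int p"
      if "gs \<in> ?S" for gs
    proof -
      have "of_nat (?w gs) / of_nat (order (centralizer_group K (set gs))) \<in> localized_int p"
        by (rule frobenius_p_elements[OF group_centralizer_group[OF assms(1) Scar[OF that]] _ assms(3)])
           (use assms(2) in \<open>auto simp: centralizer_group_def\<close>)
      then show ?thesis using stab[OF that] by (simp add: order_def)
    qed
  qed
  ultimately show ?thesis by simp
qed

section \<open>Ranks of quotients of subgroups of free abelian groups\<close>

lemma exists_linear_relation:
  fixes M :: "'t \<Rightarrow> 's \<Rightarrow> 'r::idom"
  assumes "finite S" "finite T" "card S < card T"
  shows "\<exists>c. (\<exists>t\<in>T. c t \<noteq> 0) \<and> (\<forall>s\<in>S. (\<Sum>t\<in>T. c t * M t s) = 0)"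
  using assms
proof (induction S arbitrary: T M rule: finite_induct)
  case empty
  then have "T \<noteq> {}" by auto
  then show ?case by (intro exI[of _ "\<lambda>_. 1"]) auto
next
  case (insert s0 S)
  show ?case
  proof (cases "\<forall>t\<in>T. M t s0 = 0")
    case True
    have "card S < card T" using insert by simp
    then obtain c where "\<exists>t\<in>T. c t \<noteq> 0" "\<forall>s\<in>S. (\<Sum>t\<in>T. c t * M t s) = 0"
      using insert.IH insert.prems by blast
    then show ?thesis using True by (intro exI[of _ c]) auto
  next
    case False
    then obtain t0 where t0: "t0 \<in> T" "M t0 s0 \<noteq> 0" by auto
    let ?T = "T - {t0}"
    \<comment> \<open>Gaussian elimination with pivot \<open>t0\<close>, cross-multiplying because there is no division.\<close>
    let ?M = "\<lambda>t s. M t0 s0 * M t s - M t s0 * M t0 s"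
    have "card S < card ?T" using insert t0 by simp
    then obtain c where c: "\<exists>t\<in>?T. c t \<noteq> 0" "\<forall>s\<in>S. (\<Sum>t\<in>?T. c t * ?M t s) = 0"
      using insert.IH[of ?T ?M] insert.prems by blast
    define d where "d = (\<lambda>t. if t = t0 then - (\<Sum>t\<in>?T. c t * M t s0) else M t0 s0 * c t)"
    have "(\<Sum>t\<in>T. d t * M t s) = (\<Sum>t\<in>?T. c t * ?M t s)" for s
    proof -
      have "(\<Sum>t\<in>T. d t * M t s) = d t0 * M t0 s + (\<Sum>t\<in>?T. d t * M t s)"
        using t0 insert.prems by (simp add: sum.remove)
      also have "(\<Sum>t\<in>?T. d t * M t s) = (\<Sum>t\<in>?T. c t * (M t0 s0 * M t s))"
        by (rule sum.cong) (auto simp: d_def)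
      also have "d t0 * M t0 s = (\<Sum>t\<in>?T. - (c t * (M t s0 * M t0 s)))"
        by (simp add: d_def sum_distrib_right sum_negf mult.assoc)
      finally show ?thesis
        by (simp add: right_diff_distrib sum_subtractf sum_negf)
    qed
    then have "\<forall>s\<in>insert s0 S. (\<Sum>t\<in>T. d t * M t s) = 0" using c(2) by (auto simp: mult.commute)
    moreover have "\<exists>t\<in>T. d t \<noteq> 0" using c(1) t0 by (auto simp: d_def)
    ultimately show ?thesis by blast
  qed
qed

text \<open>
  Cycles and boundaries are sets of chains. Additive subgroups as plain sets of elements of a
  free abelian group make it possible to pass between them without forming quotient groups.
\<close>

definition frag_subgroup :: "('c \<Rightarrow>\<^sub>0 int) set \<Rightarrow> bool" where
  "frag_subgroup B \<longleftrightarrow> 0 \<in> B \<and> (\<forall>a\<in>B. \<forall>b\<in>B. a - b \<in> B)"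

lemma frag_subgroup_0: "frag_subgroup B \<Longrightarrow> 0 \<in> B"
  and frag_subgroup_diff: "frag_subgroup B \<Longrightarrow> a \<in> B \<Longrightarrow> b \<in> B \<Longrightarrow> a - b \<in> B"
  by (auto simp: frag_subgroup_def)

lemma frag_subgroup_minus: "frag_subgroup B \<Longrightarrow> a \<in> B \<Longrightarrow> - a \<in> B"
  using frag_subgroup_diff[of B 0 a] frag_subgroup_0 by auto

lemma frag_subgroup_add: "frag_subgroup B \<Longrightarrow> a \<in> B \<Longrightarrow> b \<in> B \<Longrightarrow> a + b \<in> B"
  using frag_subgroup_diff[of B a "- b"] frag_subgroup_minus by auto

lemma frag_subgroup_cmul:
  assumes "frag_subgroup B" "a \<in> B"
  shows "frag_cmul k a \<in> B"
proof (induction k rule: int_induct[where k = 0])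
  case base then show ?case using assms frag_subgroup_0 by simp
next
  case (step1 i) then show ?case using assms frag_subgroup_add by (simp add: frag_cmul_distrib)
next
  case (step2 i) then show ?case using assms frag_subgroup_diff by (simp add: frag_cmul_diff_distrib)
qed

lemma frag_subgroup_sum:
  assumes "frag_subgroup B" "\<And>i. i \<in> I \<Longrightarrow> f i \<in> B"
  shows "sum f I \<in> B"
  using assms(2) by (induction I rule: infinite_finite_induct) (auto intro: frag_subgroup_0 frag_subgroup_add assms(1))

definition lincomb :: "(('c \<Rightarrow>\<^sub>0 int) \<Rightarrow> int) \<Rightarrow> ('c \<Rightarrow>\<^sub>0 int) set \<Rightarrow> ('c \<Rightarrow>\<^sub>0 int)" where
  "lincomb a S = (\<Sum>s\<in>S. frag_cmul (a s) s)"

lemma frag_cmul_diff: "frag_cmul k (a - b) = frag_cmul k a - frag_cmul k b"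
  using frag_cmul_distrib2[of k "a - b" b] by (simp add: algebra_simps)

lemma lincomb_in: "frag_subgroup Z \<Longrightarrow> S \<subseteq> Z \<Longrightarrow> lincomb a S \<in> Z"
  unfolding lincomb_def by (rule frag_subgroup_sum) (auto intro: frag_subgroup_cmul)

lemma frag_cmul_lincomb: "frag_cmul k (lincomb a S) = lincomb (\<lambda>s. k * a s) S"
  unfolding lincomb_def by (simp add: frag_cmul_sum)

definition indep_mod :: "('c \<Rightarrow>\<^sub>0 int) set \<Rightarrow> ('c \<Rightarrow>\<^sub>0 int) set \<Rightarrow> bool" where
  "indep_mod B S \<longleftrightarrow> finite S \<and> (\<forall>a. lincomb a S \<in> B \<longrightarrow> (\<forall>s\<in>S. a s = 0))"

text \<open>
  Only a nonzero multiple of each element has to be a combination of \<open>S\<close>, so that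
  \<open>has_rank Z B r\<close> below says that \<open>Z / B\<close> has torsion-free rank \<open>r\<close>, that is, \<open>Z / B\<close> tensored
  with the rationals has dimension \<open>r\<close>.
\<close>

definition spans_mod :: "('c \<Rightarrow>\<^sub>0 int) set \<Rightarrow> ('c \<Rightarrow>\<^sub>0 int) set \<Rightarrow> ('c \<Rightarrow>\<^sub>0 int) set \<Rightarrow> bool" where
  "spans_mod Z B S \<longleftrightarrow> finite S \<and> (\<forall>z\<in>Z. \<exists>k a. k \<noteq> 0 \<and> frag_cmul k z - lincomb a S \<in> B)"

definition has_rank :: "('c \<Rightarrow>\<^sub>0 int) set \<Rightarrow> ('c \<Rightarrow>\<^sub>0 int) set \<Rightarrow> nat \<Rightarrow> bool" where
  "has_rank Z B r \<longleftrightarrow> (\<exists>S\<subseteq>Z. indep_mod B S \<and> spans_mod Z B S \<and> card S = r)"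

lemma card_indep_le_card_spanning:
  assumes "frag_subgroup B" "T \<subseteq> Z" "indep_mod B T" "spans_mod Z B S"
  shows "card T \<le> card S"
proof (rule ccontr)
  assume "\<not> card T \<le> card S"
  then have lt: "card S < card T" by simp
  have fin: "finite S" "finite T" using assms by (auto simp: indep_mod_def spans_mod_def)
  have "\<forall>t\<in>T. \<exists>k a. k \<noteq> 0 \<and> frag_cmul k t - lincomb a S \<in> B"
    using assms unfolding spans_mod_def by blast
  then obtain k a where ka: "\<And>t. t \<in> T \<Longrightarrow> k t \<noteq> 0 \<and> frag_cmul (k t) t - lincomb (a t) S \<in> B"
    by metis
  obtain c where c: "\<exists>t\<in>T. c t \<noteq> 0" "\<forall>s\<in>S. (\<Sum>t\<in>T. c t * a t s) = 0"
    using exists_linear_relation[OF fin lt, of a] by blast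
  have "lincomb (\<lambda>t. c t * k t) T = (\<Sum>t\<in>T. frag_cmul (c t) (frag_cmul (k t) t - lincomb (a t) S))
     + (\<Sum>t\<in>T. frag_cmul (c t) (lincomb (a t) S))"
    unfolding lincomb_def by (simp flip: sum.distrib frag_cmul_distrib2)
  also have "(\<Sum>t\<in>T. frag_cmul (c t) (lincomb (a t) S)) = (\<Sum>s\<in>S. frag_cmul (\<Sum>t\<in>T. c t * a t s) s)"
  proof -
    have sc: "(\<Sum>t\<in>T. frag_cmul (f t) s) = frag_cmul (\<Sum>t\<in>T. f t) s" for f s
      using fin(2) by (induction T rule: finite_induct) (auto simp: frag_cmul_distrib)
    have "(\<Sum>t\<in>T. frag_cmul (c t) (lincomb (a t) S)) = (\<Sum>t\<in>T. \<Sum>s\<in>S. frag_cmul (c t * a t s) s)"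
      unfolding lincomb_def by (simp add: frag_cmul_sum)
    also have "\<dots> = (\<Sum>s\<in>S. \<Sum>t\<in>T. frag_cmul (c t * a t s) s)" by (rule sum.swap)
    finally show ?thesis by (simp add: sc)
  qed
  also have "\<dots> = 0" using c(2) by simp
  finally have "lincomb (\<lambda>t. c t * k t) T \<in> B"
    using ka by (auto intro!: frag_subgroup_sum[OF assms(1)] frag_subgroup_cmul[OF assms(1)])
  then have "\<forall>t\<in>T. c t * k t = 0" using assms(3) unfolding indep_mod_def by blast
  then show False using c(1) ka by auto
qed

lemma has_rank_unique:
  assumes "frag_subgroup B" "has_rank Z B r" "has_rank Z B s"
  shows "r = s"
  using assms card_indep_le_card_spanning[OF assms(1)] unfolding has_rank_def by (meson le_antisym)

text \<open>
  Independence modulo \<open>B'\<close> implies independence modulo \<open>B\<close>, which bounds the size of an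
  independent family. A largest one spans: adjoining any further element creates a relation in
  which the coefficient of that element is not zero.
\<close>

lemma has_rank_subquotient:
  assumes "frag_subgroup B" "frag_subgroup B'" "frag_subgroup Z'" "B \<subseteq> B'" "Z' \<subseteq> Z" "has_rank Z B r"
  shows "\<exists>r'. has_rank Z' B' r'"
proof -
  let ?P = "\<lambda>n. \<exists>S\<subseteq>Z'. indep_mod B' S \<and> card S = n"
  obtain S0 where S0: "S0 \<subseteq> Z" "indep_mod B S0" "spans_mod Z B S0" "card S0 = r"
    using assms(6) unfolding has_rank_def by blast
  have bound: "n \<le> r" if Pn: "?P n" for n
  proof -
    obtain S where S: "S \<subseteq> Z'" "indep_mod B' S" "card S = n" using Pn by (elim exE conjE)
    have "indep_mod B S" using S(2) assms(4) unfolding indep_mod_def by blast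
    then show ?thesis using card_indep_le_card_spanning[OF assms(1) _ _ S0(3)] S assms(5) S0(4) by blast
  qed
  have "?P 0" using assms(2) by (intro exI[of _ "{}"]) (auto simp: indep_mod_def)
  define n where "n = (GREATEST n. ?P n)"
  have "?P n" unfolding n_def by (rule GreatestI_nat[of ?P, OF \<open>?P 0\<close> bound])
  have max: "m \<le> n" if "?P m" for m unfolding n_def by (rule Greatest_le_nat[of ?P, OF that bound])
  obtain S where S: "S \<subseteq> Z'" "indep_mod B' S" "card S = n" using \<open>?P n\<close> by blast
  have finS: "finite S" using S by (auto simp: indep_mod_def)
  have "\<exists>k a. k \<noteq> 0 \<and> frag_cmul k z - lincomb a S \<in> B'" if z: "z \<in> Z'" for z
  proof (cases "z \<in> S")
    case True
    have "lincomb (\<lambda>s. if s = z then 1 else 0) S = (\<Sum>s\<in>S. if s = z then z else 0)"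
      unfolding lincomb_def by (rule sum.cong) auto
    also have "\<dots> = z" using True finS by simp
    finally have "frag_cmul 1 z - lincomb (\<lambda>s. if s = z then 1 else 0) S \<in> B'"
      using frag_subgroup_0[OF assms(2)] by simp
    then show ?thesis using zero_neq_one by metis
  next
    case False
    have "\<not> indep_mod B' (insert z S)"
    proof
      assume "indep_mod B' (insert z S)"
      then have "?P (Suc n)" using False finS S z by (intro exI[of _ "insert z S"]) auto
      then show False using max[of "Suc n"] by simp
    qed
    then obtain a where a: "lincomb a (insert z S) \<in> B'" "\<exists>s\<in>insert z S. a s \<noteq> 0"
      using finS unfolding indep_mod_def by auto
    have eq: "lincomb a (insert z S) = frag_cmul (a z) z + lincomb a S"
      unfolding lincomb_def using False finS by simp
    have "a z \<noteq> 0"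
    proof
      assume "a z = 0"
      then have "lincomb a S \<in> B'" using a eq by simp
      then show False using S(2) a(2) \<open>a z = 0\<close> unfolding indep_mod_def by auto
    qed
    moreover have "lincomb (\<lambda>s. - a s) S = - lincomb a S"
      unfolding lincomb_def by (simp flip: sum_negf)
    ultimately show ?thesis using a(1) eq by (intro exI[of _ "a z"] exI[of _ "\<lambda>s. - a s"]) auto
  qed
  then have "spans_mod Z' B' S" unfolding spans_mod_def using finS by simp
  then show ?thesis unfolding has_rank_def using S by (intro exI[of _ n] exI[of _ S]) simp
qed

text \<open>
  A basis of \<open>M / B\<close> and one of \<open>Z / M\<close> together form a basis of \<open>Z / B\<close>, up to multiples.
\<close>

lemma has_rank_tower:
  assumes "frag_subgroup B" "frag_subgroup M" "B \<subseteq> M" "M \<subseteq> Z" "has_rank M B r" "has_rank Z M s"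
  shows "has_rank Z B (r + s)"
proof -
  obtain S where S: "S \<subseteq> M" "indep_mod B S" "spans_mod M B S" "card S = r"
    using assms(5) unfolding has_rank_def by blast
  obtain T where T: "T \<subseteq> Z" "indep_mod M T" "spans_mod Z M T" "card T = s"
    using assms(6) unfolding has_rank_def by blast
  have fin: "finite S" "finite T" using S T by (auto simp: indep_mod_def)
  have disj: "S \<inter> T = {}"
  proof (rule ccontr)
    assume "S \<inter> T \<noteq> {}"
    then obtain x where x: "x \<in> S" "x \<in> T" by auto
    have "lincomb (\<lambda>s. if s = x then 1 else 0) T = (\<Sum>s\<in>T. if s = x then x else 0)"
      unfolding lincomb_def by (rule sum.cong) auto
    also have "\<dots> = x" using x fin by simp
    finally have "lincomb (\<lambda>s. if s = x then 1 else 0) T \<in> M" using x S(1) by auto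
    then have "(if x = x then 1 else 0 :: int) = 0" using T(2) x(2) unfolding indep_mod_def by blast
    then show False by simp
  qed
  have Un: "lincomb a (S \<union> T) = lincomb a S + lincomb a T" for a
    unfolding lincomb_def using fin disj by (rule sum.union_disjoint)
  have "indep_mod B (S \<union> T)"
    unfolding indep_mod_def
  proof (intro conjI allI impI)
    fix a assume a: "lincomb a (S \<union> T) \<in> B"
    have "lincomb a T = lincomb a (S \<union> T) - lincomb a S" using Un by simp
    also have "\<dots> \<in> M"
      using a assms(3) lincomb_in[OF assms(2) S(1)] by (intro frag_subgroup_diff[OF assms(2)]) auto
    finally have T0: "\<forall>t\<in>T. a t = 0" using T(2) unfolding indep_mod_def by blast
    then have "lincomb a T = 0" unfolding lincomb_def by simp
    then have "lincomb a S \<in> B" using a Un by simp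
    then show "\<forall>s\<in>S \<union> T. a s = 0" using T0 S(2) unfolding indep_mod_def by blast
  qed (use fin in auto)
  moreover have "spans_mod Z B (S \<union> T)"
    unfolding spans_mod_def
  proof (intro conjI ballI)
    fix z assume z: "z \<in> Z"
    obtain k a where ka: "k \<noteq> 0" "frag_cmul k z - lincomb a T \<in> M"
      using T(3) z unfolding spans_mod_def by blast
    obtain l b where lb: "l \<noteq> 0" "frag_cmul l (frag_cmul k z - lincomb a T) - lincomb b S \<in> B"
      using S(3) ka unfolding spans_mod_def by blast
    define c where "c = (\<lambda>s. if s \<in> S then b s else l * a s)"
    have "lincomb c S = lincomb b S" unfolding lincomb_def c_def by (rule sum.cong) auto
    moreover have "lincomb c T = frag_cmul l (lincomb a T)"
      unfolding frag_cmul_lincomb unfolding lincomb_def c_def by (rule sum.cong) (use disj in auto)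
    ultimately have "frag_cmul (l * k) z - lincomb c (S \<union> T) \<in> B"
      using lb(2) unfolding Un[of c] frag_cmul_diff by (simp add: diff_diff_eq add.commute)
    then show "\<exists>k a. k \<noteq> 0 \<and> frag_cmul k z - lincomb a (S \<union> T) \<in> B"
      using ka lb by (metis mult_eq_0_iff)
  qed (use fin in auto)
  moreover have "card (S \<union> T) = r + s" using fin disj S T by (simp add: card_Un_disjoint)
  moreover have "S \<union> T \<subseteq> Z" using S T assms(4) by auto
  ultimately show ?thesis unfolding has_rank_def by (intro exI[of _ "S \<union> T"]) simp
qed

text \<open>
  The map is additive only modulo \<open>B'\<close>, so that it may arise from a choice of representatives of
  an isomorphism from \<open>Z / B\<close> to \<open>Z' / B'\<close>.
\<close>

definition quotient_iso ::
    "('c \<Rightarrow>\<^sub>0 int) set \<Rightarrow> ('c \<Rightarrow>\<^sub>0 int) set \<Rightarrow> ('d \<Rightarrow>\<^sub>0 int) set \<Rightarrow> ('d \<Rightarrow>\<^sub>0 int) set \<Rightarrow> (('c \<Rightarrow>\<^sub>0 int) \<Rightarrow> ('d \<Rightarrow>\<^sub>0 int)) \<Rightarrow> bool" where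
  "quotient_iso Z B Z' B' f \<longleftrightarrow>
     (\<forall>x\<in>Z. f x \<in> Z') \<and> (\<forall>x\<in>Z. \<forall>y\<in>Z. f (x - y) - (f x - f y) \<in> B') \<and>
     (\<forall>x\<in>Z. f x \<in> B' \<longleftrightarrow> x \<in> B) \<and> (\<forall>y\<in>Z'. \<exists>x\<in>Z. y - f x \<in> B')"

lemma has_rank_iso:
  assumes Z: "frag_subgroup Z" and B: "frag_subgroup B" and Z': "frag_subgroup Z'" and B': "frag_subgroup B'"
    and iso: "quotient_iso Z B Z' B' f" and rank: "has_rank Z B r"
  shows "has_rank Z' B' r"
proof -
  note d' = frag_subgroup_diff[OF B'] and a' = frag_subgroup_add[OF B'] and m' = frag_subgroup_minus[OF B']
  have fZ: "f x \<in> Z'" if "x \<in> Z" for x using iso that unfolding quotient_iso_def by blast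
  have fd: "f (x - y) - (f x - f y) \<in> B'" if "x \<in> Z" "y \<in> Z" for x y using iso that unfolding quotient_iso_def by blast
  have fB: "f x \<in> B' \<longleftrightarrow> x \<in> B" if "x \<in> Z" for x using iso that unfolding quotient_iso_def by blast
  have surj: "\<exists>x\<in>Z. y - f x \<in> B'" if "y \<in> Z'" for y using iso that unfolding quotient_iso_def by blast
  have f0: "f 0 \<in> B'" using fB frag_subgroup_0[OF Z] frag_subgroup_0[OF B] by blast
  have fm: "f (- y) + f y \<in> B'" if "y \<in> Z" for y
  proof -
    have "f (0 - y) - (f 0 - f y) + f 0 \<in> B'" by (intro a' fd f0 that frag_subgroup_0[OF Z])
    then show ?thesis by simp
  qed
  have fa: "f (x + y) - (f x + f y) \<in> B'" if "x \<in> Z" "y \<in> Z" for x y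
  proof -
    have "f (x - - y) - (f x - f (- y)) - (f (- y) + f y) \<in> B'"
      by (rule d'[OF fd[OF that(1) frag_subgroup_minus[OF Z that(2)]] fm[OF that(2)]])
    then show ?thesis by (simp add: algebra_simps)
  qed
  have fc: "f (frag_cmul k x) - frag_cmul k (f x) \<in> B'" if x: "x \<in> Z" for k x
  proof (induction k rule: int_induct[where k = 0])
    case base then show ?case using f0 by simp
  next
    case (step1 i)
    have "f (frag_cmul i x + x) - (f (frag_cmul i x) + f x) + (f (frag_cmul i x) - frag_cmul i (f x)) \<in> B'"
      by (intro a' fa step1 x frag_subgroup_cmul[OF Z])
    then show ?case by (simp add: frag_cmul_distrib algebra_simps)
  next
    case (step2 i)
    have "f (frag_cmul i x - x) - (f (frag_cmul i x) - f x) + (f (frag_cmul i x) - frag_cmul i (f x)) \<in> B'"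
      by (intro a' fd step2 x frag_subgroup_cmul[OF Z])
    then show ?case by (simp add: frag_cmul_diff_distrib algebra_simps)
  qed
  have fs: "f (\<Sum>s\<in>S. g s) - (\<Sum>s\<in>S. f (g s)) \<in> B'" if "finite S" "\<And>s. s \<in> S \<Longrightarrow> g s \<in> Z"
    for S and g :: "('a \<Rightarrow>\<^sub>0 int) \<Rightarrow> ('a \<Rightarrow>\<^sub>0 int)"
    using that
  proof (induction S rule: finite_induct)
    case (insert s S)
    have "f (g s + sum g S) - (f (g s) + f (sum g S)) + (f (sum g S) - (\<Sum>s\<in>S. f (g s))) \<in> B'"
      using insert by (intro a' fa frag_subgroup_sum[OF Z]) auto
    then show ?case using insert by (simp add: algebra_simps)
  qed (use f0 in simp)
  have fl: "f (lincomb a S) - (\<Sum>s\<in>S. frag_cmul (a s) (f s)) \<in> B'" if "finite S" "S \<subseteq> Z" for a S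
  proof -
    have "f (lincomb a S) - (\<Sum>s\<in>S. f (frag_cmul (a s) s)) + (\<Sum>s\<in>S. f (frag_cmul (a s) s) - frag_cmul (a s) (f s)) \<in> B'"
      unfolding lincomb_def using that
      by (intro a' fs frag_subgroup_sum[OF B'] fc frag_subgroup_cmul[OF Z]) auto
    then show ?thesis by (simp add: sum_subtractf)
  qed
  obtain S where S: "S \<subseteq> Z" "indep_mod B S" "spans_mod Z B S" "card S = r"
    using rank unfolding has_rank_def by blast
  have finS: "finite S" using S by (auto simp: indep_mod_def)
  have ind: "\<forall>s\<in>S. a s = 0" if "lincomb a S \<in> B" for a using S(2) that unfolding indep_mod_def by blast
  have inj: "inj_on f S"
  proof (rule inj_onI, rule ccontr)
    fix s t assume st: "s \<in> S" "t \<in> S" "f s = f t" "s \<noteq> t"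
    have "f (s - t) \<in> B'" using fd[of s t] st S(1) by auto
    then have "s - t \<in> B" using fB[of "s - t"] frag_subgroup_diff[OF Z] st S(1) by blast
    moreover have "lincomb (\<lambda>x. if x = s then 1 else if x = t then -1 else 0) S = s - t"
    proof -
      have "lincomb (\<lambda>x. if x = s then 1 else if x = t then -1 else 0) S
          = (\<Sum>x\<in>S. (if x = s then s else 0) + (if x = t then - t else 0))"
        unfolding lincomb_def using st(4) by (intro sum.cong) auto
      also have "\<dots> = s - t" using st finS by (simp add: sum.distrib)
      finally show ?thesis .
    qed
    ultimately show False using ind[of "\<lambda>x. if x = s then 1 else if x = t then -1 else 0"] st by auto
  qed
  have img: "lincomb a (f ` S) = (\<Sum>s\<in>S. frag_cmul (a (f s)) (f s))" for a
    unfolding lincomb_def by (simp add: sum.reindex[OF inj])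
  have "indep_mod B' (f ` S)"
    unfolding indep_mod_def
  proof (intro conjI allI impI)
    fix a assume "lincomb a (f ` S) \<in> B'"
    then have "f (lincomb (a \<circ> f) S) - (\<Sum>s\<in>S. frag_cmul (a (f s)) (f s)) + (\<Sum>s\<in>S. frag_cmul (a (f s)) (f s)) \<in> B'"
      using fl[OF finS S(1), of "a \<circ> f"] img by (intro a') auto
    then have "lincomb (a \<circ> f) S \<in> B" using fB[OF lincomb_in[OF Z S(1)]] by simp
    then have "\<forall>s\<in>S. (a \<circ> f) s = 0" by (rule ind)
    then show "\<forall>s\<in>f ` S. a s = 0" by simp
  qed (use finS in auto)
  moreover have "spans_mod Z' B' (f ` S)"
    unfolding spans_mod_def
  proof (intro conjI ballI)
    fix y assume "y \<in> Z'"
    then obtain x where x: "x \<in> Z" "y - f x \<in> B'" using surj by blast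
    obtain k a where ka: "k \<noteq> 0" "frag_cmul k x - lincomb a S \<in> B"
      using S(3) x unfolding spans_mod_def by blast
    have kx: "frag_cmul k x \<in> Z" and la: "lincomb a S \<in> Z"
      using x frag_subgroup_cmul[OF Z] lincomb_in[OF Z S(1)] by auto
    have 1: "f (frag_cmul k x - lincomb a S) \<in> B'" using ka fB frag_subgroup_diff[OF Z kx la] by blast
    define b where "b = (\<lambda>s. a (the_inv_into S f s))"
    have lb: "lincomb b (f ` S) = (\<Sum>s\<in>S. frag_cmul (a s) (f s))"
      unfolding img b_def by (rule sum.cong) (auto simp: the_inv_into_f_f[OF inj])
    note f1 = frag_subgroup_cmul[OF B' x(2), of k] and f2 = fc[OF x(1), of k] and f3 = fd[OF kx la]
      and f4 = fl[OF finS S(1), of a, folded lb]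
    have "frag_cmul k y - lincomb b (f ` S) = frag_cmul k (y - f x) - (f (frag_cmul k x) - frag_cmul k (f x))
        - (f (frag_cmul k x - lincomb a S) - (f (frag_cmul k x) - f (lincomb a S)))
        + f (frag_cmul k x - lincomb a S) + (f (lincomb a S) - lincomb b (f ` S))"
      unfolding frag_cmul_diff by (simp add: algebra_simps)
    also have "\<dots> \<in> B'"
      by (rule a'[OF a'[OF d'[OF d'[OF f1 f2] f3] 1] f4])
    finally show "\<exists>k a. k \<noteq> 0 \<and> frag_cmul k y - lincomb a (f ` S) \<in> B'"
      using ka(1) by (intro exI[of _ k] exI[of _ b]) simp
  qed (use finS in auto)
  moreover have "card (f ` S) = r" using S card_image[OF inj] by simp
  ultimately show ?thesis unfolding has_rank_def using fZ S(1) by blast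
qed

lemma quotient_iso_inverse:
  assumes Z: "frag_subgroup Z" and B: "frag_subgroup B" and Z': "frag_subgroup Z'" and B': "frag_subgroup B'"
    and iso: "quotient_iso Z B Z' B' f"
  shows "\<exists>g. quotient_iso Z' B' Z B g"
proof -
  note d' = frag_subgroup_diff[OF B'] and a' = frag_subgroup_add[OF B']
  have fZ: "f x \<in> Z'" if "x \<in> Z" for x using iso that unfolding quotient_iso_def by blast
  have fd: "f (x - y) - (f x - f y) \<in> B'" if "x \<in> Z" "y \<in> Z" for x y using iso that unfolding quotient_iso_def by blast
  have fB: "f x \<in> B' \<longleftrightarrow> x \<in> B" if "x \<in> Z" for x using iso that unfolding quotient_iso_def by blast
  have "\<forall>y\<in>Z'. \<exists>x\<in>Z. y - f x \<in> B'" using iso unfolding quotient_iso_def by blast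
  then obtain g where g: "\<And>y. y \<in> Z' \<Longrightarrow> g y \<in> Z \<and> y - f (g y) \<in> B'" by metis
  have cancel: "u - v \<in> B" if "u \<in> Z" "v \<in> Z" "f u - f v \<in> B'" for u v
  proof -
    have "f (u - v) - (f u - f v) + (f u - f v) \<in> B'" by (intro a' fd that)
    then show ?thesis using fB[OF frag_subgroup_diff[OF Z that(1,2)]] by simp
  qed
  have "quotient_iso Z' B' Z B g"
    unfolding quotient_iso_def
  proof (intro conjI ballI)
    fix x y assume xy: "x \<in> Z'" "y \<in> Z'"
    have gs: "g x \<in> Z" "g y \<in> Z" "g (x - y) \<in> Z" using g xy frag_subgroup_diff[OF Z'] by auto
    have "(x - f (g x)) - (y - f (g y)) - ((x - y) - f (g (x - y))) - (f (g x - g y) - (f (g x) - f (g y))) \<in> B'"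
      using d'[OF d'[OF d'[OF conjunct2[OF g[OF xy(1)]] conjunct2[OF g[OF xy(2)]]]
          conjunct2[OF g[OF frag_subgroup_diff[OF Z' xy]]]] fd[OF gs(1,2)]] .
    then have "f (g (x - y)) - f (g x - g y) \<in> B'" by (simp add: algebra_simps)
    then show "g (x - y) - (g x - g y) \<in> B" by (intro cancel gs frag_subgroup_diff[OF Z])
  next
    fix y assume y: "y \<in> Z'"
    show "g y \<in> Z" using g y by blast
    have "f (g y) \<in> B' \<longleftrightarrow> y \<in> B'"
      using g[OF y] a'[of "y - f (g y)" "f (g y)"] d'[of y "y - f (g y)"] by auto
    then show "g y \<in> B \<longleftrightarrow> y \<in> B'" using fB g y by blast
  next
    fix x assume x: "x \<in> Z"
    have "x - g (f x) \<in> B" using g[OF fZ[OF x]] by (intro cancel x) auto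
    then show "\<exists>y\<in>Z'. x - g y \<in> B" using fZ x by blast
  qed
  then show ?thesis by blast
qed

lemma has_rank_iso_iff:
  assumes "frag_subgroup Z" "frag_subgroup B" "frag_subgroup Z'" "frag_subgroup B'" "quotient_iso Z B Z' B' f"
  shows "has_rank Z' B' r \<longleftrightarrow> has_rank Z B r"
  using has_rank_iso quotient_iso_inverse assms by metis

section \<open>Rational Betti numbers as ranks of integral homology\<close>

lemma lookup_rat_scale [simp]: "Poly_Mapping.lookup (rat_scale q c) k = q * Poly_Mapping.lookup c k"
  unfolding rat_scale_def by (simp add: Poly_Mapping.map.rep_eq when_def)

lemma rat_scale_simps:
  "rat_scale q (rat_scale r c) = rat_scale (q * r) c" "rat_scale 1 c = c" "rat_scale 0 c = 0" "rat_scale q 0 = 0"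
  "rat_scale q (c + d) = rat_scale q c + rat_scale q d" "rat_scale q (c - d) = rat_scale q c - rat_scale q d"
  by (rule poly_mapping_eqI, simp add: algebra_simps lookup_add lookup_minus)+

lemma rat_scale_sum: "rat_scale q (sum f I) = (\<Sum>i\<in>I. rat_scale q (f i))"
  by (rule poly_mapping_eqI) (simp add: lookup_sum sum_distrib_left)

lemma sum_rat_scale: "(\<Sum>i\<in>I. rat_scale (q i) c) = rat_scale (sum q I) c"
  by (rule poly_mapping_eqI) (simp add: lookup_sum sum_distrib_right)

lemma keys_rat_scale: "q \<noteq> 0 \<Longrightarrow> Poly_Mapping.keys (rat_scale q c) = Poly_Mapping.keys c"
  by (auto simp: in_keys_iff)

lemma quotient_basis_card_le:
  assumes zero: "0 \<in> B" and add: "\<And>a b. a \<in> B \<Longrightarrow> b \<in> B \<Longrightarrow> a + b \<in> B"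
    and scale: "\<And>q b. b \<in> B \<Longrightarrow> rat_scale q b \<in> B"
    and S: "quotient_basis Z B S" and T: "quotient_basis Z B T"
  shows "card T \<le> card S"
proof (rule ccontr)
  assume "\<not> card T \<le> card S"
  then have lt: "card S < card T" by simp
  have fin: "finite S" "finite T" and TZ: "T \<subseteq> Z" using S T by (auto simp: quotient_basis_def)
  have sum: "sum f I \<in> B" if "\<And>i. i \<in> I \<Longrightarrow> f i \<in> B" for f :: "('a \<Rightarrow>\<^sub>0 rat) \<Rightarrow> ('a \<Rightarrow>\<^sub>0 rat)" and I
    using that by (induction I rule: infinite_finite_induct) (auto intro: zero add)
  have "\<forall>t\<in>T. \<exists>a. t - (\<Sum>s\<in>S. rat_scale (a s) s) \<in> B"
    using S TZ unfolding quotient_basis_def by blast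
  then obtain a where a: "\<And>t. t \<in> T \<Longrightarrow> t - (\<Sum>s\<in>S. rat_scale (a t s) s) \<in> B" by metis
  obtain c where c: "\<exists>t\<in>T. c t \<noteq> 0" "\<forall>s\<in>S. (\<Sum>t\<in>T. c t * a t s) = 0"
    using exists_linear_relation[OF fin lt, of a] by blast
  have "(\<Sum>t\<in>T. rat_scale (c t) t) = (\<Sum>t\<in>T. rat_scale (c t) (t - (\<Sum>s\<in>S. rat_scale (a t s) s)))
      + (\<Sum>t\<in>T. rat_scale (c t) (\<Sum>s\<in>S. rat_scale (a t s) s))"
    by (simp flip: sum.distrib rat_scale_simps(5))
  also have "(\<Sum>t\<in>T. rat_scale (c t) (\<Sum>s\<in>S. rat_scale (a t s) s)) = (\<Sum>t\<in>T. \<Sum>s\<in>S. rat_scale (c t * a t s) s)"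
    by (simp add: rat_scale_sum rat_scale_simps)
  also have "\<dots> = (\<Sum>s\<in>S. \<Sum>t\<in>T. rat_scale (c t * a t s) s)" by (rule sum.swap)
  also have "\<dots> = 0" using c(2) by (simp add: sum_rat_scale rat_scale_simps)
  finally have "(\<Sum>t\<in>T. rat_scale (c t) t) \<in> B"
    using a by (auto intro!: sum scale)
  then have "\<forall>t\<in>T. c t = 0" using T unfolding quotient_basis_def by blast
  then show False using c(1) by blast
qed

definition frag_to_rat :: "('c \<Rightarrow>\<^sub>0 int) \<Rightarrow> ('c \<Rightarrow>\<^sub>0 rat)" where
  "frag_to_rat c = Poly_Mapping.map of_int c"

lemma lookup_frag_to_rat [simp]: "Poly_Mapping.lookup (frag_to_rat c) k = of_int (Poly_Mapping.lookup c k)"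
  unfolding frag_to_rat_def by (simp add: Poly_Mapping.map.rep_eq when_def)

lemma keys_frag_to_rat [simp]: "Poly_Mapping.keys (frag_to_rat c) = Poly_Mapping.keys c"
  by (auto simp: in_keys_iff)

lemma frag_to_rat_eq_iff [simp]: "frag_to_rat c = frag_to_rat d \<longleftrightarrow> c = d"
  by (metis lookup_frag_to_rat of_int_eq_iff poly_mapping_eqI)

lemma frag_to_rat_simps:
  "frag_to_rat 0 = 0" "frag_to_rat (c + d) = frag_to_rat c + frag_to_rat d"
  "frag_to_rat (c - d) = frag_to_rat c - frag_to_rat d"
  "frag_to_rat (frag_cmul k c) = rat_scale (of_int k) (frag_to_rat c)"
  by (rule poly_mapping_eqI, simp add: lookup_add lookup_minus)+

lemma frag_to_rat_sum: "frag_to_rat (sum f I) = (\<Sum>i\<in>I. frag_to_rat (f i))"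
  by (rule poly_mapping_eqI) (simp add: lookup_sum)

lemma common_denominator:
  fixes f :: "'s \<Rightarrow> rat"
  assumes "finite S"
  shows "\<exists>D b. D \<noteq> 0 \<and> (\<forall>s\<in>S. of_int (b s) = of_int D * f s)"
  using assms
proof (induction S rule: finite_induct)
  case empty then show ?case by (intro exI[of _ 1]) auto
next
  case (insert s S)
  then obtain D b where D: "D \<noteq> 0" "\<forall>s\<in>S. of_int (b s) = of_int D * f s" by blast
  obtain u v where q: "f s = of_int u / of_int v" "v \<noteq> 0"
    by (metis Fract_of_int_quotient quotient_of_denom_pos' quotient_of_div less_irrefl prod.collapse)
  have "of_int (if t = s then D * u else v * b t) = of_int (D * v) * f t" if "t \<in> insert s S" for t
    using that D q by (auto simp: field_simps)
  then show ?case using D q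
    by (intro exI[of _ "D * v"] exI[of _ "\<lambda>t. if t = s then D * u else v * b t"]) auto
qed

lemma clear_denominators:
  fixes q :: "'c \<Rightarrow>\<^sub>0 rat"
  shows "\<exists>N c. N \<noteq> 0 \<and> rat_scale (of_int N) q = frag_to_rat c"
proof -
  obtain N b where N: "N \<noteq> 0" "\<forall>k\<in>Poly_Mapping.keys q. of_int (b k) = of_int N * Poly_Mapping.lookup q k"
    using common_denominator[of "Poly_Mapping.keys q" "Poly_Mapping.lookup q"] by auto
  define c where "c = Abs_poly_mapping (\<lambda>k. b k when k \<in> Poly_Mapping.keys q)"
  have "finite {k. (b k when k \<in> Poly_Mapping.keys q) \<noteq> 0}"
    by (rule finite_subset[of _ "Poly_Mapping.keys q"]) (auto simp: when_def)
  then have "Poly_Mapping.lookup c = (\<lambda>k. b k when k \<in> Poly_Mapping.keys q)"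
    unfolding c_def by simp
  then have "rat_scale (of_int N) q = frag_to_rat c"
    using N by (intro poly_mapping_eqI) (auto simp: when_def in_keys_iff)
  then show ?thesis using N by blast
qed

lemma rat_boundary_frag_to_rat: "rat_boundary i (frag_to_rat c) = frag_to_rat (chain_boundary i c)"
proof (cases "i = 0")
  case False
  have "frag_to_rat (frag_cmul a (frag_cmul b (frag_of f))) = Poly_Mapping.single f (of_int b * of_int a)"
    for a b and f :: "(nat \<Rightarrow> real) \<Rightarrow> 'a"
    by (rule poly_mapping_eqI) (simp add: lookup_single when_def)
  then show ?thesis using False
    unfolding rat_boundary_def chain_boundary_def frag_extend_def
    by (simp add: frag_cmul_sum frag_to_rat_sum)
qed (simp add: rat_boundary_def chain_boundary_def frag_to_rat_simps)

lemma rat_boundary_rat_scale: "rat_boundary i (rat_scale q c) = rat_scale q (rat_boundary i c)"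
proof (cases "q = 0 \<or> i = 0")
  case True
  then show ?thesis by (auto simp: rat_boundary_def rat_scale_simps)
next
  case False
  have "rat_scale q (Poly_Mapping.single f r) = Poly_Mapping.single f (q * r)" for f :: "(nat \<Rightarrow> real) \<Rightarrow> 'a" and r
    by (rule poly_mapping_eqI) (simp add: lookup_single when_def)
  then show ?thesis using False
    by (simp add: rat_boundary_def keys_rat_scale rat_scale_sum mult.left_commute)
qed

lemma rat_scale_cancel: "q \<noteq> 0 \<Longrightarrow> rat_scale q c = d \<Longrightarrow> c = rat_scale (inverse q) d"
  by (auto simp: rat_scale_simps)

text \<open>
  Rational cycles and boundaries are the rational multiples of integral ones. This carries the
  part of the universal coefficient theorem that the comparison of Betti numbers uses.
\<close>

lemma rat_cycles_iff:
  "z \<in> rat_cycles i X \<longleftrightarrow> (\<exists>N c. N \<noteq> 0 \<and> singular_relcycle i X {} c \<and> rat_scale (of_int N) z = frag_to_rat c)"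
proof -
  have "z \<in> rat_cycles i X \<longleftrightarrow> singular_relcycle i X {} c"
    if N: "N \<noteq> 0" "rat_scale (of_int N) z = frag_to_rat c" for N c
  proof -
    have keys: "Poly_Mapping.keys z = Poly_Mapping.keys c"
      by (metis N keys_frag_to_rat keys_rat_scale of_int_eq_0_iff)
    have z: "z = rat_scale (inverse (of_int N)) (frag_to_rat c)"
      by (rule rat_scale_cancel) (use N in auto)
    have "rat_boundary i z = 0 \<longleftrightarrow> frag_to_rat (chain_boundary i c) = 0"
      unfolding z rat_boundary_rat_scale rat_boundary_frag_to_rat
      using N(1) by (metis inverse_nonzero_iff_nonzero of_int_eq_0_iff keys_rat_scale keys_eq_empty keys_frag_to_rat keys_zero poly_mapping_eqI lookup_zero not_in_keys_iff_lookup_eq_zero empty_iff)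
    also have "\<dots> \<longleftrightarrow> chain_boundary i c = 0" using frag_to_rat_eq_iff[of _ 0] by (simp add: frag_to_rat_simps)
    finally show ?thesis unfolding rat_cycles_def rat_chains_def singular_cycle singular_chain_def by (auto simp: keys)
  qed
  then show ?thesis using clear_denominators[of z] by blast
qed

lemma rat_boundaries_iff:
  "z \<in> rat_boundaries i X \<longleftrightarrow> (\<exists>N c. N \<noteq> 0 \<and> singular_relboundary i X {} c \<and> rat_scale (of_int N) z = frag_to_rat c)"
proof
  assume "z \<in> rat_boundaries i X"
  then obtain d where d: "d \<in> rat_chains (Suc i) X" "z = rat_boundary (Suc i) d"
    unfolding rat_boundaries_def by blast
  obtain N e where N: "N \<noteq> 0" "rat_scale (of_int N) d = frag_to_rat e" using clear_denominators by blast
  have "Poly_Mapping.keys e = Poly_Mapping.keys d"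
    by (metis N keys_frag_to_rat keys_rat_scale of_int_eq_0_iff)
  then have "singular_relboundary i X {} (chain_boundary (Suc i) e)"
    using d(1) unfolding rat_chains_def singular_boundary singular_chain_def by auto
  moreover have "rat_scale (of_int N) z = frag_to_rat (chain_boundary (Suc i) e)"
    by (metis N(2) d(2) rat_boundary_frag_to_rat rat_boundary_rat_scale)
  ultimately show "\<exists>N c. N \<noteq> 0 \<and> singular_relboundary i X {} c \<and> rat_scale (of_int N) z = frag_to_rat c"
    using N(1) by blast
next
  assume "\<exists>N c. N \<noteq> 0 \<and> singular_relboundary i X {} c \<and> rat_scale (of_int N) z = frag_to_rat c"
  then obtain N d where N: "N \<noteq> 0" "singular_chain (Suc i) X d" "rat_scale (of_int N) z = frag_to_rat (chain_boundary (Suc i) d)"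
    unfolding singular_boundary by blast
  have "z = rat_scale (inverse (of_int N)) (frag_to_rat (chain_boundary (Suc i) d))"
    by (rule rat_scale_cancel) (use N in auto)
  also have "\<dots> = rat_boundary (Suc i) (rat_scale (inverse (of_int N)) (frag_to_rat d))"
    by (simp add: rat_boundary_rat_scale rat_boundary_frag_to_rat)
  finally show "z \<in> rat_boundaries i X"
    unfolding rat_boundaries_def rat_chains_def using N by (auto simp: keys_rat_scale singular_chain_def)
qed

lemma frag_subgroup_relcycle: "frag_subgroup (singular_relcycle_set p X S)"
  and frag_subgroup_relboundary: "frag_subgroup (singular_relboundary_set p X S)"
  by (auto simp: frag_subgroup_def singular_relcycle_diff singular_relboundary_diff)

text \<open>
  A maximal independent family of integral cycles remains a basis of rational homology, because
  denominators can be cleared on both sides. Through this theorem excision, homotopy invariance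
  and dimension, known for integral homology, give results on rational Betti numbers.
\<close>

theorem rat_betti_eq_rank:
  assumes "has_rank (singular_relcycle_set i X {}) (singular_relboundary_set i X {}) r"
  shows "rat_betti i X = r"
proof -
  let ?Z = "singular_relcycle_set i X {}" and ?B = "singular_relboundary_set i X {}"
  note subB = frag_subgroup_relboundary[of i X "{}"]
  have zero: "0 \<in> rat_boundaries i X"
    unfolding rat_boundaries_iff by (intro exI[of _ 1] exI[of _ 0]) (auto simp: rat_scale_simps frag_to_rat_simps)
  have add: "a + b \<in> rat_boundaries i X" if ab: "a \<in> rat_boundaries i X" "b \<in> rat_boundaries i X" for a b
  proof -
    obtain N c where N: "N \<noteq> 0" "c \<in> ?B" "rat_scale (of_int N) a = frag_to_rat c"
      using ab(1) unfolding rat_boundaries_iff by blast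
    obtain M d where M: "M \<noteq> 0" "d \<in> ?B" "rat_scale (of_int M) b = frag_to_rat d"
      using ab(2) unfolding rat_boundaries_iff by blast
    have "rat_scale (of_int (N * M)) (a + b) = rat_scale (of_int M) (rat_scale (of_int N) a) + rat_scale (of_int N) (rat_scale (of_int M) b)"
      by (simp add: rat_scale_simps mult.commute)
    also have "\<dots> = frag_to_rat (frag_cmul M c + frag_cmul N d)"
      by (simp add: N M frag_to_rat_simps)
    finally have "rat_scale (of_int (N * M)) (a + b) = frag_to_rat (frag_cmul M c + frag_cmul N d)" .
    moreover have "frag_cmul M c + frag_cmul N d \<in> ?B"
      by (intro frag_subgroup_add frag_subgroup_cmul subB N M)
    ultimately show ?thesis unfolding rat_boundaries_iff using N M by (metis mem_Collect_eq mult_eq_0_iff)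
  qed
  have scale: "rat_scale q b \<in> rat_boundaries i X" if b: "b \<in> rat_boundaries i X" for q b
  proof (cases "q = 0")
    case True
    then show ?thesis using zero by (simp add: rat_scale_simps)
  next
    case False
    obtain d where d: "d \<in> rat_chains (Suc i) X" "b = rat_boundary (Suc i) d"
      using b unfolding rat_boundaries_def by blast
    have "rat_scale q d \<in> rat_chains (Suc i) X" using d(1) False by (simp add: rat_chains_def keys_rat_scale)
    then show ?thesis unfolding rat_boundaries_def d(2) rat_boundary_rat_scale[symmetric] by blast
  qed
  obtain S where S: "S \<subseteq> ?Z" "indep_mod ?B S" "spans_mod ?Z ?B S" "card S = r"
    using assms unfolding has_rank_def by blast
  have finS: "finite S" using S by (auto simp: indep_mod_def)
  have inj: "inj_on frag_to_rat S" by (auto simp: inj_on_def)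
  have basis: "quotient_basis (rat_cycles i X) (rat_boundaries i X) (frag_to_rat ` S)"
    unfolding quotient_basis_def
  proof (intro conjI allI impI ballI)
    show "finite (frag_to_rat ` S)" using finS by simp
    show "frag_to_rat ` S \<subseteq> rat_cycles i X"
    proof clarify
      fix s assume "s \<in> S"
      then have "singular_relcycle i X {} s" using S(1) by blast
      then show "frag_to_rat s \<in> rat_cycles i X"
        unfolding rat_cycles_iff by (intro exI[of _ 1] exI[of _ s]) (simp add: rat_scale_simps)
    qed
  next
    fix a t assume a: "(\<Sum>s\<in>frag_to_rat ` S. rat_scale (a s) s) \<in> rat_boundaries i X" and t: "t \<in> frag_to_rat ` S"
    let ?s = "\<Sum>s\<in>S. rat_scale (a (frag_to_rat s)) (frag_to_rat s)"
    have "?s \<in> rat_boundaries i X" using a by (simp add: sum.reindex[OF inj])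
    then obtain N c where Nc: "N \<noteq> 0 \<and> singular_relboundary i X {} c \<and> rat_scale (of_int N) ?s = frag_to_rat c"
      unfolding rat_boundaries_iff by (elim exE)
    then have N: "N \<noteq> 0" "c \<in> ?B" "rat_scale (of_int N) ?s = frag_to_rat c" by simp_all
    obtain D b where D: "D \<noteq> 0" "\<forall>s\<in>S. of_int (b s) = of_int D * a (frag_to_rat s)"
      using common_denominator[OF finS, of "\<lambda>s. a (frag_to_rat s)"] by blast
    have "frag_to_rat (lincomb b S) = rat_scale (of_int D) ?s"
      unfolding lincomb_def by (simp add: frag_to_rat_sum frag_to_rat_simps rat_scale_sum rat_scale_simps D(2))
    then have "frag_to_rat (frag_cmul N (lincomb b S)) = rat_scale (of_int N) (rat_scale (of_int D) ?s)"
      by (simp only: frag_to_rat_simps(4))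
    also have "\<dots> = rat_scale (of_int D) (rat_scale (of_int N) ?s)"
      unfolding rat_scale_simps(1) by (rule arg_cong2[where f = rat_scale, OF mult.commute refl])
    also have "\<dots> = frag_to_rat (frag_cmul D c)" by (simp only: N(3) frag_to_rat_simps(4))
    finally have "frag_to_rat (frag_cmul N (lincomb b S)) = frag_to_rat (frag_cmul D c)" .
    then have "lincomb (\<lambda>s. N * b s) S = frag_cmul D c" by (simp add: frag_cmul_lincomb)
    also have "\<dots> \<in> ?B" by (rule frag_subgroup_cmul[OF subB N(2)])
    finally have "\<forall>s\<in>S. N * b s = 0" using S(2) unfolding indep_mod_def by blast
    then show "a t = 0" using t D N by auto
  next
    fix z assume "z \<in> rat_cycles i X"
    then obtain N c where N: "N \<noteq> 0" "c \<in> ?Z" "rat_scale (of_int N) z = frag_to_rat c"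
      unfolding rat_cycles_iff by blast
    obtain k a where ka: "k \<noteq> 0" "frag_cmul k c - lincomb a S \<in> ?B"
      using S(3) N(2) unfolding spans_mod_def by blast
    define \<alpha> :: "'a rat_chain \<Rightarrow> rat" where "\<alpha> t = of_int (a (the_inv frag_to_rat t)) / of_int (k * N)" for t
    have \<alpha>: "\<alpha> (frag_to_rat s) = of_int (a s) / of_int (k * N)" for s
      unfolding \<alpha>_def by (subst the_inv_f_f) (auto simp: inj_def)
    have "rat_scale (of_int (k * N)) (z - (\<Sum>s\<in>frag_to_rat ` S. rat_scale (\<alpha> s) s))
        = rat_scale (of_int k) (rat_scale (of_int N) z) - (\<Sum>s\<in>S. rat_scale (of_int (k * N) * \<alpha> (frag_to_rat s)) (frag_to_rat s))"
      by (simp add: sum.reindex[OF inj] rat_scale_simps rat_scale_sum)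
    also have "\<dots> = frag_to_rat (frag_cmul k c - lincomb a S)"
      using ka(1) N by (simp add: \<alpha> frag_to_rat_simps lincomb_def frag_to_rat_sum)
    finally show "\<exists>a. z - (\<Sum>s\<in>frag_to_rat ` S. rat_scale (a s) s) \<in> rat_boundaries i X"
      using ka N unfolding rat_boundaries_iff
      by (intro exI[of _ \<alpha>] exI[of _ "k * N"] exI[of _ "frag_cmul k c - lincomb a S"]) auto
  qed
  show ?thesis unfolding rat_betti_def
  proof (rule the_equality)
    show "\<exists>S. quotient_basis (rat_cycles i X) (rat_boundaries i X) S \<and> card S = r"
      using basis S(4) card_image[OF inj] by auto
    fix d assume "\<exists>S. quotient_basis (rat_cycles i X) (rat_boundaries i X) S \<and> card S = d"
    then obtain T where T: "quotient_basis (rat_cycles i X) (rat_boundaries i X) T" "card T = d" by blast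
    show "d = r"
      using quotient_basis_card_le[OF zero add scale basis T(1)] quotient_basis_card_le[OF zero add scale T(1) basis]
        T(2) S(4) card_image[OF inj] by auto
  qed
qed

section \<open>Euler characteristics of pairs\<close>

definition hrank :: "nat \<Rightarrow> 'x topology \<Rightarrow> 'x set \<Rightarrow> nat \<Rightarrow> bool" where
  "hrank p X S r \<longleftrightarrow> has_rank (singular_relcycle_set p X S) (singular_relboundary_set p X S) r"

definition set_sum :: "('c \<Rightarrow>\<^sub>0 int) set \<Rightarrow> ('c \<Rightarrow>\<^sub>0 int) set \<Rightarrow> ('c \<Rightarrow>\<^sub>0 int) set" where
  "set_sum A B = {a + b | a b. a \<in> A \<and> b \<in> B}"

lemma frag_subgroup_set_sum:
  assumes "frag_subgroup A" "frag_subgroup B"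
  shows "frag_subgroup (set_sum A B)"
  unfolding frag_subgroup_def
proof (intro conjI ballI)
  show "0 \<in> set_sum A B"
    unfolding set_sum_def using frag_subgroup_0[OF assms(1)] frag_subgroup_0[OF assms(2)] by force
  fix x y assume "x \<in> set_sum A B" "y \<in> set_sum A B"
  then obtain a b a' b' where "x = a + b" "y = a' + b'" "a \<in> A" "b \<in> B" "a' \<in> A" "b' \<in> B"
    unfolding set_sum_def by blast
  then have "x - y = (a - a') + (b - b')" "a - a' \<in> A" "b - b' \<in> B"
    using assms by (auto intro: frag_subgroup_diff)
  then show "x - y \<in> set_sum A B" unfolding set_sum_def by blast
qed

lemma set_sumI: "a \<in> A \<Longrightarrow> b \<in> B \<Longrightarrow> a + b \<in> set_sum A B"
  unfolding set_sum_def by blast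

lemma set_sum_left: "frag_subgroup B \<Longrightarrow> A \<subseteq> set_sum A B"
  using set_sumI[of _ A 0 B] frag_subgroup_0[of B] by fastforce

lemma set_sum_right: "frag_subgroup A \<Longrightarrow> B \<subseteq> set_sum A B"
  using set_sumI[of 0 A _ B] frag_subgroup_0[of A] by fastforce

lemma frag_subgroup_Int: "frag_subgroup A \<Longrightarrow> frag_subgroup B \<Longrightarrow> frag_subgroup (A \<inter> B)"
  unfolding frag_subgroup_def by blast

lemma quotient_iso_id:
  assumes "Z \<subseteq> Z'" "frag_subgroup B'" "Z \<inter> B' = B" "Z' \<subseteq> set_sum Z B'" "B \<subseteq> Z"
  shows "quotient_iso Z B Z' B' (\<lambda>x. x)"
  unfolding quotient_iso_def
proof (intro conjI ballI)
  show "\<exists>x\<in>Z. y - x \<in> B'" if "y \<in> Z'" for y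
  proof -
    obtain a b where "y = a + b" "a \<in> Z" "b \<in> B'" using \<open>y \<in> Z'\<close> assms(4) unfolding set_sum_def by blast
    then show ?thesis by (intro bexI[of _ a]) auto
  qed
qed (use assms frag_subgroup_0[OF assms(2)] in auto)

text \<open>
  The exact sequence of the pair, reduced to ranks: \<open>\<alpha> p\<close>, \<open>\<beta> p\<close> and \<open>\<gamma> p\<close> are the ranks of the
  images of \<open>H\<^sub>p\<^sub>+\<^sub>1(X,A) \<rightarrow> H\<^sub>p(A)\<close>, of \<open>H\<^sub>p(A) \<rightarrow> H\<^sub>p(X)\<close> and of \<open>H\<^sub>p(X) \<rightarrow> H\<^sub>p(X,A)\<close>. That the
  homology of \<open>X\<close> has finite rank in each degree is part of the conclusion.
\<close>

lemma long_exact_sequence_ranks: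
  assumes A: "\<And>p. hrank p (subtopology X A) {} (a p)" and Q: "\<And>p. hrank p X A (q p)"
  obtains \<alpha> \<beta> \<gamma> where "\<And>p. a p = \<alpha> p + \<beta> p" "q 0 = \<gamma> 0" "\<And>p. q (Suc p) = \<gamma> (Suc p) + \<alpha> p"
    "\<And>p. hrank p X {} (\<beta> p + \<gamma> p)"
proof -
  define Za where "Za p = singular_relcycle_set p (subtopology X A) {}" for p
  define Ba where "Ba p = singular_relboundary_set p (subtopology X A) {}" for p
  define Zx where "Zx p = singular_relcycle_set p X {}" for p
  define Bx where "Bx p = singular_relboundary_set p X {}" for p
  define Zr where "Zr p = singular_relcycle_set p X A" for p
  define Br where "Br p = singular_relboundary_set p X A" for p
  note defs = Za_def Ba_def Zx_def Bx_def Zr_def Br_def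
  have sg: "frag_subgroup (Za p)" "frag_subgroup (Ba p)" "frag_subgroup (Zx p)" "frag_subgroup (Bx p)"
    "frag_subgroup (Zr p)" "frag_subgroup (Br p)" for p
    unfolding defs by (rule frag_subgroup_relcycle frag_subgroup_relboundary)+
  have Za: "c \<in> Za p \<longleftrightarrow> singular_chain p (subtopology X A) c \<and> chain_boundary p c = 0" for p c
    by (simp add: Za_def singular_cycle)
  have Zx: "c \<in> Zx p \<longleftrightarrow> singular_chain p X c \<and> chain_boundary p c = 0" for p c
    by (simp add: Zx_def singular_cycle)
  have Zr: "c \<in> Zr p \<longleftrightarrow> singular_chain p X c \<and> singular_chain (p - 1) (subtopology X A) (chain_boundary p c)" for p c
    by (simp add: Zr_def singular_relcycle)
  have Ba: "c \<in> Ba p \<longleftrightarrow> (\<exists>d. singular_chain (Suc p) (subtopology X A) d \<and> chain_boundary (Suc p) d = c)" for p c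
    by (simp add: Ba_def singular_boundary)
  have Bx: "c \<in> Bx p \<longleftrightarrow> (\<exists>d. singular_chain (Suc p) X d \<and> chain_boundary (Suc p) d = c)" for p c
    by (simp add: Bx_def singular_boundary)
  have Br: "c \<in> Br p \<longleftrightarrow> (\<exists>d e. singular_chain (Suc p) X d \<and> singular_chain p (subtopology X A) e \<and> chain_boundary (Suc p) d + e = c)" for p c
    by (simp add: Br_def singular_relboundary)
  have chA: "singular_chain p X c" if "singular_chain p (subtopology X A) c" for p c
    using that by (simp add: singular_chain_subtopology)
  have BaBx: "Ba p \<subseteq> Bx p" for p unfolding subset_iff Ba Bx using chA by blast
  have BaZa: "Ba p \<subseteq> Za p" for p unfolding defs using singular_relboundary_imp_relcycle by blast
  have BxZx: "Bx p \<subseteq> Zx p" for p unfolding defs using singular_relboundary_imp_relcycle by blast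
  have BrZr: "Br p \<subseteq> Zr p" for p unfolding defs using singular_relboundary_imp_relcycle by blast
  have ZaZx: "Za p \<subseteq> Zx p" for p using chA by (auto simp: Za Zx)
  have ZxZr: "Zx p \<subseteq> Zr p" for p by (auto simp: Zx Zr)
  have BxBr: "Bx p \<subseteq> Br p" for p by (auto simp: Bx Br) (metis add.right_neutral singular_chain_0)
  have chBr: "e \<in> Br p" if "singular_chain p (subtopology X A) e" for e p
    unfolding Br_def using singular_chain_imp_relboundary[OF that] by simp
  have sgI: "frag_subgroup (Za p \<inter> Bx p)" "frag_subgroup (set_sum (Za p) (Bx p))" "frag_subgroup (set_sum (Zx p) (Br p))" for p
    by (intro frag_subgroup_Int frag_subgroup_set_sum sg)+
  note sgs = sg sgI
  have incl1: "Br p \<subseteq> set_sum (Zx p) (Br p)" "Bx p \<subseteq> set_sum (Za p) (Bx p)"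
    "Zx p \<subseteq> set_sum (Zx p) (Br p)" "Za p \<subseteq> set_sum (Za p) (Bx p)" for p
    by (intro set_sum_left set_sum_right sg)+
  have incl2: "set_sum (Zx p) (Br p) \<subseteq> Zr p" for p
    unfolding set_sum_def using ZxZr[of p] BrZr[of p] frag_subgroup_add[OF sg(5)] by blast
  have incl3: "set_sum (Za p) (Bx p) \<subseteq> Zx p" for p
    unfolding set_sum_def using ZaZx[of p] BxZx[of p] frag_subgroup_add[OF sg(3)] by blast
  note incl = incl1 incl2 incl3 BaBx BaZa BxZx BrZr ZaZx ZxZr BxBr
  have ra: "has_rank (Za p) (Ba p) (a p)" for p using A unfolding hrank_def defs .
  have rq: "has_rank (Zr p) (Br p) (q p)" for p using Q unfolding hrank_def defs .
  \<comment> \<open>The kernel of \<open>H\<^sub>p(A) \<rightarrow> H\<^sub>p(X)\<close>, which is the image of the connecting map.\<close>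
  have "\<exists>r. has_rank (Za p \<inter> Bx p) (Ba p) r" for p
    by (rule has_rank_subquotient[OF _ _ _ _ _ ra[of p]]) (simp_all add: sgs incl)
  then obtain \<alpha> where \<alpha>: "\<And>p. has_rank (Za p \<inter> Bx p) (Ba p) (\<alpha> p)" by metis
  \<comment> \<open>The image of \<open>H\<^sub>p(A) \<rightarrow> H\<^sub>p(X)\<close>.\<close>
  have "\<exists>r. has_rank (Za p) (Za p \<inter> Bx p) r" for p
    by (rule has_rank_subquotient[OF _ _ _ _ _ ra[of p]]) (simp_all add: sgs incl)
  then obtain \<beta> where \<beta>: "\<And>p. has_rank (Za p) (Za p \<inter> Bx p) (\<beta> p)" by metis
  \<comment> \<open>The image of \<open>H\<^sub>p(X) \<rightarrow> H\<^sub>p(X,A)\<close>.\<close>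
  have "\<exists>r. has_rank (set_sum (Zx p) (Br p)) (Br p) r" for p
    by (rule has_rank_subquotient[OF _ _ _ _ _ rq[of p]]) (simp_all add: sgs incl)
  then obtain \<gamma> where \<gamma>: "\<And>p. has_rank (set_sum (Zx p) (Br p)) (Br p) (\<gamma> p)" by metis
  \<comment> \<open>The quotient of \<open>H\<^sub>p(X,A)\<close> by that image; the boundary map embeds it into \<open>H\<^sub>p\<^sub>-\<^sub>1(A)\<close>.\<close>
  have "\<exists>r. has_rank (Zr p) (set_sum (Zx p) (Br p)) r" for p
    by (rule has_rank_subquotient[OF _ _ _ _ _ rq[of p]]) (simp_all add: sgs incl)
  then obtain \<delta> where \<delta>: "\<And>p. has_rank (Zr p) (set_sum (Zx p) (Br p)) (\<delta> p)" by metis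
  have a_eq: "a p = \<alpha> p + \<beta> p" for p
    by (rule has_rank_unique[OF _ ra[of p] has_rank_tower[OF _ _ _ _ \<alpha> \<beta>]]) (simp_all add: sgs incl)
  have q_eq: "q p = \<gamma> p + \<delta> p" for p
    by (rule has_rank_unique[OF _ rq[of p] has_rank_tower[OF _ _ _ _ \<gamma> \<delta>]]) (simp_all add: sgs incl)
  have \<delta>0: "\<delta> 0 = 0"
  proof -
    have "Zr 0 \<subseteq> set_sum (Zx 0) (Br 0)"
    proof -
      have "Zr 0 \<subseteq> Zx 0" by (auto simp: Zr Zx chain_boundary_def)
      then show ?thesis using set_sum_left[OF sg(6)] by blast
    qed
    then have "spans_mod (Zr 0) (set_sum (Zx 0) (Br 0)) {}"
      unfolding spans_mod_def lincomb_def by (auto intro!: exI[of _ 1])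
    moreover have "indep_mod (set_sum (Zx 0) (Br 0)) {}" by (simp add: indep_mod_def)
    ultimately have "has_rank (Zr 0) (set_sum (Zx 0) (Br 0)) 0"
      unfolding has_rank_def by (intro exI[of _ "{}"]) auto
    then show ?thesis using has_rank_unique[OF sgI(3) \<delta>] by blast
  qed
  have \<delta>Suc: "\<delta> (Suc p) = \<alpha> p" for p
  proof -
    have iso: "quotient_iso (Zr (Suc p)) (set_sum (Zx (Suc p)) (Br (Suc p))) (Za p \<inter> Bx p) (Ba p) (chain_boundary (Suc p))"
      unfolding quotient_iso_def
    proof (intro conjI ballI)
      fix c assume c: "c \<in> Zr (Suc p)"
      show "chain_boundary (Suc p) c \<in> Za p \<inter> Bx p"
        using c chain_boundary_boundary_alt[of p X c] by (auto simp: Zr Za Bx)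
      show "chain_boundary (Suc p) c \<in> Ba p \<longleftrightarrow> c \<in> set_sum (Zx (Suc p)) (Br (Suc p))"
      proof
        assume "chain_boundary (Suc p) c \<in> Ba p"
        then obtain d where d: "singular_chain (Suc p) (subtopology X A) d" "chain_boundary (Suc p) d = chain_boundary (Suc p) c"
          by (auto simp: Ba)
        have "c - d \<in> Zx (Suc p)"
          using c d chA by (auto simp: Zx Zr chain_boundary_diff intro: singular_chain_diff)
        then show "c \<in> set_sum (Zx (Suc p)) (Br (Suc p))"
          using set_sumI[OF _ chBr[OF d(1)], of "c - d"] by simp
      next
        assume "c \<in> set_sum (Zx (Suc p)) (Br (Suc p))"
        then obtain z d e where z: "c = z + (chain_boundary (Suc (Suc p)) d + e)" "chain_boundary (Suc p) z = 0"
          "singular_chain (Suc (Suc p)) X d" "singular_chain (Suc p) (subtopology X A) e"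
          unfolding set_sum_def Zx Br by blast
        have "chain_boundary (Suc p) c = chain_boundary (Suc p) e"
          using z chain_boundary_boundary_alt[of "Suc p" X d] by (simp add: chain_boundary_add)
        then show "chain_boundary (Suc p) c \<in> Ba p" using z(4) by (auto simp: Ba)
      qed
      fix d show "chain_boundary (Suc p) (c - d) - (chain_boundary (Suc p) c - chain_boundary (Suc p) d) \<in> Ba p"
        by (simp add: chain_boundary_diff frag_subgroup_0[OF sg(2)])
    next
      fix y assume y: "y \<in> Za p \<inter> Bx p"
      then obtain d where d: "singular_chain (Suc p) X d" "chain_boundary (Suc p) d = y" by (auto simp: Bx)
      then have "d \<in> Zr (Suc p)" using y by (auto simp: Zr Za)
      then show "\<exists>x\<in>Zr (Suc p). y - chain_boundary (Suc p) x \<in> Ba p"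
        using d frag_subgroup_0[OF sg(2)] by (intro bexI[of _ d]) auto
    qed
    have "has_rank (Za p \<inter> Bx p) (Ba p) (\<delta> (Suc p))"
      by (rule has_rank_iso[OF _ _ _ _ iso \<delta>]) (simp_all add: sgs incl)
    then show ?thesis using has_rank_unique[OF sg(2) _ \<alpha>[of p]] by blast
  qed
  have hx: "hrank p X {} (\<beta> p + \<gamma> p)" for p
  proof -
    have 1: "has_rank (set_sum (Za p) (Bx p)) (Bx p) (\<beta> p)"
      by (rule has_rank_iso[OF _ _ _ _ quotient_iso_id \<beta>]) (simp_all add: sgs incl)
    have iso2: "quotient_iso (Zx p) (set_sum (Za p) (Bx p)) (set_sum (Zx p) (Br p)) (Br p) (\<lambda>x. x)"
    proof (rule quotient_iso_id)
      show "Zx p \<inter> Br p = set_sum (Za p) (Bx p)"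
      proof (intro equalityI subsetI)
        fix x assume x: "x \<in> Zx p \<inter> Br p"
        then obtain d e where de: "singular_chain (Suc p) X d" "singular_chain p (subtopology X A) e" "chain_boundary (Suc p) d + e = x"
          by (auto simp: Br)
        have "chain_boundary p x = chain_boundary p e"
          using de chain_boundary_boundary_alt[of p X d] by (auto simp: chain_boundary_add)
        then have "e \<in> Za p" using x de by (auto simp: Za Zx)
        moreover have "chain_boundary (Suc p) d \<in> Bx p" using de by (auto simp: Bx)
        ultimately show "x \<in> set_sum (Za p) (Bx p)" using set_sumI de(3) by (metis add.commute)
      next
        fix x assume "x \<in> set_sum (Za p) (Bx p)"
        then obtain u v where uv: "x = u + v" "u \<in> Za p" "v \<in> Bx p" unfolding set_sum_def by blast
        then have "u \<in> Zx p" "v \<in> Zx p" "u \<in> Br p" "v \<in> Br p"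
          using subsetD[OF ZaZx] subsetD[OF BxZx] subsetD[OF BxBr] chBr[of p u] by (simp_all add: Za)
        then show "x \<in> Zx p \<inter> Br p" using uv frag_subgroup_add sg by blast
      qed
    qed (simp_all add: sgs incl)
    have 2: "has_rank (Zx p) (set_sum (Za p) (Bx p)) (\<gamma> p)"
      by (subst has_rank_iso_iff[OF _ _ _ _ iso2, symmetric]) (simp_all add: sgs incl \<gamma>)
    have "has_rank (Zx p) (Bx p) (\<beta> p + \<gamma> p)"
      by (rule has_rank_tower[OF _ _ _ _ 1 2]) (simp_all add: sgs incl)
    then show ?thesis unfolding hrank_def defs .
  qed
  show thesis
    by (rule that[of \<alpha> \<beta> \<gamma>]) (use a_eq q_eq \<delta>0 \<delta>Suc hx in auto)
qed

text \<open>
  A relation, not a function: it includes that all homology groups of the pair have finite rank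
  and that almost all ranks vanish.
\<close>

definition has_euler :: "'x topology \<Rightarrow> 'x set \<Rightarrow> int \<Rightarrow> bool" where
  "has_euler X A e \<longleftrightarrow> (\<exists>\<rho> N. (\<forall>p. hrank p X A (\<rho> p)) \<and> (\<forall>p\<ge>N. \<rho> p = 0) \<and> e = (\<Sum>p<N. (-1) ^ p * int (\<rho> p)))"

lemma sum_extend_zero:
  fixes \<rho> :: "nat \<Rightarrow> nat"
  assumes "\<forall>p\<ge>N. \<rho> p = 0" "N \<le> M"
  shows "(\<Sum>p<M. (-1) ^ p * int (\<rho> p)) = (\<Sum>p<N. (-1) ^ p * int (\<rho> p))"
  by (rule sum.mono_neutral_right) (use assms in auto)

text \<open>
  In the alternating sums the ranks of the connecting maps occur twice, in adjacent degrees, and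
  cancel.
\<close>

lemma has_euler_pair:
  fixes a q :: int
  assumes "has_euler (subtopology X A) {} a" "has_euler X A q"
  shows "has_euler X {} (a + q)"
proof -
  obtain \<rho> N where \<rho>: "\<And>p. hrank p (subtopology X A) {} (\<rho> p)" "\<forall>p\<ge>N. \<rho> p = 0" "a = (\<Sum>p<N. (-1) ^ p * int (\<rho> p))"
    using assms(1) unfolding has_euler_def by blast
  obtain \<sigma> M where \<sigma>: "\<And>p. hrank p X A (\<sigma> p)" "\<forall>p\<ge>M. \<sigma> p = 0" "q = (\<Sum>p<M. (-1) ^ p * int (\<sigma> p))"
    using assms(2) unfolding has_euler_def by blast
  obtain \<alpha> \<beta> \<gamma> where les: "\<And>p. \<rho> p = \<alpha> p + \<beta> p" "\<sigma> 0 = \<gamma> 0" "\<And>p. \<sigma> (Suc p) = \<gamma> (Suc p) + \<alpha> p"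
    "\<And>p. hrank p X {} (\<beta> p + \<gamma> p)"
    using long_exact_sequence_ranks[OF \<rho>(1) \<sigma>(1)] by blast
  define L where "L = N + M"
  have z: "\<alpha> p = 0" "\<beta> p = 0" "\<gamma> p = 0" if "p \<ge> L" for p
  proof -
    have "\<rho> p = 0" "\<sigma> p = 0" using that \<rho>(2) \<sigma>(2) by (auto simp: L_def)
    then show "\<alpha> p = 0" "\<beta> p = 0" "\<gamma> p = 0" using les(1)[of p] les(2) les(3)[of "p - 1"] by (cases p; simp)+
  qed
  have a: "a = (\<Sum>p<Suc L. (-1) ^ p * int (\<alpha> p)) + (\<Sum>p<Suc L. (-1) ^ p * int (\<beta> p))"
  proof -
    have "a = (\<Sum>p<Suc L. (-1) ^ p * int (\<rho> p))"
      using sum_extend_zero[OF \<rho>(2), of "Suc L"] \<rho>(3) by (simp add: L_def)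
    then show ?thesis unfolding les(1) by (simp only: of_nat_add distrib_left sum.distrib)
  qed
  have "q = (\<Sum>p<Suc L. (-1) ^ p * int (\<sigma> p))"
    using sum_extend_zero[OF \<sigma>(2), of "Suc L"] \<sigma>(3) by (simp add: L_def)
  also have "\<dots> = int (\<gamma> 0) + (\<Sum>p<L. (-1) ^ Suc p * int (\<gamma> (Suc p))) + (\<Sum>p<L. (-1) ^ Suc p * int (\<alpha> p))"
    unfolding sum.lessThan_Suc_shift les(2,3) by (simp only: of_nat_add distrib_left sum.distrib power_0 mult_1 add.assoc)
  also have "int (\<gamma> 0) + (\<Sum>p<L. (-1) ^ Suc p * int (\<gamma> (Suc p))) = (\<Sum>p<Suc L. (-1) ^ p * int (\<gamma> p))"
    unfolding sum.lessThan_Suc_shift by simp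
  also have "(\<Sum>p<L. (-1) ^ Suc p * int (\<alpha> p)) = - (\<Sum>p<Suc L. (-1) ^ p * int (\<alpha> p))"
    using z[of L] by (simp add: sum_negf)
  finally have "a + q = (\<Sum>p<Suc L. (-1) ^ p * int (\<beta> p)) + (\<Sum>p<Suc L. (-1) ^ p * int (\<gamma> p))"
    unfolding a by linarith
  also have "\<dots> = (\<Sum>p<Suc L. (-1) ^ p * int (\<beta> p + \<gamma> p))"
    by (simp only: of_nat_add distrib_left sum.distrib)
  finally have "a + q = (\<Sum>p<Suc L. (-1) ^ p * int (\<beta> p + \<gamma> p))" .
  then show ?thesis unfolding has_euler_def
    using les(4) z by (intro exI[of _ "\<lambda>p. \<beta> p + \<gamma> p"] exI[of _ "Suc L"]) auto
qed

lemma has_euler_imp_rat_euler_char: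
  assumes "has_euler X {} e"
  shows "rat_euler_char X = e"
proof -
  obtain \<rho> N where \<rho>: "\<And>p. hrank p X {} (\<rho> p)" "\<forall>p\<ge>N. \<rho> p = 0" "e = (\<Sum>p<N. (-1) ^ p * int (\<rho> p))"
    using assms unfolding has_euler_def by blast
  have "rat_betti i X = \<rho> i" for i using rat_betti_eq_rank \<rho>(1) unfolding hrank_def by blast
  then have "rat_euler_char X = (\<Sum>i | \<rho> i \<noteq> 0. (-1) ^ i * int (\<rho> i))" unfolding rat_euler_char_def by simp
  also have "\<dots> = e" unfolding \<rho>(3)
    by (rule sum.mono_neutral_left) (use \<rho>(2) in \<open>auto simp: not_less[symmetric]\<close>)
  finally show ?thesis .
qed

section \<open>Spaces with finitely many cells\<close>

lemma homologous_rel_set_eq_iff: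
  "homologous_rel_set p X S a = homologous_rel_set p X S b \<longleftrightarrow> singular_relboundary p X S (a - b)"
  by (simp only: homologous_rel_set_eq) (simp add: homologous_rel_def)

lemma mult_homologous_rel_set:
  assumes "singular_relcycle p X S a" "singular_relcycle p X S b"
  shows "homologous_rel_set p X S a \<otimes>\<^bsub>relative_homology_group (int p) X S\<^esub> homologous_rel_set p X S b
       = homologous_rel_set p X S (a + b)"
proof -
  have "(#>\<^bsub>relcycle_group p X S\<^esub>) (singular_relboundary_set p X S) \<in> hom (relcycle_group p X S) (relcycle_group p X S Mod singular_relboundary_set p X S)"
    by (rule normal.r_coset_hom_Mod[OF normal_subgroup_singular_relboundary_relcycle])
  from hom_mult[OF this, of a b] show ?thesis
    using assms by (simp add: right_coset_singular_relboundary nontrivial_relative_homology_group)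
qed

text \<open>
  Choosing a representing cycle for the image of each class turns an isomorphism of homology
  groups, possibly between different degrees, into a \<^const>\<open>quotient_iso\<close>.
\<close>

lemma quotient_iso_of_group_iso:
  assumes "relative_homology_group (int p) X S \<cong> relative_homology_group (int q) Y T"
  shows "\<exists>f. quotient_iso (singular_relcycle_set p X S) (singular_relboundary_set p X S)
     (singular_relcycle_set q Y T) (singular_relboundary_set q Y T) f"
proof -
  obtain h where h: "h \<in> iso (relative_homology_group (int p) X S) (relative_homology_group (int q) Y T)"
    using assms unfolding is_iso_def by blast
  have hom: "h \<in> hom (relative_homology_group (int p) X S) (relative_homology_group (int q) Y T)"
    and bij: "bij_betw h (homologous_rel_set p X S ` singular_relcycle_set p X S) (homologous_rel_set q Y T ` singular_relcycle_set q Y T)"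
    using h unfolding iso_def by (auto simp: carrier_relative_homology_group)
  have "\<forall>x\<in>singular_relcycle_set p X S. \<exists>y\<in>singular_relcycle_set q Y T. h (homologous_rel_set p X S x) = homologous_rel_set q Y T y"
    using bij unfolding bij_betw_def by blast
  then obtain f where f: "\<And>x. singular_relcycle p X S x \<Longrightarrow> singular_relcycle q Y T (f x) \<and> h (homologous_rel_set p X S x) = homologous_rel_set q Y T (f x)"
    by (metis mem_Collect_eq)
  have one: "h (homologous_rel_set p X S 0) = homologous_rel_set q Y T 0"
  proof -
    interpret group_hom "relative_homology_group (int p) X S" "relative_homology_group (int q) Y T" h
      using hom by (simp add: group_hom_def group_hom_axioms_def)
    have "homologous_rel_set p X S 0 = \<one>\<^bsub>relative_homology_group (int p) X S\<^esub>"
      "homologous_rel_set q Y T 0 = \<one>\<^bsub>relative_homology_group (int q) Y T\<^esub>"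
      by (simp_all add: homologous_rel_set_eq_relboundary)
    then show ?thesis using hom_one by simp
  qed
  have "quotient_iso (singular_relcycle_set p X S) (singular_relboundary_set p X S)
     (singular_relcycle_set q Y T) (singular_relboundary_set q Y T) f"
    unfolding quotient_iso_def
  proof (intro conjI ballI)
    fix x y assume "x \<in> singular_relcycle_set p X S" "y \<in> singular_relcycle_set p X S"
    then have xy: "singular_relcycle p X S x" "singular_relcycle p X S y" by auto
    have d: "singular_relcycle p X S (x - y)" using xy singular_relcycle_diff by blast
    have "homologous_rel_set q Y T (f x) = h (homologous_rel_set p X S ((x - y) + y))" using f xy by simp
    also have "\<dots> = h (homologous_rel_set p X S (x - y) \<otimes>\<^bsub>relative_homology_group (int p) X S\<^esub> homologous_rel_set p X S y)"
      using mult_homologous_rel_set[OF d xy(2)] by simp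
    also have "\<dots> = h (homologous_rel_set p X S (x - y)) \<otimes>\<^bsub>relative_homology_group (int q) Y T\<^esub> h (homologous_rel_set p X S y)"
      by (rule hom_mult[OF hom]) (use d xy in \<open>auto simp: carrier_relative_homology_group\<close>)
    also have "\<dots> = homologous_rel_set q Y T (f (x - y) + f y)"
      using f[OF d] f[OF xy(2)] mult_homologous_rel_set by metis
    finally have "singular_relboundary q Y T (f x - (f (x - y) + f y))"
      by (simp only: homologous_rel_set_eq_iff)
    then show "f (x - y) - (f x - f y) \<in> singular_relboundary_set q Y T"
      using singular_relboundary_minus[of q Y T "f x - (f (x - y) + f y)"] by (simp add: algebra_simps)
  next
    fix x assume x: "x \<in> singular_relcycle_set p X S"
    then show "f x \<in> singular_relcycle_set q Y T" using f by auto
    have "f x \<in> singular_relboundary_set q Y T \<longleftrightarrow> homologous_rel_set q Y T (f x) = homologous_rel_set q Y T 0"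
      by (simp only: homologous_rel_set_eq_iff) simp
    also have "\<dots> \<longleftrightarrow> h (homologous_rel_set p X S x) = h (homologous_rel_set p X S 0)" using f x one by auto
    also have "\<dots> \<longleftrightarrow> homologous_rel_set p X S x = homologous_rel_set p X S 0"
      using bij x unfolding bij_betw_def by (intro inj_on_eq_iff[where A = "homologous_rel_set p X S ` singular_relcycle_set p X S"]) auto
    also have "\<dots> \<longleftrightarrow> x \<in> singular_relboundary_set p X S"
      by (simp only: homologous_rel_set_eq_iff) simp
    finally show "f x \<in> singular_relboundary_set q Y T \<longleftrightarrow> x \<in> singular_relboundary_set p X S" .
  next
    fix y assume "y \<in> singular_relcycle_set q Y T"
    then have "homologous_rel_set q Y T y \<in> h ` (homologous_rel_set p X S ` singular_relcycle_set p X S)"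
      using bij unfolding bij_betw_def by blast
    then obtain x where x: "singular_relcycle p X S x" "homologous_rel_set q Y T y = h (homologous_rel_set p X S x)" by blast
    then have "singular_relboundary q Y T (y - f x)" using f by (simp only: homologous_rel_set_eq_iff)
    then show "\<exists>x\<in>singular_relcycle_set p X S. y - f x \<in> singular_relboundary_set q Y T" using x by auto
  qed
  then show ?thesis by blast
qed

lemma hrank_group_iso:
  assumes "relative_homology_group (int p) X S \<cong> relative_homology_group (int q) Y T" "hrank q Y T r"
  shows "hrank p X S r"
proof -
  obtain f where "quotient_iso (singular_relcycle_set p X S) (singular_relboundary_set p X S)
     (singular_relcycle_set q Y T) (singular_relboundary_set q Y T) f"
    using quotient_iso_of_group_iso[OF assms(1)] by blast
  from has_rank_iso_iff[OF frag_subgroup_relcycle frag_subgroup_relboundary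
      frag_subgroup_relcycle frag_subgroup_relboundary this]
  show ?thesis using assms(2) unfolding hrank_def by blast
qed

lemma has_euler_group_iso:
  assumes "\<And>p. relative_homology_group (int p) X S \<cong> relative_homology_group (int p) Y T" "has_euler Y T e"
  shows "has_euler X S e"
  using assms(2) hrank_group_iso[OF assms(1)] unfolding has_euler_def by blast

lemma hrank_trivial:
  assumes "trivial_group (relative_homology_group (int p) X S)"
  shows "hrank p X S 0"
proof -
  have "singular_relcycle_set p X S \<subseteq> singular_relboundary_set p X S"
  proof
    fix c assume "c \<in> singular_relcycle_set p X S"
    then have "homologous_rel_set p X S c \<in> carrier (relative_homology_group (int p) X S)"
      by (auto simp: carrier_relative_homology_group)
    then have "homologous_rel_set p X S c = singular_relboundary_set p X S"
      using assms unfolding trivial_group_def by (metis one_relative_homology_group singletonD)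
    then show "c \<in> singular_relboundary_set p X S" by (simp add: homologous_rel_set_eq_relboundary)
  qed
  then have "spans_mod (singular_relcycle_set p X S) (singular_relboundary_set p X S) {}"
    unfolding spans_mod_def lincomb_def by (auto intro!: exI[of _ 1])
  then show ?thesis unfolding hrank_def has_rank_def by (intro exI[of _ "{}"]) (auto simp: indep_mod_def)
qed

lemma hrank_0_singleton:
  assumes "topspace X = {a}"
  shows "hrank 0 X {} 1"
proof -
  let ?s = "frag_of (restrict (\<lambda>x. a) (standard_simplex 0))"
  have Z: "singular_relcycle_set 0 X {} = range (\<lambda>b. frag_cmul b ?s)"
    using singular_cycle_singleton[OF assms, of 0] singular_chain_singleton[OF assms, of 0] by auto
  have B: "singular_relboundary_set 0 X {} = {0}"
    using singular_boundary_singleton[OF assms, of 0] by auto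
  have "?s \<in> range (\<lambda>b. frag_cmul b ?s)" by (rule range_eqI[of _ _ 1]) simp
  moreover have "indep_mod {0} {?s}" by (simp add: indep_mod_def lincomb_def)
  moreover have "spans_mod (range (\<lambda>b. frag_cmul b ?s)) {0} {?s}"
    unfolding spans_mod_def lincomb_def
  proof (intro conjI ballI)
    fix z assume "z \<in> range (\<lambda>b. frag_cmul b ?s)"
    then obtain b where "z = frag_cmul b ?s" by blast
    then show "\<exists>k a. k \<noteq> 0 \<and> frag_cmul k z - (\<Sum>s\<in>{?s}. frag_cmul (a s) s) \<in> {0}"
      by (intro exI[of _ 1] exI[of _ "\<lambda>_. b"]) simp
  qed simp
  ultimately show ?thesis unfolding hrank_def Z B has_rank_def by (intro exI[of _ "{?s}"]) auto
qed

text \<open>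
  By excision the open disc may be enlarged to Euclidean space. Its homology relative to the
  complement of the origin is that of a point, shifted up by \<open>n\<close> degrees.
\<close>

lemma has_euler_punctured_disc:
  "has_euler (subtopology (Euclidean_space n) (open_unit_disc n)) (open_unit_disc n - {\<lambda>i. 0}) ((-1) ^ n)"
proof -
  let ?E = "Euclidean_space n" and ?O = "open_unit_disc n" and ?z = "\<lambda>i::nat. 0::real"
  have cont: "continuous_map ?E euclideanreal (\<lambda>x. \<Sum>i<n. x i ^ 2)"
    unfolding Euclidean_space_def
    by (intro continuous_map_from_subtopology continuous_intros) auto
  have "openin ?E {x \<in> topspace ?E. (\<Sum>i<n. x i ^ 2) \<in> {..<1}}"
    by (rule openin_continuous_map_preimage[OF cont]) auto
  then have oO: "openin ?E ?O" by (simp add: open_unit_disc_def)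
  have zO: "?z \<in> ?O" by (simp add: open_unit_disc_def topspace_Euclidean_space)
  have cz: "closedin (Euclidean_space m) {?z}" for m
    using Hausdorff_Euclidean_space[of m] by (simp add: closedin_Hausdorff_sing_eq topspace_Euclidean_space)
  have exc: "relative_homology_group p (subtopology ?E ?O) (?O - {?z}) \<cong> relative_homology_group p ?E (topspace ?E - {?z})" for p
  proof -
    let ?U = "topspace ?E - ?O"
    have "?E closure_of ?U \<subseteq> ?E interior_of (topspace ?E - {?z})"
    proof -
      have "closedin ?E ?U" using oO by blast
      moreover have "openin ?E (topspace ?E - {?z})" using cz by blast
      ultimately show ?thesis using zO by (simp add: closure_of_closedin interior_of_openin) blast
    qed
    from homology_excision_axiom[OF this, of "topspace ?E" p]
    have "relative_homology_group p (subtopology ?E (topspace ?E - ?U)) (topspace ?E - {?z} - ?U)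
      \<cong> relative_homology_group p (subtopology ?E (topspace ?E)) (topspace ?E - {?z})"
      by (auto simp: is_iso_def)
    moreover have "topspace ?E - ?U = ?O" "topspace ?E - {?z} - ?U = ?O - {?z}"
      using openin_subset[OF oO] by auto
    ultimately show ?thesis by simp
  qed
  have pt: "topspace (Euclidean_space 0) = {?z}" by (auto simp: topspace_Euclidean_space)
  have step: "relative_homology_group (int p - int n) (Euclidean_space 0) {} \<cong> relative_homology_group (int p) ?E (topspace ?E - {?z})" for p
    using relative_homology_group_Euclidean_complement_step[OF cz[of 0], of "int p - int n" n]
    by (simp add: pt)
  have rank: "hrank p (subtopology ?E ?O) (?O - {?z}) (if p = n then 1 else 0)" for p
  proof (cases "p = n")
    case True
    have iso: "relative_homology_group (int n) (subtopology ?E ?O) (?O - {?z}) \<cong> relative_homology_group (int 0) (Euclidean_space 0) {}"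
      using iso_trans[OF exc group.iso_sym[OF _ step[of n]]] by simp
    show ?thesis using hrank_group_iso[OF iso hrank_0_singleton[OF pt]] True by simp
  next
    case False
    have "trivial_group (relative_homology_group (int p - int n) (Euclidean_space 0) {})"
      by (rule homology_dimension_axiom[OF pt]) (use False in simp)
    then have "trivial_group (relative_homology_group (int p) (subtopology ?E ?O) (?O - {?z}))"
      using isomorphic_group_triviality[OF step[of p]] isomorphic_group_triviality[OF exc[of "int p"]] by simp
    then show ?thesis using False hrank_trivial by simp
  qed
  show ?thesis unfolding has_euler_def
    by (rule exI[of _ "\<lambda>p. if p = n then 1 else 0"], rule exI[of _ "Suc n"]) (use rank in auto)
qed

lemma topspace_unit_disc: "topspace (unit_disc n) = open_unit_disc n \<union> unit_disc_boundary n"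
  and open_unit_disc_Int_boundary: "open_unit_disc n \<inter> unit_disc_boundary n = {}"
  by (auto simp: unit_disc_def open_unit_disc_def unit_disc_boundary_def)

lemma compact_space_unit_disc: "compact_space (unit_disc n)"
proof -
  let ?K = "{x :: nat \<Rightarrow> real. (\<forall>i\<ge>n. x i = 0) \<and> (\<Sum>i<n. x i ^ 2) \<le> 1}"
  have eq: "unit_disc n = subtopology (powertop_real UNIV) ?K"
    unfolding unit_disc_def Euclidean_space_def by (simp add: subtopology_subtopology Collect_conj_eq)
  have c: "compactin (powertop_real UNIV) (UNIV \<rightarrow>\<^sub>E {-1..1})"
    by (auto simp: compactin_PiE)
  have sub: "?K \<subseteq> (UNIV \<rightarrow>\<^sub>E {-1..1})"
  proof
    fix x assume x: "x \<in> ?K"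
    have "\<bar>x i\<bar> \<le> 1" for i
    proof (cases "i < n")
      case True
      have "x i ^ 2 \<le> (\<Sum>i<n. x i ^ 2)" by (rule member_le_sum) (use True in auto)
      then have "x i ^ 2 \<le> 1" using x by simp
      then show ?thesis by (simp add: abs_square_le_1)
    qed (use x in auto)
    then show "x \<in> UNIV \<rightarrow>\<^sub>E {-1..1}" by (auto simp: abs_le_iff minus_le_iff)
  qed
  have proj: "continuous_map (powertop_real UNIV) euclideanreal (\<lambda>x. x i)" for i
    by (metis UNIV_I continuous_map_product_coordinates)
  have "closedin (powertop_real UNIV) {x \<in> topspace (powertop_real UNIV). (\<Sum>i<n. x i ^ 2) \<in> {..1}}"
    by (rule closedin_continuous_map_preimage) (auto intro!: continuous_intros)
  moreover have "closedin (powertop_real UNIV) (topspace (Euclidean_space n))" by (rule closedin_Euclidean_space)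
  ultimately have "closedin (powertop_real UNIV) ?K"
    using closedin_Int by (fastforce simp: topspace_Euclidean_space Collect_conj_eq Int_commute)
  then have "compactin (powertop_real UNIV) ?K" using closed_compactin[OF c sub] by blast
  then show ?thesis unfolding eq by (simp add: compact_space_subtopology)
qed

lemma continuous_map_unit_disc_coord: "continuous_map (unit_disc n) euclideanreal (\<lambda>x. x i)"
  unfolding unit_disc_def Euclidean_space_def
  by (intro continuous_map_from_subtopology) (metis UNIV_I continuous_map_product_coordinates)

text \<open>
  The punctured closed disc is pushed along rays onto its boundary sphere: the factor
  interpolates between \<open>1\<close> and the inverse of the norm.
\<close>

lemma radial_deformation:
  fixes n :: nat
  defines "z \<equiv> (\<lambda>i::nat. 0::real)"
  defines "m \<equiv> (\<lambda>(t, x) i. ((1 - t) + t / sqrt (\<Sum>i<n. x i ^ 2)) * x i)"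
  shows "continuous_map (prod_topology (top_of_set {0..1}) (subtopology (unit_disc n) (topspace (unit_disc n) - {z})))
      (subtopology (unit_disc n) (topspace (unit_disc n) - {z})) m"
    and "\<And>x. x \<in> topspace (unit_disc n) - {z} \<Longrightarrow> m (0, x) = x"
    and "\<And>x. x \<in> topspace (unit_disc n) - {z} \<Longrightarrow> m (1, x) \<in> unit_disc_boundary n"
    and "\<And>t x. x \<in> unit_disc_boundary n \<Longrightarrow> m (t, x) = x"
proof -
  let ?D = "subtopology (unit_disc n) (topspace (unit_disc n) - {z})"
  let ?N = "\<lambda>x::nat \<Rightarrow> real. \<Sum>i<n. x i ^ 2"
  have pos: "?N x > 0" if "x \<in> topspace (unit_disc n) - {z}" for x
  proof -
    have "\<exists>i<n. x i \<noteq> 0"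
      using that by (auto simp: unit_disc_def topspace_Euclidean_space z_def fun_eq_iff) (metis not_le)
    then obtain i where "i < n" "x i \<noteq> 0" by blast
    then have "0 < x i ^ 2" by simp
    also have "x i ^ 2 \<le> ?N x" by (rule member_le_sum) (use \<open>i < n\<close> in auto)
    finally show ?thesis .
  qed
  have Nm: "?N (m (t, x)) = (((1 - t) + t / sqrt (?N x)) * sqrt (?N x)) ^ 2" for t x
    by (simp add: m_def power_mult_distrib sum_nonneg flip: sum_distrib_left)
  have Nm': "?N (m (t, x)) = ((1 - t) * sqrt (?N x) + t) ^ 2" if "x \<in> topspace (unit_disc n) - {z}" for t x
  proof -
    have "((1 - t) + t / r) * r = (1 - t) * r + t" if "r > 0" for r :: real
      using that by (simp add: field_simps)
    then show ?thesis using pos[OF that] unfolding Nm by (metis real_sqrt_gt_zero)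
  qed
  have le1: "?N x \<le> 1" and zero: "\<And>i. i \<ge> n \<Longrightarrow> x i = 0" if "x \<in> topspace (unit_disc n)" for x
    using that by (auto simp: unit_disc_def topspace_Euclidean_space)
  have mz: "m (t, x) i = 0" if "x \<in> topspace (unit_disc n)" "i \<ge> n" for t x i
    using zero[OF that] by (simp add: m_def)
  have in1: "m (t, x) \<in> topspace (unit_disc n) - {z}" if x: "x \<in> topspace (unit_disc n) - {z}" and t: "t \<in> {0..1}" for t x
  proof -
    have s: "0 < sqrt (?N x)" "sqrt (?N x) \<le> 1" using pos[OF x] le1 x by auto
    have "(1 - t) * sqrt (?N x) + t \<le> (1 - t) * 1 + t" using t s by (intro add_mono mult_left_mono) auto
    moreover have "0 < (1 - t) * sqrt (?N x) + t"
      using t s by (cases "t = 0") (auto intro!: add_nonneg_pos)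
    ultimately have "0 < ?N (m (t, x))" "?N (m (t, x)) \<le> 1"
      unfolding Nm'[OF x] by (auto simp: power_le_one)
    moreover from this have "m (t, x) \<noteq> z" by (auto simp: z_def)
    ultimately show ?thesis using mz x by (auto simp: unit_disc_def topspace_Euclidean_space)
  qed
  show "m (0, x) = x" if "x \<in> topspace (unit_disc n) - {z}" for x by (simp add: m_def)
  show "m (1, x) \<in> unit_disc_boundary n" if x: "x \<in> topspace (unit_disc n) - {z}" for x
    using Nm'[OF x, of 1] mz[of x _ 1] x by (simp add: unit_disc_boundary_def topspace_Euclidean_space)
  show "m (t, x) = x" if "x \<in> unit_disc_boundary n" for t x
    using that by (simp add: m_def unit_disc_boundary_def)
  let ?P = "prod_topology (top_of_set {0..1}) ?D"
  have ft: "continuous_map ?P euclideanreal fst"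
    using continuous_map_fst continuous_map_into_fulltopology by blast
  have fx: "continuous_map ?P euclideanreal (\<lambda>y. snd y i)" for i
    using continuous_map_compose[OF continuous_map_snd continuous_map_from_subtopology[OF continuous_map_unit_disc_coord]]
    by (simp add: o_def)
  have ne: "sqrt (?N (snd y)) \<noteq> 0" if "y \<in> topspace ?P" for y
    using pos[of "snd y"] that by auto
  have "continuous_map ?P euclideanreal (\<lambda>y. m y i)" for i
    unfolding m_def case_prod_beta
    by (intro continuous_intros ft fx ne) auto
  then have c: "continuous_map ?P (powertop_real UNIV) m"
    by (simp add: continuous_map_componentwise_UNIV)
  have in2: "m y \<in> topspace (unit_disc n) - {z}" if "y \<in> topspace ?P" for y
    using that in1[of "snd y" "fst y"] by auto
  then have in3: "m y \<in> {x. \<forall>i\<ge>n. x i = 0}" "m y \<in> {x. ?N x \<le> 1}" if "y \<in> topspace ?P" for y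
    using zero[of "m y"] le1[of "m y"] that by auto
  have "continuous_map ?P (Euclidean_space n) m"
    unfolding Euclidean_space_def by (rule continuous_map_into_subtopology[OF c]) (use in3 in blast)
  then have "continuous_map ?P (subtopology (Euclidean_space n) {x. ?N x \<le> 1}) m"
    by (rule continuous_map_into_subtopology) (use in3 in blast)
  then have "continuous_map ?P (unit_disc n) m" by (simp only: unit_disc_def)
  then show "continuous_map ?P ?D m"
    by (rule continuous_map_into_subtopology) (use in2 in blast)
qed

text \<open>
  Let \<open>U\<close> be the complement of the centre of the cell. The homology of \<open>Q\<close> relative to \<open>U\<close> is
  that of the open disc relative to the punctured open disc, by excision of the complement of
  the cell. The radial deformation of the punctured disc descends along \<open>\<Phi>\<close> to a deformation of
  \<open>U\<close> into the complement of the cell, so \<open>U\<close> and that complement have the same homology. The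
  Euler characteristics of \<open>U\<close> and of the pair add up.
\<close>

lemma has_euler_attach_cell:
  assumes haus: "Hausdorff_space Q" and e: "e \<subseteq> topspace Q" and clB: "closedin Q (topspace Q - e)"
    and \<Phi>: "continuous_map (unit_disc n) Q \<Phi>" "inj_on \<Phi> (open_unit_disc n)" "\<Phi> ` open_unit_disc n = e"
      "\<Phi> ` unit_disc_boundary n \<inter> e = {}"
    and B: "has_euler (subtopology Q (topspace Q - e)) {} a"
  shows "has_euler Q {} (a + (-1) ^ n)"
proof -
  let ?D = "unit_disc n" and ?O = "open_unit_disc n" and ?z = "\<lambda>i::nat. 0::real"
  let ?B = "topspace Q - e"
  define pt where "pt = \<Phi> ?z"
  define U where "U = topspace Q - {pt}"
  have zO: "?z \<in> ?O" by (simp add: open_unit_disc_def topspace_Euclidean_space)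
  have pte: "pt \<in> e" using zO \<Phi>(3) by (auto simp: pt_def)
  have ptQ: "pt \<in> topspace Q" using pte e by blast
  have proper: "proper_map ?D Q \<Phi>"
    using continuous_imp_proper_map[OF compact_space_unit_disc Hausdorff_imp_kc_space[OF haus] \<Phi>(1)] .
  have OD: "?O \<subseteq> topspace ?D" by (simp add: topspace_unit_disc)
  have bnd: "\<Phi> x \<in> ?B" if "x \<in> unit_disc_boundary n" for x
  proof -
    have "\<Phi> x \<in> topspace Q" using continuous_map_image_subset_topspace[OF \<Phi>(1)] that by (auto simp: topspace_unit_disc)
    then show ?thesis using \<Phi>(4) that by blast
  qed
  have preO: "{x \<in> topspace ?D. \<Phi> x \<in> e} = ?O"
    using \<Phi>(3) bnd by (auto simp: topspace_unit_disc)
  have subO: "subtopology ?D ?O = subtopology (Euclidean_space n) ?O"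
    unfolding unit_disc_def subtopology_subtopology
    by (rule arg_cong[where f = "subtopology _"]) (auto simp: open_unit_disc_def)
  have hom: "homeomorphic_map (subtopology (Euclidean_space n) ?O) (subtopology Q e) \<Phi>"
  proof (rule bijective_closed_imp_homeomorphic_map)
    show "closed_map (subtopology (Euclidean_space n) ?O) (subtopology Q e) \<Phi>"
      using proper_map_restriction[OF proper preO] unfolding subO by (rule proper_imp_closed_map)
    show "continuous_map (subtopology (Euclidean_space n) ?O) (subtopology Q e) \<Phi>"
      unfolding subO[symmetric] using \<Phi>(3)
      by (intro continuous_map_into_subtopology continuous_map_from_subtopology \<Phi>(1)) auto
    show "\<Phi> ` topspace (subtopology (Euclidean_space n) ?O) = topspace (subtopology Q e)"
      unfolding subO[symmetric] using \<Phi>(3) OD e by (simp add: Int_absorb1 Int_absorb2)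
    show "inj_on \<Phi> (topspace (subtopology (Euclidean_space n) ?O))"
      using \<Phi>(2) by (rule inj_on_subset) auto
  qed
  have oe: "openin Q e" using clB e by (simp add: openin_closedin_eq)
  have oU: "openin Q U" unfolding U_def using haus ptQ by (simp add: closedin_Hausdorff_sing_eq openin_diff)
  have local: "has_euler Q U ((-1) ^ n)"
  proof (rule has_euler_group_iso[OF _ has_euler_punctured_disc])
    fix p
    have "relative_homology_group (int p) (subtopology (Euclidean_space n) ?O) (?O - {?z}) \<cong>
        relative_homology_group (int p) (subtopology Q e) (e - {pt})"
    proof -
      have "?O - {?z} \<subseteq> topspace (subtopology (Euclidean_space n) ?O)"
        unfolding subO[symmetric] using OD by auto
      moreover have "\<Phi> ` (?O - {?z}) = e - {pt}"
        using \<Phi>(2) zO unfolding pt_def \<Phi>(3)[symmetric] by (subst inj_on_image_set_diff[where C = ?O]) auto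
      ultimately show ?thesis
        using homeomorphic_map_relative_homology_iso[OF hom] unfolding is_iso_def by blast
    qed
    moreover have "relative_homology_group (int p) (subtopology Q e) (e - {pt}) \<cong> relative_homology_group (int p) Q U"
    proof -
      have "Q closure_of ?B \<subseteq> Q interior_of U"
        using clB oU pte by (simp add: closure_of_closedin interior_of_openin U_def) blast
      from homology_excision_axiom[OF this, of "topspace Q" "int p"]
      have "relative_homology_group (int p) (subtopology Q (topspace Q - ?B)) (U - ?B) \<cong>
          relative_homology_group (int p) (subtopology Q (topspace Q)) U"
        by (auto simp: is_iso_def U_def)
      moreover have "topspace Q - ?B = e" "U - ?B = e - {pt}" using e by (auto simp: U_def)
      ultimately show ?thesis by simp
    qed
    ultimately show "relative_homology_group (int p) Q U \<cong>
        relative_homology_group (int p) (subtopology (Euclidean_space n) ?O) (?O - {?z})"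
      by (meson group.iso_sym group_relative_homology_group iso_trans)
  qed
  let ?T = "topspace ?D - {?z}"
  let ?DT = "subtopology ?D ?T"
  let ?QU = "subtopology Q U"
  let ?I = "top_of_set {0..1::real}"
  have tQU: "topspace ?QU = U" by (auto simp: U_def)
  have preU: "{x \<in> topspace ?D. \<Phi> x \<in> U} = ?T"
  proof -
    have "\<Phi> x \<in> U \<longleftrightarrow> x \<noteq> ?z" if x: "x \<in> topspace ?D" for x
    proof -
      have "\<Phi> x \<in> topspace Q" using continuous_map_image_subset_topspace[OF \<Phi>(1)] x by blast
      moreover have "\<Phi> x = pt \<longleftrightarrow> x = ?z"
      proof (cases "x \<in> ?O")
        case True
        then show ?thesis unfolding pt_def using \<Phi>(2) zO by (auto simp: inj_on_def)
      next
        case False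
        then have "\<Phi> x \<in> ?B" using x bnd by (auto simp: topspace_unit_disc)
        then show ?thesis using pte False zO by auto
      qed
      ultimately show ?thesis by (auto simp: U_def)
    qed
    then show ?thesis by auto
  qed
  have properT: "proper_map ?DT ?QU \<Phi>" by (rule proper_map_restriction[OF proper preU])
  have contT: "continuous_map ?DT ?QU \<Phi>"
    using preU by (intro continuous_map_into_subtopology continuous_map_from_subtopology \<Phi>(1)) auto
  define m where "m = (\<lambda>(t, x) i. ((1 - t) + t / sqrt (\<Sum>i<n. x i ^ 2)) * (x i :: real))"
  note m = radial_deformation[where n = n, folded m_def]
  let ?P = "prod_topology ?I ?DT" and ?R = "prod_topology ?I ?QU"
  let ?q = "\<lambda>(t, x). (t, \<Phi> x)"
  define C where "C = ?q ` topspace ?P"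
  have tP: "topspace ?P = {0..1} \<times> ?T" by auto
  have properq: "proper_map ?P ?R ?q"
    using proper_map_prod[of ?I ?DT ?I ?QU id \<Phi>] properT proper_map_id[of ?I] by (simp add: id_def)
  have contq: "continuous_map ?P ?R ?q"
    unfolding case_prod_beta using continuous_map_compose[OF continuous_map_snd contT]
    by (intro continuous_map_pairedI continuous_map_fst) (auto simp: o_def)
  have clC: "closedin ?R C"
    unfolding C_def using proper_imp_closed_map[OF properq] closedin_topspace unfolding closed_map_def by blast
  have quot: "quotient_map ?P (subtopology ?R C) ?q"
  proof (rule continuous_closed_imp_quotient_map)
    show "continuous_map ?P (subtopology ?R C) ?q"
      using contq by (rule continuous_map_into_subtopology) (auto simp: C_def)
    show "closed_map ?P (subtopology ?R C) ?q"
      using proper_imp_closed_map[OF properq] by (rule closed_map_into_subtopology) (auto simp: C_def)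
    show "?q ` topspace ?P = topspace (subtopology ?R C)"
      using closedin_subset[OF clC] C_def by auto
  qed
  define \<Psi> where "\<Psi> = the_inv_into ?O \<Phi>"
  have inv: "\<Psi> (\<Phi> x) = x" if "x \<in> ?O" for x
    unfolding \<Psi>_def by (rule the_inv_into_f_f[OF \<Phi>(2) that])
  define h where "h = (\<lambda>(t, q). if q \<in> ?B then q else \<Phi> (m (t, \<Psi> q)))"
  have hq: "h (t, \<Phi> x) = \<Phi> (m (t, x))" if "x \<in> ?T" for t x
  proof (cases "x \<in> ?O")
    case True
    then show ?thesis using \<Phi>(3) by (auto simp: h_def inv)
  next
    case False
    then have x: "x \<in> unit_disc_boundary n" using that by (auto simp: topspace_unit_disc)
    then show ?thesis using bnd m(4) by (simp add: h_def)
  qed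
  \<comment> \<open>The homotopy is glued from the identity over the complement of the cell and the image of the radial
    deformation. The latter is continuous on \<open>C\<close>, since the proper map \<open>?q\<close> is a quotient map onto \<open>C\<close>.\<close>
  have cont_h: "continuous_map ?R ?QU h"
  proof (rule pasting_lemma_closed[where I = "{True, False}" and T = "\<lambda>b. if b then {0..1} \<times> ?B else C" and f = "\<lambda>b. if b then snd else h"])
    have BU: "?B \<subseteq> U" using pte by (auto simp: U_def)
    show "closedin ?R (if b then {0..1} \<times> ?B else C)" for b
      using clC closedin_subset_topspace[OF clB, of U] BU
      by (auto simp: closedin_prod_Times_iff)
    show "continuous_map (subtopology ?R (if b then {0..1} \<times> ?B else C)) ?QU (if b then snd else h)" for b
    proof (cases b)
      case True
      then show ?thesis by (simp add: continuous_map_from_subtopology continuous_map_snd)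
    next
      case False
      have "continuous_map ?P ?QU (\<Phi> \<circ> m)"
        by (rule continuous_map_compose[OF m(1) contT])
      then have "continuous_map ?P ?QU (h \<circ> ?q)"
      proof (rule continuous_map_eq)
        fix y assume "y \<in> topspace ?P"
        then obtain t x where y: "y = (t, x)" "x \<in> ?T" by (cases y) auto
        show "(\<Phi> \<circ> m) y = (h \<circ> ?q) y" using hq[OF y(2), of t] y(1) by simp
      qed
      then show ?thesis using continuous_compose_quotient_map[OF quot] False by auto
    qed
    show "(if i then snd else h) x = (if j then snd else h) x"
      if "x \<in> topspace ?R \<inter> (if i then {0..1} \<times> ?B else C) \<inter> (if j then {0..1} \<times> ?B else C)" for i j x
      using that by (auto simp: h_def)
    show "\<exists>j. j \<in> {True, False} \<and> x \<in> (if j then {0..1} \<times> ?B else C) \<and> h x = (if j then snd else h) x"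
      if x: "x \<in> topspace ?R" for x
    proof (cases "snd x \<in> ?B")
      case True
      then show ?thesis using x by (intro exI[of _ True]) (auto simp: h_def)
    next
      case False
      have "snd x \<in> topspace ?QU" using x by (simp only: topspace_prod_topology mem_Times_iff)
      then have "snd x \<in> U" using tQU by simp
      then have "snd x \<in> e" using False unfolding U_def by blast
      then obtain y where y: "y \<in> ?O" "snd x = \<Phi> y" using \<Phi>(3) by blast
      then have "y \<in> ?T" using preU OD \<open>snd x \<in> U\<close> by auto
      then have "x \<in> C" 
      proof -
        have "(fst x, y) \<in> topspace ?P" using x \<open>y \<in> ?T\<close> by (cases x) auto
        moreover have "x = ?q (fst x, y)" using y by (cases x) simp
        ultimately show ?thesis unfolding C_def by (rule rev_image_eqI)
      qed
      then show ?thesis by (intro exI[of _ False]) auto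
    qed
  qed auto
  have h0: "h (0, q) = q" if "q \<in> U" for q
  proof (cases "q \<in> ?B")
    case False
    then have "q \<in> e" using that by (auto simp: U_def)
    then obtain y where y: "y \<in> ?O" "q = \<Phi> y" using \<Phi>(3) by blast
    then have "y \<in> ?T" using preU OD that by auto
    then show ?thesis using hq[of y 0] m(2) y by simp
  qed (simp add: h_def)
  have h1: "h (1, q) \<in> ?B" if "q \<in> U" for q
  proof (cases "q \<in> ?B")
    case False
    then have "q \<in> e" using that by (auto simp: U_def)
    then obtain y where y: "y \<in> ?O" "q = \<Phi> y" using \<Phi>(3) by blast
    then have "y \<in> ?T" using preU OD that by auto
    then show ?thesis using hq[of y 1] bnd[OF m(3)] y by simp
  qed (simp add: h_def)
  have homotopic: "homotopic_with (\<lambda>h. True) ?QU ?QU id (\<lambda>q. h (1, q))"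
    by (subst homotopic_with) (use cont_h h0 tQU in \<open>auto intro!: exI[of _ h]\<close>)
  have retr: "retraction_maps ?QU (subtopology ?QU ?B) (\<lambda>q. h (1, q)) id"
    unfolding retraction_maps_def
  proof (intro conjI ballI)
    show "continuous_map ?QU (subtopology ?QU ?B) (\<lambda>q. h (1, q))"
      by (rule continuous_map_into_subtopology)
         (use homotopic_with_imp_continuous_maps[OF homotopic] h1 tQU in auto)
  qed (auto simp: h_def)
  have "homology_group p ?QU \<cong> homology_group p (subtopology ?QU ?B)" for p
    by (rule deformation_retract_imp_isomorphic_homology_groups[OF retr]) (use homotopic homotopic_with_sym in blast)
  moreover have "subtopology ?QU ?B = subtopology Q ?B"
    using pte by (simp add: subtopology_subtopology U_def) (rule arg_cong[where f = "subtopology Q"], auto)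
  ultimately have "\<And>p. homology_group (int p) ?QU \<cong> homology_group (int p) (subtopology Q ?B)" by simp
  then have "has_euler ?QU {} a" by (rule has_euler_group_iso[OF _ B])
  then show ?thesis using has_euler_pair local by blast
qed


lemma has_euler_empty:
  assumes "topspace X = {}"
  shows "has_euler X {} 0"
  unfolding has_euler_def
proof (intro exI conjI allI)
  show "hrank p X {} 0" for p
    using hrank_trivial trivial_homology_group_empty assms by blast
qed auto

text \<open>
  Induction on the number of cells, removing one of the largest dimension. What remains is the
  union of the compact images of the other closed discs, which miss the removed cell, and is
  therefore closed.
\<close>

theorem has_euler_finite_cells:
  fixes d :: "'i \<Rightarrow> nat" and c :: "'i \<Rightarrow> 'x set"
  assumes "finite I" "Hausdorff_space Q" "topspace Q = (\<Union>i\<in>I. c i)" "disjoint_family_on c I"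
    and "\<And>i. i \<in> I \<Longrightarrow> \<exists>\<Phi>. continuous_map (unit_disc (d i)) Q \<Phi> \<and> inj_on \<Phi> (open_unit_disc (d i)) \<and>
       \<Phi> ` open_unit_disc (d i) = c i \<and> \<Phi> ` unit_disc_boundary (d i) \<subseteq> (\<Union>j\<in>{j\<in>I. d j < d i}. c j)"
  shows "has_euler Q {} (\<Sum>i\<in>I. (-1) ^ d i)"
  using assms
proof (induction "card I" arbitrary: I Q)
  case 0
  then show ?case using has_euler_empty by auto
next
  case (Suc k)
  note fin = \<open>finite I\<close> and haus = \<open>Hausdorff_space Q\<close> and top = Suc.prems(3) and disj = Suc.prems(4) and char = Suc.prems(5)
  have "d ` I \<noteq> {}" "finite (d ` I)" using Suc by auto
  then have "Max (d ` I) \<in> d ` I" by (rule Max_in[rotated])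
  then obtain i where i: "i \<in> I" "d i = Max (d ` I)" by auto
  have max: "d j \<le> d i" if "j \<in> I" for j using i(2) fin that by simp
  let ?J = "I - {i}"
  let ?B = "topspace Q - c i"
  have B: "?B = (\<Union>j\<in>?J. c j)"
    using top disj i unfolding disjoint_family_on_def by auto
  have lower: "{k\<in>I. d k < d j} = {k\<in>?J. d k < d j}" if "j \<in> I" for j
    using max[OF that] by auto
  have char': "\<exists>\<Phi>. continuous_map (unit_disc (d j)) (subtopology Q ?B) \<Phi> \<and> inj_on \<Phi> (open_unit_disc (d j)) \<and>
       \<Phi> ` open_unit_disc (d j) = c j \<and> \<Phi> ` unit_disc_boundary (d j) \<subseteq> (\<Union>k\<in>{k\<in>?J. d k < d j}. c k) \<and>
       \<Phi> ` topspace (unit_disc (d j)) \<subseteq> ?B"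
    if j: "j \<in> ?J" for j
  proof -
    have jI: "j \<in> I" using j by simp
    obtain \<Phi> where \<Phi>: "continuous_map (unit_disc (d j)) Q \<Phi>" "inj_on \<Phi> (open_unit_disc (d j))"
      "\<Phi> ` open_unit_disc (d j) = c j" "\<Phi> ` unit_disc_boundary (d j) \<subseteq> (\<Union>k\<in>{k\<in>?J. d k < d j}. c k)"
      using char[OF jI] unfolding lower[OF jI] by blast
    have "\<Phi> ` topspace (unit_disc (d j)) \<subseteq> ?B"
      unfolding B topspace_unit_disc image_Un using \<Phi>(3,4) j by blast
    then show ?thesis using \<Phi> by (intro exI[of _ \<Phi>]) (auto intro!: continuous_map_into_subtopology)
  qed
  have clB: "closedin Q ?B"
  proof -
    have "\<exists>K. compactin Q K \<and> c j \<subseteq> K \<and> K \<subseteq> ?B" if j: "j \<in> ?J" for j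
    proof -
      obtain \<Phi> where \<Phi>: "continuous_map (unit_disc (d j)) (subtopology Q ?B) \<Phi>" "\<Phi> ` open_unit_disc (d j) = c j"
        "\<Phi> ` topspace (unit_disc (d j)) \<subseteq> ?B"
        using char'[OF j] by blast
      have "compactin Q (\<Phi> ` topspace (unit_disc (d j)))"
        using image_compactin[of "unit_disc (d j)" "topspace (unit_disc (d j))" Q \<Phi>] \<Phi>(1) compact_space_unit_disc
        by (simp add: compact_space_def continuous_map_in_subtopology)
      then show ?thesis using \<Phi>(2,3) by (intro exI[of _ "\<Phi> ` topspace (unit_disc (d j))"]) (auto simp: topspace_unit_disc)
    qed
    then obtain K where K: "\<And>j. j \<in> ?J \<Longrightarrow> compactin Q (K j) \<and> c j \<subseteq> K j \<and> K j \<subseteq> ?B" by metis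
    have "?B = (\<Union>j\<in>?J. K j)"
    proof
      have "(\<Union>j\<in>?J. c j) \<subseteq> (\<Union>j\<in>?J. K j)" by (rule UN_mono[OF order_refl]) (use K in simp)
      then show "?B \<subseteq> (\<Union>j\<in>?J. K j)" by (simp only: B)
      show "(\<Union>j\<in>?J. K j) \<subseteq> ?B" by (rule UN_least) (use K in simp)
    qed
    moreover have "closedin Q (\<Union>j\<in>?J. K j)"
    proof (rule closedin_Union)
      show "finite (K ` ?J)" using fin by simp
      fix T assume "T \<in> K ` ?J"
      then obtain j where j: "j \<in> ?J" "T = K j" by blast
      show "closedin Q T" unfolding j(2)
        by (rule compactin_imp_closedin[OF haus conjunct1[OF K[OF j(1)]]])
    qed
    ultimately show ?thesis by simp
  qed
  have IH: "has_euler (subtopology Q ?B) {} (\<Sum>j\<in>?J. (-1) ^ d j)"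
  proof (rule Suc.hyps(1))
    show "k = card ?J" using Suc.hyps(2) i fin by simp
    show "disjoint_family_on c ?J" using disj unfolding disjoint_family_on_def by blast
    show "topspace (subtopology Q ?B) = (\<Union>j\<in>?J. c j)" using B by auto
    show "Hausdorff_space (subtopology Q ?B)" using haus by (rule Hausdorff_space_subtopology)
    show "finite ?J" using fin by simp
    fix j assume j: "j \<in> ?J"
    show "\<exists>\<Phi>. continuous_map (unit_disc (d j)) (subtopology Q ?B) \<Phi> \<and> inj_on \<Phi> (open_unit_disc (d j)) \<and>
       \<Phi> ` open_unit_disc (d j) = c j \<and> \<Phi> ` unit_disc_boundary (d j) \<subseteq> (\<Union>k\<in>{k\<in>?J. d k < d j}. c k)"
      using char'[OF j] by (elim exE conjE) (rule exI, intro conjI)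
  qed
  obtain \<Phi> where \<Phi>: "continuous_map (unit_disc (d i)) Q \<Phi>" "inj_on \<Phi> (open_unit_disc (d i))"
      "\<Phi> ` open_unit_disc (d i) = c i" "\<Phi> ` unit_disc_boundary (d i) \<subseteq> (\<Union>j\<in>{j\<in>I. d j < d i}. c j)"
    using char[OF i(1)] by blast
  have "\<Phi> ` unit_disc_boundary (d i) \<subseteq> ?B" using \<Phi>(4) unfolding lower[OF i(1)] B by blast
  then have "has_euler Q {} ((\<Sum>j\<in>?J. (-1) ^ d j) + (-1) ^ d i)"
    using i(1) top by (intro has_euler_attach_cell[OF haus _ clB \<Phi>(1-3) _ IH]) auto
  then show ?case using i fin by (simp add: sum.remove add.commute)
qed

section \<open>Maps that induce isomorphisms on homology\<close>

text \<open>
  The map on relative homology is injective and surjective in every degree, said in terms of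
  cycles and boundaries so that diagram chases take place in the chain groups.
\<close>

definition homology_iso :: "'x topology \<Rightarrow> 'x set \<Rightarrow> 'y topology \<Rightarrow> 'y set \<Rightarrow> ('x \<Rightarrow> 'y) \<Rightarrow> bool" where
  "homology_iso X S Y T f \<longleftrightarrow> continuous_map X Y f \<and> f \<in> S \<rightarrow> T \<and>
     (\<forall>p c. singular_relcycle p X S c \<longrightarrow> singular_relboundary p Y T (chain_map p f c) \<longrightarrow> singular_relboundary p X S c) \<and>
     (\<forall>p z. singular_relcycle p Y T z \<longrightarrow> (\<exists>c. singular_relcycle p X S c \<and> singular_relboundary p Y T (z - chain_map p f c)))"

lemma homology_isoD:
  assumes "homology_iso X S Y T f"
  shows "continuous_map X Y f" "f \<in> S \<rightarrow> T"
    and "\<And>p c. singular_relcycle p X S c \<Longrightarrow> singular_relboundary p Y T (chain_map p f c) \<Longrightarrow> singular_relboundary p X S c"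
    and "\<And>p z. singular_relcycle p Y T z \<Longrightarrow> \<exists>c. singular_relcycle p X S c \<and> singular_relboundary p Y T (z - chain_map p f c)"
  using assms unfolding homology_iso_def by blast+

lemma homology_iso_hom_induced:
  assumes f: "continuous_map X Y f" "f \<in> S \<rightarrow> T"
    and iso: "\<And>p. hom_induced (int p) X S Y T f \<in> iso (relative_homology_group (int p) X S) (relative_homology_group (int p) Y T)"
  shows "homology_iso X S Y T f"
  unfolding homology_iso_def
proof (intro conjI allI impI f)
  fix p c assume c: "singular_relcycle p X S c" and b: "singular_relboundary p Y T (chain_map p f c)"
  have bij: "bij_betw (hom_induced (int p) X S Y T f) (homologous_rel_set p X S ` singular_relcycle_set p X S) (homologous_rel_set p Y T ` singular_relcycle_set p Y T)"
    using iso[of p] unfolding iso_def by (auto simp: carrier_relative_homology_group)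
  have "hom_induced (int p) X S Y T f (homologous_rel_set p X S c) = hom_induced (int p) X S Y T f (homologous_rel_set p X S 0)"
    using b by (subst (1 2) hom_induced_chain_map[OF f]) (use c in \<open>simp_all only: homologous_rel_set_eq_iff chain_map_0 diff_zero singular_relcycle_0\<close>)
  then have "homologous_rel_set p X S c = homologous_rel_set p X S 0"
    by (rule inj_onD[OF bij_betw_imp_inj_on[OF bij]]) (use c in auto)
  then show "singular_relboundary p X S c" by (simp only: homologous_rel_set_eq_iff diff_zero)
next
  fix p z assume z: "singular_relcycle p Y T z"
  have bij: "bij_betw (hom_induced (int p) X S Y T f) (homologous_rel_set p X S ` singular_relcycle_set p X S) (homologous_rel_set p Y T ` singular_relcycle_set p Y T)"
    using iso[of p] unfolding iso_def by (auto simp: carrier_relative_homology_group)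
  have "homologous_rel_set p Y T z \<in> hom_induced (int p) X S Y T f ` (homologous_rel_set p X S ` singular_relcycle_set p X S)"
    using bij_betw_imp_surj_on[OF bij] z by blast
  then obtain c where c: "singular_relcycle p X S c" "homologous_rel_set p Y T z = hom_induced (int p) X S Y T f (homologous_rel_set p X S c)"
    by blast
  then have "singular_relboundary p Y T (z - chain_map p f c)"
    unfolding hom_induced_chain_map[OF f c(1)] by (simp only: homologous_rel_set_eq_iff)
  then show "\<exists>c. singular_relcycle p X S c \<and> singular_relboundary p Y T (z - chain_map p f c)" using c(1) by blast
qed

lemma has_euler_homology_iso:
  assumes "homology_iso X S Y T f"
  shows "has_euler X S e \<longleftrightarrow> has_euler Y T e"
proof -
  note f = homology_isoD[OF assms]
  have "quotient_iso (singular_relcycle_set p X S) (singular_relboundary_set p X S)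
     (singular_relcycle_set p Y T) (singular_relboundary_set p Y T) (chain_map p f)" for p
    unfolding quotient_iso_def
    using f singular_relcycle_chain_map[OF _ f(1,2)] singular_relboundary_chain_map[OF _ f(1,2)]
    by (auto simp: chain_map_diff)
  then have "hrank p Y T r \<longleftrightarrow> hrank p X S r" for p r
    unfolding hrank_def
    by (intro has_rank_iso_iff frag_subgroup_relcycle frag_subgroup_relboundary)
  then show ?thesis unfolding has_euler_def by simp
qed

lemma homology_iso_compose:
  assumes f: "homology_iso X S Y T f" and g: "homology_iso Y T Z U g"
  shows "homology_iso X S Z U (g \<circ> f)"
  unfolding homology_iso_def
proof (intro conjI allI impI)
  note F = homology_isoD[OF f] and G = homology_isoD[OF g]
  show "continuous_map X Z (g \<circ> f)" using F(1) G(1) by (rule continuous_map_compose)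
  show "g \<circ> f \<in> S \<rightarrow> U" using F(2) G(2) by auto
  fix p
  show "singular_relboundary p X S c" if "singular_relcycle p X S c" "singular_relboundary p Z U (chain_map p (g \<circ> f) c)" for c
    using that F(3) G(3) singular_relcycle_chain_map[OF _ F(1,2)] by (simp add: chain_map_compose)
  show "\<exists>c. singular_relcycle p X S c \<and> singular_relboundary p Z U (z - chain_map p (g \<circ> f) c)" if z: "singular_relcycle p Z U z" for z
  proof -
    obtain y where y: "singular_relcycle p Y T y" "singular_relboundary p Z U (z - chain_map p g y)" using G(4)[OF z] by blast
    obtain x where x: "singular_relcycle p X S x" "singular_relboundary p Y T (y - chain_map p f x)" using F(4)[OF y(1)] by blast
    have "singular_relboundary p Z U ((z - chain_map p g y) + chain_map p g (y - chain_map p f x))"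
      using y(2) singular_relboundary_chain_map[OF x(2) G(1,2)] by (rule singular_relboundary_add)
    then show ?thesis using x(1) by (intro exI[of _ x]) (simp add: chain_map_compose chain_map_diff)
  qed
qed

lemma homology_iso_cancel_right:
  assumes gf: "homology_iso X S Z U (g \<circ> f)" and f: "homology_iso X S Y T f"
    and g: "continuous_map Y Z g" "g \<in> T \<rightarrow> U"
  shows "homology_iso Y T Z U g"
  unfolding homology_iso_def
proof (intro conjI allI impI g)
  note F = homology_isoD[OF f] and GF = homology_isoD[OF gf]
  fix p
  show "singular_relboundary p Y T y" if y: "singular_relcycle p Y T y" "singular_relboundary p Z U (chain_map p g y)" for y
  proof -
    obtain x where x: "singular_relcycle p X S x" "singular_relboundary p Y T (y - chain_map p f x)" using F(4)[OF y(1)] by blast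
    have "singular_relboundary p Z U (chain_map p g y - chain_map p g (y - chain_map p f x))"
      using y(2) singular_relboundary_chain_map[OF x(2) g] by (rule singular_relboundary_diff)
    then have "singular_relboundary p X S x" using GF(3)[OF x(1)] by (simp add: chain_map_compose chain_map_diff)
    then have "singular_relboundary p Y T ((y - chain_map p f x) + chain_map p f x)"
      using x(2) singular_relboundary_chain_map[OF _ F(1,2)] by (intro singular_relboundary_add)
    then show ?thesis by simp
  qed
  show "\<exists>c. singular_relcycle p Y T c \<and> singular_relboundary p Z U (z - chain_map p g c)" if z: "singular_relcycle p Z U z" for z
    using GF(4)[OF z] singular_relcycle_chain_map[OF _ F(1,2)] by (auto simp: chain_map_compose)
qed

lemma homology_iso_eq:
  assumes "homology_iso X S Y T f" "\<And>x. x \<in> topspace X \<Longrightarrow> f x = g x" "g \<in> S \<rightarrow> T"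
  shows "homology_iso X S Y T g"
proof -
  have "continuous_map X Y g" using homology_isoD(1)[OF assms(1)] assms(2) by (rule continuous_map_eq)
  moreover have "chain_map p g c = chain_map p f c" if "singular_relcycle p X S c" for p c
    using that assms(2) by (intro chain_map_eq) (auto simp: singular_relcycle)
  ultimately show ?thesis using assms(1,3) unfolding homology_iso_def by (metis (no_types, lifting))
qed

lemma homology_iso_homeomorphic_map:
  assumes "homeomorphic_map X Y f"
  shows "homology_iso X {} Y {} f"
  by (rule homology_iso_hom_induced)
     (use assms homeomorphic_imp_continuous_map homeomorphic_map_homology_iso in auto)

lemma homology_iso_excision:
  assumes "openin X V" "openin X W"
  shows "homology_iso (subtopology X W) (V \<inter> W) (subtopology X (V \<union> W)) V id"
proof (rule homology_iso_hom_induced)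
  show "continuous_map (subtopology X W) (subtopology X (V \<union> W)) id"
    by (auto simp: continuous_map_in_subtopology continuous_map_from_subtopology)
  fix p
  let ?X = "subtopology X (V \<union> W)" and ?U = "(V \<union> W) - W"
  have sub: "V \<union> W \<subseteq> topspace X" using assms openin_subset by blast
  have "openin ?X W" using assms by (simp add: openin_open_subtopology openin_Un)
  then have "closedin ?X (topspace ?X - W)" by blast
  moreover have "topspace ?X - W = ?U" using sub by auto
  ultimately have "closedin ?X ?U" by simp
  moreover have "openin ?X V" using assms by (simp add: openin_open_subtopology openin_Un)
  ultimately have "?X closure_of ?U \<subseteq> ?X interior_of V"
    by (simp add: closure_of_closedin interior_of_openin) blast
  from homology_excision_axiom[OF this, of "V \<union> W" "int p"]
  show "hom_induced (int p) (subtopology X W) (V \<inter> W) (subtopology X (V \<union> W)) V id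
    \<in> iso (relative_homology_group (int p) (subtopology X W) (V \<inter> W)) (relative_homology_group (int p) (subtopology X (V \<union> W)) V)"
  proof -
    have "(V \<union> W) \<inter> (V \<union> W - ?U) = W" "V - ?U = V \<inter> W" by auto
    then show ?thesis
      using homology_excision_axiom[OF \<open>?X closure_of ?U \<subseteq> ?X interior_of V\<close>, of "V \<union> W" "int p"]
      by (simp add: subtopology_subtopology)
  qed
qed auto

lemma continuous_map_subtopologies:
  assumes "continuous_map X Y f" "f \<in> A \<rightarrow> B"
  shows "continuous_map (subtopology X A) (subtopology Y B) f"
  using assms by (auto simp: continuous_map_in_subtopology continuous_map_from_subtopology)

text \<open>
  The five lemma for the exact sequences of the pairs, carried out as a chase of chains: the
  relative term from the two absolute ones.
\<close>

lemma five_lemma_relative: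
  assumes iA: "homology_iso (subtopology X A) {} (subtopology Y B) {} f" and iX: "homology_iso X {} Y {} f"
    and AB: "f \<in> A \<rightarrow> B"
  shows "homology_iso X A Y B f"
  unfolding homology_iso_def
proof (intro conjI allI impI AB)
  note A = homology_isoD[OF iA] and X = homology_isoD[OF iX]
  show f: "continuous_map X Y f" by (rule X(1))
  have fA: "continuous_map (subtopology X A) (subtopology Y B) f" by (rule A(1))
  note bcm = chain_boundary_chain_map[symmetric]
  have subA: "singular_chain p X c" if "singular_chain p (subtopology X A) c" for p c
    using that by (simp add: singular_chain_subtopology)
  have subB: "singular_chain p Y c" if "singular_chain p (subtopology Y B) c" for p c
    using that by (simp add: singular_chain_subtopology)
  fix p
  show "singular_relboundary p X A c" if c: "singular_relcycle p X A c" "singular_relboundary p Y B (chain_map p f c)" for c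
  proof -
    have cX: "singular_chain p X c" using c(1) by (simp add: singular_relcycle)
    obtain d b where db: "singular_chain (Suc p) Y d" "singular_chain p (subtopology Y B) b"
      "chain_boundary (Suc p) d + b = chain_map p f c"
      using c(2) by (auto simp: singular_relboundary)
    have "\<exists>a. singular_chain p (subtopology X A) a \<and> chain_boundary p a = chain_boundary p c"
    proof (cases p)
      case 0
      then show ?thesis by (intro exI[of _ 0]) (simp add: chain_boundary_def)
    next
      case (Suc q)
      have cyc: "singular_relcycle q (subtopology X A) {} (chain_boundary p c)"
        using c(1) chain_boundary_boundary_alt[of q X c] Suc by (simp add: singular_cycle singular_relcycle)
      have "chain_map q f (chain_boundary p c) = chain_boundary p (chain_boundary (Suc p) d + b)"
        using chain_boundary_chain_map[OF cX, of f] db(3) Suc by simp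
      also have "\<dots> = chain_boundary p b"
        using chain_boundary_boundary_alt[OF db(1)] by (simp add: chain_boundary_add)
      finally have "singular_relboundary q (subtopology Y B) {} (chain_map q f (chain_boundary p c))"
        using db(2) Suc by (auto simp: singular_boundary)
      then show ?thesis using A(3)[OF cyc] Suc by (auto simp: singular_boundary)
    qed
    then obtain a where a: "singular_chain p (subtopology X A) a" "chain_boundary p a = chain_boundary p c" by blast
    have fa: "singular_chain p (subtopology Y B) (chain_map p f a)" using singular_chain_chain_map[OF a(1) fA] .
    have "chain_boundary p (b - chain_map p f a) = chain_boundary p (chain_map p f (c - a) - chain_boundary (Suc p) d)"
      by (simp add: chain_map_diff flip: db(3))
    also have "\<dots> = 0"
      using chain_boundary_boundary_alt[OF db(1)] chain_boundary_chain_map[of p X "c - a" f] cX subA[OF a(1)] a(2)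
      by (simp add: chain_boundary_diff singular_chain_diff)
    finally have "singular_relcycle p (subtopology Y B) {} (b - chain_map p f a)"
      using db(2) fa by (simp add: singular_cycle singular_chain_diff)
    then obtain a' where a': "singular_relcycle p (subtopology X A) {} a'"
      "singular_relboundary p (subtopology Y B) {} (b - chain_map p f a - chain_map p f a')"
      using A(4) by blast
    then obtain b' where b': "singular_chain (Suc p) (subtopology Y B) b'" "chain_boundary (Suc p) b' = b - chain_map p f a - chain_map p f a'"
      by (auto simp: singular_boundary)
    have "singular_relcycle p X {} (c - a - a')"
      using cX a a' subA by (auto simp: singular_cycle chain_boundary_diff intro!: singular_chain_diff)
    moreover have "chain_map p f (c - a - a') = chain_boundary (Suc p) (d + b')"
      by (simp add: chain_map_diff chain_boundary_add b'(2) flip: db(3))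
    then have "singular_relboundary p Y {} (chain_map p f (c - a - a'))"
      using db(1) subB[OF b'(1)] unfolding singular_boundary by (metis singular_chain_add)
    ultimately have "singular_relboundary p X {} (c - a - a')" using X(3) by blast
    then obtain x where x: "singular_chain (Suc p) X x" "chain_boundary (Suc p) x = c - a - a'" by (auto simp: singular_boundary)
    have "singular_chain p (subtopology X A) (a + a')" using a a' by (simp add: singular_cycle singular_chain_add)
    then show ?thesis unfolding singular_relboundary using x by (rule_tac exI[of _ x], rule_tac exI[of _ "a + a'"]) simp
  qed
  show "\<exists>c. singular_relcycle p X A c \<and> singular_relboundary p Y B (z - chain_map p f c)" if z: "singular_relcycle p Y B z" for z
  proof -
    have zY: "singular_chain p Y z" using z by (simp add: singular_relcycle)
    have "\<exists>x b. singular_chain p X x \<and> singular_chain (p - 1) (subtopology X A) (chain_boundary p x)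
      \<and> singular_chain p (subtopology Y B) b \<and> chain_boundary p z = chain_boundary p (chain_map p f x) + chain_boundary p b"
    proof (cases p)
      case 0
      then show ?thesis by (intro exI[of _ 0]) (simp add: chain_boundary_def)
    next
      case (Suc q)
      have "singular_relcycle q (subtopology Y B) {} (chain_boundary p z)"
        using z chain_boundary_boundary_alt[of q Y z] Suc by (simp add: singular_cycle singular_relcycle)
      then obtain a where a: "singular_relcycle q (subtopology X A) {} a" "singular_relboundary q (subtopology Y B) {} (chain_boundary p z - chain_map q f a)"
        using A(4) by blast
      then obtain b where b: "singular_chain p (subtopology Y B) b" "chain_boundary p b = chain_boundary p z - chain_map q f a"
        using Suc by (auto simp: singular_boundary)
      have "singular_relcycle q X {} a" using a(1) subA by (simp add: singular_cycle)
      moreover have "chain_map q f a = chain_boundary p (z - b)" using b(2) by (simp add: chain_boundary_diff)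
      then have "singular_relboundary q Y {} (chain_map q f a)"
        using zY subB[OF b(1)] Suc unfolding singular_boundary by (metis singular_chain_diff)
      ultimately have "singular_relboundary q X {} a" using X(3) by blast
      then obtain x where x: "singular_chain p X x" "chain_boundary p x = a" using Suc by (auto simp: singular_boundary)
      have "chain_boundary p (chain_map p f x) = chain_map q f a"
        using chain_boundary_chain_map[OF x(1), of f] x(2) Suc by simp
      then show ?thesis using x a(1) b Suc by (intro exI[of _ x] exI[of _ b]) (simp add: singular_cycle)
    qed
    then obtain x b where x: "singular_chain p X x" "singular_chain (p - 1) (subtopology X A) (chain_boundary p x)"
      and b: "singular_chain p (subtopology Y B) b" "chain_boundary p z = chain_boundary p (chain_map p f x) + chain_boundary p b" by blast
    have "singular_relcycle p Y {} (z - b - chain_map p f x)"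
      using zY subB[OF b(1)] singular_chain_chain_map[OF x(1) f] b(2)
      by (simp add: singular_cycle chain_boundary_diff singular_chain_diff)
    then obtain y where y: "singular_relcycle p X {} y" "singular_relboundary p Y {} (z - b - chain_map p f x - chain_map p f y)"
      using X(4) by blast
    then obtain w where w: "singular_chain (Suc p) Y w" "chain_boundary (Suc p) w = z - b - chain_map p f x - chain_map p f y"
      by (auto simp: singular_boundary)
    have "singular_relcycle p X A (x + y)"
    proof -
      have "singular_chain p X y" "chain_boundary p y = 0" using y(1) by (simp_all add: singular_cycle)
      then show ?thesis using x by (simp add: singular_relcycle chain_boundary_add singular_chain_add)
    qed
    moreover have "singular_relboundary p Y B (z - chain_map p f (x + y))"
      unfolding singular_relboundary using w b(1)
      by (rule_tac exI[of _ w], rule_tac exI[of _ b]) (simp add: chain_map_add)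
    ultimately show ?thesis by blast
  qed
qed

text \<open>
  The five lemma again, now for the homology of the whole space, from the subspace and the
  relative term.
\<close>

lemma five_lemma_absolute:
  assumes iA: "homology_iso (subtopology X A) {} (subtopology Y B) {} f" and iR: "homology_iso X A Y B f"
  shows "homology_iso X {} Y {} f"
  unfolding homology_iso_def
proof (intro conjI allI impI)
  note A = homology_isoD[OF iA] and R = homology_isoD[OF iR]
  show f: "continuous_map X Y f" by (rule R(1))
  have fA: "continuous_map (subtopology X A) (subtopology Y B) f" by (rule A(1))
  have subA: "singular_chain p X c" if "singular_chain p (subtopology X A) c" for p c
    using that by (simp add: singular_chain_subtopology)
  have subB: "singular_chain p Y c" if "singular_chain p (subtopology Y B) c" for p c
    using that by (simp add: singular_chain_subtopology)
  fix p
  show "singular_relboundary p X {} c" if c: "singular_relcycle p X {} c" "singular_relboundary p Y {} (chain_map p f c)" for c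
  proof -
    have cX: "singular_chain p X c" "chain_boundary p c = 0" using c(1) by (simp_all add: singular_cycle)
    obtain d where d: "singular_chain (Suc p) Y d" "chain_boundary (Suc p) d = chain_map p f c"
      using c(2) by (auto simp: singular_boundary)
    have "singular_relcycle p X A c" using cX by (simp add: singular_relcycle)
    moreover have "singular_relboundary p Y B (chain_map p f c)"
      unfolding singular_relboundary using d by (rule_tac exI[of _ d], rule_tac exI[of _ 0]) simp
    ultimately have "singular_relboundary p X A c" using R(3) by blast
    then obtain x a where x: "singular_chain (Suc p) X x" and a: "singular_chain p (subtopology X A) a" and xa: "chain_boundary (Suc p) x + a = c"
      by (auto simp: singular_relboundary)
    have fx: "chain_boundary (Suc p) (chain_map (Suc p) f x) = chain_map p f (chain_boundary (Suc p) x)"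
      using chain_boundary_chain_map[OF x, of f] by simp
    have a0: "chain_boundary p a = 0"
      using cX(2) xa chain_boundary_boundary_alt[OF x] by (metis add_0 chain_boundary_add)
    have fa: "chain_map p f a = chain_boundary (Suc p) (d - chain_map (Suc p) f x)"
      using d(2) fx xa[symmetric] by (simp add: chain_boundary_diff chain_map_add)
    have "singular_relcycle (Suc p) Y B (d - chain_map (Suc p) f x)"
      using d(1) singular_chain_chain_map[OF x f] singular_chain_chain_map[OF a fA] fa
      by (simp add: singular_relcycle singular_chain_diff)
    then obtain u where u: "singular_relcycle (Suc p) X A u" "singular_relboundary (Suc p) Y B (d - chain_map (Suc p) f x - chain_map (Suc p) f u)"
      using R(4) by blast
    then obtain w b where w: "singular_chain (Suc (Suc p)) Y w" and b: "singular_chain (Suc p) (subtopology Y B) b"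
      and wb: "chain_boundary (Suc (Suc p)) w + b = d - chain_map (Suc p) f x - chain_map (Suc p) f u"
      by (auto simp: singular_relboundary)
    have uX: "singular_chain (Suc p) X u" "singular_chain p (subtopology X A) (chain_boundary (Suc p) u)"
      using u(1) by (simp_all add: singular_relcycle)
    have fu: "chain_boundary (Suc p) (chain_map (Suc p) f u) = chain_map p f (chain_boundary (Suc p) u)"
      using chain_boundary_chain_map[OF uX(1), of f] by simp
    have "chain_boundary (Suc p) b = chain_boundary (Suc p) (d - chain_map (Suc p) f x - chain_map (Suc p) f u)"
      using chain_boundary_boundary_alt[OF w] by (simp flip: wb add: chain_boundary_add)
    then have "chain_map p f (a - chain_boundary (Suc p) u) = chain_boundary (Suc p) b"
      using fa fu by (simp add: chain_map_diff chain_boundary_diff)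
    then have "singular_relboundary p (subtopology Y B) {} (chain_map p f (a - chain_boundary (Suc p) u))"
      using b by (auto simp: singular_boundary)
    moreover have "singular_relcycle p (subtopology X A) {} (a - chain_boundary (Suc p) u)"
      using a a0 uX chain_boundary_boundary_alt[OF uX(1)] by (simp add: singular_cycle singular_chain_diff chain_boundary_diff)
    ultimately have "singular_relboundary p (subtopology X A) {} (a - chain_boundary (Suc p) u)" using A(3) by blast
    then obtain a' where a': "singular_chain (Suc p) (subtopology X A) a'" "chain_boundary (Suc p) a' = a - chain_boundary (Suc p) u"
      by (auto simp: singular_boundary)
    have "chain_boundary (Suc p) (x + u + a') = c" using a'(2) xa by (simp add: chain_boundary_add)
    then show ?thesis unfolding singular_boundary using x uX subA[OF a'(1)] by (metis singular_chain_add)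
  qed
  show "\<exists>c. singular_relcycle p X {} c \<and> singular_relboundary p Y {} (z - chain_map p f c)" if z: "singular_relcycle p Y {} z" for z
  proof -
    have zY: "singular_chain p Y z" "chain_boundary p z = 0" using z by (simp_all add: singular_cycle)
    have "singular_relcycle p Y B z" using zY by (simp add: singular_relcycle)
    then obtain c where c: "singular_relcycle p X A c" "singular_relboundary p Y B (z - chain_map p f c)" using R(4) by blast
    then obtain w b where w: "singular_chain (Suc p) Y w" and b: "singular_chain p (subtopology Y B) b"
      and wb: "chain_boundary (Suc p) w + b = z - chain_map p f c"
      by (auto simp: singular_relboundary)
    have cX: "singular_chain p X c" using c(1) by (simp add: singular_relcycle)
    have "\<exists>a. singular_chain p (subtopology X A) a \<and> chain_boundary p a = chain_boundary p c"
    proof (cases p)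
      case 0
      then show ?thesis by (intro exI[of _ 0]) (simp add: chain_boundary_def)
    next
      case (Suc q)
      have cyc: "singular_relcycle q (subtopology X A) {} (chain_boundary p c)"
        using c(1) chain_boundary_boundary_alt[of q X c] Suc by (simp add: singular_cycle singular_relcycle)
      have "chain_map q f (chain_boundary p c) = chain_boundary p (z - chain_boundary (Suc p) w - b)"
      proof -
        have "chain_map p f c = z - (z - chain_map p f c)" by simp
        then have "chain_map p f c = z - chain_boundary (Suc p) w - b" unfolding wb[symmetric] by (simp add: diff_diff_eq)
        then show ?thesis using chain_boundary_chain_map[OF cX, of f] Suc by simp
      qed
      also have "\<dots> = chain_boundary p (- b)"
        using chain_boundary_boundary_alt[OF w] zY by (simp add: chain_boundary_diff chain_boundary_minus)
      finally have "singular_relboundary q (subtopology Y B) {} (chain_map q f (chain_boundary p c))"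
        using b Suc unfolding singular_boundary by (metis singular_chain_minus)
      then show ?thesis using A(3)[OF cyc] Suc by (auto simp: singular_boundary)
    qed
    then obtain a where a: "singular_chain p (subtopology X A) a" "chain_boundary p a = chain_boundary p c" by blast
    have fa: "singular_chain p (subtopology Y B) (chain_map p f a)" using singular_chain_chain_map[OF a(1) fA] .
    have fac: "chain_boundary p (chain_map p f a) = chain_boundary p (chain_map p f c)"
      using chain_boundary_chain_map[OF cX, of f] chain_boundary_chain_map[OF subA[OF a(1)], of f] a(2) by simp
    have "chain_boundary p (b + chain_map p f a) = chain_boundary p (z - chain_map p f c - chain_boundary (Suc p) w + chain_map p f a)"
      by (simp flip: wb)
    also have "\<dots> = 0"
      using chain_boundary_boundary_alt[OF w] zY fac by (simp add: chain_boundary_diff chain_boundary_add)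
    finally have "singular_relcycle p (subtopology Y B) {} (b + chain_map p f a)"
      using b fa by (simp add: singular_cycle singular_chain_add)
    then obtain a' where a': "singular_relcycle p (subtopology X A) {} a'"
      "singular_relboundary p (subtopology Y B) {} (b + chain_map p f a - chain_map p f a')"
      using A(4) by blast
    then obtain b' where b': "singular_chain (Suc p) (subtopology Y B) b'" "chain_boundary (Suc p) b' = b + chain_map p f a - chain_map p f a'"
      by (auto simp: singular_boundary)
    have "singular_relcycle p X {} (c - a + a')"
      using cX a a' subA by (auto simp: singular_cycle chain_boundary_diff chain_boundary_add intro!: singular_chain_diff singular_chain_add)
    moreover have "chain_boundary (Suc p) (w + b') = z - chain_map p f (c - a + a')"
    proof -
      have "chain_boundary (Suc p) w = z - chain_map p f c - b" using wb by (simp add: eq_diff_eq)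
      then show ?thesis by (simp add: chain_map_diff chain_map_add chain_boundary_add b'(2))
    qed
    then have "singular_relboundary p Y {} (z - chain_map p f (c - a + a'))"
      using w subB[OF b'(1)] unfolding singular_boundary by (metis singular_chain_add)
    ultimately show ?thesis by blast
  qed
qed auto


section \<open>Patching local homology isomorphisms\<close>

definition iso_over :: "'x topology \<Rightarrow> 'y topology \<Rightarrow> ('x \<Rightarrow> 'y) \<Rightarrow> 'y set \<Rightarrow> bool" where
  "iso_over E B q V \<longleftrightarrow> homology_iso (subtopology E {x \<in> topspace E. q x \<in> V}) {} (subtopology B V) {} q"

text \<open>
  Mayer-Vietoris, without its exact sequence: from \<open>V \<inter> W\<close> and \<open>W\<close> the five lemma gives the pair
  \<open>(W, V \<inter> W)\<close>, which excision identifies with \<open>(V \<union> W, V)\<close> both in \<open>E\<close> and in \<open>B\<close>; from this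
  pair and \<open>V\<close> the five lemma gives \<open>V \<union> W\<close>.
\<close>

lemma iso_over_Un:
  assumes q: "continuous_map E B q" and V: "openin B V" "openin B W"
    and iso: "iso_over E B q V" "iso_over E B q W" "iso_over E B q (V \<inter> W)"
  shows "iso_over E B q (V \<union> W)"
proof -
  let ?p = "\<lambda>V. {x \<in> topspace E. q x \<in> V}"
  have oV: "openin E (?p V)" and oW: "openin E (?p W)"
    using q V by (auto simp: continuous_map_def)
  have pI: "?p (V \<inter> W) = ?p V \<inter> ?p W" and pU: "?p (V \<union> W) = ?p V \<union> ?p W" by auto
  have subs: "subtopology (subtopology X W) (V \<inter> W) = subtopology X (V \<inter> W)"
    "subtopology (subtopology X (V \<union> W)) V = subtopology X V" for X and V W
    by (auto simp: subtopology_subtopology intro: arg_cong[where f = "subtopology X"])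
  have "homology_iso (subtopology E (?p W)) (?p V \<inter> ?p W) (subtopology B W) (V \<inter> W) q"
  proof (rule five_lemma_relative)
    show "homology_iso (subtopology (subtopology E (?p W)) (?p V \<inter> ?p W)) {} (subtopology (subtopology B W) (V \<inter> W)) {} q"
      unfolding subs using iso(3) unfolding iso_over_def pI .
    show "homology_iso (subtopology E (?p W)) {} (subtopology B W) {} q"
      using iso(2) unfolding iso_over_def .
  qed auto
  from homology_iso_compose[OF this homology_iso_excision[OF V]]
  have "homology_iso (subtopology E (?p W)) (?p V \<inter> ?p W) (subtopology B (V \<union> W)) V (q \<circ> id)" by simp
  then have "homology_iso (subtopology E (?p V \<union> ?p W)) (?p V) (subtopology B (V \<union> W)) V q"
    by (rule homology_iso_cancel_right[OF _ homology_iso_excision[OF oV oW]])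
       (auto intro!: continuous_map_subtopologies[OF q])
  then have "homology_iso (subtopology E (?p V \<union> ?p W)) {} (subtopology B (V \<union> W)) {} q"
    by (rule five_lemma_absolute[rotated]) (use iso in \<open>simp add: iso_over_def subs\<close>)
  then show ?thesis unfolding iso_over_def pU .
qed

lemma iso_over_empty: "iso_over E B q {}"
proof -
  have "singular_chain p (subtopology E {}) c \<longleftrightarrow> c = 0" "singular_chain p (subtopology B {}) d \<longleftrightarrow> d = 0" for p c d
    by (auto simp: singular_chain_empty)
  then show ?thesis
    unfolding iso_over_def homology_iso_def
    by (auto simp: singular_cycle singular_boundary intro: exI[of _ 0])
qed

text \<open>
  The hypothesis covers all open subsets of members of the cover, not only the members, because
  the induction step meets intersections of them.
\<close>

lemma iso_over_finite_cover:
  assumes "finite \<U>" and q: "continuous_map E B q"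
    and good: "\<And>U V. U \<in> \<U> \<Longrightarrow> openin B V \<Longrightarrow> V \<subseteq> U \<Longrightarrow> iso_over E B q V"
    and op: "\<And>U. U \<in> \<U> \<Longrightarrow> openin B U"
    and V: "openin B V" "V \<subseteq> \<Union>\<U>"
  shows "iso_over E B q V"
  using assms
proof (induction \<U> arbitrary: V rule: finite_induct)
  case empty
  then show ?case using iso_over_empty by simp
next
  case (insert U \<U>)
  have oU: "openin B U" and oUs: "openin B (\<Union>\<U>)" using insert.prems by auto
  have "iso_over E B q ((V \<inter> U) \<union> (V \<inter> \<Union>\<U>))"
  proof (rule iso_over_Un[OF q])
    show "openin B (V \<inter> U)" "openin B (V \<inter> \<Union>\<U>)" using insert.prems oU oUs by auto
    show "iso_over E B q (V \<inter> U)" using insert.prems(2)[of U "V \<inter> U"] insert.prems oU by auto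
    show "iso_over E B q (V \<inter> \<Union>\<U>)" by (rule insert.IH) (use insert.prems oUs in auto)
    have "openin B ((V \<inter> U) \<inter> (V \<inter> \<Union>\<U>))" by (intro openin_Int insert.prems(4) oU oUs)
    then show "iso_over E B q ((V \<inter> U) \<inter> (V \<inter> \<Union>\<U>))" by (rule insert.prems(2)[of U, rotated]) auto
  qed
  moreover have "(V \<inter> U) \<union> (V \<inter> \<Union>\<U>) = V" using insert.prems by auto
  ultimately show ?case by simp
qed

section \<open>Orbit spaces of free actions\<close>

text \<open>
  Unlike \<^locale>\<open>group_action\<close>, this does not require extensional functions, so that a product of two
  actions is again an action as it stands.
\<close>

definition topological_action :: "('a, 'm) monoid_scheme \<Rightarrow> 'x topology \<Rightarrow> ('a \<Rightarrow> 'x \<Rightarrow> 'x) \<Rightarrow> bool" where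
  "topological_action K X \<phi> \<longleftrightarrow> group K \<and> (\<forall>g\<in>carrier K. continuous_map X X (\<phi> g)) \<and>
     (\<forall>x\<in>topspace X. \<phi> \<one>\<^bsub>K\<^esub> x = x) \<and>
     (\<forall>g\<in>carrier K. \<forall>h\<in>carrier K. \<forall>x\<in>topspace X. \<phi> (g \<otimes>\<^bsub>K\<^esub> h) x = \<phi> g (\<phi> h x))"

lemma topological_actionD:
  assumes "topological_action K X \<phi>"
  shows "group K" "\<And>g. g \<in> carrier K \<Longrightarrow> continuous_map X X (\<phi> g)"
    "\<And>x. x \<in> topspace X \<Longrightarrow> \<phi> \<one>\<^bsub>K\<^esub> x = x"
    "\<And>g h x. g \<in> carrier K \<Longrightarrow> h \<in> carrier K \<Longrightarrow> x \<in> topspace X \<Longrightarrow> \<phi> (g \<otimes>\<^bsub>K\<^esub> h) x = \<phi> g (\<phi> h x)"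
    "\<And>g x. g \<in> carrier K \<Longrightarrow> x \<in> topspace X \<Longrightarrow> \<phi> g x \<in> topspace X"
    "\<And>g x. g \<in> carrier K \<Longrightarrow> x \<in> topspace X \<Longrightarrow> \<phi> (inv\<^bsub>K\<^esub> g) (\<phi> g x) = x"
    "\<And>g x. g \<in> carrier K \<Longrightarrow> x \<in> topspace X \<Longrightarrow> \<phi> g (\<phi> (inv\<^bsub>K\<^esub> g) x) = x"
proof -
  show *: "group K" "\<And>g. g \<in> carrier K \<Longrightarrow> continuous_map X X (\<phi> g)"
    "\<And>x. x \<in> topspace X \<Longrightarrow> \<phi> \<one>\<^bsub>K\<^esub> x = x"
    "\<And>g h x. g \<in> carrier K \<Longrightarrow> h \<in> carrier K \<Longrightarrow> x \<in> topspace X \<Longrightarrow> \<phi> (g \<otimes>\<^bsub>K\<^esub> h) x = \<phi> g (\<phi> h x)"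
    using assms unfolding topological_action_def by blast+
  show "\<And>g x. g \<in> carrier K \<Longrightarrow> x \<in> topspace X \<Longrightarrow> \<phi> g x \<in> topspace X"
    using *(2) continuous_map_image_subset_topspace by blast
  interpret group K by fact
  show "\<And>g x. g \<in> carrier K \<Longrightarrow> x \<in> topspace X \<Longrightarrow> \<phi> (inv\<^bsub>K\<^esub> g) (\<phi> g x) = x"
    "\<And>g x. g \<in> carrier K \<Longrightarrow> x \<in> topspace X \<Longrightarrow> \<phi> g (\<phi> (inv\<^bsub>K\<^esub> g) x) = x"
    using *(3) *(4)[symmetric] by simp_all
qed

lemma orbit_eq_iff:
  assumes "topological_action K X \<phi>" "x \<in> topspace X" "y \<in> topspace X"
  shows "orbit K \<phi> x = orbit K \<phi> y \<longleftrightarrow> (\<exists>g\<in>carrier K. x = \<phi> g y)"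
proof -
  note D = topological_actionD[OF assms(1)]
  interpret group K by (rule D(1))
  show ?thesis
  proof
    assume eq: "orbit K \<phi> x = orbit K \<phi> y"
    have "\<phi> \<one>\<^bsub>K\<^esub> x \<in> orbit K \<phi> x" by (auto simp: orbit_def)
    then show "\<exists>g\<in>carrier K. x = \<phi> g y" using eq D(3)[OF assms(2)] by (auto simp: orbit_def)
  next
    assume "\<exists>g\<in>carrier K. x = \<phi> g y"
    then obtain g where g: "g \<in> carrier K" "x = \<phi> g y" by blast
    have "\<phi> h x \<in> orbit K \<phi> y" if "h \<in> carrier K" for h
      using g that D(4)[OF that g(1) assms(3)] by (auto simp: orbit_def intro!: exI[of _ "h \<otimes>\<^bsub>K\<^esub> g"])
    moreover have "\<phi> h y \<in> orbit K \<phi> x" if "h \<in> carrier K" for h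
      unfolding orbit_def
    proof (intro CollectI exI conjI)
      have "h \<otimes>\<^bsub>K\<^esub> inv\<^bsub>K\<^esub> g \<otimes>\<^bsub>K\<^esub> g = h" using g that by (simp add: m_assoc)
      then show "\<phi> h y = \<phi> (h \<otimes>\<^bsub>K\<^esub> inv\<^bsub>K\<^esub> g) x" using g that D(4)[of "h \<otimes>\<^bsub>K\<^esub> inv\<^bsub>K\<^esub> g" g y] assms(3) by simp
    qed (use g that in simp)
    ultimately show "orbit K \<phi> x = orbit K \<phi> y" unfolding orbit_def by blast
  qed
qed

lemma continuous_map_orbit: "continuous_map X (orbit_space K X \<phi>) (orbit K \<phi>)"
  unfolding orbit_space_def using quotient_map_quotient_topology quotient_imp_continuous_map by blast

lemma topspace_orbit_space: "topspace (orbit_space K X \<phi>) = orbit K \<phi> ` topspace X"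
  by (simp add: orbit_space_def)

lemma open_map_orbit:
  assumes "topological_action K X \<phi>"
  shows "open_map X (orbit_space K X \<phi>) (orbit K \<phi>)"
  unfolding open_map_def
proof (intro allI impI)
  note D = topological_actionD[OF assms]
  fix U assume U: "openin X U"
  have sub: "U \<subseteq> topspace X" using U openin_subset by blast
  have "{x \<in> topspace X. orbit K \<phi> x \<in> orbit K \<phi> ` U} = (\<Union>g\<in>carrier K. {x \<in> topspace X. \<phi> g x \<in> U})"
  proof (intro equalityI subsetI)
    fix x assume "x \<in> {x \<in> topspace X. orbit K \<phi> x \<in> orbit K \<phi> ` U}"
    then obtain u where x: "x \<in> topspace X" "u \<in> U" "orbit K \<phi> u = orbit K \<phi> x" by auto
    then obtain g where "g \<in> carrier K" "u = \<phi> g x" using orbit_eq_iff[OF assms] sub by blast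
    then show "x \<in> (\<Union>g\<in>carrier K. {x \<in> topspace X. \<phi> g x \<in> U})" using x by blast
  next
    fix x assume "x \<in> (\<Union>g\<in>carrier K. {x \<in> topspace X. \<phi> g x \<in> U})"
    then obtain g where g: "g \<in> carrier K" "x \<in> topspace X" "\<phi> g x \<in> U" by blast
    then have "orbit K \<phi> (\<phi> g x) = orbit K \<phi> x" using orbit_eq_iff[OF assms, of "\<phi> g x" x] D(5) by blast
    then show "x \<in> {x \<in> topspace X. orbit K \<phi> x \<in> orbit K \<phi> ` U}" using g(2) imageI[OF g(3), of "orbit K \<phi>"] by simp
  qed
  moreover have "openin X {x \<in> topspace X. \<phi> g x \<in> U}" if "g \<in> carrier K" for g
    using D(2)[OF that] U by (simp add: continuous_map_def)
  ultimately show "openin (orbit_space K X \<phi>) (orbit K \<phi> ` U)"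
    unfolding orbit_space_def openin_quotient_topology using sub by auto
qed

definition slice :: "('a, 'm) monoid_scheme \<Rightarrow> 'x topology \<Rightarrow> ('a \<Rightarrow> 'x \<Rightarrow> 'x) \<Rightarrow> 'x set \<Rightarrow> bool" where
  "slice K X \<phi> U \<longleftrightarrow> openin X U \<and> (\<forall>g\<in>carrier K. g \<noteq> \<one>\<^bsub>K\<^esub> \<longrightarrow> \<phi> g ` U \<inter> U = {})"

lemma homeomorphic_map_orbit_restrict:
  assumes act: "topological_action K X \<phi>" and W: "openin X W" "orbit K \<phi> ` W = V" "inj_on (orbit K \<phi>) W"
  shows "homeomorphic_map (subtopology X W) (subtopology (orbit_space K X \<phi>) V) (orbit K \<phi>)"
proof (rule bijective_open_imp_homeomorphic_map)
  have sub: "W \<subseteq> topspace X" using W openin_subset by blast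
  show "continuous_map (subtopology X W) (subtopology (orbit_space K X \<phi>) V) (orbit K \<phi>)"
    by (rule continuous_map_subtopologies[OF continuous_map_orbit]) (use W in auto)
  show "open_map (subtopology X W) (subtopology (orbit_space K X \<phi>) V) (orbit K \<phi>)"
    by (rule open_map_into_subtopology[OF open_map_from_subtopology[OF open_map_orbit[OF act] W(1)]])
       (use W in auto)
  show "orbit K \<phi> ` topspace (subtopology X W) = topspace (subtopology (orbit_space K X \<phi>) V)"
    using sub W by (auto simp: topspace_orbit_space)
  show "inj_on (orbit K \<phi>) (topspace (subtopology X W))" using W sub by (simp add: Int_absorb1)
qed

text \<open>
  Over the image of a slice the orbit maps of \<open>P\<close> and of \<open>X\<close> restrict to homeomorphisms, so
  there the map of orbit spaces looks like the restriction of \<open>r\<close> to an open set. By compactness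
  finitely many such images cover, and the local isomorphisms can be patched.
\<close>

lemma homology_iso_orbit_spaces:
  assumes actP: "topological_action K P \<Phi>" and actX: "topological_action K X \<phi>"
    and r: "continuous_map P X r" and equi: "\<And>g z. g \<in> carrier K \<Longrightarrow> z \<in> topspace P \<Longrightarrow> r (\<Phi> g z) = \<phi> g (r z)"
    and local: "\<And>V. openin X V \<Longrightarrow> homology_iso (subtopology P {z \<in> topspace P. r z \<in> V}) {} (subtopology X V) {} r"
    and slices: "\<And>x. x \<in> topspace X \<Longrightarrow> \<exists>U. x \<in> U \<and> slice K X \<phi> U"
    and compact: "compact_space (orbit_space K X \<phi>)"
  shows "homology_iso (orbit_space K P \<Phi>) {} (orbit_space K X \<phi>) {} (image r)"
proof -
  let ?E = "orbit_space K P \<Phi>" and ?B = "orbit_space K X \<phi>" and ?\<pi> = "orbit K \<phi>" and ?\<rho> = "orbit K \<Phi>"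
  note DP = topological_actionD[OF actP] and DX = topological_actionD[OF actX]
  have q\<rho>: "r ` ?\<rho> z = ?\<pi> (r z)" if "z \<in> topspace P" for z
    using equi that unfolding orbit_def by (auto simp: image_def)
  have rP: "r z \<in> topspace X" if "z \<in> topspace P" for z
    using continuous_map_image_subset_topspace[OF r] that by blast
  have q: "continuous_map ?E ?B (image r)"
  proof (rule continuous_compose_quotient_map)
    show "quotient_map P ?E ?\<rho>" unfolding orbit_space_def by (rule quotient_map_quotient_topology)
    show "continuous_map P ?B (image r \<circ> ?\<rho>)"
      by (rule continuous_map_eq[OF continuous_map_compose[OF r continuous_map_orbit]]) (simp add: q\<rho>)
  qed
  have good: "iso_over ?E ?B (image r) V" if U: "slice K X \<phi> U" and V: "openin ?B V" "V \<subseteq> ?\<pi> ` U" for U V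
  proof -
    have oU: "openin X U" and disj: "\<And>g. g \<in> carrier K \<Longrightarrow> g \<noteq> \<one>\<^bsub>K\<^esub> \<Longrightarrow> \<phi> g ` U \<inter> U = {}"
      using U by (auto simp: slice_def)
    have subU: "U \<subseteq> topspace X" using oU openin_subset by blast
    define V' where "V' = U \<inter> {x \<in> topspace X. ?\<pi> x \<in> V}"
    have oV': "openin X V'"
      unfolding V'_def using oU continuous_map_orbit[of X K \<phi>] V(1) by (auto simp: continuous_map_def)
    have imV': "?\<pi> ` V' = V" using V(2) subU by (auto simp: V'_def)
    have one: "g = \<one>\<^bsub>K\<^esub>" if "g \<in> carrier K" "x \<in> U" "\<phi> g x \<in> U" for g x
      using disj[of g] that by blast
    have injV': "inj_on ?\<pi> V'"
    proof (rule inj_onI)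
      fix x y assume xy: "x \<in> V'" "y \<in> V'" "?\<pi> x = ?\<pi> y"
      then have "x \<in> topspace X" "y \<in> topspace X" using subU by (auto simp: V'_def)
      then obtain g where g: "g \<in> carrier K" "x = \<phi> g y" using orbit_eq_iff[OF actX] xy(3) by blast
      then have "g = \<one>\<^bsub>K\<^esub>" using xy one by (auto simp: V'_def)
      then show "x = y" using g DX(3) \<open>y \<in> topspace X\<close> by simp
    qed
    let ?W = "{z \<in> topspace P. r z \<in> V'}"
    let ?pV = "{z \<in> topspace ?E. r ` z \<in> V}"
    have oW: "openin P ?W" using r oV' by (simp add: continuous_map_def)
    have imW: "?\<rho> ` ?W = ?pV"
    proof (intro equalityI subsetI)
      fix z assume "z \<in> ?\<rho> ` ?W"
      then show "z \<in> ?pV" using imV' by (auto simp: topspace_orbit_space q\<rho>)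
    next
      fix z assume "z \<in> ?pV"
      then obtain w where w: "w \<in> topspace P" "z = ?\<rho> w" "?\<pi> (r w) \<in> V"
        by (auto simp: topspace_orbit_space q\<rho>)
      then obtain v where v: "v \<in> V'" "?\<pi> v = ?\<pi> (r w)" using imV' by (metis imageE)
      then have "v \<in> topspace X" using subU by (auto simp: V'_def)
      then obtain g where g: "g \<in> carrier K" "v = \<phi> g (r w)" using orbit_eq_iff[OF actX] rP[OF w(1)] v(2) by blast
      then have "\<Phi> g w \<in> ?W" using v equi w DP(5) by auto
      moreover have "?\<rho> (\<Phi> g w) = z" using orbit_eq_iff[OF actP DP(5)[OF g(1) w(1)] w(1)] g(1) w(2) by auto
      ultimately show "z \<in> ?\<rho> ` ?W" by blast
    qed
    have injW: "inj_on ?\<rho> ?W"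
    proof (rule inj_onI)
      fix x y assume xy: "x \<in> ?W" "y \<in> ?W" "?\<rho> x = ?\<rho> y"
      then obtain g where g: "g \<in> carrier K" "x = \<Phi> g y" using orbit_eq_iff[OF actP, of x y] by blast
      then have "g = \<one>\<^bsub>K\<^esub>" using xy one[of g "r y"] equi by (auto simp: V'_def)
      then show "x = y" using g DP(3) xy by simp
    qed
    have h1: "homology_iso (subtopology P ?W) {} (subtopology ?E ?pV) {} ?\<rho>"
      by (rule homology_iso_homeomorphic_map[OF homeomorphic_map_orbit_restrict[OF actP oW imW injW]])
    have h2: "homology_iso (subtopology X V') {} (subtopology ?B V) {} ?\<pi>"
      by (rule homology_iso_homeomorphic_map[OF homeomorphic_map_orbit_restrict[OF actX oV' imV' injV']])
    have "homology_iso (subtopology P ?W) {} (subtopology ?B V) {} (?\<pi> \<circ> r)"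
      using homology_iso_compose[OF local[OF oV'] h2] .
    then have "homology_iso (subtopology P ?W) {} (subtopology ?B V) {} (image r \<circ> ?\<rho>)"
      by (rule homology_iso_eq) (auto simp: q\<rho>)
    then have "homology_iso (subtopology ?E ?pV) {} (subtopology ?B V) {} (image r)"
      by (rule homology_iso_cancel_right[OF _ h1]) (auto intro!: continuous_map_subtopologies[OF q])
    then show ?thesis unfolding iso_over_def .
  qed
  obtain S where S: "\<And>x. x \<in> topspace X \<Longrightarrow> x \<in> S x \<and> slice K X \<phi> (S x)" using slices by metis
  define \<C> where "\<C> = (\<lambda>x. ?\<pi> ` S x) ` topspace X"
  have "\<forall>U\<in>\<C>. openin ?B U"
    using S open_map_orbit[OF actX] by (auto simp: \<C>_def slice_def open_map_def)
  moreover have "\<Union>\<C> = topspace ?B"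
    using S by (fastforce simp: \<C>_def topspace_orbit_space slice_def dest: openin_subset)
  ultimately obtain \<F> where \<F>: "finite \<F>" "\<F> \<subseteq> \<C>" "\<Union>\<F> = topspace ?B"
    using compact unfolding compact_space_alt by (metis Sup_subset_mono order_antisym order_refl)
  have "iso_over ?E ?B (image r) (topspace ?B)"
  proof (rule iso_over_finite_cover[OF \<F>(1) q])
    fix U V assume "U \<in> \<F>" "openin ?B V" "V \<subseteq> U"
    moreover obtain x where "x \<in> topspace X" "U = ?\<pi> ` S x" using \<open>U \<in> \<F>\<close> \<F>(2) unfolding \<C>_def by blast
    ultimately show "iso_over ?E ?B (image r) V" using good S by blast
  next
    fix U assume "U \<in> \<F>"
    then show "openin ?B U" using \<F>(2) \<open>\<forall>U\<in>\<C>. openin ?B U\<close> by blast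
  qed (use \<F> in auto)
  moreover have "{z \<in> topspace ?E. r ` z \<in> topspace ?B} = topspace ?E"
    using q by (auto simp: continuous_map_def)
  ultimately show ?thesis unfolding iso_over_def by simp
qed

lemma homology_iso_fst_contractible:
  assumes "contractible_space Y" "topspace Y \<noteq> {}"
  shows "homology_iso (prod_topology X Y) {} X {} fst"
proof (rule homology_iso_hom_induced)
  obtain a where a: "a \<in> topspace Y" "homotopic_with (\<lambda>x. True) Y Y id (\<lambda>x. a)"
    using assms by (auto simp: contractible_space null_topspace_iff_trivial)
  obtain h where h: "continuous_map (prod_topology (top_of_set {0..1::real}) Y) Y h" "\<And>y. h (0, y) = y" "\<And>y. h (1, y) = a"
    using a(2) unfolding homotopic_with_def by auto
  have "homotopic_with (\<lambda>h. True) (prod_topology X Y) (prod_topology X Y) id ((\<lambda>x. (x, a)) \<circ> fst)"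
    unfolding homotopic_with_def
  proof (intro exI conjI)
    let ?P = "prod_topology (top_of_set {0..1::real}) (prod_topology X Y)"
    have 1: "continuous_map ?P X (\<lambda>z. fst (snd z))"
      using continuous_map_compose[OF continuous_map_snd continuous_map_fst] by (simp add: o_def)
    have 2: "continuous_map ?P Y (\<lambda>z. snd (snd z))"
      using continuous_map_compose[OF continuous_map_snd continuous_map_snd] by (simp add: o_def)
    have "continuous_map ?P (prod_topology (top_of_set {0..1::real}) Y) (\<lambda>z. (fst z, snd (snd z)))"
      by (intro continuous_map_pairedI continuous_map_fst 2)
    from continuous_map_compose[OF this h(1)]
    show "continuous_map ?P (prod_topology X Y) (\<lambda>z. (fst (snd z), h (fst z, snd (snd z))))"
      by (intro continuous_map_pairedI 1) (simp add: o_def)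
  qed (use h in auto)
  moreover have "homotopic_with (\<lambda>k. True) X X (fst \<circ> (\<lambda>x. (x, a))) id" by (simp add: o_def id_def)
  moreover have "continuous_map X (prod_topology X Y) (\<lambda>x. (x, a))"
    using a by (intro continuous_map_pairedI) auto
  ultimately show "hom_induced (int p) (prod_topology X Y) {} X {} fst \<in> iso (homology_group (int p) (prod_topology X Y)) (homology_group (int p) X)" for p
    by (intro homotopy_equivalence_homology_group_isomorphism[where g = "\<lambda>x. (x, a)"])
       (auto intro: continuous_map_fst homotopic_with_symD)
qed (auto intro: continuous_map_fst)

lemma homology_iso_snd_contractible:
  assumes "contractible_space X" "topspace X \<noteq> {}"
  shows "homology_iso (prod_topology X Y) {} Y {} snd"
proof -
  have "homeomorphic_map (prod_topology X Y) (prod_topology Y X) (\<lambda>(x, y). (y, x))"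
    by (rule homeomorphic_map_swap)
  from homology_iso_compose[OF homology_iso_homeomorphic_map[OF this] homology_iso_fst_contractible[OF assms]]
  show ?thesis by (rule homology_iso_eq) auto
qed

text \<open>
  The orbit space of the product \<open>X \<times> Y\<close> under the diagonal action maps to those of \<open>X\<close> and \<open>Y\<close>.
  Over small open sets these maps are projections with contractible fibre, so both induce
  isomorphisms on homology. For free actions this takes the place of the uniqueness of
  classifying spaces up to equivariant homotopy equivalence.
\<close>

theorem has_euler_orbit_space_contractible:
  assumes actX: "topological_action K X \<phi>" and actY: "topological_action K Y \<psi>"
    and contr: "contractible_space X" "topspace X \<noteq> {}" "contractible_space Y" "topspace Y \<noteq> {}"
    and slices: "\<And>x. x \<in> topspace X \<Longrightarrow> \<exists>U. x \<in> U \<and> slice K X \<phi> U" "\<And>y. y \<in> topspace Y \<Longrightarrow> \<exists>U. y \<in> U \<and> slice K Y \<psi> U"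
    and compact: "compact_space (orbit_space K X \<phi>)" "compact_space (orbit_space K Y \<psi>)"
    and euler: "has_euler (orbit_space K X \<phi>) {} e"
  shows "has_euler (orbit_space K Y \<psi>) {} e"
proof -
  let ?P = "prod_topology X Y" and ?\<Phi> = "\<lambda>g (x, y). (\<phi> g x, \<psi> g y)"
  note DX = topological_actionD[OF actX] and DY = topological_actionD[OF actY]
  have actP: "topological_action K ?P ?\<Phi>"
    unfolding topological_action_def
  proof (intro conjI ballI)
    fix g assume g: "g \<in> carrier K"
    show "continuous_map ?P ?P (?\<Phi> g)"
      unfolding case_prod_beta
      using continuous_map_compose[OF continuous_map_fst DX(2)[OF g]] continuous_map_compose[OF continuous_map_snd DY(2)[OF g]]
      by (intro continuous_map_pairedI) (simp_all add: o_def)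
  qed (use DX DY in auto)
  have "homology_iso (orbit_space K ?P ?\<Phi>) {} (orbit_space K X \<phi>) {} (image fst)"
  proof (rule homology_iso_orbit_spaces[OF actP actX continuous_map_fst])
    fix V assume V: "openin X V"
    have "subtopology ?P {z \<in> topspace ?P. fst z \<in> V} = prod_topology (subtopology X V) Y"
      using openin_subset[OF V] by (subst prod_topology_subtopology) (rule arg_cong[where f = "subtopology _"], auto)
    then show "homology_iso (subtopology ?P {z \<in> topspace ?P. fst z \<in> V}) {} (subtopology X V) {} fst"
      using homology_iso_fst_contractible[OF contr(3,4)] by simp
  qed (use slices compact in auto)
  from has_euler_homology_iso[OF this] euler have "has_euler (orbit_space K ?P ?\<Phi>) {} e" by blast
  moreover have "homology_iso (orbit_space K ?P ?\<Phi>) {} (orbit_space K Y \<psi>) {} (image snd)"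
  proof (rule homology_iso_orbit_spaces[OF actP actY continuous_map_snd])
    fix V assume V: "openin Y V"
    have "subtopology ?P {z \<in> topspace ?P. snd z \<in> V} = prod_topology X (subtopology Y V)"
      using openin_subset[OF V] by (subst prod_topology_subtopology) (rule arg_cong[where f = "subtopology _"], auto)
    then show "homology_iso (subtopology ?P {z \<in> topspace ?P. snd z \<in> V}) {} (subtopology Y V) {} snd"
      using homology_iso_snd_contractible[OF contr(1,2)] by simp
  qed (use slices compact in auto)
  from has_euler_homology_iso[OF this] have "has_euler (orbit_space K ?P ?\<Phi>) {} e = has_euler (orbit_space K Y \<psi>) {} e" .
  ultimately show ?thesis by blast
qed

section \<open>Equivariant cell complexes\<close>

lemma CW_structureD:
  assumes "CW_structure X E"
  shows "Hausdorff_space X" "topspace X = (\<Union>n. \<Union>(E n))"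
    and "\<And>m n d e. d \<in> E m \<Longrightarrow> e \<in> E n \<Longrightarrow> d \<inter> e \<noteq> {} \<Longrightarrow> m = n \<and> d = e"
    and "\<And>n e. e \<in> E n \<Longrightarrow> \<exists>\<Phi>. continuous_map (unit_disc n) X \<Phi> \<and>
       inj_on \<Phi> (open_unit_disc n) \<and> \<Phi> ` open_unit_disc n = e \<and>
       (\<exists>F. finite F \<and> F \<subseteq> (\<Union>m<n. E m) \<and> \<Phi> ` unit_disc_boundary n \<subseteq> \<Union>F)"
    and "\<And>A. A \<subseteq> topspace X \<Longrightarrow> (\<And>n e. e \<in> E n \<Longrightarrow> closedin X (A \<inter> X closure_of e)) \<Longrightarrow> closedin X A"
proof -
  note cw = assms[unfolded CW_structure_def]
  show "Hausdorff_space X" by (rule conjunct1[OF cw])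
  show top: "topspace X = (\<Union>n. \<Union>(E n))" by (rule conjunct1[OF conjunct2[OF cw]])
  note disj = conjunct1[OF conjunct2[OF conjunct2[OF cw]]]
  note char = conjunct1[OF conjunct2[OF conjunct2[OF conjunct2[OF cw]]]]
  note weak = conjunct2[OF conjunct2[OF conjunct2[OF conjunct2[OF cw]]]]
  show "m = n \<and> d = e" if "d \<in> E m" "e \<in> E n" "d \<inter> e \<noteq> {}" for m n d e
  proof (rule ccontr)
    assume "\<not> (m = n \<and> d = e)"
    then have "(m, d) \<noteq> (n, e)" by simp
    from mp[OF bspec[OF bspec[OF spec[OF spec[OF disj, of m], of n] that(1)] that(2)] this]
    show False using that(3) by simp
  qed
  show "closedin X A" if "A \<subseteq> topspace X" "\<And>n e. e \<in> E n \<Longrightarrow> closedin X (A \<inter> X closure_of e)" for A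
    using weak that by simp
  fix n e assume e: "e \<in> E n"
  obtain \<Phi> F where \<Phi>: "continuous_map (unit_disc n) X \<Phi>"
    "homeomorphic_map (subtopology (unit_disc n) (open_unit_disc n)) (subtopology X e) \<Phi>"
    and F: "finite F \<and> F \<subseteq> (\<Union>m<n. E m) \<and> \<Phi> ` unit_disc_boundary n \<subseteq> \<Union>F"
    using bspec[OF spec[OF char, of n] e] by (elim exE conjE) (rule that, assumption+, intro conjI)
  have "topspace (subtopology (unit_disc n) (open_unit_disc n)) = open_unit_disc n"
    by (auto simp: topspace_unit_disc)
  moreover have "topspace (subtopology X e) = e" using top e by auto
  ultimately have "inj_on \<Phi> (open_unit_disc n)" "\<Phi> ` open_unit_disc n = e"
    using homeomorphic_imp_injective_map[OF \<Phi>(2)] homeomorphic_imp_surjective_map[OF \<Phi>(2)] by auto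
  then show "\<exists>\<Phi>. continuous_map (unit_disc n) X \<Phi> \<and> inj_on \<Phi> (open_unit_disc n) \<and> \<Phi> ` open_unit_disc n = e \<and>
       (\<exists>F. finite F \<and> F \<subseteq> (\<Union>m<n. E m) \<and> \<Phi> ` unit_disc_boundary n \<subseteq> \<Union>F)"
    using \<Phi>(1) F by blast
qed

lemma zero_in_open_unit_disc: "(\<lambda>i. 0) \<in> open_unit_disc n"
  by (simp add: open_unit_disc_def topspace_Euclidean_space)

lemma cell_nonempty: "CW_structure X E \<Longrightarrow> e \<in> E n \<Longrightarrow> e \<noteq> {}"
  using CW_structureD(4) zero_in_open_unit_disc by blast

text \<open>
  The closure is contained in the image of the closed disc, which is compact and meets only the
  cell and the finitely many cells that receive the boundary sphere.
\<close>

lemma cell_closure_finite: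
  assumes CW: "CW_structure X E" and e: "e \<in> E n"
  shows "compactin X (X closure_of e)" "\<exists>F. finite F \<and> F \<subseteq> (\<Union>m. E m) \<and> X closure_of e \<subseteq> \<Union>F"
proof -
  obtain \<Phi> F where \<Phi>: "continuous_map (unit_disc n) X \<Phi>" "\<Phi> ` open_unit_disc n = e"
    and F: "finite F" "F \<subseteq> (\<Union>m<n. E m)" "\<Phi> ` unit_disc_boundary n \<subseteq> \<Union>F"
    using CW_structureD(4)[OF CW e] by blast
  have c: "compactin X (\<Phi> ` topspace (unit_disc n))"
    using image_compactin[OF _ \<Phi>(1)] compact_space_unit_disc by (simp add: compact_space_def)
  have "e \<subseteq> \<Phi> ` topspace (unit_disc n)" using \<Phi>(2) by (auto simp: topspace_unit_disc)
  then have sub: "X closure_of e \<subseteq> \<Phi> ` topspace (unit_disc n)"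
    using compactin_imp_closedin[OF CW_structureD(1)[OF CW] c] by (rule closure_of_minimal)
  show "compactin X (X closure_of e)" using closed_compactin[OF c sub] by simp
  have "\<Phi> ` topspace (unit_disc n) \<subseteq> \<Union>(insert e F)"
    unfolding topspace_unit_disc image_Un \<Phi>(2) using F(3) by blast
  then have "X closure_of e \<subseteq> \<Union>(insert e F)" using sub by (rule order_trans[rotated])
  moreover have "insert e F \<subseteq> (\<Union>m. E m)" using F(2) e by blast
  ultimately have "finite (insert e F) \<and> insert e F \<subseteq> (\<Union>m. E m) \<and> X closure_of e \<subseteq> \<Union>(insert e F)"
    using F(1) by simp
  then show "\<exists>F. finite F \<and> F \<subseteq> (\<Union>m. E m) \<and> X closure_of e \<subseteq> \<Union>F" by blast
qed

lemma G_CW_topological_action: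
  assumes "G_CW_structure K X \<phi> E"
  shows "topological_action K X \<phi>"
proof -
  have act: "group_action K (topspace X) \<phi>" and c: "\<forall>g\<in>carrier K. continuous_map X X (\<phi> g)"
    using assms unfolding G_CW_structure_def by blast+
  interpret group_action K "topspace X" \<phi> by fact
  have "group K" using group_hom by (simp add: group_hom_def)
  then show ?thesis unfolding topological_action_def
    using c composition_rule id_eq_one by (metis restrict_apply')
qed

text \<open>
  The dimension is part of the index, so that signs in alternating sums can be read off.
\<close>

definition cell_orbits :: "('a, 'm) monoid_scheme \<Rightarrow> ('a \<Rightarrow> 'x \<Rightarrow> 'x) \<Rightarrow> (nat \<Rightarrow> 'x set set) \<Rightarrow> (nat \<times> 'x set set) set" where
  "cell_orbits K \<phi> E = (SIGMA n:UNIV. orbits K (E n) (\<lambda>g e. \<phi> g ` e))"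

lemma finite_openin_Inter:
  assumes "finite B" "openin X U" "\<And>g. g \<in> B \<Longrightarrow> openin X (f g)"
  shows "openin X (U \<inter> (\<Inter>g\<in>B. f g))"
  using assms
proof (induction B rule: finite_induct)
  case (insert b B)
  have "U \<inter> (\<Inter>g\<in>insert b B. f g) = (U \<inter> (\<Inter>g\<in>B. f g)) \<inter> f b" by auto
  then show ?case using insert by auto
qed simp

locale G_CW_complex =
  fixes K (structure) and X :: "'x topology" and \<phi> :: "'a \<Rightarrow> 'x \<Rightarrow> 'x" and E
  assumes GCW: "G_CW_structure K X \<phi> E"
begin

lemma CW: "CW_structure X E"
  and cell_image: "\<And>g n e. g \<in> carrier K \<Longrightarrow> e \<in> E n \<Longrightarrow> \<phi> g ` e \<in> E n"
  and cell_fix: "\<And>g n e x. g \<in> carrier K \<Longrightarrow> e \<in> E n \<Longrightarrow> \<phi> g ` e = e \<Longrightarrow> x \<in> e \<Longrightarrow> \<phi> g x = x"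
  using GCW unfolding G_CW_structure_def by blast+

lemma action: "topological_action K X \<phi>" by (rule G_CW_topological_action[OF GCW])

lemmas actionD = topological_actionD[OF action]
lemmas cwD = CW_structureD[OF CW]

sublocale group K by (rule actionD(1))

lemma cell_subset: "e \<in> E n \<Longrightarrow> e \<subseteq> topspace X" using cwD(2) by blast

lemma cell_action:
  assumes "e \<in> E n"
  shows "\<phi> \<one> ` e = e" "g \<in> carrier K \<Longrightarrow> h \<in> carrier K \<Longrightarrow> \<phi> (g \<otimes> h) ` e = \<phi> g ` (\<phi> h ` e)"
proof -
  have sub: "e \<subseteq> topspace X" using cell_subset assms by blast
  show "\<phi> \<one> ` e = e" using sub actionD(3) by (simp add: subset_iff)
  show "g \<in> carrier K \<Longrightarrow> h \<in> carrier K \<Longrightarrow> \<phi> (g \<otimes> h) ` e = \<phi> g ` (\<phi> h ` e)"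
    unfolding image_image using sub actionD(4) by (intro image_cong refl) auto
qed

lemma translate_meets_cell:
  assumes "g \<in> carrier K" "d \<in> E m" "e \<in> E n" "x \<in> d" "\<phi> g x \<in> e"
  shows "m = n" "\<phi> g ` d = e"
  using cwD(3)[OF cell_image[OF assms(1,2)] assms(3)] assms(4,5) by blast+

lemma cell_orbit_mem: "e \<in> orbit K (\<lambda>g e. \<phi> g ` e) e" if "e \<in> E n"
  unfolding orbit_def using cell_action(1)[OF that] by force

lemma cell_orbit_eq:
  assumes "d \<in> E n" "g \<in> carrier K"
  shows "orbit K (\<lambda>g e. \<phi> g ` e) (\<phi> g ` d) = orbit K (\<lambda>g e. \<phi> g ` e) d"
proof (intro equalityI subsetI)
  fix e assume "e \<in> orbit K (\<lambda>g e. \<phi> g ` e) (\<phi> g ` d)"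
  then obtain h where "h \<in> carrier K" "e = \<phi> h ` \<phi> g ` d" unfolding orbit_def by blast
  then have "e = \<phi> (h \<otimes> g) ` d" "h \<otimes> g \<in> carrier K" using cell_action(2)[OF assms(1)] assms(2) by auto
  then show "e \<in> orbit K (\<lambda>g e. \<phi> g ` e) d" unfolding orbit_def by blast
next
  fix e assume "e \<in> orbit K (\<lambda>g e. \<phi> g ` e) d"
  then obtain h where h: "h \<in> carrier K" "e = \<phi> h ` d" unfolding orbit_def by blast
  have "h \<otimes> inv g \<otimes> g = h" using h assms by (simp add: m_assoc)
  then have "e = \<phi> (h \<otimes> inv g) ` \<phi> g ` d"
    using cell_action(2)[OF assms(1), of "h \<otimes> inv g" g] h assms by simp
  then show "e \<in> orbit K (\<lambda>g e. \<phi> g ` e) (\<phi> g ` d)" unfolding orbit_def using h assms by blast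
qed

lemma finite_cell_orbits:
  assumes "finite (\<Union>n. orbits K (E n) (\<lambda>g e. \<phi> g ` e))"
  shows "finite (cell_orbits K \<phi> E)"
proof (rule inj_on_finite[OF _ _ assms])
  show "inj_on snd (cell_orbits K \<phi> E)"
  proof (rule inj_onI)
    fix a b assume ab: "a \<in> cell_orbits K \<phi> E" "b \<in> cell_orbits K \<phi> E" "snd a = snd b"
    obtain m d where a: "a = (m, orbit K (\<lambda>g e. \<phi> g ` e) d)" "d \<in> E m"
      using ab(1) unfolding cell_orbits_def orbits_def by blast
    obtain n e where b: "b = (n, orbit K (\<lambda>g e. \<phi> g ` e) e)" "e \<in> E n"
      using ab(2) unfolding cell_orbits_def orbits_def by blast
    have "d \<in> orbit K (\<lambda>g e. \<phi> g ` e) e" using cell_orbit_mem[OF a(2)] ab(3) a(1) b(1) by simp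
    then obtain g where "g \<in> carrier K" "d = \<phi> g ` e" unfolding orbit_def by blast
    then have "d \<in> E n" using cell_image b by blast
    then have "m = n" using cwD(3)[OF a(2), of d n] cell_nonempty[OF CW a(2)] by blast
    then show "a = b" using a b ab(3) by simp
  qed
  show "snd ` cell_orbits K \<phi> E \<subseteq> (\<Union>n. orbits K (E n) (\<lambda>g e. \<phi> g ` e))"
    unfolding cell_orbits_def by auto
qed

end

section \<open>Free actions with finitely many orbits of cells\<close>

locale free_cocompact_G_CW_complex = G_CW_complex +
  assumes finite_orbits: "finite (\<Union>n. orbits K (E n) (\<lambda>g e. \<phi> g ` e))"
    and free: "\<And>g x. g \<in> carrier K \<Longrightarrow> x \<in> topspace X \<Longrightarrow> \<phi> g x = x \<Longrightarrow> g = \<one>"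
begin

text \<open>
  \<open>C\<close> is the union of the closures of representatives of the orbits of cells. It meets only
  finitely many cells, and for a free action at most one group element carries a given cell to a
  given other, so only finitely many translates of \<open>C\<close> meet \<open>C\<close>.
\<close>

lemma compact_fundamental_set:
  "\<exists>C. compactin X C \<and> finite {g \<in> carrier K. \<phi> g ` C \<inter> C \<noteq> {}} \<and>
    (\<forall>n. \<forall>e\<in>E n. \<exists>g\<in>carrier K. X closure_of e \<subseteq> \<phi> g ` C)"
proof -
  let ?O = "\<Union>n. orbits K (E n) (\<lambda>g e. \<phi> g ` e)"
  have "\<forall>o'\<in>?O. \<exists>e. e \<in> (\<Union>n. E n) \<and> o' = orbit K (\<lambda>g e. \<phi> g ` e) e" unfolding orbits_def by blast
  then obtain rep where rep: "\<And>o'. o' \<in> ?O \<Longrightarrow> rep o' \<in> (\<Union>n. E n) \<and> o' = orbit K (\<lambda>g e. \<phi> g ` e) (rep o')"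
    by metis
  define R where "R = rep ` ?O"
  have R: "finite R" "R \<subseteq> (\<Union>n. E n)"
    unfolding R_def using finite_orbits by (rule finite_imageI) (rule image_subsetI, use rep in blast)
  define C where "C = (\<Union>e\<in>R. X closure_of e)"
  have compC: "compactin X C"
    unfolding C_def by (rule compactin_Union) (use R cell_closure_finite(1)[OF CW] in auto)
  have "\<forall>e\<in>R. \<exists>F. finite F \<and> F \<subseteq> (\<Union>m. E m) \<and> X closure_of e \<subseteq> \<Union>F"
    using R(2) cell_closure_finite(2)[OF CW] by blast
  then obtain F where F: "\<And>e. e \<in> R \<Longrightarrow> finite (F e) \<and> F e \<subseteq> (\<Union>m. E m) \<and> X closure_of e \<subseteq> \<Union>(F e)" by metis
  define D where "D = (\<Union>e\<in>R. F e)"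
  have "finite D" unfolding D_def by (rule finite_UN_I[OF R(1)]) (use F in simp)
  moreover have "D \<subseteq> (\<Union>m. E m)" unfolding D_def by (rule UN_least) (use F in simp)
  moreover have "X closure_of e \<subseteq> \<Union>D" if "e \<in> R" for e
    using F[OF that] that unfolding D_def by (meson UN_upper Union_mono order_trans)
  then have "C \<subseteq> \<Union>D" unfolding C_def by (rule UN_least)
  ultimately have D: "finite D" "D \<subseteq> (\<Union>m. E m)" "C \<subseteq> \<Union>D" by simp_all
  have "finite {g \<in> carrier K. \<phi> g ` C \<inter> C \<noteq> {}}"
  proof (rule finite_subset)
    show "{g \<in> carrier K. \<phi> g ` C \<inter> C \<noteq> {}} \<subseteq> (\<Union>d\<in>D. \<Union>e\<in>D. {g \<in> carrier K. \<phi> g ` d = e})"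
    proof
      fix g assume "g \<in> {g \<in> carrier K. \<phi> g ` C \<inter> C \<noteq> {}}"
      then obtain x where x: "g \<in> carrier K" "x \<in> C" "\<phi> g x \<in> C" by blast
      obtain d where d: "d \<in> D" "x \<in> d" using D(3) x(2) by blast
      obtain e where e: "e \<in> D" "\<phi> g x \<in> e" using D(3) x(3) by blast
      obtain m n where "d \<in> E m" "e \<in> E n" using D(2) d(1) e(1) by blast
      then have "\<phi> g ` d = e" using translate_meets_cell(2)[OF x(1)] d(2) e(2) by metis
      then show "g \<in> (\<Union>d\<in>D. \<Union>e\<in>D. {g \<in> carrier K. \<phi> g ` d = e})"
        using x(1) d(1) e(1) by blast
    qed
    have "finite {g \<in> carrier K. \<phi> g ` d = e}" if dD: "d \<in> D" for d e
    proof -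
      obtain m where d: "d \<in> E m" using D(2) dD by blast
      have "g = h" if g: "g \<in> carrier K" "\<phi> g ` d = e" and h: "h \<in> carrier K" "\<phi> h ` d = e" for g h
      proof -
        have "\<phi> (inv h \<otimes> g) ` d = \<phi> (inv h \<otimes> h) ` d"
          using cell_action(2)[OF d, of "inv h" g] cell_action(2)[OF d, of "inv h" h] g h by simp
        also have "\<dots> = d" using cell_action(1)[OF d] h by simp
        finally have "\<phi> (inv h \<otimes> g) ` d = d" .
        obtain x where x: "x \<in> d" using cell_nonempty[OF CW d] by blast
        have "\<phi> (inv h \<otimes> g) x = x" using cell_fix[OF _ d \<open>\<phi> (inv h \<otimes> g) ` d = d\<close> x] g h by simp
        then have "inv h \<otimes> g = \<one>" using free[of "inv h \<otimes> g" x] g h x cell_subset[OF d] by auto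
        then show ?thesis using g h inv_equality[of "inv h" g] by (metis inv_inv inv_closed)
      qed
      then have "\<exists>h. {g \<in> carrier K. \<phi> g ` d = e} \<subseteq> {h}" by blast
      then show ?thesis using finite_subset by blast
    qed
    then show "finite (\<Union>d\<in>D. \<Union>e\<in>D. {g \<in> carrier K. \<phi> g ` d = e})" using D(1) by auto
  qed
  moreover have "\<exists>g\<in>carrier K. X closure_of e \<subseteq> \<phi> g ` C" if e: "e \<in> E n" for n e
  proof -
    have o': "orbit K (\<lambda>g e. \<phi> g ` e) e \<in> ?O" using e unfolding orbits_def by blast
    define r where "r = rep (orbit K (\<lambda>g e. \<phi> g ` e) e)"
    have r: "r \<in> R" using o' unfolding R_def r_def by blast
    have "e \<in> orbit K (\<lambda>g e. \<phi> g ` e) r"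
      unfolding r_def by (rule subst[of _ _ "\<lambda>S. e \<in> S", OF conjunct2[OF rep[OF o']] cell_orbit_mem[OF e]])
    then obtain g where g: "g \<in> carrier K" "e = \<phi> g ` r" unfolding orbit_def by blast
    obtain m where m: "r \<in> E m" using r R(2) by blast
    have "compactin X (\<phi> g ` (X closure_of r))"
      by (rule image_compactin[OF cell_closure_finite(1)[OF CW m] actionD(2)[OF g(1)]])
    then have "closedin X (\<phi> g ` (X closure_of r))" using compactin_imp_closedin[OF cwD(1)] by blast
    moreover have "e \<subseteq> \<phi> g ` (X closure_of r)"
      unfolding g(2) using closure_of_subset[OF cell_subset[OF m]] by (rule image_mono)
    ultimately have "X closure_of e \<subseteq> \<phi> g ` (X closure_of r)" by (intro closure_of_minimal)
    also have "\<dots> \<subseteq> \<phi> g ` C" using r unfolding C_def by blast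
    finally show ?thesis using g(1) by blast
  qed
  ultimately have "compactin X C \<and> finite {g \<in> carrier K. \<phi> g ` C \<inter> C \<noteq> {}} \<and>
    (\<forall>n. \<forall>e\<in>E n. \<exists>g\<in>carrier K. X closure_of e \<subseteq> \<phi> g ` C)" using compC by simp
  then show ?thesis by (rule exI)
qed

text \<open>
  Proper discontinuity. Each point has a neighbourhood covered by finitely many translates of
  the compact set \<open>C\<close>, so all but finitely many \<open>g\<close> satisfy the claim for any such
  neighbourhoods \<open>U\<close> and \<open>V\<close>; for the remaining ones shrink \<open>U\<close> and \<open>V\<close> by the Hausdorff
  property. The case \<open>x = y\<close> yields slices, the case of different orbits the Hausdorff property
  of the orbit space.
\<close>

lemma orbit_separating_neighbourhoods:
  assumes "x \<in> topspace X" "y \<in> topspace X"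
  shows "\<exists>U V. openin X U \<and> openin X V \<and> x \<in> U \<and> y \<in> V \<and> (\<forall>g\<in>carrier K. \<phi> g x \<noteq> y \<longrightarrow> \<phi> g ` U \<inter> V = {})"
proof -
  obtain C where C: "compactin X C \<and> finite {g \<in> carrier K. \<phi> g ` C \<inter> C \<noteq> {}} \<and>
    (\<forall>n. \<forall>e\<in>E n. \<exists>g\<in>carrier K. X closure_of e \<subseteq> \<phi> g ` C)"
    using compact_fundamental_set by (elim exE)
  have compC: "compactin X C" and finC: "finite {g \<in> carrier K. \<phi> g ` C \<inter> C \<noteq> {}}" using C by simp_all
  have cover: "\<exists>g\<in>carrier K. X closure_of e \<subseteq> \<phi> g ` C" if "e \<in> E n" for n e
    using bspec[OF spec[OF conjunct2[OF conjunct2[OF C]]] that] .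
  have subC: "C \<subseteq> topspace X" using compC by (rule compactin_subset_topspace)
  have compg: "compactin X (\<phi> g ` C)" if "g \<in> carrier K" for g
    by (rule image_compactin[OF compC actionD(2)[OF that]])
  then have clg: "closedin X (\<phi> g ` C)" if "g \<in> carrier K" for g
    using compactin_imp_closedin[OF cwD(1)] that by blast
  have finhC: "finite {g \<in> carrier K. \<phi> (g \<otimes> a) ` C \<inter> \<phi> b ` C \<noteq> {}}" if ab: "a \<in> carrier K" "b \<in> carrier K" for a b
  proof (rule inj_on_finite[OF _ _ finC])
    show "inj_on (\<lambda>g. inv b \<otimes> g \<otimes> a) {g \<in> carrier K. \<phi> (g \<otimes> a) ` C \<inter> \<phi> b ` C \<noteq> {}}"
      using ab by (auto simp: inj_on_def)
    show "(\<lambda>g. inv b \<otimes> g \<otimes> a) ` {g \<in> carrier K. \<phi> (g \<otimes> a) ` C \<inter> \<phi> b ` C \<noteq> {}} \<subseteq> {g \<in> carrier K. \<phi> g ` C \<inter> C \<noteq> {}}"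
    proof
      fix k assume "k \<in> (\<lambda>g. inv b \<otimes> g \<otimes> a) ` {g \<in> carrier K. \<phi> (g \<otimes> a) ` C \<inter> \<phi> b ` C \<noteq> {}}"
      then obtain g where g: "g \<in> carrier K" "\<phi> (g \<otimes> a) ` C \<inter> \<phi> b ` C \<noteq> {}" and k: "k = inv b \<otimes> g \<otimes> a" by blast
      obtain c d where cd: "c \<in> C" "d \<in> C" "\<phi> (g \<otimes> a) c = \<phi> b d" using g(2) by blast
      have "\<phi> (inv b \<otimes> g \<otimes> a) c = \<phi> (inv b) (\<phi> (g \<otimes> a) c)"
        using g ab cd subC actionD(4)[of "inv b" "g \<otimes> a" c] by (auto simp: m_assoc)
      also have "\<dots> = d" using cd ab subC actionD(6)[of b d] by auto
      finally have "d \<in> \<phi> k ` C" using cd(1) k by blast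
      then show "k \<in> {g \<in> carrier K. \<phi> g ` C \<inter> C \<noteq> {}}"
        using g(1) ab cd(2) k by auto
    qed
  qed
  have fin1: "finite {g \<in> carrier K. \<phi> g ` C \<inter> \<phi> b ` C \<noteq> {}}" if "b \<in> carrier K" for b
    by (rule finite_subset[OF _ finhC[of \<one> b]]) (use that in auto)
  have inC: "\<exists>h\<in>carrier K. x \<in> \<phi> h ` C" if "x \<in> topspace X" for x
  proof -
    obtain n e where e: "e \<in> E n" "x \<in> e" using cwD(2) \<open>x \<in> topspace X\<close> by blast
    then show ?thesis using cover[OF e(1)] closure_of_subset[OF cell_subset[OF e(1)]] by blast
  qed
  have nbhd: "\<exists>U F. openin X U \<and> x \<in> U \<and> finite F \<and> F \<subseteq> carrier K \<and> U \<subseteq> (\<Union>g\<in>F. \<phi> g ` C)" if x: "x \<in> topspace X" for x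
  proof -
    define B where "B = {g \<in> carrier K. x \<notin> \<phi> g ` C}"
    define F where "F = {g \<in> carrier K. x \<in> \<phi> g ` C}"
    obtain h where h: "h \<in> carrier K" "x \<in> \<phi> h ` C" using inC[OF x] by blast
    have finF: "finite F" by (rule finite_subset[OF _ fin1[OF h(1)]]) (use h in \<open>auto simp: F_def\<close>)
    \<comment> \<open>The closure of a cell lies in one translate of \<open>C\<close> and so meets only finitely many others; by the weak topology any union
      of translates is closed.\<close>
    have clB: "closedin X (\<Union>g\<in>B. \<phi> g ` C)"
    proof (rule cwD(5))
      show "(\<Union>g\<in>B. \<phi> g ` C) \<subseteq> topspace X" 
        using closedin_subset[OF clg] by (intro UN_least) (simp add: B_def)
      fix n e assume "e \<in> E n"
      then obtain b where b: "b \<in> carrier K" "X closure_of e \<subseteq> \<phi> b ` C" using cover by blast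
      let ?B = "{g \<in> B. \<phi> g ` C \<inter> \<phi> b ` C \<noteq> {}}"
      have "(\<Union>g\<in>B. \<phi> g ` C) \<inter> X closure_of e = (\<Union>g\<in>?B. \<phi> g ` C) \<inter> X closure_of e"
      proof (intro equalityI subsetI)
        fix z assume z: "z \<in> (\<Union>g\<in>B. \<phi> g ` C) \<inter> X closure_of e"
        then obtain g where g: "g \<in> B" "z \<in> \<phi> g ` C" by blast
        have "z \<in> \<phi> b ` C" using z b(2) by (simp add: subsetD)
        then have "g \<in> ?B" using g by blast
        then show "z \<in> (\<Union>g\<in>?B. \<phi> g ` C) \<inter> X closure_of e" using g(2) z by blast
      qed auto
      moreover have "closedin X (\<Union>g\<in>?B. \<phi> g ` C)"
      proof (rule closedin_Union)
        have "finite ?B" by (rule finite_subset[OF _ fin1[OF b(1)]]) (auto simp: B_def)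
        then show "finite ((\<lambda>g. \<phi> g ` C) ` ?B)" by simp
      qed (use clg in \<open>auto simp: B_def\<close>)
      ultimately show "closedin X ((\<Union>g\<in>B. \<phi> g ` C) \<inter> X closure_of e)" by (simp add: closedin_Int)
    qed
    let ?U = "topspace X - (\<Union>g\<in>B. \<phi> g ` C)"
    have "openin X ?U" using clB by blast
    moreover have "x \<in> ?U" using x by (auto simp: B_def)
    moreover have "?U \<subseteq> (\<Union>g\<in>F. \<phi> g ` C)" 
    proof
      fix y assume y: "y \<in> ?U"
      then have "y \<in> topspace X" by (rule DiffD1)
      then obtain h where "h \<in> carrier K" "y \<in> \<phi> h ` C" using inC[of y] by blast
      then show "y \<in> (\<Union>g\<in>F. \<phi> g ` C)" using y unfolding B_def F_def by blast
    qed
    moreover have "F \<subseteq> carrier K" by (auto simp: F_def)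
    ultimately show ?thesis using finF by (intro exI[of _ ?U] exI[of _ F]) simp
  qed
  obtain U0 F where U0: "openin X U0" "x \<in> U0" "finite F" "F \<subseteq> carrier K" "U0 \<subseteq> (\<Union>g\<in>F. \<phi> g ` C)"
    using nbhd[OF assms(1)] by blast
  obtain V0 F' where V0: "openin X V0" "y \<in> V0" "finite F'" "F' \<subseteq> carrier K" "V0 \<subseteq> (\<Union>g\<in>F'. \<phi> g ` C)"
    using nbhd[OF assms(2)] by blast
  define B where "B = {g \<in> carrier K. \<phi> g ` U0 \<inter> V0 \<noteq> {} \<and> \<phi> g x \<noteq> y}"
  have "B \<subseteq> (\<Union>a\<in>F. \<Union>b\<in>F'. {g \<in> carrier K. \<phi> (g \<otimes> a) ` C \<inter> \<phi> b ` C \<noteq> {}})"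
  proof
    fix g assume "g \<in> B"
    then obtain u where u: "g \<in> carrier K" "u \<in> U0" "\<phi> g u \<in> V0" by (auto simp: B_def)
    obtain a c where a: "a \<in> F" "c \<in> C" "u = \<phi> a c" using u U0(5) by blast
    obtain b d where b: "b \<in> F'" "d \<in> C" "\<phi> g u = \<phi> b d" using u V0(5) by blast
    have "\<phi> (g \<otimes> a) c = \<phi> b d" using actionD(4)[of g a c] u a b U0(4) subC by auto
    then show "g \<in> (\<Union>a\<in>F. \<Union>b\<in>F'. {g \<in> carrier K. \<phi> (g \<otimes> a) ` C \<inter> \<phi> b ` C \<noteq> {}})"
      using u(1) a b by blast
  qed
  moreover have "finite (\<Union>a\<in>F. \<Union>b\<in>F'. {g \<in> carrier K. \<phi> (g \<otimes> a) ` C \<inter> \<phi> b ` C \<noteq> {}})"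
    using U0(3,4) V0(3,4) finhC by blast
  ultimately have finB: "finite B" by (rule finite_subset)
  have "\<forall>g\<in>B. \<exists>A A'. openin X A \<and> openin X A' \<and> \<phi> g x \<in> A \<and> y \<in> A' \<and> A \<inter> A' = {}"
  proof
    fix g assume g: "g \<in> B"
    then have "\<phi> g x \<in> topspace X" "\<phi> g x \<noteq> y" using actionD(5) assms(1) by (auto simp: B_def)
    then show "\<exists>A A'. openin X A \<and> openin X A' \<and> \<phi> g x \<in> A \<and> y \<in> A' \<and> A \<inter> A' = {}"
      using cwD(1) assms(2) unfolding Hausdorff_space_def disjnt_def by blast
  qed
  then obtain A A' where A: "\<And>g. g \<in> B \<Longrightarrow> openin X (A g) \<and> openin X (A' g) \<and> \<phi> g x \<in> A g \<and> y \<in> A' g \<and> A g \<inter> A' g = {}"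
    by metis
  define U where "U = U0 \<inter> (\<Inter>g\<in>B. {z \<in> topspace X. \<phi> g z \<in> A g})"
  define V where "V = V0 \<inter> (\<Inter>g\<in>B. A' g)"
  have "openin X {z \<in> topspace X. \<phi> g z \<in> A g}" if "g \<in> B" for g
    using A[OF that] actionD(2)[of g] that by (simp add: B_def continuous_map_def)
  then have "openin X U" unfolding U_def by (intro finite_openin_Inter[OF finB U0(1)])
  moreover have "openin X V" unfolding V_def using A by (intro finite_openin_Inter[OF finB V0(1)]) blast
  moreover have "x \<in> U" using U0 assms(1) A by (auto simp: U_def)
  moreover have "y \<in> V" using V0 A by (auto simp: V_def)
  moreover have "\<phi> g ` U \<inter> V = {}" if g: "g \<in> carrier K" "\<phi> g x \<noteq> y" for g
  proof (cases "g \<in> B")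
    case True
    then show ?thesis using A[OF True] by (auto simp: U_def V_def)
  next
    case False
    then have "\<phi> g ` U0 \<inter> V0 = {}" using g by (auto simp: B_def)
    then show ?thesis by (auto simp: U_def V_def)
  qed
  ultimately show ?thesis by blast
qed

lemma ex_slice:
  assumes x: "x \<in> topspace X"
  shows "\<exists>U. x \<in> U \<and> slice K X \<phi> U"
proof -
  obtain U V where UV: "openin X U" "openin X V" "x \<in> U" "x \<in> V" "\<forall>g\<in>carrier K. \<phi> g x \<noteq> x \<longrightarrow> \<phi> g ` U \<inter> V = {}"
    using orbit_separating_neighbourhoods[OF x x] by blast
  have "slice K X \<phi> (U \<inter> V)"
    unfolding slice_def using UV free x by (auto simp: openin_Int)
  then show ?thesis using UV by blast
qed

lemma compact_orbit_space: "compact_space (orbit_space K X \<phi>)"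
proof -
  obtain C where C: "compactin X C \<and> finite {g \<in> carrier K. \<phi> g ` C \<inter> C \<noteq> {}} \<and>
    (\<forall>n. \<forall>e\<in>E n. \<exists>g\<in>carrier K. X closure_of e \<subseteq> \<phi> g ` C)"
    using compact_fundamental_set by (elim exE)
  have compC: "compactin X C" and finC: "finite {g \<in> carrier K. \<phi> g ` C \<inter> C \<noteq> {}}" using C by simp_all
  have cover: "\<exists>g\<in>carrier K. X closure_of e \<subseteq> \<phi> g ` C" if "e \<in> E n" for n e
    using bspec[OF spec[OF conjunct2[OF conjunct2[OF C]]] that] .
  have subC: "C \<subseteq> topspace X" using compC by (rule compactin_subset_topspace)
  have "orbit K \<phi> ` topspace X \<subseteq> orbit K \<phi> ` C"
  proof
    fix z assume "z \<in> orbit K \<phi> ` topspace X"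
    then obtain x where x: "x \<in> topspace X" "z = orbit K \<phi> x" by blast
    then obtain n e where e: "e \<in> E n" "x \<in> e" using cwD(2) by blast
    then obtain g c where "g \<in> carrier K" "c \<in> C" "x = \<phi> g c"
      using cover[OF e(1)] closure_of_subset[OF cell_subset[OF e(1)]] by blast
    then show "z \<in> orbit K \<phi> ` C" using orbit_eq_iff[OF action x(1), of c] x(2) subC by blast
  qed
  then have "orbit K \<phi> ` C = topspace (orbit_space K X \<phi>)" using subC by (auto simp: topspace_orbit_space)
  then show ?thesis using image_compactin[OF compC continuous_map_orbit, of K \<phi>] by (simp add: compact_space_def)
qed

lemma Hausdorff_orbit_space: "Hausdorff_space (orbit_space K X \<phi>)"
  unfolding Hausdorff_space_def
proof (intro allI impI)
  fix a b assume ab: "a \<in> topspace (orbit_space K X \<phi>) \<and> b \<in> topspace (orbit_space K X \<phi>) \<and> a \<noteq> b"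
  obtain x where x: "x \<in> topspace X" "a = orbit K \<phi> x" using ab by (auto simp: topspace_orbit_space)
  obtain y where y: "y \<in> topspace X" "b = orbit K \<phi> y" using ab by (auto simp: topspace_orbit_space)
  obtain U V where UV: "openin X U" "openin X V" "x \<in> U" "y \<in> V" "\<forall>g\<in>carrier K. \<phi> g x \<noteq> y \<longrightarrow> \<phi> g ` U \<inter> V = {}"
    using orbit_separating_neighbourhoods[OF x(1) y(1)] by blast
  have ne: "\<phi> g x \<noteq> y" if "g \<in> carrier K" for g
    using orbit_eq_iff[OF action y(1) x(1)] that ab x(2) y(2) by auto
  have "disjnt (orbit K \<phi> ` U) (orbit K \<phi> ` V)"
  proof (rule ccontr)
    assume "\<not> disjnt (orbit K \<phi> ` U) (orbit K \<phi> ` V)"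
    then obtain u v where uv: "u \<in> U" "v \<in> V" "orbit K \<phi> v = orbit K \<phi> u" unfolding disjnt_def by fastforce
    then obtain g where "g \<in> carrier K" "v = \<phi> g u"
      using orbit_eq_iff[OF action, of v u] openin_subset[OF UV(1)] openin_subset[OF UV(2)] by blast
    then show False using UV(5) ne uv by blast
  qed
  moreover have "openin (orbit_space K X \<phi>) (orbit K \<phi> ` U)" "openin (orbit_space K X \<phi>) (orbit K \<phi> ` V)"
    using open_map_orbit[OF action] UV by (auto simp: open_map_def)
  ultimately show "\<exists>U V. openin (orbit_space K X \<phi>) U \<and> openin (orbit_space K X \<phi>) V \<and> a \<in> U \<and> b \<in> V \<and> disjnt U V"
    using x y UV by blast
qed

text \<open>
  The orbit map sends each cell injectively to the orbit space, since a group element that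
  carries a cell to itself fixes it pointwise. Its characteristic map, followed by the orbit
  map, is therefore one for the image, and the images of cells from different orbits are
  disjoint.
\<close>

lemma has_euler_orbit_space:
  "has_euler (orbit_space K X \<phi>) {} (\<Sum>(n, o')\<in>cell_orbits K \<phi> E. (-1) ^ n)"
proof -
  let ?act = "\<lambda>g e. \<phi> g ` e"
  let ?\<pi> = "orbit K \<phi>"
  let ?c = "\<lambda>i :: nat \<times> _. ?\<pi> ` (\<Union>(snd i))"
  have mem: "\<exists>n e. i = (n, orbit K ?act e) \<and> e \<in> E n" if "i \<in> cell_orbits K \<phi> E" for i
    using that unfolding cell_orbits_def orbits_def by blast
  have \<pi>eq: "?\<pi> (\<phi> g x) = ?\<pi> x" if "g \<in> carrier K" "x \<in> topspace X" for g x
    using orbit_eq_iff[OF action actionD(5)[OF that] that(2)] that by blast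
  have c: "?c (n, orbit K ?act e) = ?\<pi> ` e" if e: "e \<in> E n" for n e
  proof
    show "?c (n, orbit K ?act e) \<subseteq> ?\<pi> ` e"
      using \<pi>eq cell_subset[OF e] by (force simp: orbit_def[of K ?act])
    show "?\<pi> ` e \<subseteq> ?c (n, orbit K ?act e)" using cell_orbit_mem[OF e] by auto
  qed
  have "has_euler (orbit_space K X \<phi>) {} (\<Sum>i\<in>cell_orbits K \<phi> E. (-1) ^ fst i)"
  proof (rule has_euler_finite_cells[where c = ?c])
    show "finite (cell_orbits K \<phi> E)" by (rule finite_cell_orbits[OF finite_orbits])
    show "Hausdorff_space (orbit_space K X \<phi>)" by (rule Hausdorff_orbit_space)
    show "topspace (orbit_space K X \<phi>) = (\<Union>i\<in>cell_orbits K \<phi> E. ?c i)"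
    proof (intro equalityI subsetI)
      fix z assume "z \<in> topspace (orbit_space K X \<phi>)"
      then obtain x where x: "x \<in> topspace X" "z = ?\<pi> x" by (auto simp: topspace_orbit_space)
      then obtain n e where e: "e \<in> E n" "x \<in> e" using cwD(2) by blast
      then have "(n, orbit K ?act e) \<in> cell_orbits K \<phi> E" unfolding cell_orbits_def orbits_def by blast
      moreover have "z \<in> ?c (n, orbit K ?act e)" unfolding c[OF e(1)] using x e by blast
      ultimately show "z \<in> (\<Union>i\<in>cell_orbits K \<phi> E. ?c i)" by blast
    next
      fix z assume "z \<in> (\<Union>i\<in>cell_orbits K \<phi> E. ?c i)"
      then obtain i where i: "i \<in> cell_orbits K \<phi> E" "z \<in> ?c i" by blast
      obtain n e where e: "i = (n, orbit K ?act e)" "e \<in> E n" using mem[OF i(1)] by blast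
      have "z \<in> ?\<pi> ` e" using i(2) unfolding e(1) c[OF e(2)] .
      then show "z \<in> topspace (orbit_space K X \<phi>)"
        unfolding topspace_orbit_space using cell_subset[OF e(2)] by blast
    qed
    show "disjoint_family_on ?c (cell_orbits K \<phi> E)"
      unfolding disjoint_family_on_def
    proof (intro ballI impI, rule ccontr)
      fix i j assume ij: "i \<in> cell_orbits K \<phi> E" "j \<in> cell_orbits K \<phi> E" "i \<noteq> j" "?c i \<inter> ?c j \<noteq> {}"
      obtain m d where d: "i = (m, orbit K ?act d)" "d \<in> E m" using mem[OF ij(1)] by blast
      obtain n e where e: "j = (n, orbit K ?act e)" "e \<in> E n" using mem[OF ij(2)] by blast
      have "?\<pi> ` d \<inter> ?\<pi> ` e \<noteq> {}" using ij(4) unfolding d(1) e(1) c[OF d(2)] c[OF e(2)] .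
      then obtain x y where xy: "x \<in> d" "y \<in> e" "?\<pi> y = ?\<pi> x" by fastforce
      then obtain g where g: "g \<in> carrier K" "y = \<phi> g x"
        using orbit_eq_iff[OF action, of y x] cell_subset[OF d(2)] cell_subset[OF e(2)] by blast
      have "m = n" "\<phi> g ` d = e" using translate_meets_cell[OF g(1) d(2) e(2) xy(1)] xy g by auto
      then show False using ij(3) d(1) e(1) cell_orbit_eq[OF d(2) g(1)] by simp
    qed
    fix i assume "i \<in> cell_orbits K \<phi> E"
    then obtain n e where i: "i = (n, orbit K ?act e)" and e: "e \<in> E n" using mem by blast
    obtain \<Phi> F where \<Phi>: "continuous_map (unit_disc n) X \<Phi>" "inj_on \<Phi> (open_unit_disc n)" "\<Phi> ` open_unit_disc n = e"
      and F: "F \<subseteq> (\<Union>m<n. E m)" "\<Phi> ` unit_disc_boundary n \<subseteq> \<Union>F"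
      using cwD(4)[OF e] by blast
    have "inj_on (?\<pi> \<circ> \<Phi>) (open_unit_disc n)"
    proof (rule inj_onI)
      fix a b assume ab: "a \<in> open_unit_disc n" "b \<in> open_unit_disc n" "(?\<pi> \<circ> \<Phi>) a = (?\<pi> \<circ> \<Phi>) b"
      have in_e: "\<Phi> a \<in> e" "\<Phi> b \<in> e" using ab \<Phi>(3) by auto
      then obtain g where g: "g \<in> carrier K" "\<Phi> a = \<phi> g (\<Phi> b)"
        using orbit_eq_iff[OF action, of "\<Phi> a" "\<Phi> b"] cell_subset[OF e] ab(3) by auto
      have "\<phi> g ` e = e" using translate_meets_cell(2)[OF g(1) e e in_e(2)] g in_e by simp
      then have "\<Phi> a = \<Phi> b" using cell_fix[OF g(1) e _ in_e(2)] g by simp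
      then show "a = b" using \<Phi>(2) ab by (auto simp: inj_on_def)
    qed
    moreover have "continuous_map (unit_disc n) (orbit_space K X \<phi>) (?\<pi> \<circ> \<Phi>)"
      by (rule continuous_map_compose[OF \<Phi>(1) continuous_map_orbit])
    moreover have "(?\<pi> \<circ> \<Phi>) ` open_unit_disc n = ?c i" unfolding i c[OF e] image_comp[symmetric] \<Phi>(3) ..
    moreover have "(?\<pi> \<circ> \<Phi>) ` unit_disc_boundary n \<subseteq> (\<Union>j\<in>{j \<in> cell_orbits K \<phi> E. fst j < fst i}. ?c j)"
    proof
      fix z assume "z \<in> (?\<pi> \<circ> \<Phi>) ` unit_disc_boundary n"
      then obtain w where "w \<in> unit_disc_boundary n" "z = ?\<pi> (\<Phi> w)" by auto
      then have x: "\<Phi> w \<in> \<Union>F" "z = ?\<pi> (\<Phi> w)" using F(2) by auto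
      then obtain d where "d \<in> F" and wd: "\<Phi> w \<in> d" by blast
      then obtain m where d: "m < n" "d \<in> E m" using F(1) by blast
      have "(m, orbit K ?act d) \<in> cell_orbits K \<phi> E" using d unfolding cell_orbits_def orbits_def by blast
      moreover have "z \<in> ?c (m, orbit K ?act d)" unfolding c[OF d(2)] using x(2) wd by blast
      ultimately show "z \<in> (\<Union>j\<in>{j \<in> cell_orbits K \<phi> E. fst j < fst i}. ?c j)"
        using d(1) i by (intro UN_I[of "(m, orbit K ?act d)"]) auto
    qed
    ultimately show "\<exists>\<Phi>. continuous_map (unit_disc (fst i)) (orbit_space K X \<phi>) \<Phi> \<and> inj_on \<Phi> (open_unit_disc (fst i)) \<and>
       \<Phi> ` open_unit_disc (fst i) = ?c i \<and> \<Phi> ` unit_disc_boundary (fst i) \<subseteq> (\<Union>j\<in>{j\<in>cell_orbits K \<phi> E. fst j < fst i}. ?c j)"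
      unfolding i fst_conv by (intro exI[of _ "?\<pi> \<circ> \<Phi>"]) simp
  qed
  then show ?thesis by (simp add: case_prod_beta)
qed

end

section \<open>The orbifold Euler characteristic as a count of cells\<close>

lemma centralizer_simps [simp]:
  "\<one>\<^bsub>centralizer_group G H\<^esub> = \<one>\<^bsub>G\<^esub>"
  "x \<otimes>\<^bsub>centralizer_group G H\<^esub> y = x \<otimes>\<^bsub>G\<^esub> y"
  "carrier (centralizer_group G H) = {x \<in> carrier G. \<forall>h\<in>H. x \<otimes>\<^bsub>G\<^esub> h = h \<otimes>\<^bsub>G\<^esub> x}"
  "x [^]\<^bsub>centralizer_group G H\<^esub> (n::nat) = x [^]\<^bsub>G\<^esub> n"
  by (simp_all add: centralizer_group_def nat_pow_def)

lemma finite_EG_model_imp_finite_stabilizer: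
  assumes "finite_EG_model G X \<phi>" "x \<in> topspace X"
  shows "finite (stabilizer G \<phi> x)" "subgroup (stabilizer G \<phi> x) G"
proof -
  obtain E where "G_CW_structure G X \<phi> E" using assms unfolding finite_EG_model_def finite_G_CW_def by blast
  then have "group_action G (topspace X) \<phi>" unfolding G_CW_structure_def by (elim conjE)
  then show sub: "subgroup (stabilizer G \<phi> x) G" using group_action.stabilizer_subgroup assms(2) by fastforce
  have "x \<in> fixed_points X \<phi> (stabilizer G \<phi> x)"
    using assms(2) by (auto simp: fixed_points_def stabilizer_def)
  then show "finite (stabilizer G \<phi> x)" using assms(1) sub unfolding finite_EG_model_def by (metis empty_iff)
qed

lemma torsion_free_in_finite_subgroup:
  assumes "group G" "subgroup S G" "finite S" "x \<in> S"
    and tf: "\<And>k::nat. 0 < k \<Longrightarrow> x [^]\<^bsub>G\<^esub> k = \<one>\<^bsub>G\<^esub> \<Longrightarrow> x = \<one>\<^bsub>G\<^esub>"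
  shows "x = \<one>\<^bsub>G\<^esub>"
proof -
  interpret group "G\<lparr>carrier := S\<rparr>" using group.subgroup_imp_group[OF assms(1,2)] .
  have "x [^]\<^bsub>G\<lparr>carrier := S\<rparr>\<^esub> order (G\<lparr>carrier := S\<rparr>) = \<one>\<^bsub>G\<^esub>"
    using pow_order_eq_1[of x] assms(4) by simp
  then have "x [^]\<^bsub>G\<^esub> card S = \<one>\<^bsub>G\<^esub>" by (simp add: order_def nat_pow_def)
  moreover have "card S > 0" using assms(3,4) card_gt_0_iff by blast
  ultimately show ?thesis using tf by blast
qed

lemma G_CW_structure_subgroup:
  assumes gcw: "G_CW_structure G X \<phi> E" and sub: "subgroup \<Lambda> G"
  shows "G_CW_structure (G\<lparr>carrier := \<Lambda>\<rparr>) X \<phi> E"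
proof -
  interpret G: G_CW_complex G X \<phi> E by unfold_locales (rule gcw)
  have \<Lambda>G: "\<Lambda> \<subseteq> carrier G" using subgroup.subset[OF sub] .
  have act: "group_action G (topspace X) \<phi>" using gcw unfolding G_CW_structure_def by (elim conjE)
  then have hom: "\<phi> \<in> hom G (BijGroup (topspace X))"
    by (simp add: group_action_def group_hom_def group_hom_axioms_def)
  have "\<phi> \<in> hom (G\<lparr>carrier := \<Lambda>\<rparr>) (BijGroup (topspace X))"
    using hom \<Lambda>G unfolding hom_def by auto
  then have "group_action (G\<lparr>carrier := \<Lambda>\<rparr>) (topspace X) \<phi>"
    using G.subgroup_imp_group[OF sub] group_BijGroup
    by (simp add: group_action_def group_hom_def group_hom_axioms_def)
  then show ?thesis
    unfolding G_CW_structure_def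
  proof (intro conjI ballI allI impI)
    show "CW_structure X E" by (rule G.CW)
    fix g assume "g \<in> carrier (G\<lparr>carrier := \<Lambda>\<rparr>)"
    then have g: "g \<in> carrier G" using \<Lambda>G by auto
    show "continuous_map X X (\<phi> g)" by (rule G.actionD(2)[OF g])
    fix n e assume e: "e \<in> E n"
    show "\<phi> g ` e \<in> E n" by (rule G.cell_image[OF g e])
    show "\<phi> g x = x" if "\<phi> g ` e = e" "x \<in> e" for x by (rule G.cell_fix[OF g e that])
  qed
qed

text \<open>
  Stabilizers of points are finite, so they meet a torsion-free subgroup trivially. Every orbit
  of cells under \<open>G\<close> splits into at most as many orbits under \<open>\<Lambda>\<close> as \<open>\<Lambda>\<close> has cosets.
\<close>

lemma free_cocompact_torsion_free_subgroup:
  assumes gcw: "G_CW_structure G X \<phi> E" and fin: "finite (\<Union>n. orbits G (E n) (\<lambda>g e. \<phi> g ` e))"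
    and model: "finite_EG_model G X \<phi>" and \<Lambda>: "torsion_free_finite_index \<Lambda> G"
  shows "free_cocompact_G_CW_complex (G\<lparr>carrier := \<Lambda>\<rparr>) X \<phi> E"
proof -
  interpret G: G_CW_complex G X \<phi> E by unfold_locales (rule gcw)
  have sub: "subgroup \<Lambda> G" and finidx: "finite (rcosets\<^bsub>G\<^esub> \<Lambda>)"
    and tf: "\<And>x k. x \<in> \<Lambda> \<Longrightarrow> 0 < (k::nat) \<Longrightarrow> x [^]\<^bsub>G\<^esub> k = \<one>\<^bsub>G\<^esub> \<Longrightarrow> x = \<one>\<^bsub>G\<^esub>"
    using \<Lambda> unfolding torsion_free_finite_index_def by blast+
  have \<Lambda>G: "\<Lambda> \<subseteq> carrier G" using subgroup.subset[OF sub] .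
  have gcw': "G_CW_structure (G\<lparr>carrier := \<Lambda>\<rparr>) X \<phi> E" by (rule G_CW_structure_subgroup[OF gcw sub])
  interpret L: G_CW_complex "G\<lparr>carrier := \<Lambda>\<rparr>" X \<phi> E by unfold_locales (rule gcw')
  show ?thesis
  proof (unfold_locales)
    let ?act = "\<lambda>g e. \<phi> g ` e"
    let ?O = "\<Union>n. orbits G (E n) ?act"
    have "\<forall>o'\<in>?O. \<exists>e. e \<in> (\<Union>n. E n) \<and> o' = orbit G ?act e" unfolding orbits_def by blast
    then obtain rep where rep: "\<And>o'. o' \<in> ?O \<Longrightarrow> rep o' \<in> (\<Union>n. E n) \<and> o' = orbit G ?act (rep o')"
      by metis
    have "\<forall>D\<in>rcosets\<^bsub>G\<^esub> \<Lambda>. \<exists>t\<in>carrier G. D = \<Lambda> #>\<^bsub>G\<^esub> t" unfolding RCOSETS_def by blast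
    then obtain t where t: "\<And>D. D \<in> rcosets\<^bsub>G\<^esub> \<Lambda> \<Longrightarrow> t D \<in> carrier G \<and> D = \<Lambda> #>\<^bsub>G\<^esub> t D" by metis
    let ?f = "\<lambda>(o', D). orbit (G\<lparr>carrier := \<Lambda>\<rparr>) ?act (\<phi> (t D) ` rep o')"
    have "(\<Union>n. orbits (G\<lparr>carrier := \<Lambda>\<rparr>) (E n) ?act) \<subseteq> ?f ` (?O \<times> (rcosets\<^bsub>G\<^esub> \<Lambda>))"
    proof
      fix z assume "z \<in> (\<Union>n. orbits (G\<lparr>carrier := \<Lambda>\<rparr>) (E n) ?act)"
      then obtain n e where e: "e \<in> E n" "z = orbit (G\<lparr>carrier := \<Lambda>\<rparr>) ?act e" unfolding orbits_def by blast
      define o' where "o' = orbit G ?act e"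
      define r where "r = rep o'"
      have o': "o' \<in> ?O" using e(1) unfolding o'_def orbits_def by blast
      have r: "r \<in> (\<Union>n. E n)" "o' = orbit G ?act r" unfolding r_def using rep[OF o'] by (simp_all only:) 
      have "e \<in> orbit G ?act r" using G.cell_orbit_mem[OF e(1)] r(2) unfolding o'_def by simp
      then obtain g where g: "g \<in> carrier G" "e = \<phi> g ` r" unfolding orbit_def by blast
      obtain m where m: "r \<in> E m" using r(1) by blast
      define D where "D = \<Lambda> #>\<^bsub>G\<^esub> g"
      have D: "D \<in> rcosets\<^bsub>G\<^esub> \<Lambda>" unfolding D_def RCOSETS_def using g(1) by blast
      have "g \<in> D" unfolding D_def using G.rcos_self[OF g(1) sub] .
      then obtain l where l: "l \<in> \<Lambda>" "g = l \<otimes>\<^bsub>G\<^esub> t D" using t[OF D] unfolding r_coset_def by blast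
      have lG: "l \<in> carrier G" using l(1) \<Lambda>G by blast
      have "e = \<phi> l ` (\<phi> (t D) ` r)" using g(2) l(2) G.cell_action(2)[OF m lG] t[OF D] by simp
      then have "z = orbit (G\<lparr>carrier := \<Lambda>\<rparr>) ?act (\<phi> (t D) ` r)"
        using L.cell_orbit_eq[OF G.cell_image[OF _ m], of "t D" l] t[OF D] l(1) e(2) by simp
      then have "z = ?f (o', D)" by (simp add: r_def)
      then show "z \<in> ?f ` (?O \<times> (rcosets\<^bsub>G\<^esub> \<Lambda>))" using o' D by blast
    qed
    moreover have "finite (?f ` (?O \<times> (rcosets\<^bsub>G\<^esub> \<Lambda>)))" using fin finidx by blast
    ultimately show "finite (\<Union>n. orbits (G\<lparr>carrier := \<Lambda>\<rparr>) (E n) ?act)" by (rule finite_subset)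
    fix g x assume g: "g \<in> carrier (G\<lparr>carrier := \<Lambda>\<rparr>)" and x: "x \<in> topspace X" "\<phi> g x = x"
    have "g \<in> stabilizer G \<phi> x" using g x \<Lambda>G by (auto simp: stabilizer_def)
    from torsion_free_in_finite_subgroup[OF G.actionD(1) finite_EG_model_imp_finite_stabilizer(2,1)[OF model x(1)] this]
    have "g = \<one>\<^bsub>G\<^esub>" using tf g by auto
    then show "g = \<one>\<^bsub>G\<lparr>carrier := \<Lambda>\<rparr>\<^esub>" by simp
  qed
qed

lemma finite_EG_model_contractible:
  assumes "finite_EG_model G X \<phi>"
  shows "contractible_space X" "topspace X \<noteq> {}"
proof -
  obtain E where gcw: "G_CW_structure G X \<phi> E" using assms unfolding finite_EG_model_def finite_G_CW_def by blast
  interpret G_CW_complex G X \<phi> E by unfold_locales (rule gcw)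
  have fix_one: "fixed_points X \<phi> {\<one>\<^bsub>G\<^esub>} = topspace X" using actionD(3) by (auto simp: fixed_points_def)
  have "\<forall>H. subgroup H G \<longrightarrow> (if finite H
         then fixed_points X \<phi> H \<noteq> {} \<and> contractible_space (subtopology X (fixed_points X \<phi> H))
         else fixed_points X \<phi> H = {})"
    using assms unfolding finite_EG_model_def by (rule conjunct2)
  from mp[OF spec[OF this, of "{\<one>\<^bsub>G\<^esub>}"] triv_subgroup]
  have "topspace X \<noteq> {} \<and> contractible_space (subtopology X (topspace X))" unfolding fix_one by simp
  then show "contractible_space X" "topspace X \<noteq> {}" by simp_all
qed

text \<open>
  The definition of \<^const>\<open>orb_euler_char\<close> picks some model and some \<open>\<Lambda>\<close>. For this \<open>\<Lambda>\<close> the cells are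
  counted in the model at hand; since both models are contractible, their orbit spaces have the
  same Euler characteristic.
\<close>

theorem orb_euler_char_eq:
  assumes gcw: "G_CW_structure G X \<phi> E" and fin: "finite (\<Union>n. orbits G (E n) (\<lambda>g e. \<phi> g ` e))"
    and model: "finite_EG_model G (X :: 'x topology) \<phi>" and vtf: "virtually_torsion_free G"
  shows "\<exists>\<Lambda>. torsion_free_finite_index \<Lambda> G \<and> finite (cell_orbits (G\<lparr>carrier := \<Lambda>\<rparr>) \<phi> E) \<and>
    orb_euler_char TYPE('x) G = of_int (\<Sum>(n, o')\<in>cell_orbits (G\<lparr>carrier := \<Lambda>\<rparr>) \<phi> E. (-1) ^ n) / of_nat (card (rcosets\<^bsub>G\<^esub> \<Lambda>))"
proof -
  define \<Lambda> where "\<Lambda> = (SOME \<Lambda>. torsion_free_finite_index \<Lambda> G)"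
  have \<Lambda>: "torsion_free_finite_index \<Lambda> G"
    unfolding \<Lambda>_def using vtf unfolding virtually_torsion_free_def by (rule someI_ex)
  define P where "P = (SOME (X :: 'x topology, \<phi>). finite_EG_model G X \<phi>)"
  obtain Y \<psi> where P: "P = (Y, \<psi>)" by (cases P)
  have "case P of (Y, \<psi>) \<Rightarrow> finite_EG_model G Y \<psi>"
    unfolding P_def by (rule someI[of _ "(X, \<phi>)"]) (use model in simp)
  then have modelY: "finite_EG_model G Y \<psi>" by (simp add: P)
  then obtain E' where E': "G_CW_structure G Y \<psi> E'" "finite (\<Union>n. orbits G (E' n) (\<lambda>g e. \<psi> g ` e))"
    unfolding finite_EG_model_def finite_G_CW_def by blast
  interpret X: free_cocompact_G_CW_complex "G\<lparr>carrier := \<Lambda>\<rparr>" X \<phi> E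
    by (rule free_cocompact_torsion_free_subgroup[OF gcw fin model \<Lambda>])
  interpret Y: free_cocompact_G_CW_complex "G\<lparr>carrier := \<Lambda>\<rparr>" Y \<psi> E'
    by (rule free_cocompact_torsion_free_subgroup[OF E' modelY \<Lambda>])
  have "has_euler (orbit_space (G\<lparr>carrier := \<Lambda>\<rparr>) Y \<psi>) {} (\<Sum>(n, o')\<in>cell_orbits (G\<lparr>carrier := \<Lambda>\<rparr>) \<phi> E. (-1) ^ n)"
    by (rule has_euler_orbit_space_contractible[OF X.action Y.action
        finite_EG_model_contractible[OF model] finite_EG_model_contractible[OF modelY]
        X.ex_slice Y.ex_slice X.compact_orbit_space Y.compact_orbit_space X.has_euler_orbit_space])
  then have "rat_euler_char (orbit_space (G\<lparr>carrier := \<Lambda>\<rparr>) Y \<psi>) = (\<Sum>(n, o')\<in>cell_orbits (G\<lparr>carrier := \<Lambda>\<rparr>) \<phi> E. (-1) ^ n)"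
    by (rule has_euler_imp_rat_euler_char)
  then have "orb_euler_char TYPE('x) G = of_int (\<Sum>(n, o')\<in>cell_orbits (G\<lparr>carrier := \<Lambda>\<rparr>) \<phi> E. (-1) ^ n) / of_nat (card (rcosets\<^bsub>G\<^esub> \<Lambda>))"
    unfolding orb_euler_char_def P_def[symmetric] P orb_euler_char_space_def \<Lambda>_def[symmetric] by (simp add: Let_def)
  then show ?thesis using \<Lambda> X.finite_cell_orbits[OF X.finite_orbits] by blast
qed

section \<open>Fixed points as a complex for the centralizer\<close>

text \<open>
  A point \<open>z\<close> of the sphere is the limit of \<open>t z\<close> as \<open>t\<close> tends to \<open>1\<close> from below.
\<close>

lemma closure_of_open_unit_disc: "unit_disc n closure_of open_unit_disc n = topspace (unit_disc n)"
proof (rule antisym[OF closure_of_subset_topspace], rule subsetI)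
  fix z assume z: "z \<in> topspace (unit_disc n)"
  then have zE: "z \<in> topspace (Euclidean_space n)" and z1: "(\<Sum>i<n. z i ^ 2) \<le> 1"
    by (auto simp: unit_disc_def)
  let ?f = "\<lambda>t::real. \<lambda>i. t * z i"
  have sum: "(\<Sum>i<n. (t * z i) ^ 2) = t ^ 2 * (\<Sum>i<n. z i ^ 2)" for t
    by (simp add: power_mult_distrib sum_distrib_left)
  have fE: "?f t \<in> topspace (Euclidean_space n)" for t
    using zE by (auto simp: topspace_Euclidean_space)
  have le: "t ^ 2 * (\<Sum>i<n. z i ^ 2) \<le> t ^ 2" for t using mult_left_mono[OF z1, of "t ^ 2"] by simp
  have "continuous_map (top_of_set {0..1}) (unit_disc n) ?f"
    unfolding unit_disc_def continuous_map_in_subtopology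
  proof
    show "continuous_map (top_of_set {0..1}) (Euclidean_space n) ?f"
      unfolding Euclidean_space_def continuous_map_in_subtopology
    proof
      show "continuous_map (top_of_set {0..1}) (powertop_real UNIV) ?f"
        unfolding continuous_map_componentwise_UNIV by (auto intro!: continuous_intros)
      show "?f \<in> topspace (top_of_set {0..1}) \<rightarrow> {x. \<forall>i\<ge>n. x i = 0}"
        using zE by (auto simp: topspace_Euclidean_space)
    qed
    have "(\<Sum>i<n. (?f t i) ^ 2) \<le> 1" if "t \<in> {0..1}" for t
    proof -
      have "t ^ 2 \<le> 1" using that by (simp add: power_le_one)
      then show ?thesis unfolding sum using le[of t] by linarith
    qed
    then show "?f \<in> topspace (top_of_set {0..1}) \<rightarrow> {x. (\<Sum>i<n. (x i)\<^sup>2) \<le> 1}" by auto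
  qed
  then have "?f ` (top_of_set {0..1} closure_of {0..<1}) \<subseteq> unit_disc n closure_of (?f ` {0..<1})"
    by (rule continuous_map_image_closure_subset)
  moreover have "(1::real) \<in> top_of_set {0..1} closure_of {0..<1}"
  proof -
    have "{0..1::real} \<inter> {0..<1} = {0..<1}" by auto
    then show ?thesis by (simp add: closure_of_subtopology)
  qed
  ultimately have "z \<in> unit_disc n closure_of (?f ` {0..<1})" by force
  moreover have "?f ` {0..<1} \<subseteq> open_unit_disc n"
  proof (rule image_subsetI)
    fix t :: real assume t: "t \<in> {0..<1}"
    then have "t ^ 2 < 1" by (simp add: power2_less_1_iff abs_less_iff power_less_one_iff)
    then have "(\<Sum>i<n. (?f t i) ^ 2) < 1" unfolding sum using le[of t] by linarith
    then show "?f t \<in> open_unit_disc n" using fE by (simp add: open_unit_disc_def)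
  qed
  ultimately show "z \<in> unit_disc n closure_of open_unit_disc n" using closure_of_mono by blast
qed

context G_CW_complex
begin

lemma closedin_fixed_points:
  assumes "H \<subseteq> carrier K"
  shows "closedin X (fixed_points X \<phi> H)"
proof -
  have "fixed_points X \<phi> H = \<Inter>(insert (topspace X) ((\<lambda>h. {x \<in> topspace X. \<phi> h x = x}) ` H))"
    by (auto simp: fixed_points_def)
  moreover have "closedin X {x \<in> topspace X. \<phi> h x = x}" if "h \<in> H" for h
    using closedin_continuous_maps_eq[OF cwD(1) actionD(2) continuous_map_id] that assms by auto
  moreover have "closedin X (\<Inter>(insert (topspace X) ((\<lambda>h. {x \<in> topspace X. \<phi> h x = x}) ` H)))"
    by (rule closedin_Inter) (use calculation(2) in auto)
  ultimately show ?thesis by (simp only:)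
qed

text \<open>
  An element that fixes one point of a cell maps the cell to itself, hence fixes all of it. So
  the set of fixed points is a union of cells.
\<close>

lemma cell_subset_fixed_points:
  assumes "H \<subseteq> carrier K" "e \<in> E n" "x \<in> e" "x \<in> fixed_points X \<phi> H"
  shows "e \<subseteq> fixed_points X \<phi> H"
proof
  fix y assume y: "y \<in> e"
  have "\<phi> h y = y" if h: "h \<in> H" for h
  proof -
    have hK: "h \<in> carrier K" using h assms(1) by blast
    have "\<phi> h x = x" using h assms(4) by (simp add: fixed_points_def)
    then have "\<phi> h ` e = e" using translate_meets_cell(2)[OF hK assms(2,2,3)] assms(3) by simp
    then show ?thesis using cell_fix[OF hK assms(2) _ y] by simp
  qed
  then show "y \<in> fixed_points X \<phi> H" using y cell_subset[OF assms(2)] by (auto simp: fixed_points_def)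
qed

lemma cell_subset_fixed_points_iff:
  assumes "H \<subseteq> carrier K" "e \<in> E n"
  shows "e \<subseteq> fixed_points X \<phi> H \<longleftrightarrow> (\<forall>h\<in>H. \<phi> h ` e = e)"
proof
  assume "e \<subseteq> fixed_points X \<phi> H"
  then show "\<forall>h\<in>H. \<phi> h ` e = e" by (auto simp: fixed_points_def subset_iff image_iff)
next
  assume fixed: "\<forall>h\<in>H. \<phi> h ` e = e"
  show "e \<subseteq> fixed_points X \<phi> H"
  proof
    fix x assume x: "x \<in> e"
    have "\<phi> h x = x" if h: "h \<in> H" for h
      using cell_fix[OF _ assms(2) _ x, of h] h assms(1) fixed by blast
    then show "x \<in> fixed_points X \<phi> H" using x cell_subset[OF assms(2)] by (auto simp: fixed_points_def)
  qed
qed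

lemma centralizer_fixed_points:
  assumes "H \<subseteq> carrier K" "g \<in> carrier (centralizer_group K H)" "x \<in> fixed_points X \<phi> H"
  shows "\<phi> g x \<in> fixed_points X \<phi> H"
proof -
  have g: "g \<in> carrier K" "\<And>h. h \<in> H \<Longrightarrow> g \<otimes> h = h \<otimes> g" using assms(2) by auto
  have x: "x \<in> topspace X" "\<And>h. h \<in> H \<Longrightarrow> \<phi> h x = x" using assms(3) by (auto simp: fixed_points_def)
  have "\<phi> h (\<phi> g x) = \<phi> g x" if "h \<in> H" for h
    using actionD(4)[of h g x] actionD(4)[of g h x] g x that assms(1) by auto
  then show ?thesis using actionD(5)[OF g(1) x(1)] by (simp add: fixed_points_def)
qed

text \<open>
  The characteristic map of a fixed cell takes values in the fixed points, because these form a
  closed set and the open disc is dense in the closed one. For the weak topology, note that a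
  cell outside the fixed points may have a closure that meets them, but only in finitely many
  fixed cells.
\<close>

lemma CW_structure_fixed_points:
  assumes H: "H \<subseteq> carrier K"
  shows "CW_structure (subtopology X (fixed_points X \<phi> H)) (\<lambda>n. {e \<in> E n. e \<subseteq> fixed_points X \<phi> H})"
proof -
  let ?Y = "fixed_points X \<phi> H"
  note cw = CW[unfolded CW_structure_def]
  note char = conjunct1[OF conjunct2[OF conjunct2[OF conjunct2[OF cw]]]]
  have Ytop: "?Y \<subseteq> topspace X" by (auto simp: fixed_points_def)
  have Ycl: "closedin X ?Y" by (rule closedin_fixed_points[OF H])
  have top: "topspace (subtopology X ?Y) = ?Y" using Ytop by auto
  show ?thesis
    unfolding CW_structure_def
  proof (intro conjI allI ballI impI)
    show "Hausdorff_space (subtopology X ?Y)" by (rule Hausdorff_space_subtopology[OF cwD(1)])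
    show "topspace (subtopology X ?Y) = (\<Union>n. \<Union>{e \<in> E n. e \<subseteq> ?Y})"
      unfolding top
    proof (intro equalityI subsetI)
      fix x assume x: "x \<in> ?Y"
      then have "x \<in> topspace X" using Ytop by blast
      then obtain n e where e: "e \<in> E n" "x \<in> e" unfolding cwD(2) by blast
      then show "x \<in> (\<Union>n. \<Union>{e \<in> E n. e \<subseteq> ?Y})" using cell_subset_fixed_points[OF H e x] by blast
    qed blast
    show "d \<inter> e = {}" if "d \<in> {e \<in> E m. e \<subseteq> ?Y}" "e \<in> {e \<in> E n. e \<subseteq> ?Y}" "(m, d) \<noteq> (n, e)" for m n d e
      using cwD(3)[of d m e n] that by blast
  next
    fix n e assume "e \<in> {e \<in> E n. e \<subseteq> ?Y}"
    then have e: "e \<in> E n" "e \<subseteq> ?Y" by simp_all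
    obtain \<Phi> F where \<Phi>: "continuous_map (unit_disc n) X \<Phi>"
      "homeomorphic_map (subtopology (unit_disc n) (open_unit_disc n)) (subtopology X e) \<Phi>"
      and F: "finite F" "F \<subseteq> (\<Union>m<n. E m)" "\<Phi> ` unit_disc_boundary n \<subseteq> \<Union>F"
      using bspec[OF spec[OF char, of n] e(1)] by (elim exE conjE) (rule that, assumption+)
    have sub: "unit_disc_boundary n \<subseteq> topspace (unit_disc n)" by (simp add: topspace_unit_disc)
    have img: "\<Phi> ` topspace (unit_disc n) \<subseteq> ?Y"
    proof -
      have "topspace (subtopology (unit_disc n) (open_unit_disc n)) = open_unit_disc n"
        by (auto simp: topspace_unit_disc)
      moreover have "topspace (subtopology X e) = e" using cell_subset[OF e(1)] by auto
      ultimately have "\<Phi> ` open_unit_disc n = e" using homeomorphic_imp_surjective_map[OF \<Phi>(2)] by auto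
      then have "\<Phi> ` (unit_disc n closure_of open_unit_disc n) \<subseteq> X closure_of e"
        using continuous_map_image_closure_subset[OF \<Phi>(1), of "open_unit_disc n"] by simp
      then show ?thesis unfolding closure_of_open_unit_disc using closure_of_minimal[OF e(2) Ycl] by blast
    qed
    show "\<exists>\<Phi>. continuous_map (unit_disc n) (subtopology X ?Y) \<Phi> \<and>
            homeomorphic_map (subtopology (unit_disc n) (open_unit_disc n)) (subtopology (subtopology X ?Y) e) \<Phi> \<and>
            (\<exists>F. finite F \<and> F \<subseteq> (\<Union>m<n. {e \<in> E m. e \<subseteq> ?Y}) \<and> \<Phi> ` unit_disc_boundary n \<subseteq> \<Union>F)"
    proof (intro exI[of _ \<Phi>] conjI exI[of _ "{d \<in> F. d \<subseteq> ?Y}"])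
      show "continuous_map (unit_disc n) (subtopology X ?Y) \<Phi>"
        using \<Phi>(1) img by (auto simp: continuous_map_in_subtopology)
      have "?Y \<inter> e = e" using e(2) by blast
      then show "homeomorphic_map (subtopology (unit_disc n) (open_unit_disc n)) (subtopology (subtopology X ?Y) e) \<Phi>"
        using \<Phi>(2) by (simp add: subtopology_subtopology)
      show "finite {d \<in> F. d \<subseteq> ?Y}" using F(1) by simp
      show "{d \<in> F. d \<subseteq> ?Y} \<subseteq> (\<Union>m<n. {e \<in> E m. e \<subseteq> ?Y})" using F(2) by blast
      show "\<Phi> ` unit_disc_boundary n \<subseteq> \<Union>{d \<in> F. d \<subseteq> ?Y}"
      proof
        fix z assume z: "z \<in> \<Phi> ` unit_disc_boundary n"
        then obtain d where d: "d \<in> F" "z \<in> d" using F(3) by blast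
        then obtain m where m: "d \<in> E m" using F(2) by blast
        have "z \<in> ?Y" using z sub img by blast
        then have "d \<subseteq> ?Y" by (rule cell_subset_fixed_points[OF H m d(2)])
        then show "z \<in> \<Union>{d \<in> F. d \<subseteq> ?Y}" using d by blast
      qed
    qed
  next
    fix A assume "A \<subseteq> topspace (subtopology X ?Y)"
      and A: "\<forall>n. \<forall>e\<in>{e \<in> E n. e \<subseteq> ?Y}. closedin (subtopology X ?Y) (A \<inter> subtopology X ?Y closure_of e)"
    then have AY: "A \<subseteq> ?Y" by simp
    have clA: "closedin X (A \<inter> X closure_of d)" if d: "d \<in> E m" "d \<subseteq> ?Y" for m d
    proof -
      have "?Y \<inter> d = d" using d(2) by blast
      moreover have "A \<inter> (?Y \<inter> X closure_of d) = A \<inter> X closure_of d" using AY by blast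
      moreover have "closedin (subtopology X ?Y) (A \<inter> subtopology X ?Y closure_of d)" using A d by blast
      ultimately have "closedin (subtopology X ?Y) (A \<inter> X closure_of d)" by (simp add: closure_of_subtopology)
      then show ?thesis using closedin_trans_full[OF _ Ycl] by blast
    qed
    have "closedin X A"
    proof (rule cwD(5))
      show "A \<subseteq> topspace X" using AY Ytop by blast
      fix n e assume e: "e \<in> E n"
      obtain F where F: "finite F" "F \<subseteq> (\<Union>m. E m)" "X closure_of e \<subseteq> \<Union>F"
        using cell_closure_finite(2)[OF CW e] by blast
      let ?F = "{d \<in> F. d \<subseteq> ?Y}"
      have "A \<inter> X closure_of e = (\<Union>d\<in>?F. A \<inter> X closure_of d) \<inter> X closure_of e"
      proof (intro equalityI subsetI)
        fix z assume z: "z \<in> A \<inter> X closure_of e"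
        then obtain d where d: "d \<in> F" "z \<in> d" using F(3) by blast
        then obtain m where m: "d \<in> E m" using F(2) by blast
        have "d \<subseteq> ?Y" by (rule cell_subset_fixed_points[OF H m d(2)]) (use z AY in blast)
        moreover have "z \<in> X closure_of d" using closure_of_subset[OF cell_subset[OF m]] d(2) by blast
        ultimately show "z \<in> (\<Union>d\<in>?F. A \<inter> X closure_of d) \<inter> X closure_of e" using d z by blast
      qed blast
      moreover have "closedin X (\<Union>d\<in>?F. A \<inter> X closure_of d)"
      proof (rule closedin_Union)
        show "finite ((\<lambda>d. A \<inter> X closure_of d) ` ?F)" using F(1) by simp
        fix S assume "S \<in> (\<lambda>d. A \<inter> X closure_of d) ` ?F"
        then obtain d where d: "d \<in> F" "d \<subseteq> ?Y" "S = A \<inter> X closure_of d" by blast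
        then obtain m where "d \<in> E m" using F(2) by blast
        then show "closedin X S" using clA d by blast
      qed
      ultimately show "closedin X (A \<inter> X closure_of e)" by (simp add: closedin_Int)
    qed
    then show "closedin (subtopology X ?Y) A" using closedin_subset_topspace[OF _ AY] by blast
  qed
qed

lemma G_CW_structure_fixed_points:
  assumes H: "H \<subseteq> carrier K"
  shows "G_CW_structure (centralizer_group K H) (subtopology X (fixed_points X \<phi> H))
    (\<lambda>g. restrict (\<phi> g) (fixed_points X \<phi> H)) (\<lambda>n. {e \<in> E n. e \<subseteq> fixed_points X \<phi> H})"
proof -
  let ?Y = "fixed_points X \<phi> H" and ?C = "centralizer_group K H"
  have Ytop: "?Y \<subseteq> topspace X" by (auto simp: fixed_points_def)
  then have top: "topspace (subtopology X ?Y) = ?Y" by auto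
  have CK: "g \<in> carrier K" if "g \<in> carrier ?C" for g using that by simp
  note closed = centralizer_fixed_points[OF H]
  have res: "restrict (\<phi> g) ?Y ` e = \<phi> g ` e" if "e \<subseteq> ?Y" for g e
    using that by (intro image_cong) auto
  show ?thesis
    unfolding G_CW_structure_def top
  proof (intro conjI ballI allI impI)
    show "group_action ?C ?Y (\<lambda>g. restrict (\<phi> g) ?Y)"
    proof (rule group_actionI)
      show "group ?C" by (rule group_centralizer_group[OF is_group H])
      show "\<phi> g x \<in> ?Y" if "g \<in> carrier ?C" "x \<in> ?Y" for g x using closed that .
      show "\<phi> \<one>\<^bsub>?C\<^esub> x = x" if "x \<in> ?Y" for x using actionD(3) that Ytop by auto
      show "\<phi> (g \<otimes>\<^bsub>?C\<^esub> h) x = \<phi> g (\<phi> h x)" if "g \<in> carrier ?C" "h \<in> carrier ?C" "x \<in> ?Y" for g h x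
        using actionD(4)[OF CK[OF that(1)] CK[OF that(2)]] that(3) Ytop by auto
    qed
    show "CW_structure (subtopology X ?Y) (\<lambda>n. {e \<in> E n. e \<subseteq> ?Y})" by (rule CW_structure_fixed_points[OF H])
    fix g assume g: "g \<in> carrier ?C"
    have "continuous_map (subtopology X ?Y) (subtopology X ?Y) (\<phi> g)"
      using continuous_map_from_subtopology[OF actionD(2)[OF CK[OF g]]] closed[OF g] top
      by (auto simp: continuous_map_in_subtopology)
    then show "continuous_map (subtopology X ?Y) (subtopology X ?Y) (restrict (\<phi> g) ?Y)"
      by (rule continuous_map_eq) (simp add: top)
    fix n e assume e: "e \<in> {e \<in> E n. e \<subseteq> ?Y}"
    then have e': "e \<in> E n" "e \<subseteq> ?Y" by simp_all
    have "\<phi> g ` e \<subseteq> ?Y" using closed[OF g] e'(2) by blast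
    then show "restrict (\<phi> g) ?Y ` e \<in> {e \<in> E n. e \<subseteq> ?Y}"
      using cell_image[OF CK[OF g] e'(1)] by (simp only: res[OF e'(2)] mem_Collect_eq simp_thms)
    show "restrict (\<phi> g) ?Y x = x" if "restrict (\<phi> g) ?Y ` e = e" "x \<in> e" for x
      using cell_fix[OF CK[OF g] e'(1) _ that(2)] that res[OF e'(2)] e'(2) by auto
  qed
qed

end

lemma (in group) subgroup_set_mult_commuting:
  assumes L: "subgroup L G" and H: "subgroup H G"
    and comm: "\<And>l h. l \<in> L \<Longrightarrow> h \<in> H \<Longrightarrow> l \<otimes> h = h \<otimes> l"
  shows "subgroup (L <#> H) G"
proof -
  note LG = subgroup.mem_carrier[OF L] and HG = subgroup.mem_carrier[OF H]
  show ?thesis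
  proof (rule subgroupI)
    show "L <#> H \<subseteq> carrier G" using LG HG unfolding set_mult_def by blast
    have "\<one> \<otimes> \<one> \<in> L <#> H"
      using subgroup.one_closed[OF L] subgroup.one_closed[OF H] unfolding set_mult_def by blast
    then show "L <#> H \<noteq> {}" by blast
  next
    fix a assume "a \<in> L <#> H"
    then obtain l h where a: "l \<in> L" "h \<in> H" "a = l \<otimes> h" unfolding set_mult_def by blast
    have i: "inv l \<in> L" "inv h \<in> H" using a subgroup.m_inv_closed L H by metis+
    have "inv a = inv h \<otimes> inv l" using a LG HG by (simp add: inv_mult_group)
    also have "\<dots> = inv l \<otimes> inv h" using comm[OF i] by simp
    finally show "inv a \<in> L <#> H" using i unfolding set_mult_def by blast
    fix b assume "b \<in> L <#> H"
    then obtain l' h' where b: "l' \<in> L" "h' \<in> H" "b = l' \<otimes> h'" unfolding set_mult_def by blast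
    have c: "l \<in> carrier G" "h \<in> carrier G" "l' \<in> carrier G" "h' \<in> carrier G" using a b LG HG by auto
    have "a \<otimes> b = l \<otimes> (h \<otimes> l') \<otimes> h'" using a b c by (simp add: m_assoc)
    also have "\<dots> = l \<otimes> (l' \<otimes> h) \<otimes> h'" using comm[OF b(1) a(2)] by simp
    also have "\<dots> = (l \<otimes> l') \<otimes> (h \<otimes> h')" using c by (simp add: m_assoc)
    finally have "a \<otimes> b = (l \<otimes> l') \<otimes> (h \<otimes> h')" .
    moreover have "l \<otimes> l' \<in> L" "h \<otimes> h' \<in> H" using a b subgroup.m_closed L H by metis+
    ultimately show "a \<otimes> b \<in> L <#> H" unfolding set_mult_def by blast
  qed
qed

lemma (in group) subset_set_mult:
  assumes "subgroup L G" "subgroup H G"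
  shows "L \<subseteq> L <#> H" "H \<subseteq> L <#> H"
proof -
  show "L \<subseteq> L <#> H"
  proof
    fix l assume l: "l \<in> L"
    then have "l = l \<otimes> \<one>" using subgroup.mem_carrier[OF assms(1)] by simp
    then show "l \<in> L <#> H" using l subgroup.one_closed[OF assms(2)] unfolding set_mult_def by blast
  qed
  show "H \<subseteq> L <#> H"
  proof
    fix h assume h: "h \<in> H"
    then have "h = \<one> \<otimes> h" using subgroup.mem_carrier[OF assms(2)] by simp
    then show "h \<in> L <#> H" using h subgroup.one_closed[OF assms(1)] unfolding set_mult_def by blast
  qed
qed

lemma finite_set_mult: "finite L \<Longrightarrow> finite H \<Longrightarrow> finite (L <#>\<^bsub>G\<^esub> H)"
  unfolding set_mult_def by simp

lemma (in group) centralizes_generate: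
  assumes "A \<subseteq> carrier G" "x \<in> carrier G" "\<And>a. a \<in> A \<Longrightarrow> x \<otimes> a = a \<otimes> x" "b \<in> generate G A"
  shows "x \<otimes> b = b \<otimes> x"
proof -
  have "A \<subseteq> {b \<in> carrier G. \<forall>y\<in>{x}. b \<otimes> y = y \<otimes> b}" using assms(1,3) by force
  then have "generate G A \<subseteq> {b \<in> carrier G. \<forall>y\<in>{x}. b \<otimes> y = y \<otimes> b}"
    using generate_subgroup_incl subgroup_centralizer[OF is_group, of "{x}"] assms(2) by blast
  then show ?thesis using assms(4) by force
qed

lemma (in group) centralizer_group_generate:
  assumes "A \<subseteq> carrier G"
  shows "centralizer_group G (generate G A) = centralizer_group G A"
proof -
  have "{x \<in> carrier G. \<forall>h\<in>generate G A. x \<otimes> h = h \<otimes> x} = {x \<in> carrier G. \<forall>h\<in>A. x \<otimes> h = h \<otimes> x}"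
    using centralizes_generate[OF assms] generate.incl[of _ A G] by blast
  then show ?thesis unfolding centralizer_group_def by simp
qed

lemma (in group) finite_generate_commuting_torsion:
  assumes "finite A" "A \<subseteq> carrier G" "\<And>a. a \<in> A \<Longrightarrow> ord a \<noteq> 0"
    "\<And>a b. a \<in> A \<Longrightarrow> b \<in> A \<Longrightarrow> a \<otimes> b = b \<otimes> a"
  shows "finite (generate G A)"
  using assms
proof (induction A rule: finite_induct)
  case empty
  then show ?case by (simp add: generate_empty)
next
  case (insert a A)
  let ?L = "generate G {a}" and ?H = "generate G A"
  have a: "a \<in> carrier G" and A: "A \<subseteq> carrier G" using insert.prems(1) by auto
  have finH: "finite ?H" using insert.IH A insert.prems(2,3) by simp
  have finL: "finite ?L"
    using generate_pow_card[OF a] insert.prems(2)[of a] by (metis card.infinite insertI1)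
  have sub: "subgroup ?L G" "subgroup ?H G" using a A by (auto intro: generate_is_subgroup)
  have "l \<otimes> h = h \<otimes> l" if "l \<in> ?L" "h \<in> ?H" for l h
  proof (rule centralizes_generate[OF A _ _ that(2)])
    show "l \<in> carrier G" using that(1) subgroup.mem_carrier[OF sub(1)] by simp
    fix b assume b: "b \<in> A"
    have "b \<otimes> l = l \<otimes> b"
      by (rule centralizes_generate[OF _ _ _ that(1)]) (use a A b insert.prems(3) in auto)
    then show "l \<otimes> b = b \<otimes> l" by simp
  qed
  then have "subgroup (?L <#> ?H) G" using subgroup_set_mult_commuting sub by blast
  moreover have "insert a A \<subseteq> ?L <#> ?H"
    using subset_set_mult[OF sub] generate.incl[of a "{a}" G] generate.incl[of _ A G] by blast
  ultimately have "generate G (insert a A) \<subseteq> ?L <#> ?H" by (rule generate_subgroup_incl[rotated])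
  then show ?case using finite_subset finite_set_mult[OF finL finH] by blast
qed

context G_CW_complex
begin

text \<open>
  Let \<open>r\<close> be a representative of an orbit of cells. If \<open>g r\<close> is fixed by \<open>H\<close>, then
  \<open>h \<mapsto> g\<^sup>-\<^sup>1 h g\<close> maps \<open>H\<close> to the stabilizer of \<open>r\<close>. There are finitely many such maps, and if
  \<open>g\<close> and \<open>g'\<close> induce the same one, then \<open>g' g\<^sup>-\<^sup>1\<close> centralizes \<open>H\<close> and carries \<open>g r\<close> to \<open>g' r\<close>.
\<close>

lemma finite_orbits_fixed_points:
  assumes H: "H \<subseteq> carrier K" "finite H"
    and fin: "finite (\<Union>n. orbits K (E n) (\<lambda>g e. \<phi> g ` e))"
    and stab: "\<And>n e. e \<in> E n \<Longrightarrow> finite {g \<in> carrier K. \<phi> g ` e = e}"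
  shows "finite (\<Union>n. orbits (centralizer_group K H) {e \<in> E n. e \<subseteq> fixed_points X \<phi> H}
    (\<lambda>g e. restrict (\<phi> g) (fixed_points X \<phi> H) ` e))"
proof -
  let ?Y = "fixed_points X \<phi> H" and ?C = "centralizer_group K H" and ?act = "\<lambda>g e. \<phi> g ` e"
  let ?\<psi> = "\<lambda>g. restrict (\<phi> g) ?Y"
  interpret C: G_CW_complex ?C "subtopology X ?Y" ?\<psi> "\<lambda>n. {e \<in> E n. e \<subseteq> ?Y}"
    by unfold_locales (rule G_CW_structure_fixed_points[OF H(1)])
  let ?O = "\<Union>n. orbits K (E n) ?act"
  have "\<forall>o'\<in>?O. \<exists>e. e \<in> (\<Union>n. E n) \<and> o' = orbit K ?act e" unfolding orbits_def by blast
  then obtain rep where rep: "\<And>o'. o' \<in> ?O \<Longrightarrow> rep o' \<in> (\<Union>n. E n) \<and> o' = orbit K ?act (rep o')"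
    by metis
  define S where "S o' = {g \<in> carrier K. \<phi> g ` rep o' = rep o'}" for o'
  \<comment> \<open>Restricted to \<open>H\<close>, so that its values lie in a finite extensional function space.\<close>
  define conj where "conj g = (\<lambda>h\<in>H. inv g \<otimes> h \<otimes> g)" for g
  define f where "f = (\<lambda>(o', c). orbit ?C (\<lambda>g e. ?\<psi> g ` e) (\<phi> (SOME g. g \<in> carrier K \<and> conj g = c \<and> \<phi> g ` rep o' \<subseteq> ?Y) ` rep o'))"
  have "(\<Union>n. orbits ?C {e \<in> E n. e \<subseteq> ?Y} (\<lambda>g e. ?\<psi> g ` e)) \<subseteq> f ` (SIGMA o':?O. PiE H (\<lambda>_. S o'))"
  proof
    fix z assume "z \<in> (\<Union>n. orbits ?C {e \<in> E n. e \<subseteq> ?Y} (\<lambda>g e. ?\<psi> g ` e))"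
    then obtain n e where e: "e \<in> E n" "e \<subseteq> ?Y" "z = orbit ?C (\<lambda>g e. ?\<psi> g ` e) e" unfolding orbits_def by blast
    define o' where "o' = orbit K ?act e"
    define r where "r = rep o'"
    have o': "o' \<in> ?O" using e(1) unfolding o'_def orbits_def by blast
    have r: "r \<in> (\<Union>n. E n)" "o' = orbit K ?act r" unfolding r_def using rep[OF o'] by (simp_all only:)
    have "e \<in> orbit K ?act r" using cell_orbit_mem[OF e(1)] r(2) unfolding o'_def by simp
    then obtain g where g: "g \<in> carrier K" "e = \<phi> g ` r" unfolding orbit_def by blast
    obtain m where m: "r \<in> E m" using r(1) by blast
    have unmove: "\<phi> (inv g) ` e = r"
      using cell_action(2)[OF m, of "inv g" g] cell_action(1)[OF m] g by simp
    define g' where "g' = (SOME g'. g' \<in> carrier K \<and> conj g' = conj g \<and> \<phi> g' ` rep o' \<subseteq> ?Y)"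
    have g': "g' \<in> carrier K" "conj g' = conj g" "\<phi> g' ` r \<subseteq> ?Y"
      using someI[of "\<lambda>g'. g' \<in> carrier K \<and> conj g' = conj g \<and> \<phi> g' ` rep o' \<subseteq> ?Y" g] g e(2)
      unfolding g'_def[symmetric] r_def by simp_all
    have "conj g \<in> PiE H (\<lambda>_. S o')"
    proof (rule PiE_I)
      fix h assume h: "h \<in> H"
      have hK: "h \<in> carrier K" using h H by blast
      have "\<phi> h ` e = e" using cell_subset_fixed_points_iff[OF H(1) e(1)] e(2) h by blast
      then have "\<phi> (inv g \<otimes> (h \<otimes> g)) ` r = r"
        using cell_action(2)[OF m, of "inv g" "h \<otimes> g"] cell_action(2)[OF m, of h g] g hK unmove by simp
      then show "conj g h \<in> S o'" using h g hK by (simp add: conj_def S_def r_def m_assoc)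
    qed (simp add: conj_def)
    then have in_dom: "(o', conj g) \<in> (SIGMA o':?O. PiE H (\<lambda>_. S o'))" using o' by blast
    define c where "c = g' \<otimes> inv g"
    have cC: "c \<in> carrier ?C"
    proof -
      have "c \<otimes> h = h \<otimes> c" if h: "h \<in> H" for h
      proof -
        have hK: "h \<in> carrier K" using h H by blast
        have "inv g' \<otimes> h \<otimes> g' = inv g \<otimes> h \<otimes> g" using fun_cong[OF g'(2), of h] h by (simp add: conj_def)
        then have "g' \<otimes> (inv g' \<otimes> h \<otimes> g') \<otimes> inv g = g' \<otimes> (inv g \<otimes> h \<otimes> g) \<otimes> inv g" by simp
        then show ?thesis using g(1) g'(1) hK unfolding c_def by (simp add: m_assoc inv_mult_cancel)
      qed
      then show ?thesis using g(1) g'(1) by (simp add: c_def)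
    qed
    have "\<phi> g' ` r = \<phi> c ` e"
      using cell_action(2)[OF m, of c g] g g'(1) by (simp add: c_def m_assoc)
    also have "\<dots> = ?\<psi> c ` e" using e(2) by (intro image_cong) auto
    finally have "orbit ?C (\<lambda>g e. ?\<psi> g ` e) (\<phi> g' ` r) = z"
      using C.cell_orbit_eq[OF _ cC, of e n] e by simp
    then have "z = f (o', conj g)" by (simp add: f_def g'_def r_def)
    then show "z \<in> f ` (SIGMA o':?O. PiE H (\<lambda>_. S o'))" using in_dom by (rule image_eqI)
  qed
  moreover have "finite (SIGMA o':?O. PiE H (\<lambda>_. S o'))"
  proof (rule finite_SigmaI[OF fin])
    fix o' assume "o' \<in> ?O"
    then obtain n where "rep o' \<in> E n" using rep by blast
    then show "finite (PiE H (\<lambda>_. S o'))" using stab unfolding S_def by (intro finite_PiE[OF H(2)]) 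
  qed
  ultimately show ?thesis using finite_subset by blast
qed

lemma finite_EG_model_cell_stabilizer:
  assumes "finite_EG_model K X \<phi>" "e \<in> E n"
  shows "finite {g \<in> carrier K. \<phi> g ` e = e}"
proof -
  obtain x where x: "x \<in> e" using cell_nonempty[OF CW assms(2)] by blast
  have "{g \<in> carrier K. \<phi> g ` e = e} \<subseteq> stabilizer K \<phi> x"
    using cell_fix[OF _ assms(2) _ x] by (auto simp: stabilizer_def)
  then show ?thesis
    using finite_EG_model_imp_finite_stabilizer(1)[OF assms(1), of x] cell_subset[OF assms(2)] x finite_subset by blast
qed

end

text \<open>
  A subgroup \<open>L\<close> of the centralizer of \<open>H\<close> commutes with \<open>H\<close>, so \<open>L H\<close> is a subgroup of \<open>G\<close>,
  finite if and only if \<open>L\<close> is, and the points of the fixed set of \<open>H\<close> that \<open>L\<close> fixes are the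
  points fixed by \<open>L H\<close>.
\<close>

theorem finite_EG_model_fixed_points:
  assumes gcw: "G_CW_structure G X \<phi> E" and fin: "finite (\<Union>n. orbits G (E n) (\<lambda>g e. \<phi> g ` e))"
    and model: "finite_EG_model G X \<phi>" and H: "subgroup H G" "finite H"
  shows "finite_EG_model (centralizer_group G H) (subtopology X (fixed_points X \<phi> H))
    (\<lambda>g. restrict (\<phi> g) (fixed_points X \<phi> H))"
proof -
  interpret G_CW_complex G X \<phi> E by unfold_locales (rule gcw)
  let ?Y = "fixed_points X \<phi> H" and ?C = "centralizer_group G H"
  let ?\<psi> = "\<lambda>g. restrict (\<phi> g) ?Y" and ?XY = "subtopology X (fixed_points X \<phi> H)"
  have HG: "H \<subseteq> carrier G" using subgroup.subset[OF H(1)] .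
  have "finite_G_CW ?C ?XY ?\<psi>"
    unfolding finite_G_CW_def
    by (intro exI conjI, rule G_CW_structure_fixed_points[OF HG])
      (rule finite_orbits_fixed_points[OF HG H(2) fin finite_EG_model_cell_stabilizer[OF model]])
  moreover have "if finite L then fixed_points ?XY ?\<psi> L \<noteq> {} \<and> contractible_space (subtopology ?XY (fixed_points ?XY ?\<psi> L))
      else fixed_points ?XY ?\<psi> L = {}" if L: "subgroup L ?C" for L
  proof -
    have mod: "if finite M then fixed_points X \<phi> M \<noteq> {} \<and> contractible_space (subtopology X (fixed_points X \<phi> M))
      else fixed_points X \<phi> M = {}" if "subgroup M G" for M
      using model that unfolding finite_EG_model_def by blast
    have LC: "L \<subseteq> carrier ?C" using subgroup.subset[OF L] .
    have LG: "subgroup L G"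
      using incl_subgroup[OF subgroup_centralizer[OF is_group HG]] L unfolding centralizer_group_def by blast
    have comm: "l \<otimes>\<^bsub>G\<^esub> h = h \<otimes>\<^bsub>G\<^esub> l" if "l \<in> L" "h \<in> H" for l h using LC that by auto
    let ?M = "L <#>\<^bsub>G\<^esub> H"
    have M: "subgroup ?M G" using subgroup_set_mult_commuting[OF LG H(1) comm] by blast
    have fixM: "fixed_points ?XY ?\<psi> L = fixed_points X \<phi> ?M"
    proof (intro equalityI subsetI)
      fix x assume "x \<in> fixed_points ?XY ?\<psi> L"
      then have x: "x \<in> topspace X" "\<And>h. h \<in> H \<Longrightarrow> \<phi> h x = x" "\<And>l. l \<in> L \<Longrightarrow> \<phi> l x = x"
        by (auto simp: fixed_points_def)
      have "\<phi> (l \<otimes>\<^bsub>G\<^esub> h) x = x" if "l \<in> L" "h \<in> H" for l h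
        using actionD(4)[of l h x] x that subgroup.mem_carrier[OF LG] HG by auto
      then show "x \<in> fixed_points X \<phi> ?M" using x(1) by (auto simp: fixed_points_def set_mult_def)
    next
      fix x assume "x \<in> fixed_points X \<phi> ?M"
      then show "x \<in> fixed_points ?XY ?\<psi> L"
        using subset_set_mult[OF LG H(1)] by (auto simp: fixed_points_def subset_iff)
    qed
    have "?Y \<inter> fixed_points X \<phi> ?M = fixed_points X \<phi> ?M" unfolding fixM[symmetric] by (auto simp: fixed_points_def)
    moreover have "finite ?M \<longleftrightarrow> finite L"
      using finite_set_mult[OF _ H(2), of L G] subset_set_mult(1)[OF LG H(1)] finite_subset by blast
    ultimately show ?thesis using mod[OF M] unfolding fixM by (simp add: subtopology_subtopology)
  qed
  ultimately show ?thesis unfolding finite_EG_model_def by blast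
qed

lemma virtually_torsion_free_centralizer:
  assumes "group G" "virtually_torsion_free G" "H \<subseteq> carrier G"
  shows "virtually_torsion_free (centralizer_group G H)"
proof -
  interpret group G by fact
  obtain \<Lambda> where sub: "subgroup \<Lambda> G" and fin: "finite (rcosets\<^bsub>G\<^esub> \<Lambda>)"
    and tf: "\<And>x k. x \<in> \<Lambda> \<Longrightarrow> 0 < (k::nat) \<Longrightarrow> x [^]\<^bsub>G\<^esub> k = \<one>\<^bsub>G\<^esub> \<Longrightarrow> x = \<one>\<^bsub>G\<^esub>"
    using assms(2) unfolding virtually_torsion_free_def torsion_free_finite_index_def by blast
  define S where "S = {x \<in> carrier G. \<forall>h\<in>H. x \<otimes>\<^bsub>G\<^esub> h = h \<otimes>\<^bsub>G\<^esub> x}"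
  let ?C = "G\<lparr>carrier := S\<rparr>"
  have S: "subgroup S G" unfolding S_def by (rule subgroup_centralizer[OF assms(1,3)])
  have C: "centralizer_group G H = ?C" by (simp add: centralizer_group_def S_def)
  have "subgroup (\<Lambda> \<inter> S) ?C"
    by (rule subgroup_incl[OF subgroups_Inter_pair[OF sub S] S]) simp
  moreover have "finite (rcosets\<^bsub>?C\<^esub> (\<Lambda> \<inter> S))"
  proof (rule finite_subset)
    show "rcosets\<^bsub>?C\<^esub> (\<Lambda> \<inter> S) \<subseteq> (\<lambda>D. D \<inter> S) ` (rcosets\<^bsub>G\<^esub> \<Lambda>)"
    proof
      fix D assume "D \<in> rcosets\<^bsub>?C\<^esub> (\<Lambda> \<inter> S)"
      then obtain c where c: "c \<in> S" "D = (\<Lambda> \<inter> S) #>\<^bsub>?C\<^esub> c" unfolding RCOSETS_def by auto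
      have cG: "c \<in> carrier G" using subgroup.mem_carrier[OF S c(1)] .
      have "D = (\<Lambda> #>\<^bsub>G\<^esub> c) \<inter> S"
      proof (intro equalityI subsetI)
        fix x assume "x \<in> D"
        then obtain l where "l \<in> \<Lambda>" "l \<in> S" "x = l \<otimes>\<^bsub>G\<^esub> c" unfolding c(2) r_coset_def by auto
        then show "x \<in> (\<Lambda> #>\<^bsub>G\<^esub> c) \<inter> S" using subgroup.m_closed[OF S _ c(1)] unfolding r_coset_def by blast
      next
        fix x assume "x \<in> (\<Lambda> #>\<^bsub>G\<^esub> c) \<inter> S"
        then obtain l where l: "l \<in> \<Lambda>" "x = l \<otimes>\<^bsub>G\<^esub> c" and x: "x \<in> S" unfolding r_coset_def by blast
        have "l \<in> carrier G" using l(1) subgroup.mem_carrier[OF sub] by simp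
        then have "l = x \<otimes>\<^bsub>G\<^esub> inv\<^bsub>G\<^esub> c" using l(2) cG by (simp add: m_assoc)
        then have "l \<in> S" using subgroup.m_closed[OF S x subgroup.m_inv_closed[OF S c(1)]] by simp
        then show "x \<in> D" unfolding c(2) r_coset_def using l by auto
      qed
      then show "D \<in> (\<lambda>D. D \<inter> S) ` (rcosets\<^bsub>G\<^esub> \<Lambda>)" unfolding RCOSETS_def using cG by blast
    qed
  qed (use fin in simp)
  ultimately show ?thesis
    unfolding C virtually_torsion_free_def torsion_free_finite_index_def
    using tf by (intro exI[of _ "\<Lambda> \<inter> S"]) (auto simp: nat_pow_def)
qed

section \<open>Counting fixed cells\<close>

lemma card_uniform_fibres:
  assumes "finite (f ` Q)" "\<And>q. q \<in> Q \<Longrightarrow> finite {x \<in> Q. f x = f q} \<and> card {x \<in> Q. f x = f q} = k"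
  shows "finite Q" "card Q = card (f ` Q) * k"
proof -
  have "Q = (\<Union>y\<in>f ` Q. {x \<in> Q. f x = y})" by blast
  moreover have "finite (\<Union>y\<in>f ` Q. {x \<in> Q. f x = y})" using assms by blast
  ultimately show fin: "finite Q" by (rule ssubst)
  have "card Q = (\<Sum>y\<in>f ` Q. card {x \<in> Q. f x = y})"
    unfolding card_eq_sum by (rule sum.image_gen[OF fin])
  also have "\<dots> = (\<Sum>y\<in>f ` Q. k)" by (rule sum.cong) (use assms(2) in auto)
  finally show "card Q = card (f ` Q) * k" by simp
qed

lemma (in group) rcoset_eq_iff:
  assumes "subgroup \<Lambda> G" "x \<in> carrier G" "y \<in> carrier G"
  shows "\<Lambda> #> x = \<Lambda> #> y \<longleftrightarrow> (\<exists>l\<in>\<Lambda>. x = l \<otimes> y)"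
proof
  assume "\<Lambda> #> x = \<Lambda> #> y"
  then have "x \<in> \<Lambda> #> y" using rcos_self[OF assms(2,1)] by simp
  then show "\<exists>l\<in>\<Lambda>. x = l \<otimes> y" unfolding r_coset_def by blast
next
  assume "\<exists>l\<in>\<Lambda>. x = l \<otimes> y"
  then have "x \<in> \<Lambda> #> y" unfolding r_coset_def by blast
  then show "\<Lambda> #> x = \<Lambda> #> y" using repr_independence[OF _ assms(3,1)] by simp
qed

context G_CW_complex
begin

lemma subgroup_cell_stabilizer:
  assumes "r \<in> E m"
  shows "subgroup {g \<in> carrier K. \<phi> g ` r = r} K"
proof (rule subgroupI)
  show "{g \<in> carrier K. \<phi> g ` r = r} \<noteq> {}" using cell_action(1)[OF assms] by blast
  fix a assume a: "a \<in> {g \<in> carrier K. \<phi> g ` r = r}"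
  then show "inv a \<in> {g \<in> carrier K. \<phi> g ` r = r}"
    using cell_action(2)[OF assms, of "inv a" a] cell_action(1)[OF assms] by simp
  fix b assume b: "b \<in> {g \<in> carrier K. \<phi> g ` r = r}"
  then show "a \<otimes> b \<in> {g \<in> carrier K. \<phi> g ` r = r}"
    using a cell_action(2)[OF assms, of a b] by simp
qed blast

lemma cell_translates_eq_iff:
  assumes "r \<in> E m" "g \<in> carrier K" "h \<in> carrier K"
  shows "\<phi> g ` r = \<phi> h ` r \<longleftrightarrow> inv h \<otimes> g \<in> {g \<in> carrier K. \<phi> g ` r = r}"
proof -
  have 1: "\<phi> (inv h \<otimes> g) ` r = \<phi> (inv h) ` (\<phi> g ` r)" using cell_action(2)[OF assms(1)] assms by simp
  have 2: "\<phi> (inv h) ` (\<phi> h ` r) = r"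
    using cell_action(2)[OF assms(1), of "inv h" h] cell_action(1)[OF assms(1)] assms by simp
  have 3: "\<phi> h ` (\<phi> (inv h \<otimes> g) ` r) = \<phi> g ` r"
    using cell_action(2)[OF assms(1), of h "inv h \<otimes> g"] assms by (simp add: inv_mult_cancel)
  show ?thesis
  proof
    assume "\<phi> g ` r = \<phi> h ` r"
    then have "\<phi> (inv h \<otimes> g) ` r = r" using 1 2 by (simp only:)
    then show "inv h \<otimes> g \<in> {g \<in> carrier K. \<phi> g ` r = r}" using assms by simp
  next
    assume "inv h \<otimes> g \<in> {g \<in> carrier K. \<phi> g ` r = r}"
    then have "\<phi> (inv h \<otimes> g) ` r = r" by simp
    then show "\<phi> g ` r = \<phi> h ` r" using 3 by (simp only:)
  qed
qed

text \<open>
  Both sides are \<open>card Q\<close> written as a product, where \<open>T\<close> is the stabilizer of \<open>r\<close> and \<open>Q\<close> is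
  the set of cosets \<open>\<Lambda> g\<close> such that all \<open>g\<^sup>-\<^sup>1 h g\<close> with \<open>h\<close> in the tuple lie in \<open>T\<close>;
  equivalently, such that the tuple fixes the cell \<open>g r\<close>. The coset determines the conjugate
  tuple, whose entries lie in \<open>T\<close>, and the fibres of this map are translates of the set of
  cosets of \<open>\<Lambda>\<close> in the centralizer. It also determines the \<open>\<Lambda>\<close>-orbit of \<open>g r\<close>, and the fibres of
  this second map are in bijection with \<open>T\<close>, because \<open>\<Lambda>\<close> meets the finite conjugates of \<open>T\<close>
  trivially.
\<close>

theorem card_fixed_cell_orbits:
  assumes r: "r \<in> E m" and fin: "finite {g \<in> carrier K. \<phi> g ` r = r}"
    and gs: "set gs \<subseteq> carrier K"
    and \<Lambda>: "torsion_free_finite_index \<Lambda> (centralizer_group K (set gs))"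
  shows "card (orbit (K\<lparr>carrier := \<Lambda>\<rparr>) (\<lambda>g e. \<phi> g ` e) ` {e \<in> orbit K (\<lambda>g e. \<phi> g ` e) r. \<forall>h\<in>set gs. \<phi> h ` e = e})
      * card {g \<in> carrier K. \<phi> g ` r = r} =
    card {hs \<in> orbit K (conj_tuple K) gs. set hs \<subseteq> {g \<in> carrier K. \<phi> g ` r = r}}
      * card (rcosets\<^bsub>centralizer_group K (set gs)\<^esub> \<Lambda>)"
proof -
  define S where "S = {x \<in> carrier K. \<forall>h\<in>set gs. x \<otimes> h = h \<otimes> x}"
  define T where "T = {g \<in> carrier K. \<phi> g ` r = r}"
  have C: "centralizer_group K (set gs) = K\<lparr>carrier := S\<rparr>" by (simp add: centralizer_group_def S_def)
  have S: "subgroup S K" unfolding S_def by (rule subgroup_centralizer[OF is_group gs])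
  have T: "subgroup T K" unfolding T_def by (rule subgroup_cell_stabilizer[OF r])
  have finT: "finite T" using fin unfolding T_def .
  have sub': "subgroup \<Lambda> (K\<lparr>carrier := S\<rparr>)" and finidx: "finite (rcosets\<^bsub>K\<lparr>carrier := S\<rparr>\<^esub> \<Lambda>)"
    and tf: "\<And>x k. x \<in> \<Lambda> \<Longrightarrow> 0 < (k::nat) \<Longrightarrow> x [^] k = \<one> \<Longrightarrow> x = \<one>"
    using \<Lambda> unfolding C torsion_free_finite_index_def by (auto simp: nat_pow_def)
  have sub: "subgroup \<Lambda> K" by (rule incl_subgroup[OF S sub'])
  have \<Lambda>S: "\<Lambda> \<subseteq> S" using subgroup.subset[OF sub'] by simp
  note SK = subgroup.mem_carrier[OF S] and TK = subgroup.mem_carrier[OF T] and \<Lambda>K = subgroup.mem_carrier[OF sub]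
  let ?act = "\<lambda>g e. \<phi> g ` e" and ?L = "K\<lparr>carrier := \<Lambda>\<rparr>"
  define M where "M = {g \<in> carrier K. \<forall>h\<in>set gs. inv g \<otimes> h \<otimes> g \<in> T}"
  have MK: "g \<in> carrier K" if "g \<in> M" for g using that by (simp add: M_def)
  define Q where "Q = (\<lambda>g. \<Lambda> #> g) ` M"
  define pick where "pick D = (SOME g. g \<in> M \<and> D = \<Lambda> #> g)" for D
  have pick: "pick (\<Lambda> #> g) \<in> M" "\<exists>l\<in>\<Lambda>. pick (\<Lambda> #> g) = l \<otimes> g" if g: "g \<in> M" for g
  proof -
    have *: "pick (\<Lambda> #> g) \<in> M \<and> \<Lambda> #> g = \<Lambda> #> pick (\<Lambda> #> g)"
      unfolding pick_def[of "\<Lambda> #> g"] by (rule someI[of _ g]) (use g in simp)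
    then show "pick (\<Lambda> #> g) \<in> M" by simp
    show "\<exists>l\<in>\<Lambda>. pick (\<Lambda> #> g) = l \<otimes> g"
      using * rcoset_eq_iff[OF sub, of "pick (\<Lambda> #> g)" g] MK g by auto
  qed
  define f1 where "f1 D = conj_tuple K (inv (pick D)) gs" for D
  define f2 where "f2 D = orbit ?L ?act (\<phi> (pick D) ` r)" for D
  have L: "G_CW_structure ?L X \<phi> E" by (rule G_CW_structure_subgroup[OF GCW sub])
  interpret L: G_CW_complex ?L X \<phi> E by unfold_locales (rule L)
  have f1: "f1 (\<Lambda> #> g) = conj_tuple K (inv g) gs" if g: "g \<in> M" for g
  proof -
    obtain l where l: "l \<in> \<Lambda>" "pick (\<Lambda> #> g) = l \<otimes> g" using pick[OF g] by blast
    have "inv (inv g) \<otimes> inv (l \<otimes> g) = inv l" 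
      using l(1) \<Lambda>K MK[OF g] by (simp add: inv_mult_group inv_mult_cancel)
    moreover have "inv l \<in> carrier (centralizer_group K (set gs))"
      using subgroup.m_inv_closed[OF S, of l] l(1) \<Lambda>S unfolding C by auto
    ultimately show ?thesis
      unfolding f1_def l(2) using conj_tuple_eq_iff[OF _ _ gs, of "inv (l \<otimes> g)" "inv g"] l(1) \<Lambda>K MK[OF g] by simp
  qed
  have f2: "f2 (\<Lambda> #> g) = orbit ?L ?act (\<phi> g ` r)" if g: "g \<in> M" for g
  proof -
    obtain l where l: "l \<in> \<Lambda>" "pick (\<Lambda> #> g) = l \<otimes> g" using pick[OF g] by blast
    have "\<phi> (l \<otimes> g) ` r = \<phi> l ` (\<phi> g ` r)" using cell_action(2)[OF r] l(1) \<Lambda>K MK[OF g] by simp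
    then show ?thesis
      unfolding f2_def l(2) using L.cell_orbit_eq[OF cell_image[OF MK[OF g] r], of l] l(1) by simp
  qed
  have fix_iff: "(\<forall>h\<in>set gs. \<phi> h ` (\<phi> g ` r) = \<phi> g ` r) \<longleftrightarrow> g \<in> M" if g: "g \<in> carrier K" for g
  proof -
    have "\<phi> h ` (\<phi> g ` r) = \<phi> g ` r \<longleftrightarrow> inv g \<otimes> h \<otimes> g \<in> T" if "h \<in> set gs" for h
    proof -
      have h: "h \<in> carrier K" using that gs by blast
      have "\<phi> h ` (\<phi> g ` r) = \<phi> g ` r \<longleftrightarrow> \<phi> (h \<otimes> g) ` r = \<phi> g ` r" using cell_action(2)[OF r h g] by simp
      also have "\<dots> \<longleftrightarrow> inv g \<otimes> (h \<otimes> g) \<in> T" unfolding T_def using cell_translates_eq_iff[OF r _ g] h g by simp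
      finally show ?thesis using h g by (simp add: m_assoc)
    qed
    then show ?thesis using g by (simp add: M_def)
  qed
  have im1: "f1 ` Q = {hs \<in> orbit K (conj_tuple K) gs. set hs \<subseteq> T}"
  proof (intro equalityI subsetI)
    fix hs assume "hs \<in> f1 ` Q"
    then obtain g where g: "g \<in> M" "hs = conj_tuple K (inv g) gs" using f1 unfolding Q_def by auto
    then have "hs \<in> orbit K (conj_tuple K) gs" using MK unfolding orbit_def by blast
    moreover have "set hs \<subseteq> T" using g MK[OF g(1)] by (auto simp: conj_tuple_def M_def)
    ultimately show "hs \<in> {hs \<in> orbit K (conj_tuple K) gs. set hs \<subseteq> T}" by simp
  next
    fix hs assume "hs \<in> {hs \<in> orbit K (conj_tuple K) gs. set hs \<subseteq> T}"
    then obtain g where g: "g \<in> carrier K" "hs = conj_tuple K g gs" "set hs \<subseteq> T" unfolding orbit_def by blast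
    then have "inv g \<in> M" by (auto simp: M_def conj_tuple_def)
    moreover have "hs = f1 (\<Lambda> #> inv g)" using f1[OF \<open>inv g \<in> M\<close>] g by simp
    ultimately show "hs \<in> f1 ` Q" unfolding Q_def by blast
  qed
  have im2: "f2 ` Q = orbit ?L ?act ` {e \<in> orbit K ?act r. \<forall>h\<in>set gs. \<phi> h ` e = e}"
  proof -
    have "{e \<in> orbit K ?act r. \<forall>h\<in>set gs. \<phi> h ` e = e} = (\<lambda>g. \<phi> g ` r) ` M"
    proof (intro equalityI subsetI)
      fix e assume "e \<in> {e \<in> orbit K ?act r. \<forall>h\<in>set gs. \<phi> h ` e = e}"
      then obtain g where "g \<in> carrier K" "e = \<phi> g ` r" "\<forall>h\<in>set gs. \<phi> h ` e = e" unfolding orbit_def by blast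
      then show "e \<in> (\<lambda>g. \<phi> g ` r) ` M" using fix_iff[of g] by simp
    next
      fix e assume "e \<in> (\<lambda>g. \<phi> g ` r) ` M"
      then obtain g where "g \<in> M" "e = \<phi> g ` r" by blast
      then show "e \<in> {e \<in> orbit K ?act r. \<forall>h\<in>set gs. \<phi> h ` e = e}"
        using fix_iff[of g] MK[of g] unfolding orbit_def by auto
    qed
    then have "orbit ?L ?act ` {e \<in> orbit K ?act r. \<forall>h\<in>set gs. \<phi> h ` e = e} = (\<lambda>g. orbit ?L ?act (\<phi> g ` r)) ` M"
      by (simp only: image_image)
    also have "\<dots> = (\<lambda>g. f2 (\<Lambda> #> g)) ` M" by (rule image_cong[OF refl]) (simp only: f2)
    finally show ?thesis unfolding Q_def image_image by (rule sym)
  qed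
  \<comment> \<open>Cosets \<open>\<Lambda> g\<close> and \<open>\<Lambda> g'\<close> give the same conjugate tuple if and only if \<open>g' g\<^sup>-\<^sup>1\<close> centralizes the tuple.\<close>
  have fib1: "bij_betw (\<lambda>D. D #> g) (rcosets\<^bsub>K\<lparr>carrier := S\<rparr>\<^esub> \<Lambda>) {q \<in> Q. f1 q = f1 (\<Lambda> #> g)}" if g: "g \<in> M" for g
  proof -
    have gK: "g \<in> carrier K" using MK[OF g] .
    have rc: "rcosets\<^bsub>K\<lparr>carrier := S\<rparr>\<^esub> \<Lambda> = (\<lambda>c. \<Lambda> #> c) ` S" unfolding RCOSETS_def r_coset_def by auto
    have shift: "(\<Lambda> #> c) #> g = \<Lambda> #> (c \<otimes> g)" if "c \<in> S" for c
      using coset_mult_assoc[OF subgroup.subset[OF sub] SK[OF that] gK] .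
    have "inj_on (\<lambda>D. D #> g) ((\<lambda>c. \<Lambda> #> c) ` S)"
    proof (rule inj_onI)
      fix A B assume AB: "A \<in> (\<lambda>c. \<Lambda> #> c) ` S" "B \<in> (\<lambda>c. \<Lambda> #> c) ` S" "A #> g = B #> g"
      have "(D #> g) #> inv g = D" if "D \<in> (\<lambda>c. \<Lambda> #> c) ` S" for D
      proof -
        obtain c where "c \<in> S" "D = \<Lambda> #> c" using \<open>D \<in> _\<close> by blast
        then have "D \<subseteq> carrier K" using r_coset_subset_G[OF subgroup.subset[OF sub] SK] by simp
        then show ?thesis using coset_mult_assoc[of D g "inv g"] gK by (simp add: coset_mult_one)
      qed
      then show "A = B" using AB by metis
    qed
    moreover have "(\<lambda>D. D #> g) ` ((\<lambda>c. \<Lambda> #> c) ` S) = {q \<in> Q. f1 q = f1 (\<Lambda> #> g)}"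
    proof (intro equalityI subsetI)
      fix q assume "q \<in> (\<lambda>D. D #> g) ` ((\<lambda>c. \<Lambda> #> c) ` S)"
      then obtain c where c: "c \<in> S" "q = \<Lambda> #> (c \<otimes> g)" using shift by auto
      have cK: "c \<in> carrier K" using SK[OF c(1)] .
      have eq: "conj_tuple K (inv (c \<otimes> g)) gs = conj_tuple K (inv g) gs"
      proof -
        have "inv (inv g) \<otimes> inv (c \<otimes> g) = inv c" using cK gK by (simp add: inv_mult_group inv_mult_cancel)
        moreover have "inv c \<in> carrier (centralizer_group K (set gs))"
          using subgroup.m_inv_closed[OF S c(1)] unfolding C by simp
        ultimately show ?thesis using conj_tuple_eq_iff[OF _ _ gs, of "inv (c \<otimes> g)" "inv g"] cK gK by simp
      qed
      then have "set (conj_tuple K (inv (c \<otimes> g)) gs) \<subseteq> T" using g gK by (auto simp: M_def conj_tuple_def)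
      then have "c \<otimes> g \<in> M" using cK gK by (auto simp: M_def conj_tuple_def)
      then show "q \<in> {q \<in> Q. f1 q = f1 (\<Lambda> #> g)}" using c(2) f1 g eq unfolding Q_def by auto
    next
      fix q assume "q \<in> {q \<in> Q. f1 q = f1 (\<Lambda> #> g)}"
      then obtain g' where g': "g' \<in> M" "q = \<Lambda> #> g'" "conj_tuple K (inv g') gs = conj_tuple K (inv g) gs"
        using f1 g unfolding Q_def by auto
      have g'K: "g' \<in> carrier K" using MK[OF g'(1)] .
      have "g \<otimes> inv g' \<in> S"
        using conj_tuple_eq_iff[OF _ _ gs, of "inv g'" "inv g"] g'(3) gK g'K unfolding C by simp
      then have c: "g' \<otimes> inv g \<in> S" using subgroup.m_inv_closed[OF S] gK g'K by (force simp: inv_mult_group)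
      moreover have "g' = (g' \<otimes> inv g) \<otimes> g" using gK g'K by (simp add: m_assoc)
      ultimately have "q = (\<Lambda> #> (g' \<otimes> inv g)) #> g" using shift[OF c] g'(2) by simp
      then show "q \<in> (\<lambda>D. D #> g) ` ((\<lambda>c. \<Lambda> #> c) ` S)" using c by blast
    qed
    ultimately show ?thesis unfolding rc bij_betw_def by blast
  qed
  \<comment> \<open>Cosets \<open>\<Lambda> g\<close> and \<open>\<Lambda> g'\<close> give the same orbit of cells if and only if \<open>\<Lambda> g' = \<Lambda> g t\<close> for some \<open>t\<close> in \<open>T\<close>.\<close>
  have fib2: "bij_betw (\<lambda>t. \<Lambda> #> (g \<otimes> t)) T {q \<in> Q. f2 q = f2 (\<Lambda> #> g)}" if g: "g \<in> M" for g
  proof -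
    have gK: "g \<in> carrier K" using MK[OF g] .
    have gt: "g \<otimes> t \<in> M" if t: "t \<in> T" for t
    proof -
      have tK: "t \<in> carrier K" using TK[OF t] .
      have "\<phi> (g \<otimes> t) ` r = \<phi> g ` r" using cell_action(2)[OF r gK tK] t by (simp add: T_def)
      then show ?thesis using fix_iff[of "g \<otimes> t"] fix_iff[OF gK] g gK tK by simp
    qed
    have "inj_on (\<lambda>t. \<Lambda> #> (g \<otimes> t)) T"
    proof (rule inj_onI)
      fix s t assume st: "s \<in> T" "t \<in> T" "\<Lambda> #> (g \<otimes> s) = \<Lambda> #> (g \<otimes> t)"
      have sK: "s \<in> carrier K" and tK: "t \<in> carrier K" using TK st by auto
      obtain l where l: "l \<in> \<Lambda>" "g \<otimes> s = l \<otimes> (g \<otimes> t)" using rcoset_eq_iff[OF sub, of "g \<otimes> s" "g \<otimes> t"] st(3) gK sK tK by auto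
      have lK: "l \<in> carrier K" using \<Lambda>K[OF l(1)] .
      define u where "u = s \<otimes> inv t"
      have u: "u \<in> T" unfolding u_def using st subgroup.m_closed[OF T] subgroup.m_inv_closed[OF T] by blast
      have uK: "u \<in> carrier K" using TK[OF u] .
      have "l = (g \<otimes> s) \<otimes> inv (g \<otimes> t)" using l(2) lK gK tK by (simp add: m_assoc)
      then have lu: "l = g \<otimes> u \<otimes> inv g" using gK sK tK by (simp add: u_def m_assoc inv_mult_group)
      interpret T: group "K\<lparr>carrier := T\<rparr>" by (rule subgroup_imp_group[OF T])
      have "u [^] card T = \<one>"
        using T.pow_order_eq_1[of u] u by (simp add: order_def nat_pow_def)
      then have "l [^] card T = \<one>" using conj_nat_pow[OF gK uK, of "card T"] gK unfolding lu by simp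
      moreover have "card T > 0" using finT u card_gt_0_iff by blast
      ultimately have "l = \<one>" using tf[OF l(1)] by blast
      then show "s = t" using l(2) gK sK tK by simp
    qed
    moreover have "(\<lambda>t. \<Lambda> #> (g \<otimes> t)) ` T = {q \<in> Q. f2 q = f2 (\<Lambda> #> g)}"
    proof (intro equalityI subsetI)
      fix q assume "q \<in> (\<lambda>t. \<Lambda> #> (g \<otimes> t)) ` T"
      then obtain t where t: "t \<in> T" "q = \<Lambda> #> (g \<otimes> t)" by blast
      have "\<phi> (g \<otimes> t) ` r = \<phi> g ` r" using cell_action(2)[OF r gK TK[OF t(1)]] t by (simp add: T_def)
      then show "q \<in> {q \<in> Q. f2 q = f2 (\<Lambda> #> g)}"
        using f2[OF gt[OF t(1)]] f2[OF g] gt[OF t(1)] t(2) unfolding Q_def by simp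
    next
      fix q assume "q \<in> {q \<in> Q. f2 q = f2 (\<Lambda> #> g)}"
      then obtain g' where g': "g' \<in> M" "q = \<Lambda> #> g'" "orbit ?L ?act (\<phi> g' ` r) = orbit ?L ?act (\<phi> g ` r)"
        using f2 g unfolding Q_def by auto
      have g'K: "g' \<in> carrier K" using MK[OF g'(1)] .
      have "\<phi> g' ` r \<in> orbit ?L ?act (\<phi> g ` r)"
        using L.cell_orbit_mem[OF cell_image[OF g'K r]] g'(3) by simp
      then obtain l where l: "l \<in> \<Lambda>" "\<phi> g' ` r = \<phi> l ` (\<phi> g ` r)" unfolding orbit_def by auto
      have lK: "l \<in> carrier K" using \<Lambda>K[OF l(1)] .
      have "\<phi> g' ` r = \<phi> (l \<otimes> g) ` r" using l(2) cell_action(2)[OF r lK gK] by simp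
      then have "inv (l \<otimes> g) \<otimes> g' \<in> T" unfolding T_def using cell_translates_eq_iff[OF r g'K, of "l \<otimes> g"] lK gK by simp
      moreover have "\<Lambda> #> g' = \<Lambda> #> (g \<otimes> (inv (l \<otimes> g) \<otimes> g'))"
      proof (subst rcoset_eq_iff[OF sub g'K])
        have "g' = l \<otimes> (g \<otimes> (inv (l \<otimes> g) \<otimes> g'))"
          using lK gK g'K by (simp add: inv_mult_group m_assoc inv_mult_cancel)
        then show "\<exists>l'\<in>\<Lambda>. g' = l' \<otimes> (g \<otimes> (inv (l \<otimes> g) \<otimes> g'))" using l(1) by (rule bexI)
      qed (use lK gK g'K in simp)
      ultimately show "q \<in> (\<lambda>t. \<Lambda> #> (g \<otimes> t)) ` T" using g'(2) by blast
    qed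
    ultimately show ?thesis unfolding bij_betw_def by blast
  qed
  have fin1: "finite (f1 ` Q)"
  proof (rule finite_subset[OF _ finite_lists_length_eq[OF finT, of "length gs"]])
    show "f1 ` Q \<subseteq> {xs. set xs \<subseteq> T \<and> length xs = length gs}"
      unfolding im1 orbit_def by (auto simp: conj_tuple_def)
  qed
  have fibs1: "finite {x \<in> Q. f1 x = f1 q} \<and> card {x \<in> Q. f1 x = f1 q} = card (rcosets\<^bsub>K\<lparr>carrier := S\<rparr>\<^esub> \<Lambda>)"
    if "q \<in> Q" for q
  proof -
    obtain g where g: "g \<in> M" "q = \<Lambda> #> g" using \<open>q \<in> Q\<close> unfolding Q_def by blast
    show ?thesis using bij_betw_finite[OF fib1[OF g(1)]] bij_betw_same_card[OF fib1[OF g(1)]] finidx g(2) by simp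
  qed
  have fibs2: "finite {x \<in> Q. f2 x = f2 q} \<and> card {x \<in> Q. f2 x = f2 q} = card T" if "q \<in> Q" for q
  proof -
    obtain g where g: "g \<in> M" "q = \<Lambda> #> g" using \<open>q \<in> Q\<close> unfolding Q_def by blast
    show ?thesis using bij_betw_finite[OF fib2[OF g(1)]] bij_betw_same_card[OF fib2[OF g(1)]] finT g(2) by simp
  qed
  note Q1 = card_uniform_fibres[OF fin1 fibs1]
  have "card Q = card (f2 ` Q) * card T" by (rule card_uniform_fibres(2)[OF finite_imageI[OF Q1(1)] fibs2])
  then show ?thesis using Q1(2) unfolding im1 im2 T_def C by simp
qed

end

context G_CW_complex
begin

lemma cell_orbit_eq_iff:
  assumes "d \<in> E m" "e \<in> E n"
  shows "d \<in> orbit K (\<lambda>g e. \<phi> g ` e) e \<longleftrightarrow> orbit K (\<lambda>g e. \<phi> g ` e) d = orbit K (\<lambda>g e. \<phi> g ` e) e"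
proof
  assume "d \<in> orbit K (\<lambda>g e. \<phi> g ` e) e"
  then obtain g where "g \<in> carrier K" "d = \<phi> g ` e" unfolding orbit_def by blast
  then show "orbit K (\<lambda>g e. \<phi> g ` e) d = orbit K (\<lambda>g e. \<phi> g ` e) e" using cell_orbit_eq[OF assms(2)] by simp
next
  assume "orbit K (\<lambda>g e. \<phi> g ` e) d = orbit K (\<lambda>g e. \<phi> g ` e) e"
  then show "d \<in> orbit K (\<lambda>g e. \<phi> g ` e) e" using cell_orbit_mem[OF assms(1)] by simp
qed

lemma generate_fixes_cell_iff:
  assumes "A \<subseteq> carrier K" "e \<in> E n"
  shows "e \<subseteq> fixed_points X \<phi> (generate K A) \<longleftrightarrow> (\<forall>a\<in>A. \<phi> a ` e = e)"
proof -
  have "(\<forall>h\<in>generate K A. \<phi> h ` e = e) \<longleftrightarrow> (\<forall>a\<in>A. \<phi> a ` e = e)"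
  proof
    assume "\<forall>a\<in>A. \<phi> a ` e = e"
    then have "A \<subseteq> {g \<in> carrier K. \<phi> g ` e = e}" using assms(1) by blast
    then have "generate K A \<subseteq> {g \<in> carrier K. \<phi> g ` e = e}"
      using generate_subgroup_incl subgroup_cell_stabilizer[OF assms(2)] by blast
    then show "\<forall>h\<in>generate K A. \<phi> h ` e = e" by blast
  qed (use generate.incl[of _ A K] in blast)
  then show ?thesis
    using cell_subset_fixed_points_iff[OF generate_incl[OF assms(1)] assms(2)] by simp
qed

end

text \<open>
  Count the cells of the fixed-point complex of the subgroup generated by the tuple, collecting
  those that belong to the same orbit of cells under \<open>G\<close>; the index of \<open>\<Lambda>\<close> cancels.
\<close>

theorem orb_euler_char_centralizer:
  fixes X :: "'x topology"
  assumes gcw: "G_CW_structure G X \<phi> E" and fin: "finite (\<Union>n. orbits G (E n) (\<lambda>g e. \<phi> g ` e))"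
    and model: "finite_EG_model G X \<phi>" and vtf: "virtually_torsion_free G"
    and gs: "set gs \<subseteq> carrier G" "finite (generate G (set gs))"
    and rep: "\<And>n o'. (n, o') \<in> cell_orbits G \<phi> E \<Longrightarrow> rep (n, o') \<in> E n \<and> o' = orbit G (\<lambda>g e. \<phi> g ` e) (rep (n, o'))"
  shows "orb_euler_char TYPE('x) (centralizer_group G (generate G (set gs))) =
    (\<Sum>i\<in>cell_orbits G \<phi> E. (-1) ^ fst i *
       (of_nat (card {hs \<in> orbit G (conj_tuple G) gs. set hs \<subseteq> {g \<in> carrier G. \<phi> g ` rep i = rep i}}) /
        of_nat (card {g \<in> carrier G. \<phi> g ` rep i = rep i})))"
proof -
  interpret G_CW_complex G X \<phi> E by unfold_locales (rule gcw)
  define H where "H = generate G (set gs)"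
  have H: "subgroup H G" "finite H" "H \<subseteq> carrier G"
    unfolding H_def using generate_is_subgroup[OF gs(1)] gs(2) generate_incl[OF gs(1)] by auto
  let ?Y = "fixed_points X \<phi> H" and ?act = "\<lambda>g e. \<phi> g ` e"
  let ?\<psi> = "\<lambda>g. restrict (\<phi> g) ?Y" and ?EY = "\<lambda>n. {e \<in> E n. e \<subseteq> ?Y}"
  have C: "centralizer_group G H = centralizer_group G (set gs)"
    unfolding H_def by (rule centralizer_group_generate[OF gs(1)])
  have stab: "finite {g \<in> carrier G. \<phi> g ` e = e}" if "e \<in> E n" for n e
    by (rule finite_EG_model_cell_stabilizer[OF model that])
  have finY: "finite (\<Union>n. orbits (centralizer_group G H) (?EY n) (\<lambda>g e. ?\<psi> g ` e))"
    by (rule finite_orbits_fixed_points[OF H(3,2) fin]) (rule stab)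
  obtain \<Lambda> where \<Lambda>: "torsion_free_finite_index \<Lambda> (centralizer_group G H)"
    and finL: "finite (cell_orbits (centralizer_group G H\<lparr>carrier := \<Lambda>\<rparr>) ?\<psi> ?EY)"
    and eul: "orb_euler_char TYPE('x) (centralizer_group G H) =
      of_int (\<Sum>(n, o')\<in>cell_orbits (centralizer_group G H\<lparr>carrier := \<Lambda>\<rparr>) ?\<psi> ?EY. (-1) ^ n) /
      of_nat (card (rcosets\<^bsub>centralizer_group G H\<^esub> \<Lambda>))"
    using orb_euler_char_eq[OF G_CW_structure_fixed_points[OF H(3)]
        finY
        finite_EG_model_fixed_points[OF gcw fin model H(1,2)]
        virtually_torsion_free_centralizer[OF is_group vtf H(3)]] by blast
  let ?L = "G\<lparr>carrier := \<Lambda>\<rparr>" and ?idx = "card (rcosets\<^bsub>centralizer_group G H\<^esub> \<Lambda>)"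
  have CL: "centralizer_group G H\<lparr>carrier := \<Lambda>\<rparr> = ?L" by (simp add: centralizer_group_def)
  have "subgroup \<Lambda> (centralizer_group G H)" "finite (rcosets\<^bsub>centralizer_group G H\<^esub> \<Lambda>)"
    using \<Lambda> unfolding torsion_free_finite_index_def by auto
  then have \<Lambda>C: "\<Lambda> \<subseteq> carrier (centralizer_group G H)" using subgroup.subset by blast
  have idx: "?idx \<noteq> 0"
  proof -
    have "\<Lambda> #>\<^bsub>centralizer_group G H\<^esub> \<one>\<^bsub>G\<^esub> \<in> rcosets\<^bsub>centralizer_group G H\<^esub> \<Lambda>"
      unfolding RCOSETS_def by (rule UN_I[of "\<one>\<^bsub>G\<^esub>"]) (use H(3) in auto)
    then show ?thesis using \<open>finite (rcosets\<^bsub>centralizer_group G H\<^esub> \<Lambda>)\<close> by (metis card_0_eq empty_iff)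
  qed
  have \<Lambda>G: "\<Lambda> \<subseteq> carrier G" using \<Lambda>C by auto
  have orb\<psi>: "orbit ?L (\<lambda>g e. ?\<psi> g ` e) e = orbit ?L ?act e" if "e \<subseteq> ?Y" for e
  proof -
    have "?\<psi> g ` e = \<phi> g ` e" for g using that by (intro image_cong) auto
    then show ?thesis by (simp add: orbit_def)
  qed
  let ?S = "cell_orbits ?L ?\<psi> ?EY"
  have S_mem: "i \<in> ?S \<longleftrightarrow> (\<exists>n e. i = (n, orbit ?L ?act e) \<and> e \<in> E n \<and> e \<subseteq> ?Y)" for i
  proof
    assume "i \<in> ?S"
    then obtain n e where "i = (n, orbit ?L (\<lambda>g e. ?\<psi> g ` e) e)" "e \<in> E n" "e \<subseteq> ?Y"
      unfolding cell_orbits_def orbits_def by blast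
    then show "\<exists>n e. i = (n, orbit ?L ?act e) \<and> e \<in> E n \<and> e \<subseteq> ?Y" using orb\<psi> by blast
  next
    assume "\<exists>n e. i = (n, orbit ?L ?act e) \<and> e \<in> E n \<and> e \<subseteq> ?Y"
    then obtain n e where e: "i = (n, orbit ?L ?act e)" "e \<in> E n" "e \<subseteq> ?Y" by (elim exE conjE)
    have "i = (n, orbit ?L (\<lambda>g e. ?\<psi> g ` e) e)" unfolding orb\<psi>[OF e(3)] by (rule e(1))
    then show "i \<in> ?S" unfolding cell_orbits_def orbits_def using e(2,3) by blast
  qed
  \<comment> \<open>The orbit of cells under \<open>G\<close> that contains a given orbit under \<open>\<Lambda>\<close>.\<close>
  define f where "f i = (fst i, \<Union>e\<in>snd i. orbit G ?act e)" for i :: "nat \<times> 'x set set"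
  have f: "f (n, orbit ?L ?act e) = (n, orbit G ?act e)" if e: "e \<in> E n" for n e
  proof -
    have "orbit G ?act d = orbit G ?act e" if d: "d \<in> orbit ?L ?act e" for d
    proof -
      obtain l where "l \<in> \<Lambda>" "d = \<phi> l ` e" using d unfolding orbit_def by auto
      then show ?thesis using cell_orbit_eq[OF e, of l] \<Lambda>G by auto
    qed
    moreover have "orbit ?L ?act e \<noteq> {}"
      using subgroup.one_closed[OF \<open>subgroup \<Lambda> (centralizer_group G H)\<close>] unfolding orbit_def by auto
    ultimately show ?thesis unfolding f_def by auto
  qed
  have f_im: "f ` ?S \<subseteq> cell_orbits G \<phi> E"
  proof
    fix i assume "i \<in> f ` ?S"
    then obtain j where "j \<in> ?S" "i = f j" by blast
    then obtain n e where e: "j = (n, orbit ?L ?act e)" "e \<in> E n" unfolding S_mem by (elim exE conjE)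
    have "i = (n, orbit G ?act e)" unfolding \<open>i = f j\<close> e(1) by (rule f[OF e(2)])
    then show "i \<in> cell_orbits G \<phi> E" unfolding cell_orbits_def orbits_def using e(2) by blast
  qed
  define T where "T i = {g \<in> carrier G. \<phi> g ` rep i = rep i}" for i
  define N where "N i = card {hs \<in> orbit G (conj_tuple G) gs. set hs \<subseteq> T i}" for i
  have fibre: "of_int (\<Sum>j\<in>{j \<in> ?S. f j = i}. (-1) ^ fst j) = (-1) ^ fst i * (of_nat (N i * ?idx) / of_nat (card (T i)) :: rat)"
    if i: "i \<in> cell_orbits G \<phi> E" for i
  proof -
    obtain n o' where io: "i = (n, o')" by (cases i)
    have r: "rep i \<in> E n" "o' = orbit G ?act (rep i)" using rep i unfolding io by auto
    let ?F = "{e \<in> orbit G ?act (rep i). \<forall>h\<in>set gs. \<phi> h ` e = e}"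
    have in_E: "e \<in> E n" if "e \<in> orbit G ?act (rep i)" for e
      using that cell_image[OF _ r(1)] unfolding orbit_def by blast
    have "{j \<in> ?S. f j = i} = Pair n ` (orbit ?L ?act ` ?F)"
    proof (intro equalityI subsetI)
      fix j assume "j \<in> {j \<in> ?S. f j = i}"
      then obtain m e where e: "j = (m, orbit ?L ?act e)" "e \<in> E m" "e \<subseteq> ?Y" "f j = i" using S_mem by blast
      have "(m, orbit G ?act e) = (n, o')" using e(4) unfolding e(1) f[OF e(2)] io .
      then have "m = n" "orbit G ?act e = orbit G ?act (rep i)" using r(2) by simp_all
      then have "e \<in> ?F"
        using cell_orbit_eq_iff[OF e(2) r(1)] generate_fixes_cell_iff[OF gs(1) e(2)] e(3) unfolding H_def by blast
      then show "j \<in> Pair n ` (orbit ?L ?act ` ?F)" using e(1) \<open>m = n\<close> by blast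
    next
      fix j assume "j \<in> Pair n ` (orbit ?L ?act ` ?F)"
      then obtain e where e: "e \<in> ?F" "j = (n, orbit ?L ?act e)" by blast
      then have eE: "e \<in> E n" using in_E by blast
      have "e \<subseteq> ?Y" using generate_fixes_cell_iff[OF gs(1) eE] e(1) unfolding H_def by blast
      with e(2) eE have "j \<in> ?S" unfolding S_mem by (intro exI[of _ n] exI[of _ e] conjI)
      have "orbit G ?act e = o'" unfolding r(2) using cell_orbit_eq_iff[OF eE r(1)] e(1) by blast
      then have "f j = (n, o')" unfolding e(2) f[OF eE] by simp
      then have "f j = i" unfolding io .
      with \<open>j \<in> ?S\<close> show "j \<in> {j \<in> ?S. f j = i}" by (intro CollectI conjI)
    qed
    then have "(\<Sum>j\<in>{j \<in> ?S. f j = i}. (-1) ^ fst j) = (\<Sum>j\<in>Pair n ` (orbit ?L ?act ` ?F). (-1 :: int) ^ fst j)" by simp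
    also have "\<dots> = (-1) ^ n * of_nat (card (orbit ?L ?act ` ?F))"
      by (subst sum.reindex) (auto simp: inj_on_def)
    finally have sum: "(\<Sum>j\<in>{j \<in> ?S. f j = i}. (-1) ^ fst j) = (-1) ^ n * int (card (orbit ?L ?act ` ?F))" .
    have finT: "finite (T i)" unfolding T_def by (rule finite_EG_model_cell_stabilizer[OF model r(1)])
    have "card (T i) \<noteq> 0"
    proof -
      have "\<one>\<^bsub>G\<^esub> \<in> T i" unfolding T_def by (rule subgroup.one_closed[OF subgroup_cell_stabilizer[OF r(1)]])
      then show ?thesis using finT by (metis card_0_eq empty_iff)
    qed
    moreover have "card (orbit ?L ?act ` ?F) * card (T i) = N i * ?idx"
      unfolding N_def T_def C
      by (rule card_fixed_cell_orbits[OF r(1) finT[unfolded T_def] gs(1) \<Lambda>[unfolded C]])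
    then have "of_nat (N i * ?idx) = (of_nat (card (orbit ?L ?act ` ?F) * card (T i)) :: rat)"
      by (simp only:)
    ultimately have ratio: "(of_nat (N i * ?idx) / of_nat (card (T i)) :: rat) = of_nat (card (orbit ?L ?act ` ?F))"
      by simp
    have "fst i = n" by (simp add: io)
    then show ?thesis unfolding ratio sum by (simp only: of_int_mult of_int_power of_int_minus of_int_1 of_int_of_nat_eq)
  qed
  have finO: "finite (cell_orbits G \<phi> E)" by (rule finite_cell_orbits[OF fin])
  have "(\<Sum>(n, o')\<in>?S. (-1) ^ n) = (\<Sum>j\<in>?S. (-1 :: int) ^ fst j)" by (simp add: case_prod_beta)
  also have "\<dots> = (\<Sum>i\<in>cell_orbits G \<phi> E. \<Sum>j\<in>{j \<in> ?S. f j = i}. (-1) ^ fst j)"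
    by (rule sum.group[symmetric, OF finL[unfolded CL] finO f_im])
  finally have "orb_euler_char TYPE('x) (centralizer_group G H) =
    (\<Sum>i\<in>cell_orbits G \<phi> E. of_int (\<Sum>j\<in>{j \<in> ?S. f j = i}. (-1) ^ fst j)) / of_nat ?idx"
    unfolding eul CL by (simp only: of_int_sum)
  also have "\<dots> = (\<Sum>i\<in>cell_orbits G \<phi> E. (-1) ^ fst i * (of_nat (N i * ?idx) / of_nat (card (T i)))) / of_nat ?idx"
    using fibre by (simp only: cong: sum.cong)
  also have "\<dots> = (\<Sum>i\<in>cell_orbits G \<phi> E. (-1) ^ fst i * (of_nat (N i) / of_nat (card (T i))))"
    unfolding sum_divide_distrib using idx by (intro sum.cong) auto
  finally show ?thesis unfolding H_def N_def T_def .
qed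

section \<open>Summation over classes of commuting tuples\<close>

lemma (in group) conj_tuple_orbit_mem:
  "set gs \<subseteq> carrier G \<Longrightarrow> gs \<in> orbit G (conj_tuple G) gs"
  unfolding orbit_def using conj_tuple_one[of gs] by force

lemma (in group) conj_tuple_orbit_eq:
  assumes gs: "set gs \<subseteq> carrier G" and hs: "hs \<in> orbit G (conj_tuple G) gs"
  shows "orbit G (conj_tuple G) hs = orbit G (conj_tuple G) gs"
proof -
  obtain g where g: "g \<in> carrier G" "hs = conj_tuple G g gs" using hs unfolding orbit_def by blast
  show ?thesis
  proof (intro equalityI subsetI)
    fix z assume "z \<in> orbit G (conj_tuple G) hs"
    then obtain h where "h \<in> carrier G" "z = conj_tuple G h hs" unfolding orbit_def by blast
    then have "z = conj_tuple G (h \<otimes> g) gs" "h \<otimes> g \<in> carrier G" using conj_tuple_mult[OF _ g(1) gs] g by auto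
    then show "z \<in> orbit G (conj_tuple G) gs" unfolding orbit_def by blast
  next
    fix z assume "z \<in> orbit G (conj_tuple G) gs"
    then obtain h where h: "h \<in> carrier G" "z = conj_tuple G h gs" unfolding orbit_def by blast
    have "h \<otimes> inv g \<otimes> g = h" using h(1) g(1) by (simp add: m_assoc)
    then have "z = conj_tuple G (h \<otimes> inv g) hs"
      using conj_tuple_mult[of "h \<otimes> inv g" g gs] h g gs by simp
    then show "z \<in> orbit G (conj_tuple G) hs" unfolding orbit_def using h(1) g(1) by blast
  qed
qed

lemma (in group) commuting_p_tuples_subgroup:
  assumes "prime p" "subgroup T G"
  shows "commuting_p_tuples (G\<lparr>carrier := T\<rparr>) n p = {gs \<in> commuting_p_tuples G n p. set gs \<subseteq> T}"
proof -
  have "p_elements (G\<lparr>carrier := T\<rparr>) p = p_elements G p \<inter> T"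
    using subgroup.mem_carrier[OF assms(2)] by (auto simp: p_elements_def nat_pow_def)
  then show ?thesis
    unfolding commuting_p_tuples_eq_p_elements[OF is_group assms(1)]
      commuting_p_tuples_eq_p_elements[OF subgroup_imp_group[OF assms(2)] assms(1)] by auto
qed

lemma (in group) finite_generate_commuting_p_tuple:
  assumes "prime p" "gs \<in> commuting_p_tuples G n p"
  shows "finite (generate G (set gs))"
proof (rule finite_generate_commuting_torsion)
  show "set gs \<subseteq> carrier G" and "\<And>x y. x \<in> set gs \<Longrightarrow> y \<in> set gs \<Longrightarrow> x \<otimes> y = y \<otimes> x"
    using assms(2) unfolding commuting_p_tuples_def by auto
  fix x assume "x \<in> set gs"
  then obtain k where "ord x = p ^ k" using assms(2) unfolding commuting_p_tuples_def by auto
  then show "ord x \<noteq> 0" using assms(1) by (simp add: prime_gt_0_nat)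
qed simp

theorem theorem1:
  fixes G :: "('a, 'm) monoid_scheme" and p n :: nat
  assumes "prime p" and "n \<ge> 1"
    and "group G" and "virtually_torsion_free G"
    and "admits_finite_EG TYPE('x) G"
  shows "cong_localized p
           (\<Sum>c \<in> orbits G (commuting_p_tuples G n p) (conj_tuple G).
              orb_euler_char TYPE('x)
                (centralizer_group G (generate G (set (SOME gs. gs \<in> c))))) 0"
proof (cases "finite (orbits G (commuting_p_tuples G n p) (conj_tuple G))")
  case False
  \<comment> \<open>The sum over an infinite index set is \<open>0\<close> by convention.\<close>
  then show ?thesis using localized_int_of_int[OF assms(1), of 0] by (simp add: cong_localized_def)
next
  case True
  interpret group G by fact
  obtain X :: "'x topology" and \<phi> where model: "finite_EG_model G X \<phi>"
    using assms(5) unfolding admits_finite_EG_def by blast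
  then obtain E where gcw: "G_CW_structure G X \<phi> E" and fin: "finite (\<Union>n. orbits G (E n) (\<lambda>g e. \<phi> g ` e))"
    unfolding finite_EG_model_def finite_G_CW_def by blast
  interpret G_CW_complex G X \<phi> E by unfold_locales (rule gcw)
  let ?O = "orbits G (commuting_p_tuples G n p) (conj_tuple G)"
  have "\<exists>e. (case i of (n, o') \<Rightarrow> e \<in> E n \<and> o' = orbit G (\<lambda>g e. \<phi> g ` e) e)" if "i \<in> cell_orbits G \<phi> E" for i
    using that unfolding cell_orbits_def orbits_def by auto
  then obtain rep where rep': "\<And>i. i \<in> cell_orbits G \<phi> E \<Longrightarrow>
      (case i of (n, o') \<Rightarrow> rep i \<in> E n \<and> o' = orbit G (\<lambda>g e. \<phi> g ` e) (rep i))" by metis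
  have rep: "rep (m, o') \<in> E m \<and> o' = orbit G (\<lambda>g e. \<phi> g ` e) (rep (m, o'))" if "(m, o') \<in> cell_orbits G \<phi> E" for m o'
    using rep'[OF that] by simp
  define T where "T i = {g \<in> carrier G. \<phi> g ` rep i = rep i}" for i
  have T: "finite (T i)" "subgroup (T i) G" if "i \<in> cell_orbits G \<phi> E" for i
  proof -
    obtain m o' where "i = (m, o')" by (cases i)
    then have "rep i \<in> E m" using rep'[OF that] by simp
    then show "finite (T i)" "subgroup (T i) G" unfolding T_def
      using finite_EG_model_cell_stabilizer[OF model] subgroup_cell_stabilizer by blast+
  qed
  have tuple_carrier: "set gs \<subseteq> carrier G" if "gs \<in> commuting_p_tuples G n p" for gs
    using that unfolding commuting_p_tuples_def by blast
  have some: "(SOME gs. gs \<in> c) \<in> commuting_p_tuples G n p \<and> c = orbit G (conj_tuple G) (SOME gs. gs \<in> c)"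
    if c: "c \<in> ?O" for c
  proof -
    obtain gs where gs: "gs \<in> commuting_p_tuples G n p" "c = orbit G (conj_tuple G) gs"
      using c unfolding orbits_def by blast
    have hs: "(SOME gs. gs \<in> c) \<in> c"
      by (rule someI[of _ gs]) (unfold gs(2), rule conj_tuple_orbit_mem[OF tuple_carrier[OF gs(1)]])
    then have "orbit G (conj_tuple G) (SOME gs. gs \<in> c) = c"
      using conj_tuple_orbit_eq[OF tuple_carrier[OF gs(1)]] gs(2) by metis
    moreover have "d \<in> commuting_p_tuples G n p" if "d \<in> c" for d
      using that conj_tuple_commuting_p_tuples[OF assms(1) _ gs(1)] unfolding gs(2) orbit_def by blast
    ultimately show ?thesis using hs by simp
  qed
  have count: "(\<Sum>c\<in>?O. card {hs \<in> c. set hs \<subseteq> T i}) = card (commuting_p_tuples (G\<lparr>carrier := T i\<rparr>) n p)"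
    if i: "i \<in> cell_orbits G \<phi> E" for i
  proof -
    have "commuting_p_tuples (G\<lparr>carrier := T i\<rparr>) n p = (\<Union>c\<in>?O. {hs \<in> c. set hs \<subseteq> T i})"
      unfolding commuting_p_tuples_subgroup[OF assms(1) T(2)[OF i]]
    proof (intro equalityI subsetI)
      fix hs assume "hs \<in> {gs \<in> commuting_p_tuples G n p. set gs \<subseteq> T i}"
      then show "hs \<in> (\<Union>c\<in>?O. {hs \<in> c. set hs \<subseteq> T i})"
        using conj_tuple_orbit_mem[OF tuple_carrier] unfolding orbits_def by blast
    next
      fix hs assume "hs \<in> (\<Union>c\<in>?O. {hs \<in> c. set hs \<subseteq> T i})"
      then obtain gs where "gs \<in> commuting_p_tuples G n p" "hs \<in> orbit G (conj_tuple G) gs" "set hs \<subseteq> T i"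
        unfolding orbits_def by blast
      then show "hs \<in> {gs \<in> commuting_p_tuples G n p. set gs \<subseteq> T i}"
        using conj_tuple_commuting_p_tuples[OF assms(1)] unfolding orbit_def by blast
    qed
    moreover have "card (\<Union>c\<in>?O. {hs \<in> c. set hs \<subseteq> T i}) = (\<Sum>c\<in>?O. card {hs \<in> c. set hs \<subseteq> T i})"
    proof (rule card_UN_disjoint[OF True])
      show "\<forall>c\<in>?O. finite {hs \<in> c. set hs \<subseteq> T i}"
      proof
        fix c assume c: "c \<in> ?O"
        have "{hs \<in> c. set hs \<subseteq> T i} \<subseteq> {hs. set hs \<subseteq> T i \<and> length hs = length (SOME gs. gs \<in> c)}"
        proof
          fix hs assume hs: "hs \<in> {hs \<in> c. set hs \<subseteq> T i}"
          then have "hs \<in> orbit G (conj_tuple G) (SOME gs. gs \<in> c)" using some[OF c] by auto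
          then show "hs \<in> {hs. set hs \<subseteq> T i \<and> length hs = length (SOME gs. gs \<in> c)}"
            using hs unfolding orbit_def conj_tuple_def by auto
        qed
        then show "finite {hs \<in> c. set hs \<subseteq> T i}"
          using finite_lists_length_eq[OF T(1)[OF i]] finite_subset by blast
      qed
      have eq: "c = d" if cd: "c \<in> ?O" "d \<in> ?O" "hs \<in> c" "hs \<in> d" for c d hs
      proof -
        obtain gs where gs: "gs \<in> commuting_p_tuples G n p" "c = orbit G (conj_tuple G) gs"
          using cd(1) unfolding orbits_def by blast
        obtain gs' where gs': "gs' \<in> commuting_p_tuples G n p" "d = orbit G (conj_tuple G) gs'"
          using cd(2) unfolding orbits_def by blast
        show "c = d"
          using conj_tuple_orbit_eq[OF tuple_carrier[OF gs(1)], of hs]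
            conj_tuple_orbit_eq[OF tuple_carrier[OF gs'(1)], of hs] cd(3,4) gs(2) gs'(2) by simp
      qed
      show "\<forall>c\<in>?O. \<forall>d\<in>?O. c \<noteq> d \<longrightarrow> {hs \<in> c. set hs \<subseteq> T i} \<inter> {hs \<in> d. set hs \<subseteq> T i} = {}"
      proof (intro ballI impI, rule ccontr)
        fix c d assume cd: "c \<in> ?O" "d \<in> ?O" "c \<noteq> d" "{hs \<in> c. set hs \<subseteq> T i} \<inter> {hs \<in> d. set hs \<subseteq> T i} \<noteq> {}"
        then obtain hs where "hs \<in> c" "hs \<in> d" by blast
        then show False using eq[OF cd(1,2)] cd(3) by simp
      qed
    qed
    ultimately show ?thesis by simp
  qed
  have "(\<Sum>c\<in>?O. orb_euler_char TYPE('x) (centralizer_group G (generate G (set (SOME gs. gs \<in> c))))) =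
    (\<Sum>c\<in>?O. \<Sum>i\<in>cell_orbits G \<phi> E. (-1) ^ fst i * (of_nat (card {hs \<in> c. set hs \<subseteq> T i}) / of_nat (card (T i))))"
  proof (rule sum.cong[OF refl])
    fix c assume c: "c \<in> ?O"
    define gs where "gs = (SOME gs. gs \<in> c)"
    have gs: "gs \<in> commuting_p_tuples G n p" "orbit G (conj_tuple G) gs = c" unfolding gs_def using some[OF c] by auto
    show "orb_euler_char TYPE('x) (centralizer_group G (generate G (set (SOME gs. gs \<in> c)))) =
      (\<Sum>i\<in>cell_orbits G \<phi> E. (-1) ^ fst i * (of_nat (card {hs \<in> c. set hs \<subseteq> T i}) / of_nat (card (T i))))"
      using orb_euler_char_centralizer[where rep = rep, OF gcw fin model assms(4) tuple_carrier[OF gs(1)]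
          finite_generate_commuting_p_tuple[OF assms(1) gs(1)] rep]
      unfolding gs_def[symmetric] gs(2) T_def .
  qed
  also have "\<dots> = (\<Sum>i\<in>cell_orbits G \<phi> E. (-1) ^ fst i * (of_nat (\<Sum>c\<in>?O. card {hs \<in> c. set hs \<subseteq> T i}) / of_nat (card (T i))))"
    by (subst sum.swap) (simp add: sum_distrib_left sum_divide_distrib)
  also have "\<dots> = (\<Sum>i\<in>cell_orbits G \<phi> E. of_int ((-1) ^ fst i) *
      (of_nat (card (commuting_p_tuples (G\<lparr>carrier := T i\<rparr>) n p)) / of_nat (order (G\<lparr>carrier := T i\<rparr>))))"
    by (rule sum.cong[OF refl]) (simp add: count order_def)
  also have "\<dots> \<in> localized_int p"
  proof (rule localized_int_sum[OF assms(1)])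
    fix i assume i: "i \<in> cell_orbits G \<phi> E"
    have "group (G\<lparr>carrier := T i\<rparr>)" by (rule subgroup_imp_group[OF T(2)[OF i]])
    then show "of_int ((-1) ^ fst i) *
      (of_nat (card (commuting_p_tuples (G\<lparr>carrier := T i\<rparr>) n p)) / of_nat (order (G\<lparr>carrier := T i\<rparr>))) \<in> localized_int p"
      using T(1)[OF i] assms(1,2)
      by (intro localized_int_mult localized_int_of_int card_commuting_p_tuples_localized) simp_all
  qed
  finally show ?thesis by (simp add: cong_localized_def)
qed

end
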